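(* Let $K$ be a number field of degree $\rho=[K:\mathbb{Q}]$ and let $F(X_1,X_2)\in O_K[X_1,X_2]$ be irreducible in $K[X_1,X_2]$ and monic in $X_2$. For $B>0$ put $$N(F,B)=\#\{(x_1,x_2)\in O_K^2:\ F(x_1,x_2)=0,\ H(x_1)\leq B,\ H(x_2)\leq B\}.$$ Then, for $B$ suitably large (depending on $K$), $$N(F,B)\leq c\,\deg(F)^{8}\,(\log B)^{3}\,B^{\rho/\deg(F)},$$ where $c$ is a constant depending only on $K$.
   Context: $O_K$ is the ring of integers of $K$. For $x\in O_K$, the height (house) of $x$ is $H(x)=\max(|x_1|,\dots,|x_\rho|)$ where $x_1,\dots,x_\rho$ are the images of $x$ under the $\rho$ complex embeddings of $K$. $\deg(F)$ is the total degree of $F$. *)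

theory Defs
  imports Complex_Main "HOL-Computational_Algebra.Computational_Algebra"
begin

definition rat_scale :: "rat \<Rightarrow> 'a::field_char_0 \<Rightarrow> 'a" where
  "rat_scale q x = of_rat q * x"

lemma vector_space_rat_scale: "vector_space (rat_scale :: rat \<Rightarrow> 'a::field_char_0 \<Rightarrow> 'a)"
  by unfold_locales (simp_all add: rat_scale_def of_rat_add of_rat_mult algebra_simps)

text \<open>A number field is a field of characteristic 0 that has finite dimension as a vector
  space over \<^typ>\<open>rat\<close>; the field is the whole type.\<close>

definition number_field :: "'a::field_char_0 itself \<Rightarrow> bool" where
  "number_field _ \<longleftrightarrow>
     (\<exists>S :: 'a set. finite S \<and> module.span (rat_scale :: rat \<Rightarrow> 'a \<Rightarrow> 'a) S = UNIV)"

definition number_field_degree :: "'a::field_char_0 itself \<Rightarrow> nat" where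
  "number_field_degree _ = vector_space.dim (rat_scale :: rat \<Rightarrow> 'a \<Rightarrow> 'a) UNIV"

definition ring_of_integers :: "'a::field_char_0 set" where
  "ring_of_integers = {x. algebraic_int x}"

definition complex_embeddings :: "('a::field_char_0 \<Rightarrow> complex) set" where
  "complex_embeddings =
     {\<sigma>. \<sigma> 1 = 1 \<and> (\<forall>x y. \<sigma> (x + y) = \<sigma> x + \<sigma> y) \<and> (\<forall>x y. \<sigma> (x * y) = \<sigma> x * \<sigma> y)}"

definition house :: "'a::field_char_0 \<Rightarrow> real" where
  "house x = Max ((\<lambda>\<sigma>. cmod (\<sigma> x)) ` complex_embeddings)"

text \<open>An element of \<^typ>\<open>'a poly poly\<close> is a polynomial in two variables: the outer variable
  is \<open>X\<^sub>2\<close> and the coefficients are polynomials in \<open>X\<^sub>1\<close>. So \<open>coeff (coeff F j) i\<close> is the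
  coefficient of \<open>X\<^sub>1\<^sup>i X\<^sub>2\<^sup>j\<close>, and being monic in \<open>X\<^sub>2\<close> is \<open>lead_coeff F = 1\<close>.\<close>

definition integral_coeffs :: "'a::field_char_0 poly poly \<Rightarrow> bool" where
  "integral_coeffs F \<longleftrightarrow> (\<forall>i j. coeff (coeff F j) i \<in> ring_of_integers)"

definition eval2 :: "'a::comm_ring_1 poly poly \<Rightarrow> 'a \<Rightarrow> 'a \<Rightarrow> 'a" where
  "eval2 F x\<^sub>1 x\<^sub>2 = poly (poly F [:x\<^sub>2:]) x\<^sub>1"

text \<open>Like \<^const>\<open>degree\<close>, the total degree of the zero polynomial is 0.\<close>

definition total_degree :: "'a::zero poly poly \<Rightarrow> nat" where
  "total_degree F = Max (insert 0 {i + j | i j. coeff (coeff F j) i \<noteq> 0})"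

definition integral_zeros :: "'a::field_char_0 poly poly \<Rightarrow> real \<Rightarrow> ('a \<times> 'a) set" where
  "integral_zeros F B =
     {(x\<^sub>1, x\<^sub>2). x\<^sub>1 \<in> ring_of_integers \<and> x\<^sub>2 \<in> ring_of_integers \<and>
        eval2 F x\<^sub>1 x\<^sub>2 = 0 \<and> house x\<^sub>1 \<le> B \<and> house x\<^sub>2 \<le> B}"

end

theory Submission
  imports Defs "HOL-Algebra.Algebraic_Closure_Type" "Jordan_Normal_Form.Char_Poly"
begin

text \<open>The determinant method, with \<open>p\<close>-adic branches of the curve. Let \<open>\<theta>\<close> be an integral generator of
  \<open>K\<close> with minimal polynomial \<open>g\<close>. A simple root of \<open>g\<close> modulo \<open>p\<close> lifts to every \<open>p\<^sup>E\<close> and gives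
  homomorphisms from the ring of integers to \<open>\<int>/p\<^sup>E\<close>. The integral points of height at most \<open>B\<close> in one
  residue class modulo \<open>q = p\<^sup>k\<close>, nonsingular modulo \<open>p\<close>, lie on one branch \<open>X\<^sub>2 = \<Psi> X\<^sub>1\<close>. If \<open>q\<close> exceeds a
  constant times \<open>B powr (\<rho> / d)\<close> with \<open>d = deg F\<close>, the pigeonhole principle yields a polynomial \<open>G\<close>, not
  divisible by \<open>F\<close>, of degree about \<open>d + ln B\<close>, whose values at these points are divisible by a power of
  \<open>p\<close> larger than their norms. So \<open>G\<close> vanishes there and Bezout's theorem bounds the number of points in
  the class; there are at most \<open>d q\<close> classes.

  A point with nonzero \<open>\<partial>F/\<partial>X\<^sub>2\<close> is singular modulo \<open>p\<close> only if \<open>p\<close> divides the norm of \<open>c \<partial>F/\<partial>X\<^sub>2\<close>,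
  where \<open>c F\<close> is a multiple of \<open>F\<close> whose coefficients have height bounded in terms of \<open>B\<close>, unless \<open>F\<close> has at
  most \<open>d\<^sup>3\<close> zeros. The logarithm of this norm is at most some \<open>T\<close> of order \<open>d\<^sup>3 ln B\<close>, so among primes
  between \<open>T\<close> and \<open>T powr (4/3)\<close> of total weight \<open>2 T\<close> one leaves at least half of the points
  nonsingular. Enough such primes with a root of \<open>g\<close> exist by Mertens-type bounds, which come from
  averaging the logarithm of the norm over boxes in \<open>\<int>[\<theta>]\<close>.\<close>

hide_const (open) Polynomials.lead_coeff Polynomials.degree up_ring.coeff up_ring.monom Coset.order Divisibility.irreducible Divisibility.prime module.smult
no_notation fps_nth (infixl "$" 75)

section \<open>Algebraic integers\<close>

text \<open>The exponents are the sum of three costs. The prime obeys p \<le> T^(4/3) = O(d^4 (ln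
  B)^(4/3)); there are at most d q classes, where q = O(p B^(\<rho>/d)); a class holds at most d^2
  deg G points with deg G = O(d ln B). The product contains d^8 and (ln B)^(7/3), rounded up to (ln
  B)^3. The power 4/3 is the price of Mertens bounds with the crude constants 9/10 and 11/10: primes
  between T and T^x are found as soon as 9 x > 11, and x = 4/3 turns d^3 into exactly d^4.
  Uniformity in F is the obstacle that shapes the argument. The coefficients of F are unrestricted,
  so no single prime can be asked to be one of good reduction; the primes are chosen from T alone,
  and F enters through a multiple of bounded height. A degree of G of order ln B keeps the loss
  against B^(\<rho>/d) bounded, so no B^\<epsilon> appears. The ring \<int>[\<theta>] may fail to be
  integrally closed and its ideals to factor uniquely. Its ideals are therefore compared through
  indices and norms, and a square factor p^2 of a norm is explained by membership in one of a few
  ideals of index at least p^2.\<close>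

lemma algebraic_int_if_integer_matrix:
  fixes x :: "'a::field_char_0" and v :: "'b \<Rightarrow> 'a" and M :: "'b \<Rightarrow> 'b \<Rightarrow> int"
  assumes fin: "finite S" and r: "r \<in> S" "v r \<noteq> 0"
    and M: "\<And>s. s \<in> S \<Longrightarrow> x * v s = (\<Sum>t\<in>S. of_int (M s t) * v t)"
  shows "algebraic_int x"
proof -
  obtain h where h: "bij_betw h {0..<card S} S"
    using ex_bij_betw_nat_finite[OF fin] by blast
  define n where "n = card S"
  define A :: "int mat" where "A = mat n n (\<lambda>(i,j). M (h i) (h j))"
  define w where "w = vec n (\<lambda>i. v (h i))"
  define Ac where "Ac = map_mat (of_int :: int \<Rightarrow> 'a) A"
  have A: "A \<in> carrier_mat n n" unfolding A_def by simp
  have Ac: "Ac \<in> carrier_mat n n" unfolding Ac_def using A by simp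
  have hS: "h i \<in> S" if "i < n" for i
    using h that unfolding n_def bij_betw_def by auto
  \<comment> \<open>The hypothesis says that \<open>w\<close> is an eigenvector of an integer matrix
    with eigenvalue x, and the characteristic polynomial of that matrix is monic over the
    integers.\<close>
  have "Ac *\<^sub>v w = x \<cdot>\<^sub>v w"
  proof (rule eq_vecI)
    fix i assume "i < dim_vec (x \<cdot>\<^sub>v w)"
    hence i: "i < n" by (simp add: w_def)
    have "(Ac *\<^sub>v w) $ i = (\<Sum>j\<in>{0..<n}. of_int (M (h i) (h j)) * v (h j))"
      using i unfolding Ac_def A_def w_def by (simp add: scalar_prod_def)
    also have "\<dots> = (\<Sum>t\<in>S. of_int (M (h i) t) * v t)"
      using sum.reindex_bij_betw[OF h, of "\<lambda>t. of_int (M (h i) t) * v t"] by (simp add: n_def)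
    also have "\<dots> = x * v (h i)" using M[OF hS[OF i]] by simp
    finally show "(Ac *\<^sub>v w) $ i = (x \<cdot>\<^sub>v w) $ i" using i by (simp add: w_def)
  qed (simp_all add: w_def Ac_def A_def)
  moreover have "w \<noteq> 0\<^sub>v n"
  proof
    assume w0: "w = 0\<^sub>v n"
    obtain i where i: "i < n" "h i = r"
      using h r unfolding bij_betw_def n_def by (metis atLeastLessThan_iff imageE)
    have "w $ i = v r" using i by (simp add: w_def)
    with w0 i r show False by simp
  qed
  ultimately have "eigenvector Ac w x"
    unfolding eigenvector_def using Ac by (auto simp: w_def)
  hence "poly (char_poly Ac) x = 0"
    using eigenvalue_root_char_poly[OF Ac] unfolding eigenvalue_def by blast
  moreover have "char_poly Ac = map_poly of_int (char_poly A)"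
    unfolding Ac_def by (rule of_int_hom.char_poly_hom[OF A])
  moreover have "lead_coeff (char_poly A) = 1"
    using degree_monic_char_poly[OF A] by simp
  ultimately show ?thesis
    unfolding algebraic_int_altdef_ipoly by auto
qed

lemma sum_Times: "(\<Sum>t\<in>A \<times> B. F t) = (\<Sum>x\<in>A. \<Sum>y\<in>B. F (x, y))"
  by (simp add: sum.cartesian_product)

text \<open>The products x^i y^j with exponents below the two degrees generate a module stable under
  multiplication by x and by y. On it x + y and x y act through the sum and the product of two
  integer matrices.\<close>

lemma algebraic_int_add_mult:
  fixes x y :: "'a::field_char_0"
  assumes x: "algebraic_int x" and y: "algebraic_int y"
  shows "algebraic_int (x + y)" "algebraic_int (x * y)"
proof -
  obtain p :: "int poly" where p: "poly (map_poly of_int p) x = 0" "lead_coeff p = 1"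
    using x unfolding algebraic_int_altdef_ipoly by blast
  obtain q :: "int poly" where q: "poly (map_poly of_int q) y = 0" "lead_coeff q = 1"
    using y unfolding algebraic_int_altdef_ipoly by blast
  have pw: "\<exists>c::nat \<Rightarrow> int. z ^ degree p = (\<Sum>l<degree p. of_int (c l) * z ^ l)"
    if "poly (map_poly of_int p) z = 0" "lead_coeff p = 1" for p and z :: 'a
  proof -
    have "0 = (\<Sum>l\<le>degree p. of_int (coeff p l) * z ^ l)"
      using that(1) by (simp add: poly_altdef)
    also have "\<dots> = (\<Sum>l<degree p. of_int (coeff p l) * z ^ l) + z ^ degree p"
      using that(2) by (simp add: lessThan_Suc_atMost[symmetric])
    finally have "z ^ degree p = (\<Sum>l<degree p. of_int (- coeff p l) * z ^ l)"
      by (simp add: sum_negf eq_neg_iff_add_eq_0 add.commute)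
    thus ?thesis by (intro exI[of _ "\<lambda>l. - coeff p l"])
  qed
  obtain c where c: "x ^ degree p = (\<Sum>l<degree p. of_int (c l) * x ^ l)" using pw[OF p] by blast
  obtain d where d: "y ^ degree q = (\<Sum>l<degree q. of_int (d l) * y ^ l)" using pw[OF q] by blast
  \<comment> \<open>A monic constant is 1 and has no root. Positive degrees put the index (0,0) into
    \<open>S\<close>, and its value 1 is the nonzero entry that the matrix criterion asks
    for.\<close>
  have dp: "degree p > 0" 
  proof (rule ccontr)
    assume "\<not> degree p > 0" 
    hence "p = [:1:]" using p(2) by (metis degree_eq_zeroE lead_coeff_pCons(2) neq0_conv pCons_0_0 zero_neq_one leading_coeff_0_iff coeff_pCons_0)
    thus False using p(1) by simp
  qed
  have dq: "degree q > 0" 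
  proof (rule ccontr)
    assume "\<not> degree q > 0" 
    hence "q = [:1:]" using q(2) by (metis degree_eq_zeroE lead_coeff_pCons(2) neq0_conv pCons_0_0 zero_neq_one leading_coeff_0_iff coeff_pCons_0)
    thus False using q(1) by simp
  qed
  define S where "S = {..<degree p} \<times> {..<degree q}"
  define v where "v = (\<lambda>(i,j). x ^ i * y ^ j)"
  define act where "act z \<longleftrightarrow> (\<exists>M. \<forall>s\<in>S. z * v s = (\<Sum>t\<in>S. of_int (M s t) * v t))" for z
  have fin: "finite S" by (simp add: S_def)
  have "act x" unfolding act_def
  proof (intro exI ballI)
    fix s assume "s \<in> S"
    then obtain i j where s: "s = (i,j)" "i < degree p" "j < degree q" by (auto simp: S_def)
    show "x * v s = (\<Sum>t\<in>S. of_int (if snd t = snd s then 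
        (if Suc (fst s) < degree p then (if fst t = Suc (fst s) then 1 else 0) else c (fst t)) else 0) * v t)" (is "_ = ?r")
    proof -
      have "?r = (\<Sum>i'<degree p. \<Sum>j'<degree q. if j' = j then of_int (if Suc i < degree p then (if i' = Suc i then 1 else 0) else c i') * v (i',j) else 0)"
        unfolding S_def s(1) sum_Times fst_conv snd_conv by (intro sum.cong refl) auto
      also have "\<dots> = (\<Sum>i'<degree p. of_int (if Suc i < degree p then (if i' = Suc i then 1 else 0) else c i') * v (i',j))"
        using s(3) by simp
      also have "\<dots> = x * v s"
      proof (cases "Suc i < degree p")
        case True
        thus ?thesis by (simp add: s v_def if_distrib[of of_int] if_distrib[of "\<lambda>z. z * _"] cong: if_cong)
      next
        case False
        hence "Suc i = degree p" using s by simp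
        hence "x * x ^ i = (\<Sum>l<degree p. of_int (c l) * x ^ l)" using c by (metis power_Suc)
        thus ?thesis using False by (simp add: s v_def mult.assoc[symmetric] sum_distrib_right)
      qed
      finally show ?thesis by simp
    qed
  qed
  moreover have "act y" unfolding act_def
  proof (intro exI ballI)
    fix s assume "s \<in> S"
    then obtain i j where s: "s = (i,j)" "i < degree p" "j < degree q" by (auto simp: S_def)
    show "y * v s = (\<Sum>t\<in>S. of_int (if fst t = fst s then 
        (if Suc (snd s) < degree q then (if snd t = Suc (snd s) then 1 else 0) else d (snd t)) else 0) * v t)" (is "_ = ?r")
    proof -
      have "?r = (\<Sum>i'<degree p. if i' = i then (\<Sum>j'<degree q. of_int (if Suc j < degree q then (if j' = Suc j then 1 else 0) else d j') * v (i,j')) else 0)"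
        unfolding S_def s(1) sum_Times fst_conv snd_conv by (intro sum.cong refl) (auto intro!: sum.cong)
      also have "\<dots> = (\<Sum>j'<degree q. of_int (if Suc j < degree q then (if j' = Suc j then 1 else 0) else d j') * v (i,j'))"
        using s(2) by simp
      also have "\<dots> = y * v s"
      proof (cases "Suc j < degree q")
        case True
        thus ?thesis by (simp add: s v_def if_distrib[of of_int] if_distrib[of "\<lambda>z. z * _"] mult_delta_right mult.left_commute cong: if_cong)
      next
        case False
        hence "Suc j = degree q" using s by simp
        hence "y * y ^ j = (\<Sum>l<degree q. of_int (d l) * y ^ l)" using d by (metis power_Suc)
        hence "y * v s = x ^ i * (\<Sum>l<degree q. of_int (d l) * y ^ l)"
          by (simp add: s v_def mult.left_commute)
        thus ?thesis using False by (simp add: s v_def sum_distrib_left mult.left_commute)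
      qed
      finally show ?thesis by simp
    qed
  qed
  ultimately obtain M N where M: "\<And>s. s \<in> S \<Longrightarrow> x * v s = (\<Sum>t\<in>S. of_int (M s t) * v t)" 
    and N: "\<And>s. s \<in> S \<Longrightarrow> y * v s = (\<Sum>t\<in>S. of_int (N s t) * v t)" unfolding act_def by blast
  have v0: "(0,0) \<in> S" "v (0,0) \<noteq> 0" using dp dq by (auto simp: S_def v_def)
  show "algebraic_int (x + y)"
    by (rule algebraic_int_if_integer_matrix[where S = S and v = v and r = "(0,0)" and M = "\<lambda>s t. M s t + N s t", OF fin v0])
       (simp add: M N distrib_right sum.distrib)
  show "algebraic_int (x * y)"
  proof (rule algebraic_int_if_integer_matrix[where S = S and v = v and r = "(0,0)" and M = "\<lambda>s t. \<Sum>u\<in>S. N s u * M u t", OF fin v0])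
    fix s assume s: "s \<in> S"
    have "x * y * v s = (\<Sum>u\<in>S. of_int (N s u) * (x * v u))"
      using N[OF s] by (simp add: mult.assoc sum_distrib_left mult.left_commute)
    also have "\<dots> = (\<Sum>u\<in>S. \<Sum>t\<in>S. of_int (N s u) * (of_int (M u t) * v t))"
      by (intro sum.cong refl) (simp add: M sum_distrib_left)
    also have "\<dots> = (\<Sum>t\<in>S. \<Sum>u\<in>S. of_int (N s u) * (of_int (M u t) * v t))" by (rule sum.swap)
    also have "\<dots> = (\<Sum>t\<in>S. of_int (\<Sum>u\<in>S. N s u * M u t) * v t)"
      by (simp add: sum_distrib_right mult.assoc)
    finally show "x * y * v s = (\<Sum>t\<in>S. of_int (\<Sum>u\<in>S. N s u * M u t) * v t)" .
  qed
qed

lemma algebraic_int_sum: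
  "(\<And>i. i \<in> A \<Longrightarrow> algebraic_int (f i :: 'a::field_char_0)) \<Longrightarrow> algebraic_int (sum f A)"
  by (induction A rule: infinite_finite_induct) (auto intro: algebraic_int_add_mult)

lemma algebraic_int_prod:
  "(\<And>i. i \<in> A \<Longrightarrow> algebraic_int (f i :: 'a::field_char_0)) \<Longrightarrow> algebraic_int (prod f A)"
  by (induction A rule: infinite_finite_induct) (auto intro: algebraic_int_add_mult)

lemma algebraic_int_of_int: "algebraic_int (of_int k :: 'a::field_char_0)"
  by (rule int_imp_algebraic_int) auto

lemma algebraic_int_power: "algebraic_int (x :: 'a::field_char_0) \<Longrightarrow> algebraic_int (x ^ k)"
  by (induction k) (auto intro: algebraic_int_add_mult)

lemma algebraic_int_diff:
  "algebraic_int (x :: 'a::field_char_0) \<Longrightarrow> algebraic_int y \<Longrightarrow> algebraic_int (x - y)"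
  using algebraic_int_add_mult(1)[of x "- y"] by auto

section \<open>Chebyshev-type estimates\<close>

definition theta :: "nat \<Rightarrow> real" where "theta m = (\<Sum>p | prime (p::nat) \<and> p \<le> m. ln p)"

lemma finite_primes [simp]: "finite {p::nat. prime p \<and> p \<le> m}" "finite {p::nat. prime p \<and> l < p \<and> p \<le> m}"
  using finite_subset[of _ "{..m}"] by auto

lemma prod_primes_dvd:
  fixes N :: nat
  assumes "finite P" "\<And>p. p \<in> P \<Longrightarrow> prime p" "\<And>p. p \<in> P \<Longrightarrow> p dvd N"
  shows "\<Prod>P dvd N"
  using assms
proof (induction P rule: finite_induct)
  case (insert p P)
  have "coprime p (\<Prod>P)"
    using insert by (intro prod_coprime_right) (auto intro!: primes_coprime)
  thus ?case using insert by (auto intro!: divides_mult)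
qed simp

text \<open>Every prime in (m, 2 m] divides the central binomial coefficient, which is at most
  4^m.\<close>

lemma theta_double: "theta (2 * m) \<le> theta m + 2 * m * ln 2"
proof -
  define P where "P = {p. prime p \<and> m < p \<and> p \<le> 2 * m}"
  have fin: "finite P" unfolding P_def by (rule finite_subset[of _ "{..2*m}"]) auto
  have "\<Prod>P dvd (2 * m) choose m"
  proof (rule prod_primes_dvd[OF fin])
    fix p assume p: "p \<in> P"
    have "p dvd fact (2 * m)" using p by (simp add: P_def prime_dvd_fact_iff)
    also have "(fact (2 * m) :: nat) = fact m * fact m * (2 * m choose m)"
      using binomial_fact_lemma[of m "2 * m"] by (simp add: mult_2)
    finally show "p dvd 2 * m choose m"
      using p by (simp add: P_def prime_dvd_mult_iff prime_dvd_fact_iff)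
  qed (simp add: P_def)
  hence "\<Prod>P \<le> 2 * m choose m" by (rule dvd_imp_le) simp
  also have "\<dots> \<le> 2 ^ (2 * m)" by (rule binomial_le_pow2)
  finally have "real (\<Prod>P) \<le> 2 ^ (2 * m)" by (metis of_nat_le_iff of_nat_numeral of_nat_power)
  moreover have pos: "\<And>p. p \<in> P \<Longrightarrow> p > 0" by (auto simp: P_def prime_gt_0_nat)
  have "0 < real (\<Prod>P)" using pos by (simp add: fin prod_pos)
  ultimately have "ln (real (\<Prod>P)) \<le> ln (2 ^ (2 * m))" by (subst ln_le_cancel_iff) auto
  also have "ln (2 ^ (2 * m) :: real) = 2 * m * ln 2" by (simp add: ln_realpow)
  also have "ln (real (\<Prod>P)) = (\<Sum>p\<in>P. ln p)" using fin pos by (simp add: ln_prod)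
  finally have "(\<Sum>p\<in>P. ln p) \<le> 2 * m * ln 2" by simp
  moreover have "theta (2 * m) = theta m + (\<Sum>p\<in>P. ln p)"
    unfolding theta_def P_def
    by (subst sum.union_disjoint[symmetric]) (auto intro!: sum.cong)
  ultimately show ?thesis by simp
qed

lemma theta_mono: "m \<le> k \<Longrightarrow> theta m \<le> theta k"
  unfolding theta_def by (intro sum_mono2) (auto intro!: ln_ge_zero simp: Suc_le_eq prime_gt_0_nat)

lemma theta_le: "theta m \<le> 5 * real m"
proof (induction m rule: less_induct)
  case (less m)
  consider "m \<le> 1" | "m = 2" | "m \<ge> 3" by linarith
  thus ?case
  proof cases
    case 1
    hence *: "{p::nat. prime p \<and> p \<le> m} = {}"
    proof safe
      fix p :: nat assume "prime p" "p \<le> m"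
      thus "p \<in> {}" using prime_ge_2_nat[of p] 1 by simp
    qed
    show ?thesis unfolding theta_def * by simp
  next
    case 2
    have "{p::nat. prime p \<and> p \<le> 2} = {2}"
    proof safe
      fix p :: nat assume "prime p" "p \<le> 2"
      thus "p = 2" using prime_ge_2_nat[of p] by simp
    qed (use two_is_prime_nat in auto)
    hence "theta m = ln 2" unfolding theta_def 2 by simp
    thus ?thesis using ln_2_less_1 2 by simp
  next
    case 3
    \<comment> \<open>The induction closes because 5 k + 2 k \<le> 7 (m + 1) / 2 \<le> 5 m as soon
      as m \<ge> 3; smaller m are treated by hand.\<close>
    define k where "k = (m + 1) div 2"
    have k: "m \<le> 2 * k" "2 * k \<le> m + 1" "k < m" using 3 unfolding k_def by linarith+
    have "theta m \<le> theta (2 * k)" by (rule theta_mono[OF k(1)])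
    also have "\<dots> \<le> theta k + 2 * real k * ln 2" using theta_double[of k] by simp
    also have "\<dots> \<le> real (5 * k) + 2 * real k * 1"
      using less[OF k(3)] ln_2_less_1 by (intro add_mono mult_left_mono) auto
    also have "\<dots> \<le> 5 * real m" using k 3 by simp
    finally show ?thesis .
  qed
qed

text \<open>Primes with p^2 \<le> m number at most sqrt m, and ln m \<le> 2 sqrt m, which gives 2 m.
  For the others ln m \<le> 2 ln p, so they contribute at most 2 \<open>theta m\<close> \<le> 10
  m.\<close>

lemma primes_le_count: 
  fixes m :: nat
  shows "real (card {p. prime (p::nat) \<and> p \<le> m}) * ln m \<le> 12 * m"
proof (cases "m = 0")
  case False
  define A where "A = {p::nat. prime p \<and> p ^ 2 \<le> m}"
  define B where "B = {p::nat. prime p \<and> p \<le> m \<and> p ^ 2 > m}"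
  have fin: "finite {p::nat. prime p \<and> p \<le> m}" by (rule finite_subset[of _ "{..m}"]) auto
  have split: "{p::nat. prime p \<and> p \<le> m} = A \<union> B" unfolding A_def B_def
    by (auto dest: power2_nat_le_imp_le)
  hence finAB: "finite A" "finite B" using fin by auto
  have "A \<subseteq> {1..nat \<lfloor>sqrt m\<rfloor>}" unfolding A_def
  proof safe
    fix p :: nat assume "prime p" "p ^ 2 \<le> m"
    hence "real p \<le> sqrt m" by (intro real_le_rsqrt) (metis of_nat_le_iff of_nat_power)
    thus "p \<in> {1..nat \<lfloor>sqrt m\<rfloor>}" using prime_gt_0_nat[OF \<open>prime p\<close>] by (auto simp: le_nat_floor Suc_le_eq)
  qed
  from card_mono[OF finite_atLeastAtMost this] have "card A \<le> nat \<lfloor>sqrt m\<rfloor>" by simp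
  hence "real (card A) \<le> real (nat \<lfloor>sqrt m\<rfloor>)" by (simp only: of_nat_le_iff)
  also have "\<dots> \<le> sqrt m" by (rule of_nat_floor) simp
  finally have A: "real (card A) \<le> sqrt m" .
  have lnm: "ln m \<ge> 0" using False by (simp add: ln_ge_zero)
  have lnsq: "ln (real m) \<le> 2 * sqrt m"
  proof -
    have "ln (sqrt m) \<le> sqrt m" using False ln_bound[of "sqrt m"] by simp
    thus ?thesis using False by (simp add: ln_sqrt)
  qed
  have "real (card A) * ln m \<le> sqrt m * (2 * sqrt m)"
    using A lnsq lnm by (intro mult_mono) auto
  also have "\<dots> = 2 * m" by (simp add: mult.assoc[symmetric])
  finally have 1: "real (card A) * ln m \<le> 2 * m" .
  have "real (card B) * ln m = (\<Sum>p\<in>B. ln m)" by simp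
  also have "\<dots> \<le> (\<Sum>p\<in>B. 2 * ln p)"
  proof (rule sum_mono)
    fix p assume p: "p \<in> B"
    hence "real m \<le> real p ^ 2" unfolding B_def by (simp flip: of_nat_power)
    hence "ln (real m) \<le> ln (real p ^ 2)"
      using False p by (subst ln_le_cancel_iff) (auto simp: B_def prime_gt_0_nat)
    thus "ln (real m) \<le> 2 * ln p" using p by (simp add: B_def ln_realpow prime_gt_0_nat)
  qed
  also have "\<dots> \<le> 2 * theta m" unfolding theta_def sum_distrib_left split
    using finAB by (intro sum_mono2) (auto simp: A_def Suc_le_eq prime_gt_0_nat intro!: ln_ge_zero)
  also have "\<dots> \<le> 10 * m" using theta_le[of m] by simp
  finally have 2: "real (card B) * ln m \<le> 10 * m" .
  have "card {p::nat. prime p \<and> p \<le> m} \<le> card A + card B" unfolding split by (rule card_Un_le)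
  hence "real (card {p::nat. prime p \<and> p \<le> m}) * ln m \<le> (real (card A) + real (card B)) * ln m"
    using lnm by (intro mult_right_mono) (simp_all flip: of_nat_add)
  thus ?thesis using 1 2 by (simp add: algebra_simps)
qed simp

text \<open>Each term is at most 1 / (p - 1) - 1 / p, and the sum telescopes.\<close>

lemma sum_inverse_squares_le:
  assumes "m > 0" 
  shows "(\<Sum>p\<in>{m<..k}. 1 / real p ^ 2) \<le> 1 / m"
proof (cases "m \<le> k")
  case True
  have "(\<Sum>p\<in>{m<..k}. 1 / real p ^ 2) \<le> 1 / m - 1 / k"
    using True
  proof (induction k rule: dec_induct)
    case (step j)
    have "{m<..Suc j} = insert (Suc j) {m<..j}" using step by auto
    hence "(\<Sum>p\<in>{m<..Suc j}. 1 / real p ^ 2) \<le> 1 / real (Suc j) ^ 2 + (1 / m - 1 / j)"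
      using step by simp
    also have "1 / real (Suc j) ^ 2 \<le> 1 / (real j * real (Suc j))"
      using step assms by (intro divide_left_mono) (auto simp: power2_eq_square)
    also have "\<dots> = 1 / real j - 1 / real (Suc j)"
      using step assms by (simp add: field_simps)
    finally show ?case by simp
  qed simp
  moreover have "1 / real k \<ge> 0" by simp
  ultimately show ?thesis by linarith
qed simp

section \<open>The norm form of an irreducible polynomial\<close>

definition ipoly :: "int poly \<Rightarrow> 'a::comm_ring_1 \<Rightarrow> 'a" where
  "ipoly a x = poly (map_poly of_int a) x"

lemma ipoly_simps [simp]:
  "ipoly (a + b) x = ipoly a x + ipoly b x" "ipoly (a - b) x = ipoly a x - ipoly b x"
  "ipoly (a * b) x = ipoly a x * ipoly b x" "ipoly 0 x = 0" "ipoly 1 x = 1" "ipoly (- a) x = - ipoly a x"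
  "ipoly (smult c a) x = of_int c * ipoly a x" "ipoly (pCons c a) x = of_int c + x * ipoly a x"
  unfolding ipoly_def by (simp_all add: of_int_poly_hom.hom_add of_int_poly_hom.hom_mult hom_distribs)

lemma ipoly_int [simp]: "ipoly a (k::int) = poly a k"
  unfolding ipoly_def by (simp add: map_poly_idI)

lemma ipoly_of_int: "ipoly a (of_int k) = of_int (poly a k)"
  by (induction a) (simp_all)

lemma ipoly_altdef: "ipoly a x = (\<Sum>i\<le>degree a. of_int (coeff a i) * x ^ i)"
proof -
  have "ipoly (\<Sum>i\<in>A. monom (c i) i) x = (\<Sum>i\<in>A. of_int (c i) * x ^ i)" for c and A :: "nat set"
    by (induction A rule: infinite_finite_induct) (simp_all add: ipoly_def[of "monom _ _"] map_poly_monom poly_monom)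
  from this[of "coeff a" "{..degree a}"] show ?thesis by (simp only: poly_as_sum_of_monoms)
qed

lemma ipoly_bound: 
  assumes "\<And>i. i \<ge> n \<Longrightarrow> coeff a i = 0"
  shows "ipoly a x = (\<Sum>i<n. of_int (coeff a i) * x ^ i)"
proof (cases "a = 0")
  case True thus ?thesis by simp
next
  case False
  hence "degree a < n" using assms by (meson leading_coeff_0_iff not_le_imp_less)
  thus ?thesis unfolding ipoly_altdef by (intro sum.mono_neutral_left) (auto simp: coeff_eq_0)
qed

lemma rat_poly_clear_denominators:
  "\<exists>(c::int) P. c > 0 \<and> smult (of_int c) (p :: rat poly) = map_poly of_int P"
proof (induction p)
  case 0 show ?case by (intro exI[of _ 1] exI[of _ 0]) simp
next
  case (pCons a p)
  then obtain c P where c: "c > 0" "smult (of_int c) p = map_poly of_int P" by blast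
  obtain u v where uv: "quotient_of a = (u, v)" by fastforce
  hence v: "v > 0" "a = of_int u / of_int v" using quotient_of_denom_pos quotient_of_div by blast+
  show ?case
  proof (intro exI conjI)
    show "v * c > 0" using c v by simp
    show "smult (of_int (v * c)) (pCons a p) = map_poly of_int (pCons (c * u) (smult v P))"
      using c(2)[symmetric] v by (simp add: hom_distribs map_poly_pCons)
  qed
qed

locale int_poly_field =
  fixes g :: "int poly" and n :: nat
  assumes monic: "lead_coeff g = 1" and deg: "degree g = n" and n_pos: "n > 0"
    and irr: "irreducible (map_poly of_int g :: rat poly)"
begin

lemma g_nz: "g \<noteq> 0" using n_pos deg by auto

text \<open>The integer \<open>D\<close> is what becomes of 1 when the denominators of a rational
  Bezout identity are cleared. Later \<open>V\<close> / \<open>D\<close> serves as the inverse of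
  \<open>a\<close> modulo \<open>g\<close>.\<close>

lemma bezout_coprime:
  assumes "\<not> (map_poly of_int g :: rat poly) dvd map_poly of_int a"
  obtains U V D where "D \<noteq> 0" "U * g + V * a = [:D:]"
proof -
  let ?g = "map_poly of_int g :: rat poly" and ?a = "map_poly of_int a :: rat poly"
  have "prime_elem ?g" using irr by (simp add: irreducible_imp_prime_elem)
  hence "coprime ?g ?a" using assms by (simp add: prime_elem_imp_coprime)
  then obtain u v where uv: "u * ?g + v * ?a = 1"
    using bezout_coefficients_fst_snd[of ?g ?a] by (auto simp: coprime_iff_gcd_eq_1)
  obtain c P where c: "c > 0" "smult (of_int c) u = map_poly of_int P" using rat_poly_clear_denominators by blast
  obtain d Q where d: "d > 0" "smult (of_int d) v = map_poly of_int Q" using rat_poly_clear_denominators by blast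
  have "(map_poly of_int (smult d P * g + smult c Q * a) :: rat poly) = 
    smult (of_int d) (smult (of_int c) u) * ?g + smult (of_int c) (smult (of_int d) v) * ?a"
    unfolding c d by (simp add: hom_distribs)
  also have "\<dots> = smult (of_int (c * d)) (u * ?g + v * ?a)"
    by (simp add: smult_add_right mult.commute)
  also have "\<dots> = map_poly of_int [:c * d:]" unfolding uv by (simp add: hom_distribs one_pCons)
  finally have "smult d P * g + smult c Q * a = [:c * d:]" 
    by (simp only: of_int_poly_hom.eq_iff)
  moreover have "c * d \<noteq> 0" using c d by simp
  ultimately show ?thesis by (rule that[rotated])
qed

definition Theta :: "complex set" where "Theta = {z. ipoly g z = 0}"

lemma bezout_pderiv: obtains U V D where "D \<noteq> 0" "U * g + V * pderiv g = [:D:]"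
proof (rule bezout_coprime)
  let ?g = "map_poly of_int g :: rat poly"
  have dg: "pderiv g \<noteq> 0" using n_pos deg by (simp add: pderiv_eq_0_iff)
  show "\<not> ?g dvd map_poly of_int (pderiv g)"
  proof
    assume "?g dvd map_poly of_int (pderiv g)"
    hence "degree ?g \<le> degree (map_poly of_int (pderiv g) :: rat poly)"
      by (rule dvd_imp_degree_le) (use dg in simp)
    thus False using deg n_pos by (simp add: degree_pderiv)
  qed
qed (use that in blast)

lemma Theta_finite: "finite Theta" 
  unfolding Theta_def ipoly_def by (rule poly_roots_finite) (use g_nz in simp)

lemma Theta_prod: "(map_poly of_int g :: complex poly) = (\<Prod>z\<in>Theta. [:-z, 1:])"
  and Theta_card: "card Theta = n"
proof -
  let ?g = "map_poly of_int g :: complex poly"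
  obtain U V D where D: "D \<noteq> 0" "U * g + V * pderiv g = [:D:]" by (rule bezout_pderiv)
  have "rsquarefree ?g" unfolding rsquarefree_roots
  proof safe
    fix z assume "poly ?g z = 0" "poly (pderiv ?g) z = 0"
    hence "ipoly g z = 0" "ipoly (pderiv g) z = 0" unfolding ipoly_def by (simp_all add: of_int_hom.map_poly_pderiv)
    hence "ipoly [:D:] z = 0" unfolding D(2)[symmetric] by simp
    thus False using D(1) by simp
  qed
  hence "smult (lead_coeff ?g) (\<Prod>z|poly ?g z = 0. [:-z, 1:]) = ?g" by (rule complex_poly_decompose_rsquarefree)
  thus *: "?g = (\<Prod>z\<in>Theta. [:-z, 1:])" using monic by (simp add: Theta_def ipoly_def)
  have "n = degree ?g" using deg by simp
  also have "\<dots> = card Theta" unfolding * by (subst degree_prod_eq_sum_degree) auto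
  finally show "card Theta = n" by simp
qed

section \<open>Division by the monic polynomial and the norm of Z[X]/(g)\<close>

definition quo :: "int poly \<Rightarrow> int poly" where "quo a = fst (pseudo_divmod a g)"
definition rem :: "int poly \<Rightarrow> int poly" where "rem a = snd (pseudo_divmod a g)"

text \<open>As \<open>g\<close> is monic, the multiplier of the pseudo-division is 1, so this is a
  genuine division over the integers; \<open>rem a\<close> is the reduced representative of
  \<open>a\<close> modulo \<open>g\<close>.\<close>

lemma rem_eq: "a = g * quo a + rem a" and coeff_rem: "i \<ge> n \<Longrightarrow> coeff (rem a) i = 0"
proof -
  have *: "pseudo_divmod a g = (quo a, rem a)" by (simp add: quo_def rem_def)
  show "a = g * quo a + rem a" using pseudo_divmod(1)[OF g_nz *] monic by simp
  have "rem a = 0 \<or> degree (rem a) < n" using pseudo_divmod(2)[OF g_nz *] deg by simp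
  thus "i \<ge> n \<Longrightarrow> coeff (rem a) i = 0" by (auto simp: coeff_eq_0)
qed

lemma ipoly_rem: "ipoly g z = 0 \<Longrightarrow> ipoly (rem a) z = ipoly a z"
  using arg_cong[OF rem_eq[of a], of "\<lambda>p. ipoly p z"] by simp

text \<open>The product is the determinant of multiplication by \<open>a\<close> on the basis 1, X,
  ..., X^(n-1) of Z[X]/(g). That matrix has integer entries, and the Vandermonde matrix of the roots
  conjugates it into the diagonal matrix of the values of \<open>a\<close>.\<close>

lemma norm_exists: "\<exists>k::int. of_int k = (\<Prod>z\<in>Theta. ipoly a z)"
proof -
  obtain h where h: "bij_betw h {0..<n} Theta"
    using ex_bij_betw_nat_finite[OF Theta_finite] Theta_card by auto
  define A :: "int mat" where "A = mat n n (\<lambda>(j,k). coeff (rem (monom 1 j * a)) k)"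
  define V :: "complex mat" where "V = mat n n (\<lambda>(k,i). h i ^ k)"
  define L :: "complex mat" where "L = mat n n (\<lambda>(i,j). if i = j then ipoly a (h i) else 0)"
  let ?A = "map_mat (of_int :: int \<Rightarrow> complex) A"
  have c: "A \<in> carrier_mat n n" "?A \<in> carrier_mat n n" "V \<in> carrier_mat n n" "L \<in> carrier_mat n n"
    by (auto simp: A_def V_def L_def)
  have hT: "h i \<in> Theta" if "i < n" for i using h that by (auto simp: bij_betw_def)
  have "?A * V = V * L"
  proof (rule eq_matI)
    fix j i assume "j < dim_row (V * L)" "i < dim_col (V * L)"
    hence ji: "j < n" "i < n" by (auto simp: V_def L_def)
    have "(?A * V) $$ (j,i) = (\<Sum>k<n. of_int (coeff (rem (monom 1 j * a)) k) * h i ^ k)"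
      using ji c by (simp add: scalar_prod_def A_def V_def atLeast0LessThan)
    also have "\<dots> = ipoly (rem (monom 1 j * a)) (h i)"
      by (rule ipoly_bound[symmetric]) (rule coeff_rem)
    also have "\<dots> = ipoly (monom 1 j * a) (h i)"
      by (rule ipoly_rem) (use hT[OF ji(2)] in \<open>simp add: Theta_def\<close>)
    also have "\<dots> = h i ^ j * ipoly a (h i)"
      by (simp add: ipoly_def[of "monom 1 j"] map_poly_monom poly_monom)
    also have "\<dots> = (V * L) $$ (j,i)"
      using ji c by (simp add: scalar_prod_def V_def L_def if_distrib[of "\<lambda>x. _ * x"] cong: if_cong)
    finally show "(?A * V) $$ (j,i) = (V * L) $$ (j,i)" .
  qed (auto simp: A_def V_def L_def)
  hence "det (?A * V) = det (V * L)" by simp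
  hence "det ?A * det V = det V * det L" unfolding det_mult[OF c(2,3)] det_mult[OF c(3,4)] .
  \<comment> \<open>A kernel vector of the transpose is the coefficient vector of a polynomial of
    degree below n that vanishes at all n roots.\<close>
  moreover have "det V \<noteq> 0"
  proof
    assume "det V = 0"
    hence "det (transpose_mat V) = 0" using det_transpose[OF c(3)] by simp
    then obtain v where v: "v \<in> carrier_vec n" "v \<noteq> 0\<^sub>v n" "transpose_mat V *\<^sub>v v = 0\<^sub>v n"
      using det_0_iff_vec_prod_zero_field[of "transpose_mat V" n] c by auto
    define p where "p = (\<Sum>k<n. monom (v $ k) k)"
    have cp: "coeff p k = (if k < n then v $ k else 0)" for k
      unfolding p_def by (simp add: coeff_sum)
    have "poly p z = 0" if "z \<in> Theta" for z
    proof -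
      have "z \<in> h ` {0..<n}" using h that by (simp add: bij_betw_def)
      then obtain i where i: "i < n" "z = h i" by auto
      have "0 = (transpose_mat V *\<^sub>v v) $ i" using v i by simp
      also have "\<dots> = (\<Sum>k<n. z ^ k * v $ k)" 
        using i v(1) by (simp add: scalar_prod_def V_def atLeast0LessThan)
      finally show ?thesis by (simp add: p_def poly_sum poly_monom mult.commute)
    qed
    hence "Theta \<subseteq> {z. poly p z = 0}" by auto
    moreover have "degree p < n"
      using n_pos by (intro degree_lessI) (auto simp: cp)
    ultimately have "p = 0"
    proof -
      assume "Theta \<subseteq> {z. poly p z = 0}" "degree p < n"
      show "p = 0"
      proof (rule ccontr)
        assume p: "p \<noteq> 0"
        have "n \<le> card {z. poly p z = 0}"
          unfolding Theta_card[symmetric] by (rule card_mono) (use p poly_roots_finite \<open>Theta \<subseteq> _\<close> in auto)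
        thus False using card_poly_roots_bound[OF p] \<open>degree p < n\<close> by simp
      qed
    qed
    hence "v $ k = 0" if "k < n" for k using cp[of k] that by simp
    hence "v = 0\<^sub>v n" using v(1) by (intro eq_vecI) auto
    thus False using v(2) by simp
  qed
  ultimately have "det ?A = det L" by simp
  also have "det L = prod_list (diag_mat L)"
    by (rule det_upper_triangular[OF _ c(4)]) (auto simp: L_def)
  also have "\<dots> = (\<Prod>i\<in>{0..<n}. ipoly a (h i))"
    unfolding diag_mat_def by (subst prod.distinct_set_conv_list[symmetric]) (auto simp: L_def)
  also have "\<dots> = (\<Prod>z\<in>Theta. ipoly a z)" by (rule prod.reindex_bij_betw[OF h])
  finally have "of_int (det A) = (\<Prod>z\<in>Theta. ipoly a z)" by (simp add: of_int_hom.hom_det)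
  thus ?thesis by blast
qed

text \<open>The norm from Z[X]/(g) to Z. The choice is unique because the integers embed into the
  complex numbers.\<close>

definition nrm :: "int poly \<Rightarrow> int" where
  "nrm a = (SOME k. of_int k = (\<Prod>z\<in>Theta. ipoly a z))"

lemma nrm: "of_int (nrm a) = (\<Prod>z\<in>Theta. ipoly a z)"
  unfolding nrm_def by (rule someI_ex[OF norm_exists])

lemma nrm_eqI: "of_int k = (\<Prod>z\<in>Theta. ipoly a z) \<Longrightarrow> nrm a = k"
  unfolding nrm[symmetric] by simp

lemma nrm_mult: "nrm (a * b) = nrm a * nrm b"
  by (rule nrm_eqI) (simp add: nrm prod.distrib)

lemma nrm_mod_g: "nrm (a + g * b) = nrm a"
  by (rule nrm_eqI) (simp add: nrm Theta_def)

lemma nrm_linear: "nrm [:r, -1:] = poly g r"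
proof (rule nrm_eqI)
  have "of_int (poly g r) = ipoly g (of_int r :: complex)" by (simp add: ipoly_of_int)
  also have "\<dots> = (\<Prod>z\<in>Theta. of_int r - z)" unfolding ipoly_def Theta_prod by (simp add: poly_prod)
  also have "\<dots> = (\<Prod>z\<in>Theta. ipoly [:r, -1:] z)" by simp
  finally show "of_int (poly g r) = (\<Prod>z\<in>Theta. ipoly [:r, -1:] z)" .
qed

lemma nrm_const: "nrm [:c:] = c ^ n"
  by (rule nrm_eqI) (simp add: Theta_card)

lemma nrm_one: "nrm 1 = 1" using nrm_const[of 1] by (simp add: one_pCons)

lemma Theta_algebraic_int: "z \<in> Theta \<Longrightarrow> algebraic_int z"
  unfolding algebraic_int_altdef_ipoly Theta_def ipoly_def using monic by auto

lemma algebraic_int_ipoly: "algebraic_int z \<Longrightarrow> algebraic_int (ipoly a z)" for z :: "'b::field_char_0"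
  unfolding ipoly_altdef by (intro algebraic_int_sum algebraic_int_add_mult algebraic_int_of_int algebraic_int_power)

text \<open>Expanding the product over the conjugates shows that the two norms differ by m times an
  algebraic integer; this factor is also rational, hence an integer.\<close>

lemma nrm_cong: "m dvd nrm (a + smult m b) - nrm a"
proof (cases "m = 0")
  case False
  have "\<exists>w::complex. algebraic_int w \<and> (\<Prod>z\<in>S. ipoly (a + smult m b) z) = (\<Prod>z\<in>S. ipoly a z) + of_int m * w" if "S \<subseteq> Theta" for S
    using finite_subset[OF that Theta_finite] that
  proof (induction S rule: finite_induct)
    case empty show ?case by (intro exI[of _ 0]) auto
  next
    case (insert x F)
    then obtain w where w: "algebraic_int w" "(\<Prod>z\<in>F. ipoly (a + smult m b) z) = (\<Prod>z\<in>F. ipoly a z) + of_int m * w" by auto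
    have x: "algebraic_int x" using insert Theta_algebraic_int by auto
    show ?case
    proof (intro exI conjI)
      show "algebraic_int (ipoly a x * w + ipoly b x * (\<Prod>z\<in>F. ipoly a z) + of_int m * (ipoly b x * w))"
        using insert by (intro algebraic_int_add_mult algebraic_int_prod algebraic_int_ipoly x w algebraic_int_of_int)
          (auto simp: Theta_algebraic_int)
      show "(\<Prod>z\<in>insert x F. ipoly (a + smult m b) z) = (\<Prod>z\<in>insert x F. ipoly a z) + 
         of_int m * (ipoly a x * w + ipoly b x * (\<Prod>z\<in>F. ipoly a z) + of_int m * (ipoly b x * w))"
        using insert(1,2) w(2) by (simp add: algebra_simps)
    qed
  qed
  from this[of Theta] obtain w :: complex where w: "algebraic_int w" "of_int (nrm (a + smult m b)) = of_int (nrm a) + of_int m * w"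
    unfolding nrm by auto
  have "w = of_int (nrm (a + smult m b) - nrm a) / of_int m" using w(2) False by (simp add: field_simps)
  hence "w \<in> \<rat>" by auto
  hence "w \<in> \<int>" using w(1) rational_algebraic_int_is_int by blast
  then obtain k where "w = of_int k" by (auto elim: Ints_cases)
  hence "of_int (nrm (a + smult m b) - nrm a) = (of_int (m * k) :: complex)" using w(2) by simp
  hence "nrm (a + smult m b) - nrm a = m * k" by (simp only: of_int_eq_iff)
  thus ?thesis by simp
next
  case True thus ?thesis by simp
qed

text \<open>Modulo \<open>g\<close> the reduced polynomial \<open>a\<close> divides a nonzero
  integer \<open>D\<close>, so by multiplicativity its norm divides D^n.\<close>

lemma nrm_nz: 
  assumes "\<And>i. i \<ge> n \<Longrightarrow> coeff a i = 0" "a \<noteq> 0" 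
  shows "nrm a \<noteq> 0"
proof -
  have "\<not> (map_poly of_int g :: rat poly) dvd map_poly of_int a"
  proof
    assume "(map_poly of_int g :: rat poly) dvd map_poly of_int a"
    hence "degree (map_poly of_int g :: rat poly) \<le> degree (map_poly of_int a :: rat poly)"
      by (rule dvd_imp_degree_le) (use assms in simp)
    hence "n \<le> degree a" using deg by simp
    thus False using assms(1)[of "degree a"] assms(2) by simp
  qed
  from bezout_coprime[OF this] obtain U V D where D: "D \<noteq> 0" "U * g + V * a = [:D:]" .
  have "nrm (V * a + g * U) = D ^ n" using D(2) nrm_const[of D] by (simp add: algebra_simps)
  hence "nrm V * nrm a = D ^ n" by (simp only: nrm_mod_g nrm_mult)
  thus ?thesis using D(1) by auto
qed

section \<open>Boxes of reduced polynomials; coefficients against conjugates\<close>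

definition small :: "int \<Rightarrow> int poly set" where
  "small M = {a. (\<forall>i<n. \<bar>coeff a i\<bar> \<le> M) \<and> (\<forall>i\<ge>n. coeff a i = 0)}"

definition box :: "int \<Rightarrow> int \<Rightarrow> int poly set" where
  "box l u = {a. (\<forall>i<n. l \<le> coeff a i \<and> coeff a i < u) \<and> (\<forall>i\<ge>n. coeff a i = 0)}"

lemma bij_box: "bij_betw (\<lambda>f. \<Sum>i<n. monom (f i) i) ({..<n} \<rightarrow>\<^sub>E {l..<u}) (box l u)"
proof (rule bij_betw_byWitness[where f' = "\<lambda>a. \<lambda>i\<in>{..<n}. coeff a i"])
  show "\<forall>f\<in>{..<n} \<rightarrow>\<^sub>E {l..<u}. (\<lambda>i\<in>{..<n}. coeff (\<Sum>i<n. monom (f i) i) i) = f"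
    by (auto simp: coeff_sum fun_eq_iff PiE_def extensional_def)
  show "\<forall>a\<in>box l u. (\<Sum>i<n. monom ((\<lambda>i\<in>{..<n}. coeff a i) i) i) = a"
    by (auto simp: coeff_sum poly_eq_iff box_def)
  show "(\<lambda>f. \<Sum>i<n. monom (f i) i) ` ({..<n} \<rightarrow>\<^sub>E {l..<u}) \<subseteq> box l u"
    by (auto simp: coeff_sum box_def PiE_def Pi_def)
  show "(\<lambda>a. \<lambda>i\<in>{..<n}. coeff a i) ` box l u \<subseteq> {..<n} \<rightarrow>\<^sub>E {l..<u}"
    by (auto simp: box_def split: if_splits)
qed

lemma finite_box: "finite (box l u)" and card_box: "card (box l u) = nat (u - l) ^ n"
  using bij_betw_finite[OF bij_box, of l u] bij_betw_same_card[OF bij_box, of l u]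
  by (auto simp: card_PiE intro: finite_PiE)

lemma poly_zero_if_Theta:
  assumes "\<And>i. i \<ge> n \<Longrightarrow> coeff p i = 0" "\<And>z. z \<in> Theta \<Longrightarrow> poly p z = 0"
  shows "p = 0"
proof (rule ccontr)
  assume p: "p \<noteq> 0"
  hence "degree p < n" using assms(1)[of "degree p"] by (cases "degree p < n") auto
  moreover have "card Theta \<le> card {z. poly p z = 0}"
    using assms(2) p by (intro card_mono poly_roots_finite) auto
  moreover have "card {z. poly p z = 0} \<le> degree p" by (rule card_poly_roots_bound[OF p])
  ultimately show False using Theta_card by simp
qed

text \<open>The cofactor of X - t in \<open>g\<close>; divided by its value at t it is the Lagrange
  basis polynomial belonging to t.\<close>

definition qt :: "complex \<Rightarrow> complex poly" where "qt t = (\<Prod>z\<in>Theta - {t}. [:-z, 1:])"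

lemma degree_qt: "t \<in> Theta \<Longrightarrow> degree (qt t) < n"
  unfolding qt_def using Theta_card Theta_finite n_pos
  by (subst degree_prod_eq_sum_degree) (auto simp: card_Diff_singleton)

lemma coeff_qt: "t \<in> Theta \<Longrightarrow> i \<ge> n \<Longrightarrow> coeff (qt t) i = 0"
  using degree_qt[of t] by (simp add: coeff_eq_0)

lemma poly_qt: "s \<in> Theta \<Longrightarrow> poly (qt t) s = 0 \<longleftrightarrow> s \<noteq> t"
  unfolding qt_def using Theta_finite by (auto simp: poly_prod)

lemma g_qt: "t \<in> Theta \<Longrightarrow> map_poly of_int g = [:-t, 1:] * qt t"
  unfolding Theta_prod qt_def using Theta_finite by (subst prod.remove[of _ t]) auto

lemma pderiv_g_qt: "t \<in> Theta \<Longrightarrow> ipoly (pderiv g) t = poly (qt t) t"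
proof -
  assume t: "t \<in> Theta"
  have "ipoly (pderiv g) t = poly (pderiv (map_poly of_int g)) t"
    by (simp add: ipoly_def of_int_hom.map_poly_pderiv)
  also have "\<dots> = poly (qt t) t" unfolding g_qt[OF t] by (simp only: pderiv_mult) (simp add: pderiv_pCons)
  finally show ?thesis .
qed

lemma lagrange:
  assumes "\<And>i. i \<ge> n \<Longrightarrow> coeff a i = 0"
  shows "a = (\<Sum>t\<in>Theta. smult (poly a t / poly (qt t) t) (qt t))"
proof -
  have "a - (\<Sum>t\<in>Theta. smult (poly a t / poly (qt t) t) (qt t)) = 0"
  proof (rule poly_zero_if_Theta)
    fix i assume "i \<ge> n"
    thus "coeff (a - (\<Sum>t\<in>Theta. smult (poly a t / poly (qt t) t) (qt t))) i = 0"
      using assms by (simp add: coeff_sum coeff_qt)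
  next
    fix z assume z: "z \<in> Theta"
    have "(\<Sum>t\<in>Theta. poly a t / poly (qt t) t * poly (qt t) z) = (\<Sum>t\<in>Theta. if t = z then poly a z else 0)"
      using z by (intro sum.cong refl) (auto simp: poly_qt)
    thus "poly (a - (\<Sum>t\<in>Theta. smult (poly a t / poly (qt t) t) (qt t))) z = 0"
      using z Theta_finite by (simp add: poly_sum)
  qed
  thus ?thesis by simp
qed

text \<open>By Lagrange interpolation the coefficients are fixed linear combinations of the values
  at the conjugates. Together with the reverse estimate below, size measured by coefficients and
  size measured by conjugates agree up to constants depending on \<open>g\<close> only.\<close>

lemma coeff_le_values:
  obtains C :: real where "C > 0" 
    "\<And>a M i. (\<And>i. i \<ge> n \<Longrightarrow> coeff a i = 0) \<Longrightarrow> (\<And>t. t \<in> Theta \<Longrightarrow> cmod (poly a t) \<le> M) \<Longrightarrow> cmod (coeff a i) \<le> C * M"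
proof -
  define c where "c i = (\<Sum>t\<in>Theta. cmod (coeff (qt t) i / poly (qt t) t))" for i
  define C where "C = 1 + (\<Sum>i<n. c i)"
  have c0: "c i \<ge> 0" for i unfolding c_def by (intro sum_nonneg) auto
  have cC: "c i \<le> C" for i
  proof (cases "i < n")
    case True thus ?thesis unfolding C_def using c0 member_le_sum[of i "{..<n}" c] by auto
  next
    case False
    hence "c i = 0" unfolding c_def by (auto simp: coeff_qt)
    thus ?thesis unfolding C_def using sum_nonneg[of "{..<n}" c] c0 by simp
  qed
  show ?thesis
  proof
    show "C > 0" unfolding C_def using sum_nonneg[of "{..<n}" c] c0 by (simp add: add_pos_nonneg)
    fix a M i assume a: "\<And>i. i \<ge> n \<Longrightarrow> coeff a i = 0" "\<And>t. t \<in> Theta \<Longrightarrow> cmod (poly a t) \<le> M"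
    have "Theta \<noteq> {}" using Theta_card n_pos by auto
    then obtain t where "t \<in> Theta" by blast
    from order.trans[OF norm_ge_zero a(2)[OF this]] have M: "M \<ge> 0" .
    have "coeff a i = (\<Sum>t\<in>Theta. poly a t * (coeff (qt t) i / poly (qt t) t))"
      by (subst lagrange[OF a(1)]) (simp_all add: coeff_sum)
    also have "cmod \<dots> \<le> (\<Sum>t\<in>Theta. M * cmod (coeff (qt t) i / poly (qt t) t))"
    proof (rule sum_norm_le)
      fix t assume "t \<in> Theta"
      thus "cmod (poly a t * (coeff (qt t) i / poly (qt t) t)) \<le> M * cmod (coeff (qt t) i / poly (qt t) t)"
        unfolding norm_mult by (intro mult_right_mono a(2)) auto
    qed
    also have "\<dots> = M * c i" unfolding c_def by (simp add: sum_distrib_left)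
    also have "\<dots> \<le> C * M" using mult_right_mono[OF cC[of i] M] by (simp add: mult.commute)
    finally show "cmod (coeff a i) \<le> C * M" .
  qed
qed

lemma values_le_coeff:
  obtains C :: real where "C > 0" 
    "\<And>a M t. a \<in> small M \<Longrightarrow> t \<in> Theta \<Longrightarrow> cmod (ipoly a t) \<le> C * M"
proof -
  define c where "c t = (\<Sum>i<n. cmod t ^ i)" for t
  define C where "C = 1 + (\<Sum>t\<in>Theta. c t)"
  have c0: "c t \<ge> 0" for t unfolding c_def by (intro sum_nonneg) auto
  have cC: "c t \<le> C" if "t \<in> Theta" for t
    unfolding C_def using c0 member_le_sum[OF that, of c] Theta_finite by auto
  show ?thesis
  proof
    show "C > 0" unfolding C_def using sum_nonneg[of Theta c] c0 by (simp add: add_pos_nonneg)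
    fix a M t assume a: "a \<in> small M" "t \<in> Theta"
    have M: "M \<ge> 0" using a n_pos unfolding small_def by force
    have "ipoly a t = (\<Sum>i<n. of_int (coeff a i) * t ^ i)"
      by (rule ipoly_bound) (use a in \<open>auto simp: small_def\<close>)
    also have "cmod \<dots> \<le> (\<Sum>i<n. of_int M * cmod t ^ i)"
      by (intro sum_norm_le) (use a in \<open>auto simp: small_def norm_mult norm_power intro!: mult_right_mono\<close>)
    also have "\<dots> = of_int M * c t" by (simp add: c_def sum_distrib_left)
    also have "\<dots> \<le> C * M" using mult_right_mono[OF cC[OF a(2)], of "of_int M"] M by (simp add: mult.commute)
    finally show "cmod (ipoly a t) \<le> C * M" .
  qed
qed

section \<open>Ideals of Z[X]/(g), encoded as ideals of Z[X] that contain g\<close>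

definition is_ideal :: "int poly set \<Rightarrow> bool" where
  "is_ideal I \<longleftrightarrow> 0 \<in> I \<and> (\<forall>a\<in>I. \<forall>b\<in>I. a + b \<in> I) \<and> (\<forall>a\<in>I. \<forall>b. b * a \<in> I) \<and> g \<in> I"

lemma is_ideal_closed:
  assumes "is_ideal I"
  shows "0 \<in> I" "g \<in> I" "a \<in> I \<Longrightarrow> b \<in> I \<Longrightarrow> a + b \<in> I" "a \<in> I \<Longrightarrow> b * a \<in> I" "a \<in> I \<Longrightarrow> a * b \<in> I"
    "a \<in> I \<Longrightarrow> - a \<in> I" "a \<in> I \<Longrightarrow> b \<in> I \<Longrightarrow> a - b \<in> I" "a \<in> I \<Longrightarrow> smult c a \<in> I"
proof -
  show *: "0 \<in> I" "g \<in> I" "a \<in> I \<Longrightarrow> b \<in> I \<Longrightarrow> a + b \<in> I" "a \<in> I \<Longrightarrow> b * a \<in> I" for a b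
    using assms unfolding is_ideal_def by auto
  show "a \<in> I \<Longrightarrow> a * b \<in> I" using *(4)[of a b] by (simp add: mult.commute)
  show m: "a \<in> I \<Longrightarrow> - a \<in> I" for a using *(4)[of a "-1"] by simp
  show "a \<in> I \<Longrightarrow> b \<in> I \<Longrightarrow> a - b \<in> I" using *(3)[of a "- b"] m by simp
  show "a \<in> I \<Longrightarrow> smult c a \<in> I" using *(4)[of a "[:c:]"] by simp
qed

definition cls :: "int poly set \<Rightarrow> int poly \<Rightarrow> int poly set" where
  "cls I a = {b. b - a \<in> I}"

definition idx :: "int poly set \<Rightarrow> nat" where "idx I = card (range (cls I))"

text \<open>\<open>card\<close> gives 0 for an infinite quotient, so finiteness of the index has to
  be recorded separately.\<close>

definition fin_idx :: "int poly set \<Rightarrow> bool" where "fin_idx I \<longleftrightarrow> finite (range (cls I))"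

lemma cls_eq_iff: "is_ideal I \<Longrightarrow> cls I a = cls I b \<longleftrightarrow> a - b \<in> I"
proof
  assume I: "is_ideal I" and "cls I a = cls I b"
  moreover have "a \<in> cls I a" using is_ideal_closed(1)[OF I] by (simp add: cls_def)
  ultimately show "a - b \<in> I" by (auto simp: cls_def)
next
  assume I: "is_ideal I" and ab: "a - b \<in> I"
  have "c - a \<in> I \<longleftrightarrow> c - b \<in> I" for c
    using is_ideal_closed(3)[OF I, of "c - a" "a - b"] is_ideal_closed(7)[OF I, of "c - b" "a - b"] ab by auto
  thus "cls I a = cls I b" by (simp add: cls_def)
qed

lemma not_dvd_small:
  assumes "\<And>i. i \<ge> n \<Longrightarrow> coeff a i = 0" "a \<noteq> 0"
  shows "\<not> (map_poly of_int g :: rat poly) dvd map_poly of_int a"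
proof
  assume "(map_poly of_int g :: rat poly) dvd map_poly of_int a"
  hence "degree (map_poly of_int g :: rat poly) \<le> degree (map_poly of_int a :: rat poly)"
    by (rule dvd_imp_degree_le) (use assms in simp)
  hence "n \<le> degree a" using deg by simp
  thus False using assms(1)[of "degree a"] assms(2) by simp
qed

text \<open>By pigeonhole \<open>I\<close> contains a nonzero \<beta> with coefficients at most s,
  roughly the n-th root of the index. Dividing \<open>a\<close> by \<beta> and rounding the quotient
  leaves a remainder of the size of \<beta>, so a full system of residues fits into a box whose side
  is comparable with the n-th root of the index.\<close>

lemma small_representatives:
  obtains K :: nat where 
    "\<And>I s a. is_ideal I \<Longrightarrow> fin_idx I \<Longrightarrow> idx I < (s + 1) ^ n \<Longrightarrow> \<exists>b \<in> small (int (K * s)). b - a \<in> I"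
proof -
  obtain C1 :: real where C1: "C1 > 0" 
    "\<And>a M i. (\<And>i. i \<ge> n \<Longrightarrow> coeff a i = 0) \<Longrightarrow> (\<And>t. t \<in> Theta \<Longrightarrow> cmod (poly a t) \<le> M) \<Longrightarrow> cmod (coeff a i) \<le> C1 * M"
    by (rule coeff_le_values) blast
  obtain C2 :: real where C2: "C2 > 0" 
    "\<And>a M t. a \<in> small M \<Longrightarrow> t \<in> Theta \<Longrightarrow> cmod (ipoly a t) \<le> C2 * M" by (rule values_le_coeff) blast
  define K where "K = nat \<lceil>C1 * C2 ^ 2\<rceil>"
  have K: "C1 * C2 ^ 2 \<le> real K" unfolding K_def by linarith
  show ?thesis
  proof
    fix I s a assume I: "is_ideal I" and fin: "fin_idx I" and s: "idx I < (s + 1) ^ n"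
    have "\<not> inj_on (cls I) (box 0 (int s + 1))"
    proof
      assume "inj_on (cls I) (box 0 (int s + 1))"
      hence "card (box 0 (int s + 1)) \<le> idx I"
        unfolding idx_def using fin by (intro card_inj_on_le) (auto simp: fin_idx_def)
      thus False using s by (simp add: card_box nat_add_distrib)
    qed
    then obtain u v where uv: "u \<in> box 0 (int s + 1)" "v \<in> box 0 (int s + 1)" "u \<noteq> v" "cls I u = cls I v"
      unfolding inj_on_def by blast
    define \<beta> where "\<beta> = u - v"
    have \<beta>: "\<beta> \<noteq> 0" "\<beta> \<in> I" "\<beta> \<in> small (int s)" "\<And>i. i \<ge> n \<Longrightarrow> coeff \<beta> i = 0"
    proof -
      show "\<beta> \<noteq> 0" "\<beta> \<in> I" using uv(3,4) cls_eq_iff[OF I] by (auto simp: \<beta>_def)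
      show *: "coeff \<beta> i = 0" if "i \<ge> n" for i using uv(1,2) that by (simp add: \<beta>_def box_def)
      have "\<bar>coeff \<beta> i\<bar> \<le> int s" if "i < n" for i
      proof -
        have "0 \<le> coeff u i" "coeff u i < int s + 1" "0 \<le> coeff v i" "coeff v i < int s + 1"
          using uv(1,2) that by (auto simp: box_def)
        thus ?thesis unfolding \<beta>_def by simp
      qed
      thus "\<beta> \<in> small (int s)" using * by (simp add: small_def)
    qed
    obtain U V D where D: "D \<noteq> 0" "U * g + V * \<beta> = [:D:]"
      by (rule bezout_coprime[OF not_dvd_small[OF \<beta>(4,1)]])
    have D\<tau>: "ipoly V t * ipoly \<beta> t = of_int D" if "t \<in> Theta" for t
      using arg_cong[OF D(2), of "\<lambda>p. ipoly p t"] that by (simp add: Theta_def)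
    \<comment> \<open>Since \<open>V\<close> / \<open>D\<close> inverts \<beta> modulo
      \<open>g\<close>, the exact quotient a / \<beta> is \<open>w\<close> / \<open>D\<close>;
      \<open>w0\<close> is its coefficientwise integral part and \<open>w1\<close> /
      \<open>D\<close> the fractional part.\<close>
    define w where "w = rem (V * a)"
    define w0 where "w0 = map_poly (\<lambda>c. c div D) w"
    define w1 where "w1 = map_poly (\<lambda>c. c mod D) w"
    have cw: "coeff w0 i = coeff w i div D" "coeff w1 i = coeff w i mod D" for i
      by (simp_all add: w0_def w1_def coeff_map_poly)
    have w: "w = smult D w0 + w1" by (simp add: poly_eq_iff cw)
    have w1: "w1 \<in> small \<bar>D\<bar>" unfolding small_def
    proof safe
      fix i show "\<bar>coeff w1 i\<bar> \<le> \<bar>D\<bar>" using abs_mod_less[OF D(1), of "coeff w i"] by (simp add: cw)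
    next
      fix i assume "n \<le> i" thus "coeff w1 i = 0" by (simp add: cw w_def coeff_rem)
    qed
    define b where "b = rem (a - \<beta> * w0)"
    have "b - a = - (\<beta> * w0) - g * quo (a - \<beta> * w0)" 
      unfolding b_def using rem_eq[of "a - \<beta> * w0"] by (simp add: algebra_simps)
    hence "b - a \<in> I" using is_ideal_closed[OF I] \<beta>(2) by auto
    moreover have "b \<in> small (int (K * s))"
    proof -
      \<comment> \<open>At each conjugate b equals \<beta> times the fractional part
        \<open>w1\<close> / \<open>D\<close>. One factor \<open>C2\<close> bounds \<beta>, the other
        bounds the fractional part, whose coefficients are at most 1 in absolute value.\<close>
      have val: "cmod (ipoly b t) \<le> C2 ^ 2 * s" if t: "t \<in> Theta" for t
      proof -
        have gt: "ipoly g t = 0" using t by (simp add: Theta_def)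
        have "of_int D * ipoly b t = ipoly V t * ipoly \<beta> t * (ipoly a t - ipoly \<beta> t * ipoly w0 t)"
          unfolding D\<tau>[OF t] b_def by (simp add: ipoly_rem[OF gt])
        also have "\<dots> = ipoly \<beta> t * (ipoly w t - of_int D * ipoly w0 t)"
          unfolding w_def ipoly_rem[OF gt] D\<tau>[OF t, symmetric] by (simp add: algebra_simps)
        also have "\<dots> = ipoly \<beta> t * ipoly w1 t" unfolding w by simp
        finally have "cmod (of_int D * ipoly b t) = cmod (ipoly \<beta> t * ipoly w1 t)" by (rule arg_cong)
        hence "\<bar>real_of_int D\<bar> * cmod (ipoly b t) = cmod (ipoly \<beta> t) * cmod (ipoly w1 t)"
          by (simp only: norm_mult norm_of_int)
        also have "\<dots> \<le> (C2 * s) * (C2 * \<bar>real_of_int D\<bar>)"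
          using C2(2)[OF \<beta>(3) t] C2(2)[OF w1 t] C2(1) by (intro mult_mono) auto
        finally have "\<bar>real_of_int D\<bar> * cmod (ipoly b t) \<le> \<bar>real_of_int D\<bar> * (C2 ^ 2 * s)"
          by (simp add: power2_eq_square algebra_simps)
        thus ?thesis using D(1) by simp
      qed
      have "cmod (coeff (map_poly of_int b) i) \<le> C1 * (C2 ^ 2 * s)" for i
        by (rule C1(2)) (use val in \<open>auto simp: ipoly_def b_def coeff_rem\<close>)
      hence "real_of_int \<bar>coeff b i\<bar> \<le> C1 * (C2 ^ 2 * s)" for i by simp
      hence "real_of_int \<bar>coeff b i\<bar> \<le> real K * real s" for i
        using order.trans[OF _ mult_right_mono[OF K, of "real s"]] by (simp add: mult.assoc)
      hence "real_of_int \<bar>coeff b i\<bar> \<le> real_of_int (int (K * s))" for i by simp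
      hence "\<bar>coeff b i\<bar> \<le> int (K * s)" for i by (simp only: of_int_le_iff)
      thus ?thesis by (simp add: small_def b_def coeff_rem)
    qed
    ultimately show "\<exists>b \<in> small (int (K * s)). b - a \<in> I" by blast
  qed
qed

text \<open>Translate the points of one class by a system \<open>T\<close> of small representatives,
  one for each class. The sums are distinct, they stay in the box enlarged by K s on every side, and
  they cover the box shrunk by as much. The shift \<open>c\<close> allows classes other than
  \<open>I\<close> itself.\<close>

lemma ideal_count:
  obtains K :: nat where 
    "\<And>I s c R. is_ideal I \<Longrightarrow> fin_idx I \<Longrightarrow> idx I < (s + 1) ^ n \<Longrightarrow> 
       idx I * card {a \<in> box 0 (int R). a - c \<in> I} \<le> (R + 2 * K * s) ^ n"
    "\<And>I s c R. is_ideal I \<Longrightarrow> fin_idx I \<Longrightarrow> idx I < (s + 1) ^ n \<Longrightarrow> 2 * K * s \<le> R \<Longrightarrow>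
       (R - 2 * K * s) ^ n \<le> idx I * card {a \<in> box 0 (int R). a - c \<in> I}"
proof -
  obtain K :: nat where K:
    "\<And>I s a. is_ideal I \<Longrightarrow> fin_idx I \<Longrightarrow> idx I < (s + 1) ^ n \<Longrightarrow> \<exists>b \<in> small (int (K * s)). b - a \<in> I"
    by (rule small_representatives) blast
  have main: "idx I * card {a \<in> box 0 (int R). a - c \<in> I} \<le> (R + 2 * K * s) ^ n \<and>
     (2 * K * s \<le> R \<longrightarrow> (R - 2 * K * s) ^ n \<le> idx I * card {a \<in> box 0 (int R). a - c \<in> I})" 
    if I: "is_ideal I" and fin: "fin_idx I" and s: "idx I < (s + 1) ^ n" for I s c R
  proof -
    define ks where "ks = int (K * s)"
    have "\<forall>a. \<exists>b. b \<in> small ks \<and> b - a \<in> I" using K[OF I fin s] unfolding ks_def by blast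
    then obtain r where r: "\<And>a. r a \<in> small ks" "\<And>a. r a - a \<in> I" by metis
    define t where "t Y = r (SOME a. Y = cls I a)" for Y
    have t: "t Y \<in> small ks" "cls I (t Y) = Y" if "Y \<in> range (cls I)" for Y
    proof -
      have "Y = cls I (SOME a. Y = cls I a)" by (rule someI_ex) (use that in blast)
      also have "\<dots> = cls I (t Y)"
        using r(2)[of "SOME a. Y = cls I a"] cls_eq_iff[OF I, of "t Y" "SOME a. Y = cls I a"] unfolding t_def by simp
      finally show "cls I (t Y) = Y" by simp
    qed (simp add: t_def r)
    define T where "T = t ` range (cls I)"
    have injt: "inj_on t (range (cls I))" by (rule inj_on_inverseI[where g = "cls I"]) (rule t(2))
    have cT: "card T = idx I" "finite T" unfolding T_def idx_def 
      using fin injt by (auto simp: card_image fin_idx_def)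
    have Tsmall: "x \<in> small ks" if "x \<in> T" for x using that t unfolding T_def by auto
    have Tinj: "x = y" if "x \<in> T" "y \<in> T" "x - y \<in> I" for x y
      using that t(2) cls_eq_iff[OF I, of x y] unfolding T_def by auto
    have Trep: "\<exists>x\<in>T. a - x \<in> I" for a
    proof 
      show "t (cls I a) \<in> T" unfolding T_def by blast
      show "a - t (cls I a) \<in> I" using t(2)[of "cls I a"] cls_eq_iff[OF I, of a "t (cls I a)"] by auto
    qed
    define A where "A = {a \<in> box 0 (int R). a - c \<in> I}"
    have finA: "finite A" unfolding A_def using finite_box by auto
    have inj: "inj_on (\<lambda>(a,x). a + x) (A \<times> T)"
    proof (rule inj_onI, safe)
      fix a x b y assume *: "a \<in> A" "b \<in> A" "x \<in> T" "y \<in> T" "a + x = b + y"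
      have eq: "x - y = (b - c) - (a - c)" using *(5) by (simp add: algebra_simps)
      have "x - y \<in> I" unfolding eq by (rule is_ideal_closed(7)[OF I]) (use *(1,2) in \<open>auto simp: A_def\<close>)
      hence "x = y" using Tinj * by blast
      thus "a = b" "x = y" using *(5) by auto
    qed
    have ks0: "ks \<ge> 0" by (simp add: ks_def)
    have "card (A \<times> T) \<le> card (box (- ks) (int R + ks))"
    proof (rule card_inj_on_le[OF inj _ finite_box], safe)
      fix a x assume ax: "a \<in> A" "x \<in> T"
      have "- ks \<le> coeff a i + coeff x i \<and> coeff a i + coeff x i < int R + ks" if "i < n" for i
      proof -
        have "0 \<le> coeff a i" "coeff a i < int R" using ax that unfolding A_def box_def by auto
        moreover have "\<bar>coeff x i\<bar> \<le> ks" using Tsmall[OF ax(2)] that unfolding small_def by auto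
        ultimately show ?thesis by linarith
      qed
      moreover have "coeff a i + coeff x i = 0" if "i \<ge> n" for i
        using ax Tsmall[OF ax(2)] that unfolding small_def A_def box_def by auto
      ultimately show "a + x \<in> box (- ks) (int R + ks)" unfolding box_def by auto
    qed
    hence "card A * idx I \<le> nat (int R + ks - (- ks)) ^ n"
      using cT by (simp add: card_cartesian_product card_box)
    also have "nat (int R + ks - (- ks)) = R + 2 * K * s" by (simp add: ks_def nat_eq_iff)
    finally have 1: "idx I * card A \<le> (R + 2 * K * s) ^ n" by (simp add: mult.commute)
    have 2: "(R - 2 * K * s) ^ n \<le> idx I * card A" if "2 * K * s \<le> R"
    proof -
      have "box ks (int R - ks) \<subseteq> (\<lambda>(a,x). a + x) ` (A \<times> T)"
      proof
        fix b assume b: "b \<in> box ks (int R - ks)"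
        obtain x where x: "x \<in> T" "(b - c) - x \<in> I" using Trep by blast
        have "0 \<le> coeff b i - coeff x i \<and> coeff b i - coeff x i < int R" if "i < n" for i
        proof -
          have "ks \<le> coeff b i" "coeff b i < int R - ks" using b that unfolding box_def by auto
          moreover have "\<bar>coeff x i\<bar> \<le> ks" using Tsmall[OF x(1)] that unfolding small_def by auto
          ultimately show ?thesis by linarith
        qed
        moreover have "coeff b i - coeff x i = 0" if "i \<ge> n" for i
          using b Tsmall[OF x(1)] that unfolding small_def box_def by auto
        ultimately have "b - x \<in> box 0 (int R)" unfolding box_def by auto
        moreover have "(b - x) - c \<in> I" using x(2) by (simp add: algebra_simps)
        ultimately have "(b - x, x) \<in> A \<times> T" using x(1) by (simp add: A_def)
        thus "b \<in> (\<lambda>(a,x). a + x) ` (A \<times> T)" by force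
      qed
      hence "card (box ks (int R - ks)) \<le> card (A \<times> T)"
        using finA cT(2) by (intro surj_card_le[of _ _ "\<lambda>(a,x). a + x"]) auto
      moreover have "int R - ks - ks = int (R - 2 * K * s)" using that by (subst of_nat_diff) (auto simp: ks_def)
      ultimately show ?thesis using cT by (simp add: card_cartesian_product card_box mult.commute)
    qed
    show ?thesis using 1 2 unfolding A_def by blast
  qed
  show ?thesis
  proof (rule that[of K])
    fix I s c R assume "is_ideal I" "fin_idx I" "idx I < (s + 1) ^ n"
    from main[OF this] show "idx I * card {a \<in> box 0 (int R). a - c \<in> I} \<le> (R + 2 * K * s) ^ n"
      and "2 * K * s \<le> R \<Longrightarrow> (R - 2 * K * s) ^ n \<le> idx I * card {a \<in> box 0 (int R). a - c \<in> I}" by simp_all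
  qed
qed

end

section \<open>Roots of a polynomial modulo a prime\<close>

lemma poly_split: "p = [:- c, 1:] * synthetic_div p c + [:poly p c:]" for p :: "'a::comm_ring_1 poly"
  using synthetic_div_correct'[of c p] by simp

text \<open>Lagrange's bound over the field with p elements, with \<open>S\<close> standing for a
  set of distinct residues; one root is split off at a time.\<close>

lemma roots_mod_prime_card:
  fixes f :: "int poly" and p :: int
  assumes p: "prime p" and "lead_coeff f = 1" and "finite S"
    and "\<And>s. s \<in> S \<Longrightarrow> p dvd poly f s"
    and "\<And>s t. s \<in> S \<Longrightarrow> t \<in> S \<Longrightarrow> p dvd s - t \<Longrightarrow> s = t"
  shows "card S \<le> degree f"
  using assms(2-)
proof (induction "degree f" arbitrary: f S)
  case 0
  then obtain c where "f = [:c:]" by (metis degree_eq_zeroE)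
  hence f: "f = [:1:]" using 0 by simp
  have "\<not> p dvd 1" using p not_prime_unit by blast
  hence "\<not> p dvd poly f s" for s using f by simp
  hence "S = {}" using 0 by auto
  thus ?case by simp
next
  case (Suc d)
  show ?case
  proof (cases "S = {}")
    case False
    then obtain r where r: "r \<in> S" by blast
    define h where "h = synthetic_div f r"
    have f: "f = [:- r, 1:] * h + [:poly f r:]" unfolding h_def by (rule poly_split)
    have dh: "degree h = d" unfolding h_def using Suc(2) by (simp add: degree_synthetic_div)
    have "coeff f (Suc d) = coeff h d"
      using arg_cong[OF f, of "\<lambda>q. coeff q (Suc d)"] dh by (simp add: coeff_eq_0)
    hence lh: "lead_coeff h = 1" using Suc(2,3) dh by simp
    have "card (S - {r}) \<le> degree h"
    proof (rule Suc(1)[OF _ lh])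
      fix s assume s: "s \<in> S - {r}"
      have "poly f s = (s - r) * poly h s + poly f r"
        using arg_cong[OF f, of "\<lambda>q. poly q s"] by (simp add: algebra_simps)
      hence "p dvd (s - r) * poly h s" using Suc(5)[of s] Suc(5)[OF r] s by (simp add: dvd_add_left_iff)
      moreover have "\<not> p dvd s - r" using Suc(6)[of s r] s r by blast
      ultimately show "p dvd poly h s" using p by (simp add: prime_dvd_mult_iff)
    qed (use dh Suc(4,6) in auto)
    thus ?thesis using r Suc(2,4) dh by (simp add: card_Diff_singleton)
  qed simp
qed

context int_poly_field
begin

section \<open>Root ideals, the ideals (a, g, q) and maximal ideals\<close>

lemma fin_idx_if_const:
  assumes I: "is_ideal I" and N: "[:int N:] \<in> I" "N > 0"
  shows "fin_idx I" "idx I \<le> N ^ n"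
proof -
  have "cls I a \<in> cls I ` box 0 (int N)" for a
  proof
    define b where "b = map_poly (\<lambda>c. c mod int N) (rem a)"
    define q where "q = map_poly (\<lambda>c. c div int N) (rem a)"
    have c: "coeff b i = coeff (rem a) i mod int N" "coeff q i = coeff (rem a) i div int N" for i
      by (simp_all add: b_def q_def coeff_map_poly)
    have "rem a = b + q * [:int N:]" by (simp add: poly_eq_iff c)
    hence eq: "a - b = g * quo a + q * [:int N:]" using rem_eq[of a] by simp
    have "a - b \<in> I" unfolding eq by (intro is_ideal_closed(3,4,5)[OF I] is_ideal_closed(2)[OF I] N(1))
    thus "cls I a = cls I b" using cls_eq_iff[OF I] by simp
    show "b \<in> box 0 (int N)" using N(2) by (simp add: box_def c coeff_rem)
  qed
  hence *: "range (cls I) \<subseteq> cls I ` box 0 (int N)" by auto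
  show "fin_idx I" unfolding fin_idx_def by (rule finite_subset[OF *]) (simp add: finite_box)
  have "idx I \<le> card (cls I ` box 0 (int N))" unfolding idx_def by (rule card_mono[OF _ *]) (simp add: finite_box)
  also have "\<dots> \<le> card (box 0 (int N))" by (rule card_image_le[OF finite_box])
  finally show "idx I \<le> N ^ n" by (simp add: card_box)
qed

lemma idx_ge:
  assumes I: "is_ideal I" "fin_idx I" and f: "\<And>x y. x \<in> S \<Longrightarrow> y \<in> S \<Longrightarrow> f x - f y \<in> I \<Longrightarrow> x = y"
  shows "card S \<le> idx I"
proof -
  have "inj_on (\<lambda>x. cls I (f x)) S" by (rule inj_onI) (simp add: cls_eq_iff[OF I(1)] f)
  thus ?thesis unfolding idx_def using I(2) by (intro card_inj_on_le[of "\<lambda>x. cls I (f x)"]) (auto simp: fin_idx_def)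
qed

text \<open>The kernel of evaluation at r modulo q. If q is a prime and r a root of \<open>g\<close>
  modulo q, it is a prime ideal of residue degree one.\<close>

definition rt :: "int \<Rightarrow> int \<Rightarrow> int poly set" where "rt q r = {a. q dvd poly a r}"

lemma rt_ideal: "q dvd poly g r \<Longrightarrow> is_ideal (rt q r)"
  unfolding is_ideal_def rt_def by auto

lemma rt_fin: "q > 0 \<Longrightarrow> int q dvd poly g r \<Longrightarrow> fin_idx (rt (int q) r)"
  by (rule fin_idx_if_const(1)[OF rt_ideal, of _ _ q]) (auto simp: rt_def)

lemma rt_idx: 
  assumes "q > 0" "int q dvd poly g r" shows "idx (rt (int q) r) = q"
proof (rule antisym)
  let ?I = "rt (int q) r"
  have I: "is_ideal ?I" by (rule rt_ideal[OF assms(2)])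
  have "range (cls ?I) \<subseteq> (\<lambda>k. cls ?I [:int k:]) ` {..<q}"
  proof safe
    fix a
    have "a - [:int (nat (poly a r mod int q)):] \<in> ?I" using assms(1) by (simp add: rt_def)
    hence "cls ?I a = cls ?I [:int (nat (poly a r mod int q)):]" using cls_eq_iff[OF I] by simp
    moreover have "nat (poly a r mod int q) < q" using assms(1) by (simp add: nat_less_iff)
    ultimately show "cls ?I a \<in> (\<lambda>k. cls ?I [:int k:]) ` {..<q}" by blast
  qed
  from card_mono[OF _ this] show "idx ?I \<le> q" unfolding idx_def
    using card_image_le[of "{..<q}" "\<lambda>k. cls ?I [:int k:]"] by simp
  have "card {0..<int q} \<le> idx ?I"
  proof (rule idx_ge[OF I rt_fin[OF assms], where f = "\<lambda>k. [:k:]"])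
    fix x y assume "x \<in> {0..<int q}" "y \<in> {0..<int q}" "[:x:] - [:y:] \<in> ?I"
    thus "x = y" using zdvd_imp_le[of "int q" "x - y"] zdvd_imp_le[of "int q" "y - x"]
      by (cases x y rule: linorder_cases) (auto simp: rt_def dvd_diff_commute)
  qed
  thus "q \<le> idx ?I" by simp
qed

definition idl :: "int poly \<Rightarrow> int \<Rightarrow> int poly set" where
  "idl a q = {u * a + v * g + smult q w | u v w. True}"

lemma idl_ideal: "is_ideal (idl a q)"
proof -
  have "0 \<in> idl a q" unfolding idl_def by (auto intro!: exI[of _ 0])
  moreover have "x + y \<in> idl a q" if xy: "x \<in> idl a q" "y \<in> idl a q" for x y
  proof -
    obtain u v w where x: "x = u * a + v * g + smult q w" using xy(1) by (auto simp: idl_def)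
    obtain u' v' w' where y: "y = u' * a + v' * g + smult q w'" using xy(2) by (auto simp: idl_def)
    have "x + y = (u + u') * a + (v + v') * g + smult q (w + w')"
      unfolding x y by (simp add: algebra_simps smult_add_right)
    thus ?thesis unfolding idl_def by blast
  qed
  moreover have "y * x \<in> idl a q" if xy: "x \<in> idl a q" for x y
  proof -
    obtain u v w where x: "x = u * a + v * g + smult q w" using xy by (auto simp: idl_def)
    have "y * x = (y * u) * a + (y * v) * g + smult q (y * w)" unfolding x by (simp add: algebra_simps)
    thus ?thesis unfolding idl_def by blast
  qed
  moreover have "g = 0 * a + 1 * g + smult q 0" by simp
  hence "g \<in> idl a q" unfolding idl_def by blast
  ultimately show ?thesis unfolding is_ideal_def by blast
qed

lemma idl_mem: "a \<in> idl a q" "[:q:] \<in> idl a q"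
proof -
  have "a = 1 * a + 0 * g + smult q 0" "[:q:] = 0 * a + 0 * g + smult q 1" by simp_all
  thus "a \<in> idl a q" "[:q:] \<in> idl a q" unfolding idl_def by blast+
qed

lemma idl_subset: "is_ideal I \<Longrightarrow> a \<in> I \<Longrightarrow> [:q:] \<in> I \<Longrightarrow> idl a q \<subseteq> I"
proof
  fix x assume I: "is_ideal I" "a \<in> I" "[:q:] \<in> I" and "x \<in> idl a q"
  then obtain u v w where x: "x = u * a + v * g + w * [:q:]" by (auto simp: idl_def mult.commute)
  show "x \<in> I" unfolding x by (intro is_ideal_closed(3,4)[OF I(1)] I is_ideal_closed(2)[OF I(1)])
qed

text \<open>The summand in \<open>g\<close> leaves the norm unchanged and the summand in q changes
  it by a multiple of q. So divisibility of the norm of \<open>a\<close> by q spreads over the whole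
  ideal (a, g, q).\<close>

lemma nrm_cong_idl:
  assumes "x = u * a + v * g + smult q w"
  shows "q dvd nrm x - nrm u * nrm a"
proof -
  have "nrm (u * a + smult q w) = nrm x" 
    using nrm_mod_g[of "u * a + smult q w" v] assms by (simp add: algebra_simps)
  thus ?thesis using nrm_cong[of q "u * a" w] by (simp add: nrm_mult)
qed

definition maxi :: "int poly set \<Rightarrow> bool" where
  "maxi m \<longleftrightarrow> is_ideal m \<and> 1 \<notin> m \<and> (\<forall>J. is_ideal J \<longrightarrow> m \<subseteq> J \<longrightarrow> 1 \<notin> J \<longrightarrow> J = m)"

text \<open>An ideal above \<open>I\<close> is a union of classes of \<open>I\<close>, of which
  there are finitely many; a proper ideal made of as many classes as possible is maximal.\<close>

lemma ex_maxi:
  assumes I: "is_ideal I" "fin_idx I" "1 \<notin> I"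
  obtains m where "maxi m" "I \<subseteq> m"
proof -
  let ?P = "\<lambda>J. is_ideal J \<and> I \<subseteq> J \<and> 1 \<notin> J"
  have fin: "finite (cls I ` J)" for J using I(2) unfolding fin_idx_def by (rule finite_subset[rotated]) auto
  have "\<exists>J. ?P J \<and> (\<forall>J'. ?P J' \<longrightarrow> card (cls I ` J') \<le> card (cls I ` J))"
  proof (rule ex_has_greatest_nat[of ?P I _ "idx I + 1"])
    show "\<forall>J. ?P J \<longrightarrow> card (cls I ` J) < idx I + 1"
      unfolding idx_def using I(2) by (auto simp: fin_idx_def less_Suc_eq_le intro!: card_mono)
  qed (use I in auto)
  then obtain J where J: "?P J" "\<And>J'. ?P J' \<Longrightarrow> card (cls I ` J') \<le> card (cls I ` J)" by blast
  have "J' = J" if J': "is_ideal J'" "J \<subseteq> J'" "1 \<notin> J'" for J'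
  proof (rule ccontr)
    assume "J' \<noteq> J"
    then obtain x where x: "x \<in> J'" "x \<notin> J" using J'(2) by blast
    have "cls I x \<notin> cls I ` J"
    proof
      assume "cls I x \<in> cls I ` J"
      then obtain y where y: "y \<in> J" "x - y \<in> I" using cls_eq_iff[OF I(1)] by auto
      hence "(x - y) + y \<in> J" using J(1) is_ideal_closed(3)[of J] by blast
      thus False using x by simp
    qed
    hence "cls I ` J \<subset> cls I ` J'" using J'(2) x by blast
    hence "card (cls I ` J) < card (cls I ` J')" by (rule psubset_card_mono[OF fin])
    thus False using J(2)[of J'] J(1) J' by auto
  qed
  thus ?thesis using that[of J] J(1) unfolding maxi_def by blast
qed

lemma maxi_prime:
  assumes m: "maxi m" and ab: "a * b \<in> m" shows "a \<in> m \<or> b \<in> m"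
proof (rule ccontr)
  assume n: "\<not> (a \<in> m \<or> b \<in> m)"
  have I: "is_ideal m" using m by (simp add: maxi_def)
  define J where "J = {x + y * a | x y. x \<in> m}"
  have "is_ideal J" unfolding is_ideal_def
  proof (intro conjI ballI allI)
    have "0 = 0 + 0 * a" "g = g + 0 * a" by simp_all
    thus "0 \<in> J" "g \<in> J" unfolding J_def using is_ideal_closed(1,2)[OF I] by blast+
    fix x assume "x \<in> J"
    then obtain u v where x: "x = u + v * a" "u \<in> m" unfolding J_def by blast
    { fix y assume "y \<in> J"
      then obtain u' v' where y: "y = u' + v' * a" "u' \<in> m" unfolding J_def by blast
      have "x + y = (u + u') + (v + v') * a" unfolding x y by (simp add: algebra_simps)
      thus "x + y \<in> J" unfolding J_def using is_ideal_closed(3)[OF I x(2) y(2)] by blast }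
    fix y 
    have "y * x = y * u + (y * v) * a" unfolding x by (simp add: algebra_simps)
    thus "y * x \<in> J" unfolding J_def using is_ideal_closed(4)[OF I x(2)] by blast
  qed
  moreover have "m \<subseteq> J"
  proof
    fix x assume "x \<in> m"
    moreover have "x = x + 0 * a" by simp
    ultimately show "x \<in> J" unfolding J_def by blast
  qed
  moreover have "a \<in> J" 
  proof -
    have "a = 0 + 1 * a" by simp
    thus ?thesis unfolding J_def using is_ideal_closed(1)[OF I] by blast
  qed
  ultimately have "1 \<in> J" using m n unfolding maxi_def by blast
  then obtain x y where xy: "1 = x + y * a" "x \<in> m" unfolding J_def by blast
  have "b = b * (x + y * a)" unfolding xy(1)[symmetric] by simp
  also have "\<dots> = b * x + y * (a * b)" by (simp add: algebra_simps)
  also have "\<dots> \<in> m" by (intro is_ideal_closed(3,4)[OF I] xy ab)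
  finally show False using n by simp
qed

lemma maxi_const:
  assumes m: "maxi m" and p: "prime p" "[:p:] \<in> m" and k: "[:k:] \<in> m"
  shows "p dvd k"
proof (rule ccontr)
  assume "\<not> p dvd k"
  hence "coprime p k" using p(1) by (rule prime_imp_coprime[rotated])
  hence "gcd p k = 1" by simp
  then obtain u v where uv: "u * p + v * k = 1" using bezout_int[of p k] by auto
  have I: "is_ideal m" using m by (simp add: maxi_def)
  have "smult u [:p:] + smult v [:k:] \<in> m" by (intro is_ideal_closed(3,8)[OF I] p k)
  moreover have "smult u [:p:] + smult v [:k:] = 1" using uv by (simp add: one_pCons)
  ultimately show False using m by (simp add: maxi_def)
qed

text \<open>Otherwise the norm 1 of the unit element would be congruent modulo p to a multiple of
  the norm of \<open>a\<close>, hence to 0.\<close>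

lemma idl_proper: 
  assumes p: "prime p" and a: "p dvd nrm a" shows "1 \<notin> idl a p"
proof
  assume "1 \<in> idl a p"
  then obtain u v w where "1 = u * a + v * g + smult p w" by (auto simp: idl_def)
  from nrm_cong_idl[OF this] have "p dvd 1 - nrm u * nrm a" by (simp add: nrm_one)
  moreover have "p dvd nrm u * nrm a" using a by simp
  ultimately have "p dvd (1 - nrm u * nrm a) + nrm u * nrm a" by (rule dvd_add)
  hence "p dvd 1" by simp
  thus False using p not_prime_unit by blast
qed

text \<open>Look at the classes of u + v X with 0 \<le> u, v < p. If they are distinct, the index is
  at least p^2. If two of them coincide, the coefficient of X in the difference is invertible modulo
  p, so X is congruent to an integer r and the ideal is the root ideal of r.\<close>

lemma maxi_cases:
  assumes m: "maxi m" and p: "prime (int p)" "[:int p:] \<in> m"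
  shows "p ^ 2 \<le> idx m \<or> (\<exists>r\<in>{0..<int p}. int p dvd poly g r \<and> m = rt (int p) r)"
proof (cases "\<exists>u v. \<bar>u\<bar> < int p \<and> \<bar>v\<bar> < int p \<and> (u, v) \<noteq> (0, 0) \<and> [:u, v:] \<in> m")
  case False
  have I: "is_ideal m" using m by (simp add: maxi_def)
  have p0: "p > 0" using prime_gt_0_int[OF p(1)] by simp
  have "card ({0..<int p} \<times> {0..<int p}) \<le> idx m"
  proof (rule idx_ge[OF I, where f = "\<lambda>(u,v). [:u,v:]"])
    show "fin_idx m" by (rule fin_idx_if_const(1)[OF I p(2) p0])
    fix x y assume xy: "x \<in> {0..<int p} \<times> {0..<int p}" "y \<in> {0..<int p} \<times> {0..<int p}"
      "(case x of (u,v) \<Rightarrow> [:u,v:]) - (case y of (u,v) \<Rightarrow> [:u,v:]) \<in> m"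
    obtain u v u' v' where e: "x = (u,v)" "y = (u',v')" by (cases x; cases y)
    have "[:u - u', v - v':] \<in> m" using xy(3) by (simp add: e)
    moreover have "\<bar>u - u'\<bar> < int p" "\<bar>v - v'\<bar> < int p" using xy e by auto
    ultimately have "(u - u', v - v') = (0,0)" using False by blast
    thus "x = y" using e by simp
  qed
  thus ?thesis by (simp add: card_cartesian_product power2_eq_square)
next
  case True
  have I: "is_ideal m" using m by (simp add: maxi_def)
  obtain u v where uv: "\<bar>u\<bar> < int p" "\<bar>v\<bar> < int p" "(u, v) \<noteq> (0, 0)" "[:u, v:] \<in> m" using True by blast
  have v: "v \<noteq> 0"
  proof
    assume "v = 0"
    hence "int p dvd u" using maxi_const[OF m p, of u] uv by simp
    hence "u = 0" using uv(1) dvd_imp_le_int[of u "int p"] by fastforce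
    thus False using uv(3) \<open>v = 0\<close> by simp
  qed
  have "\<not> int p dvd v" using v uv(2) dvd_imp_le_int[of v "int p"] by fastforce
  hence "coprime (int p) v" using p(1) by (rule prime_imp_coprime[rotated])
  hence "gcd (int p) v = 1" by simp
  then obtain c w where cw: "c * int p + w * v = 1" using bezout_int[of "int p" v] by auto
  define r where "r = (- w * u) mod int p"
  have p0: "int p > 0" by (rule prime_gt_0_int[OF p(1)])
  define t where "t = - ((- w * u) div int p)"
  have t: "r = - w * u + t * int p" unfolding r_def t_def
    using mult_div_mod_eq[of "int p" "- w * u"] by (simp add: algebra_simps)
  have "smult w [:u, v:] + [:- t, c:] * [:int p:] \<in> m" by (intro is_ideal_closed(3,4,8)[OF I] uv p)
  moreover have "smult w [:u, v:] + [:- t, c:] * [:int p:] = [:- r, 1:]"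
    using cw t by (simp add: algebra_simps)
  ultimately have xr: "[:- r, 1:] \<in> m" by simp
  have iff: "a \<in> m \<longleftrightarrow> int p dvd poly a r" for a
  proof
    assume "a \<in> m"
    hence "a - [:- r, 1:] * synthetic_div a r \<in> m" by (intro is_ideal_closed(5,7)[OF I] xr)
    moreover have "a - [:- r, 1:] * synthetic_div a r = [:poly a r:]" using poly_split[of a r] by simp
    ultimately have "[:poly a r:] \<in> m" by simp
    thus "int p dvd poly a r" by (rule maxi_const[OF m p])
  next
    assume "int p dvd poly a r"
    then obtain k where k: "poly a r = int p * k" by blast
    have "[:- r, 1:] * synthetic_div a r + smult k [:int p:] \<in> m" by (intro is_ideal_closed(3,5,8)[OF I] xr p)
    thus "a \<in> m" using poly_split[of a r] k by (simp add: mult.commute)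
  qed
  have "m = rt (int p) r" using iff by (auto simp: rt_def)
  moreover have "int p dvd poly g r" using iff is_ideal_closed(2)[OF I] by blast
  moreover have "r \<in> {0..<int p}" unfolding r_def using p0 by simp
  ultimately show ?thesis by blast
qed

end

section \<open>Primes modulo which the polynomial has a root\<close>

lemma poly_diff_dvd: "s - r dvd poly f s - poly f (r::'a::comm_ring_1)"
proof -
  have "poly f s = (s - r) * poly (synthetic_div f r) s + poly f r"
    using arg_cong[OF poly_split[of f r], of "\<lambda>q. poly q s"] by (simp add: algebra_simps)
  thus ?thesis by simp
qed

lemma dvd_iff_if_dvd_diff: "q dvd x - y \<Longrightarrow> q dvd x \<longleftrightarrow> q dvd (y::'a::comm_ring_1)"
  using dvd_add[of q "x - y" y] dvd_diff[of q x "x - y"] by auto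

lemma bezout_prime_int: 
  assumes "prime (p::int)" "\<not> p dvd k" obtains u v where "u * p + v * k = 1"
proof -
  have "gcd p k = 1" using prime_imp_coprime[OF assms] by simp
  thus ?thesis using bezout_int[of p k] that by auto
qed

lemma poly_taylor1: obtains c where "poly f (r + h) = poly f r + h * poly (pderiv f) r + h ^ 2 * (c::int)"
proof -
  have "\<exists>c. poly f (r + h) = poly f r + h * poly (pderiv f) r + h ^ 2 * c"
  proof (induction f)
    case (pCons a f)
    then obtain c where "poly f (r + h) = poly f r + h * poly (pderiv f) r + h ^ 2 * c" by blast
    hence "poly (pCons a f) (r + h) = poly (pCons a f) r + h * poly (pderiv (pCons a f)) r + h ^ 2 * ((r + h) * c + poly (pderiv f) r)"
      by (simp add: pderiv_pCons algebra_simps power2_eq_square)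
    thus ?case by blast
  qed simp
  thus ?thesis using that by blast
qed

lemma hensel_step:
  fixes f :: "int poly"
  assumes p: "prime (int p)" and r: "int p dvd q" "q dvd poly f r" "\<not> int p dvd poly (pderiv f) r"
  obtains t where "(q * int p) dvd poly f (r + q * t)"
proof -
  obtain v w where w: "v * int p + w * poly (pderiv f) r = 1" by (rule bezout_prime_int[OF p r(3)])
  obtain k where k: "poly f r = q * k" using r(2) by blast
  define t where "t = - k * w"
  obtain c where c: "poly f (r + q * t) = poly f r + (q * t) * poly (pderiv f) r + (q * t) ^ 2 * c" by (rule poly_taylor1)
  have "int p dvd 1 - poly (pderiv f) r * w" by (rule dvdI[of _ _ v]) (use w in \<open>simp add: algebra_simps\<close>)
  moreover have "poly f r + (q * t) * poly (pderiv f) r = q * (k * (1 - poly (pderiv f) r * w))"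
    unfolding k t_def by (simp add: algebra_simps)
  ultimately have "q * int p dvd poly f r + (q * t) * poly (pderiv f) r" by simp
  moreover have "q * int p dvd (q * t) ^ 2 * c" using r(1) by (simp add: power2_eq_square mult.assoc dvd_mult)
  ultimately have "q * int p dvd poly f (r + q * t)" unfolding c by (rule dvd_add)
  thus ?thesis by (rule that)
qed

lemma hensel_lift:
  fixes f :: "int poly"
  assumes p: "prime (int p)" and r: "int p dvd poly f r" "\<not> int p dvd poly (pderiv f) r"
  shows "\<exists>s. int p ^ Suc k dvd poly f s \<and> int p dvd s - r"
proof (induction k)
  case 0 show ?case using r by (intro exI[of _ r]) simp
next
  case (Suc k)
  then obtain s where s: "int p ^ Suc k dvd poly f s" "int p dvd s - r" by blast
  have "int p dvd poly (pderiv f) s - poly (pderiv f) r"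
  proof -
    have "s - r dvd poly (pderiv f) s - poly (pderiv f) r" by (rule poly_diff_dvd)
    thus ?thesis using s(2) by (rule dvd_trans[rotated])
  qed
  hence "\<not> int p dvd poly (pderiv f) s" using r(2) dvd_iff_if_dvd_diff by blast
  from hensel_step[OF p _ s(1) this] obtain t where t: "int p ^ Suc k * int p dvd poly f (s + int p ^ Suc k * t)" by auto
  have "int p dvd (s + int p ^ Suc k * t) - r" using dvd_add[OF s(2), of "int p ^ Suc k * t"] by (simp add: algebra_simps)
  thus ?case using t by (intro exI[of _ "s + int p ^ Suc k * t"]) (simp add: mult.commute)
qed

text \<open>The difference of the two values is the difference of the arguments times a factor
  congruent to the derivative modulo p, and that factor is prime to p.\<close>

lemma simple_root_unique:
  fixes f :: "int poly"
  assumes p: "prime (int p)" and s: "int p ^ k dvd poly f s" "int p ^ k dvd poly f t" "int p dvd s - t"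
    and "\<not> int p dvd poly (pderiv f) s"
  shows "int p ^ k dvd s - t"
proof -
  obtain c where c: "poly f (s + (t - s)) = poly f s + (t - s) * poly (pderiv f) s + (t - s) ^ 2 * c" by (rule poly_taylor1)
  have "(t - s) * (poly (pderiv f) s + (t - s) * c) = poly f t - poly f s"
    using c by (simp add: algebra_simps power2_eq_square)
  hence "int p ^ k dvd (t - s) * (poly (pderiv f) s + (t - s) * c)" using s by simp
  moreover have "int p dvd (t - s) * c" using s(3) by (simp add: dvd_diff_commute)
  hence "\<not> int p dvd poly (pderiv f) s + (t - s) * c" using assms(5) by (simp add: dvd_add_left_iff)
  hence "coprime (int p ^ k) (poly (pderiv f) s + (t - s) * c)"
    using prime_imp_coprime[OF p] by (simp add: coprime_power_left_iff)
  ultimately have "int p ^ k dvd t - s" by (simp add: coprime_dvd_mult_left_iff)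
  thus ?thesis by (simp add: dvd_diff_commute)
qed

context int_poly_field
begin

section \<open>Norms divisible by p^2 and ideals of index at least p^2\<close>

definition good :: "nat \<Rightarrow> bool" where
  "good p \<longleftrightarrow> prime p \<and> (\<forall>r. int p dvd poly g r \<longrightarrow> \<not> int p dvd poly (pderiv g) r)"

text \<open>A prime at which \<open>g\<close> has a multiple root divides the integer
  \<open>D\<close> of a Bezout identity for \<open>g\<close> and its derivative.\<close>

lemma good_eventually: obtains D where "D > 0" "\<And>p. prime p \<Longrightarrow> p > D \<Longrightarrow> good p"
proof -
  obtain U V D where D: "D \<noteq> 0" "U * g + V * pderiv g = [:D:]" by (rule bezout_pderiv)
  show ?thesis
  proof (rule that)
    show "nat \<bar>D\<bar> > 0" using D by simp
    fix p :: nat assume p: "prime p" "p > nat \<bar>D\<bar>"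
    show "good p" unfolding good_def
    proof (intro conjI allI impI notI p)
      fix r assume "int p dvd poly g r" "int p dvd poly (pderiv g) r"
      hence "int p dvd poly (U * g + V * pderiv g) r" by simp
      hence "int p dvd D" unfolding D(2) by simp
      hence "int p \<le> \<bar>D\<bar>" using dvd_imp_le_int[OF D(1)] by force
      thus False using p by simp
    qed
  qed
qed

text \<open>The three families are the possible sources of a factor p^2 in a norm: a maximal ideal
  above p of index at least p^2, two different root ideals, and a root modulo p^2, which takes the
  place of the square of a root ideal. Their indices are at least p^2, so sums of 1 / index over all
  p converge.\<close>

definition fam1 :: "nat \<Rightarrow> int poly set set" where
  "fam1 p = {m. maxi m \<and> [:int p:] \<in> m \<and> p ^ 2 \<le> idx m}"
definition roots :: "nat \<Rightarrow> int set" where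
  "roots p = {r\<in>{0..<int p}. int p dvd poly g r}"
definition fam2 :: "nat \<Rightarrow> int poly set set" where
  "fam2 p = (\<lambda>(r,s). rt (int p) r \<inter> rt (int p) s) ` {(r,s). r \<in> roots p \<and> s \<in> roots p \<and> r \<noteq> s}"
definition fam3 :: "nat \<Rightarrow> int poly set set" where
  "fam3 p = rt (int (p ^ 2)) ` roots (p ^ 2)"

text \<open>Suppose that no such ideal contains \<open>a\<close>. Then (a, g, p) lies in only one
  maximal ideal, a root ideal at some r, which lifts to r2 modulo p^2. Working near this ideal shows
  that (a, g, p^2) contains X - r2 and p, hence r2 + p - X. The norm of the latter is g (r2 + p), so
  p^2 divides it, although r2 is a simple root of \<open>g\<close>.\<close>

lemma square_dividing_norm:
  assumes gp: "good p" and a: "int p ^ 2 dvd nrm a"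
  shows "\<exists>I\<in>fam1 p \<union> fam2 p \<union> fam3 p. a \<in> I"
proof (rule ccontr)
  assume no: "\<not> ?thesis"
  have p: "prime (int p)" "p > 0" using gp prime_gt_0_nat by (auto simp: good_def)
  define J1 where "J1 = idl a (int p)"
  define I2 where "I2 = idl a (int p ^ 2)"
  have id: "is_ideal J1" "is_ideal I2" unfolding J1_def I2_def by (rule idl_ideal)+
  have pa: "int p dvd nrm a" using a by (metis dvd_trans dvd_triv_left power2_eq_square)
  have a1: "1 \<notin> J1" unfolding J1_def by (rule idl_proper[OF p(1) pa])
  have fin1: "fin_idx J1" using fin_idx_if_const(1)[OF id(1), of p] idl_mem(2) p(2) by (simp add: J1_def)
  have fin2: "fin_idx I2" using fin_idx_if_const(1)[OF id(2), of "p ^ 2"] idl_mem(2) p(2) by (simp add: I2_def)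
  have J1max: "\<exists>r\<in>roots p. m = rt (int p) r" if "maxi m" "J1 \<subseteq> m" for m
  proof -
    have mem: "a \<in> m" "[:int p:] \<in> m" using that(2) idl_mem unfolding J1_def by blast+
    hence "m \<notin> fam1 p" using no by blast
    hence "\<not> p ^ 2 \<le> idx m" using that(1) mem by (simp add: fam1_def)
    thus ?thesis using maxi_cases[OF that(1) p(1) mem(2)] by (auto simp: roots_def)
  qed
  obtain m where m: "maxi m" "J1 \<subseteq> m" using ex_maxi[OF id(1) fin1 a1] .
  from J1max[OF m] obtain r where r: "r \<in> roots p" "m = rt (int p) r" by blast
  have uniq: "m' = m" if m': "maxi m'" "J1 \<subseteq> m'" for m'
  proof -
    from J1max[OF m'] obtain r' where r': "r' \<in> roots p" "m' = rt (int p) r'" by blast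
    have "r = r'"
    proof (rule ccontr)
      assume "r \<noteq> r'"
      hence "rt (int p) r \<inter> rt (int p) r' \<in> fam2 p" using r r' by (auto simp: fam2_def)
      moreover have "a \<in> m" "a \<in> m'" using m m' idl_mem unfolding J1_def by blast+
      ultimately show False using no r r' by blast
    qed
    thus ?thesis using r r' by simp
  qed
  have gr: "int p dvd poly g r" "\<not> int p dvd poly (pderiv g) r" using r gp by (auto simp: roots_def good_def)
  obtain r2 where r2: "int p ^ Suc 1 dvd poly g r2" "int p dvd r2 - r" using hensel_lift[OF p(1) gr] by blast
  hence r2': "int p ^ 2 dvd poly g r2" by (simp add: power2_eq_square)
  define k where "k = synthetic_div g r2"
  have gk: "g = [:- r2, 1:] * k + [:poly g r2:]" unfolding k_def by (rule poly_split)
  have xk: "[:- r2, 1:] * k \<in> I2"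
  proof -
    obtain c where "poly g r2 = int p ^ 2 * c" using r2' by blast
    hence "[:- r2, 1:] * k = g - smult c [:int p ^ 2:]" using gk by (simp add: algebra_simps)
    also have "\<dots> \<in> I2" by (intro is_ideal_closed(7,8)[OF id(2)] is_ideal_closed(2)[OF id(2)]) (simp add: I2_def idl_mem)
    finally show ?thesis .
  qed
  have pd: "int p dvd poly (pderiv g) r2 - poly (pderiv g) r"
    using poly_diff_dvd[of r2 r "pderiv g"] r2(2) by (rule dvd_trans[rotated])
  hence pr2: "\<not> int p dvd poly (pderiv g) r2" using gr(2) dvd_iff_if_dvd_diff by blast
  have "poly (pderiv g) r2 = poly k r2"
    by (subst gk) (simp add: pderiv_mult pderiv_pCons pderiv_add del: mult_pCons_left)
  moreover have "int p dvd poly k r2 - poly k r"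
    using poly_diff_dvd[of r2 r k] r2(2) by (rule dvd_trans[rotated])
  ultimately have kr: "\<not> int p dvd poly k r" using pr2 dvd_iff_if_dvd_diff by metis
  \<comment> \<open>The cofactor \<open>k\<close> of X - r2 takes the value g' r2 at r2, so it
    avoids the only maximal ideal above \<open>J1\<close>.\<close>
  have km: "k \<notin> m" using kr by (simp add: r rt_def)
  \<comment> \<open>\<open>Q\<close> is the ideal generated by \<open>I2\<close> and
    \<open>k\<close>. A maximal ideal above it would contain p and \<open>a\<close>, hence be
    \<open>m\<close>, which does not contain \<open>k\<close>; so \<open>Q\<close> is the whole
    ring. Thus \<open>k\<close> is invertible modulo \<open>I2\<close>, and (X - r2) k in
    \<open>I2\<close> gives X - r2 in \<open>I2\<close>.\<close>
  define Q where "Q = {x + y * k | x y. x \<in> I2}"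
  have Q: "is_ideal Q" unfolding is_ideal_def
  proof (intro conjI ballI allI)
    have "0 = 0 + 0 * k" "g = g + 0 * k" by simp_all
    thus "0 \<in> Q" "g \<in> Q" unfolding Q_def using is_ideal_closed(1,2)[OF id(2)] by blast+
    fix x assume "x \<in> Q"
    then obtain u v where x: "x = u + v * k" "u \<in> I2" unfolding Q_def by blast
    { fix y assume "y \<in> Q"
      then obtain u' v' where y: "y = u' + v' * k" "u' \<in> I2" unfolding Q_def by blast
      have "x + y = (u + u') + (v + v') * k" unfolding x y by (simp add: algebra_simps)
      thus "x + y \<in> Q" unfolding Q_def using is_ideal_closed(3)[OF id(2) x(2) y(2)] by blast }
    fix y 
    have "y * x = y * u + (y * v) * k" unfolding x by (simp add: algebra_simps)
    thus "y * x \<in> Q" unfolding Q_def using is_ideal_closed(4)[OF id(2) x(2)] by blast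
  qed
  have I2Q: "I2 \<subseteq> Q"
  proof
    fix x assume "x \<in> I2"
    moreover have "x = x + 0 * k" by simp
    ultimately show "x \<in> Q" unfolding Q_def by blast
  qed
  have kQ: "k \<in> Q"
  proof -
    have "k = 0 + 1 * k" by simp
    thus ?thesis unfolding Q_def using is_ideal_closed(1)[OF id(2)] by blast
  qed
  have p2I2: "[:int p ^ 2:] \<in> I2" "a \<in> I2" unfolding I2_def by (rule idl_mem)+
  have "1 \<in> Q"
  proof (rule ccontr)
    assume "1 \<notin> Q"
    have "[:int (p ^ 2):] \<in> Q" using I2Q p2I2(1) by auto
    hence "fin_idx Q" using fin_idx_if_const(1)[OF Q, of "p ^ 2"] p(2) by simp
    from ex_maxi[OF Q this \<open>1 \<notin> Q\<close>] obtain m' where m': "maxi m'" "Q \<subseteq> m'" .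
    have "[:int p:] * [:int p:] \<in> m'" using p2I2(1) I2Q m'(2) by (simp add: power2_eq_square subset_iff)
    hence "[:int p:] \<in> m'" using maxi_prime[OF m'(1)] by blast
    moreover have "a \<in> m'" using p2I2(2) I2Q m'(2) by blast
    ultimately have "J1 \<subseteq> m'" unfolding J1_def using m'(1) by (intro idl_subset) (auto simp: maxi_def)
    hence "m' = m" using uniq m'(1) by blast
    thus False using km kQ m'(2) by blast
  qed
  then obtain i h where ih: "1 = i + h * k" "i \<in> I2" unfolding Q_def by blast
  have x2: "[:- r2, 1:] \<in> I2"
  proof -
    have "[:- r2, 1:] = [:- r2, 1:] * (i + h * k)" unfolding ih(1)[symmetric] by simp
    also have "\<dots> = [:- r2, 1:] * i + h * ([:- r2, 1:] * k)" by (simp only: algebra_simps)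
    also have "\<dots> \<in> I2" by (intro is_ideal_closed(3,4)[OF id(2)] ih xk)
    finally show ?thesis .
  qed
  have ar2: "\<not> int p ^ 2 dvd poly a r2"
  proof
    assume *: "int p ^ 2 dvd poly a r2"
    define s where "s = r2 mod int (p ^ 2)"
    have rs: "int p ^ 2 dvd r2 - s" unfolding s_def by (simp add: minus_mod_eq_mult_div)
    have "int p ^ 2 dvd poly f r2 - poly f s" for f using poly_diff_dvd[of r2 s f] rs by (rule dvd_trans[rotated])
    hence eq: "int p ^ 2 dvd poly f s \<longleftrightarrow> int p ^ 2 dvd poly f r2" for f
      using dvd_iff_if_dvd_diff by blast
    have "s \<in> roots (p ^ 2)" unfolding roots_def using p(2) eq r2' by (simp add: s_def)
    hence "rt (int (p ^ 2)) s \<in> fam3 p" by (auto simp: fam3_def)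
    moreover have "a \<in> rt (int (p ^ 2)) s" using eq * by (simp add: rt_def)
    ultimately show False using no by blast
  qed
  have "[:poly a r2:] = a - [:- r2, 1:] * synthetic_div a r2" using poly_split[of a r2] by (simp add: algebra_simps)
  also have "\<dots> \<in> I2" by (intro is_ideal_closed(5,7)[OF id(2)] p2I2 x2)
  finally have ca: "[:poly a r2:] \<in> I2" .
  \<comment> \<open>The integer \<open>poly a r2\<close> lies in \<open>I2\<close> and is not
    divisible by p^2, so its gcd with p^2 is 1 or p.\<close>
  have pI2: "[:int p:] \<in> I2"
  proof -
    have "\<exists>u v. int p = u * poly a r2 + v * int p ^ 2"
    proof (cases "int p dvd poly a r2")
      case True
      then obtain c where c: "poly a r2 = int p * c" by blast
      hence "\<not> int p dvd c" using ar2 by (auto simp: power2_eq_square)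
      then obtain u v where "u * int p + v * c = 1" by (rule bezout_prime_int[OF p(1)])
      hence "int p * (u * int p + v * c) = int p" by simp
      hence "int p = v * poly a r2 + u * int p ^ 2" unfolding c by (simp add: algebra_simps power2_eq_square)
      thus ?thesis by blast
    next
      case False
      then obtain u v where "u * int p + v * poly a r2 = 1" by (rule bezout_prime_int[OF p(1)])
      hence "int p * (u * int p + v * poly a r2) = int p" by simp
      hence "int p = (int p * v) * poly a r2 + u * int p ^ 2" by (simp add: algebra_simps power2_eq_square)
      thus ?thesis by blast
    qed
    then obtain u v where uv: "int p = u * poly a r2 + v * int p ^ 2" by blast
    have "[:int p:] = smult u [:poly a r2:] + smult v [:int p ^ 2:]"
      using uv by simp
    also have "\<dots> \<in> I2" by (intro is_ideal_closed(3,8)[OF id(2)] ca p2I2)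
    finally show ?thesis .
  qed
  \<comment> \<open>A second root of \<open>g\<close> modulo p^2 above the same residue: r' - X lies
    in \<open>I2\<close>, and its norm is g r'.\<close>
  define r' where "r' = r2 + int p"
  have "[:r', -1:] = [:int p:] - [:- r2, 1:]" by (simp add: r'_def)
  also have "\<dots> \<in> I2" by (intro is_ideal_closed(7)[OF id(2)] pI2 x2)
  finally have "[:r', -1:] \<in> I2" .
  then obtain u v w where "[:r', -1:] = u * a + v * g + smult (int p ^ 2) w" unfolding I2_def idl_def by blast
  from nrm_cong_idl[OF this] have "int p ^ 2 dvd poly g r' - nrm u * nrm a" by (simp add: nrm_linear)
  moreover have "int p ^ 2 dvd nrm u * nrm a" using a by simp
  ultimately have "int p ^ 2 dvd (poly g r' - nrm u * nrm a) + nrm u * nrm a" by (rule dvd_add)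
  hence gr': "int p ^ 2 dvd poly g r'" by simp
  obtain c where c: "poly g (r2 + int p) = poly g r2 + int p * poly (pderiv g) r2 + int p ^ 2 * c" by (rule poly_taylor1)
  have "int p * poly (pderiv g) r2 = poly g r' - poly g r2 - int p ^ 2 * c" using c by (simp add: r'_def)
  also have "int p ^ 2 dvd \<dots>" using gr' r2' by (intro dvd_diff) auto
  finally have "int p * int p dvd int p * poly (pderiv g) r2" by (simp add: power2_eq_square)
  hence "int p dvd poly (pderiv g) r2" using p(2) by simp
  thus False using pr2 by simp
qed

lemma prime_dividing_norm:
  assumes gp: "prime p" and a: "int p dvd nrm a"
  shows "(\<exists>r\<in>roots p. a \<in> rt (int p) r) \<or> (\<exists>I\<in>fam1 p. a \<in> I)"
proof -
  have p: "prime (int p)" "p > 0" using gp prime_gt_0_nat by auto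
  have id: "is_ideal (idl a (int p))" by (rule idl_ideal)
  have "fin_idx (idl a (int p))" using fin_idx_if_const(1)[OF id, of p] idl_mem(2) p(2) by simp
  from ex_maxi[OF id this idl_proper[OF p(1) a]] obtain m where m: "maxi m" "idl a (int p) \<subseteq> m" .
  have mem: "a \<in> m" "[:int p:] \<in> m" using m(2) idl_mem by blast+
  from maxi_cases[OF m(1) p(1) mem(2)] show ?thesis using m(1) mem by (auto simp: fam1_def roots_def)
qed

text \<open>If q divides the value at r, then \<open>a\<close> is modulo q a multiple of r - X,
  whose norm is g r.\<close>

lemma root_divides_norm:
  assumes "q dvd poly g r" "q dvd poly a r" shows "q dvd nrm a"
proof -
  obtain c where c: "poly a r = q * c" using assms(2) by blast
  have "a = (- synthetic_div a r) * [:r, -1:] + 0 * g + smult q [:c:]"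
    using poly_split[of a r] c by (simp add: algebra_simps)
  from nrm_cong_idl[OF this] have "q dvd nrm a - nrm (- synthetic_div a r) * poly g r" by (simp add: nrm_linear)
  moreover have "q dvd nrm (- synthetic_div a r) * poly g r" using assms(1) by simp
  ultimately have "q dvd (nrm a - nrm (- synthetic_div a r) * poly g r) + nrm (- synthetic_div a r) * poly g r" by (rule dvd_add)
  thus ?thesis by simp
qed

definition fam :: "nat \<Rightarrow> int poly set set" where "fam p = fam1 p \<union> fam2 p \<union> fam3 p"

lemma finite_roots [simp]: "finite (roots p)"
  unfolding roots_def by (rule finite_subset[of _ "{0..<int p}"]) auto

lemma roots_inj: "s \<in> roots q \<Longrightarrow> t \<in> roots q \<Longrightarrow> int q dvd s - t \<Longrightarrow> s = t"
  unfolding roots_def using zdvd_imp_le[of "int q" "s - t"] zdvd_imp_le[of "int q" "t - s"]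
  by (cases s t rule: linorder_cases) (auto simp: dvd_diff_commute)

lemma card_roots: 
  assumes "prime p" shows "card (roots p) \<le> n"
  unfolding deg[symmetric]
proof (rule roots_mod_prime_card[of "int p"])
  show "s = t" if "s \<in> roots p" "t \<in> roots p" "int p dvd s - t" for s t using roots_inj[OF that] .
  show "prime (int p)" "lead_coeff g = 1" "finite (roots p)" using assms monic by simp_all
  show "int p dvd poly g s" if "s \<in> roots p" for s using that by (simp add: roots_def)
qed

text \<open>The roots are simple, so two roots modulo p^2 that agree modulo p are equal; hence they
  may be counted modulo p.\<close>

lemma card_roots_sq: 
  assumes "good p" shows "card (roots (p ^ 2)) \<le> n"
  unfolding deg[symmetric]
proof (rule roots_mod_prime_card[of "int p"])
  show p: "prime (int p)" using assms by (simp add: good_def)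
  fix s assume s: "s \<in> roots (p ^ 2)"
  hence s2: "int p ^ 2 dvd poly g s" by (simp add: roots_def)
  thus ps: "int p dvd poly g s" by (rule dvd_trans[rotated]) (simp add: power2_eq_square)
  fix t assume t: "t \<in> roots (p ^ 2)" and st: "int p dvd s - t"
  have t2: "int p ^ 2 dvd poly g t" using t by (simp add: roots_def)
  have "\<not> int p dvd poly (pderiv g) s" using assms ps by (simp add: good_def)
  from simple_root_unique[OF p s2 t2 st this] have "int (p ^ 2) dvd s - t" by simp
  thus "s = t" by (rule roots_inj[OF s t])
qed (use monic in auto)

text \<open>As in Chinese remaindering, \<open>e m\<close> lies in every ideal of \<open>S\<close>
  except \<open>m\<close>. The p^|S| combinations of the \<open>e m\<close> with coefficients in [0,
  p) are therefore incongruent modulo (g, p), whose index is at most p^n.\<close>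

lemma fam1_card: 
  assumes p: "prime p" shows "finite (fam1 p) \<and> card (fam1 p) \<le> n"
proof (rule finite_if_finite_subsets_card_bdd)
  fix S assume S: "S \<subseteq> fam1 p" "finite S"
  hence fS: "finite S" and Sf: "\<And>m. m \<in> S \<Longrightarrow> maxi m \<and> [:int p:] \<in> m" by (auto simp: fam1_def)
  have pp: "prime (int p)" "p > 0" using p prime_gt_0_nat by auto
  have ex: "\<exists>x. x \<in> m' \<and> x \<notin> m" if "m \<in> S" "m' \<in> S" "m \<noteq> m'" for m m'
  proof (rule ccontr)
    assume "\<not> ?thesis"
    hence "m' \<subseteq> m" by blast
    hence "m = m'" using Sf[OF that(1)] Sf[OF that(2)] unfolding maxi_def by blast
    thus False using that by simp
  qed
  define d where "d m m' = (SOME x. x \<in> m' \<and> x \<notin> m)" for m m' :: "int poly set"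
  have d: "d m m' \<in> m'" "d m m' \<notin> m" if "m \<in> S" "m' \<in> S" "m \<noteq> m'" for m m'
    using someI_ex[OF ex[OF that]] by (simp_all add: d_def)
  define e where "e m = (\<Prod>m'\<in>S - {m}. d m m')" for m
  have e1: "e m \<in> m'" if "m \<in> S" "m' \<in> S" "m \<noteq> m'" for m m'
  proof -
    have "e m = d m m' * (\<Prod>m'\<in>S - {m} - {m'}. d m m')"
      unfolding e_def using that fS by (intro prod.remove) auto
    thus ?thesis using d(1)[OF that] is_ideal_closed(5)[of m'] Sf[OF that(2)] by (simp add: maxi_def)
  qed
  have e2: "e m \<notin> m" if m: "m \<in> S" for m
  proof -
    have "(\<Prod>m'\<in>A. d m m') \<notin> m" if "finite A" "A \<subseteq> S - {m}" for A
      using that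
    proof (induction A rule: finite_induct)
      case empty thus ?case using Sf[OF m] by (simp add: maxi_def)
    next
      case (insert y A)
      hence "d m y \<notin> m" using d(2)[OF m, of y] by auto
      thus ?case using maxi_prime[of m "d m y" "\<Prod>m'\<in>A. d m m'"] Sf[OF m] insert by auto
    qed
    thus ?thesis unfolding e_def using fS by simp
  qed
  define I0 where "I0 = idl 0 (int p)"
  have I0: "is_ideal I0" "[:int p:] \<in> I0" unfolding I0_def by (rule idl_ideal idl_mem)+
  note fi = fin_idx_if_const[OF I0 pp(2)]
  have sub: "I0 \<subseteq> m" if "m \<in> S" for m
    unfolding I0_def using Sf[OF that] by (intro idl_subset) (auto simp: maxi_def is_ideal_closed(1))
  have "card (S \<rightarrow>\<^sub>E {0..<int p}) \<le> idx I0"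
  proof (rule idx_ge[OF I0(1) fi(1), where f = "\<lambda>c. \<Sum>m\<in>S. smult (c m) (e m)"])
    fix c c' assume c: "c \<in> S \<rightarrow>\<^sub>E {0..<int p}" "c' \<in> S \<rightarrow>\<^sub>E {0..<int p}"
      and "(\<Sum>m\<in>S. smult (c m) (e m)) - (\<Sum>m\<in>S. smult (c' m) (e m)) \<in> I0"
    hence in0: "(\<Sum>m\<in>S. smult (c m - c' m) (e m)) \<in> I0" by (simp add: sum_subtractf smult_diff_left)
    have "c m = c' m" if m: "m \<in> S" for m
    proof (rule ccontr)
      assume ne: "c m \<noteq> c' m"
      have im: "is_ideal m" "maxi m" using Sf[OF m] by (auto simp: maxi_def)
      have "(\<Sum>m'\<in>A. smult (c m' - c' m') (e m')) \<in> m" if "finite A" "A \<subseteq> S - {m}" for A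
        using that
      proof (induction A rule: finite_induct)
        case empty thus ?case using is_ideal_closed(1)[OF im(1)] by simp
      next
        case (insert y A)
        thus ?case using e1[of y m] m by (auto intro!: is_ideal_closed(3,8)[OF im(1)])
      qed
      hence rest: "(\<Sum>m'\<in>S - {m}. smult (c m' - c' m') (e m')) \<in> m" using fS by simp
      have "(\<Sum>m'\<in>S. smult (c m' - c' m') (e m')) - (\<Sum>m'\<in>S - {m}. smult (c m' - c' m') (e m')) \<in> m"
        by (rule is_ideal_closed(7)[OF im(1) _ rest]) (use in0 sub[OF m] in blast)
      hence "smult (c m - c' m) (e m) \<in> m" using m fS by (simp add: sum.remove[of S m])
      hence "[:c m - c' m:] * e m \<in> m" by simp
      hence "[:c m - c' m:] \<in> m" using maxi_prime[OF im(2)] e2[OF m] by blast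
      hence "int p dvd c m - c' m" using maxi_const[OF im(2) pp(1)] Sf[OF m] by blast
      hence "int p \<le> \<bar>c m - c' m\<bar>" using ne dvd_imp_le_int[of "c m - c' m" "int p"] by simp
      moreover have "c m \<in> {0..<int p}" "c' m \<in> {0..<int p}" using c m by (auto simp: PiE_def)
      ultimately show False by auto
    qed
    thus "c = c'" using c by (intro PiE_ext) auto
  qed
  also have "card (S \<rightarrow>\<^sub>E {0..<int p}) = p ^ card S" using fS by (simp add: card_PiE)
  also have "idx I0 \<le> p ^ n" by (rule fi(2))
  finally have "p ^ card S \<le> p ^ n" .
  thus "card S \<le> n" by (rule power_le_imp_le_exp[OF prime_gt_1_nat[OF p]])
qed

lemma fam_card: 
  assumes "good p" shows "finite (fam p)" "card (fam p) \<le> 3 * n ^ 2"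
proof -
  have p: "prime p" using assms by (simp add: good_def)
  have s2: "{(r,s). r \<in> roots p \<and> s \<in> roots p \<and> r \<noteq> s} \<subseteq> roots p \<times> roots p" by auto
  have f2: "finite (fam2 p)" unfolding fam2_def using finite_subset[OF s2] by simp
  have "card (fam2 p) \<le> card {(r,s). r \<in> roots p \<and> s \<in> roots p \<and> r \<noteq> s}"
    unfolding fam2_def using finite_subset[OF s2] by (intro card_image_le) simp
  also have "\<dots> \<le> card (roots p \<times> roots p)" by (intro card_mono s2) simp
  also have "\<dots> \<le> n * n" using card_roots[OF p] by (simp add: card_cartesian_product mult_le_mono)
  finally have c2: "card (fam2 p) \<le> n * n" .
  have f3: "finite (fam3 p)" unfolding fam3_def by simp
  have c3: "card (fam3 p) \<le> n" unfolding fam3_def by (rule order.trans[OF card_image_le[OF finite_roots] card_roots_sq[OF assms]])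
  show "finite (fam p)" unfolding fam_def using fam1_card[OF p] f2 f3 by simp
  have nn: "n \<le> n * n" by simp
  have "card (fam p) \<le> card (fam1 p \<union> fam2 p) + card (fam3 p)" unfolding fam_def by (rule card_Un_le)
  also have "\<dots> \<le> card (fam1 p) + card (fam2 p) + card (fam3 p)" by (intro add_mono card_Un_le) simp
  also have "\<dots> \<le> n * n + n * n + n * n"
    by (intro add_mono c2 order.trans[OF conjunct2[OF fam1_card[OF p]] nn] order.trans[OF c3 nn])
  finally show "card (fam p) \<le> 3 * n ^ 2" by (simp add: power2_eq_square)
qed

lemma fam_props:
  assumes p: "prime p" and I: "I \<in> fam p"
  shows "is_ideal I" "fin_idx I" "p ^ 2 \<le> idx I" "[:int (p ^ 2):] \<in> I"
proof -
  have p0: "p > 0" "int p > 0" using p prime_gt_0_nat by auto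
  have "is_ideal I \<and> p ^ 2 \<le> idx I \<and> [:int (p ^ 2):] \<in> I"
    using I unfolding fam_def
  proof (elim UnE)
    assume "I \<in> fam1 p"
    hence *: "maxi I" "[:int p:] \<in> I" "p ^ 2 \<le> idx I" by (auto simp: fam1_def)
    have "smult (int p) [:int p:] \<in> I" using *(1,2) is_ideal_closed(8)[of I "[:int p:]" "int p"] by (simp only: maxi_def)
    thus ?thesis using * by (simp add: maxi_def power2_eq_square)
  next
    assume "I \<in> fam2 p"
    then obtain r s where rs: "r \<in> roots p" "s \<in> roots p" "r \<noteq> s" "I = rt (int p) r \<inter> rt (int p) s"
      by (auto simp: fam2_def)
    have id: "is_ideal (rt (int p) r)" "is_ideal (rt (int p) s)" using rs by (auto simp: roots_def intro!: rt_ideal)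
    hence id': "is_ideal I" unfolding rs(4) is_ideal_def by blast
    have pI: "[:int p:] \<in> I" by (simp add: rs rt_def)
    have "card ({0..<int p} \<times> {0..<int p}) \<le> idx I"
    proof (rule idx_ge[OF id' fin_idx_if_const(1)[OF id' pI p0(1)], where f = "\<lambda>(u,v). [:u,v:]"])
      fix x y assume xy: "x \<in> {0..<int p} \<times> {0..<int p}" "y \<in> {0..<int p} \<times> {0..<int p}"
        "(case x of (u,v) \<Rightarrow> [:u,v:]) - (case y of (u,v) \<Rightarrow> [:u,v:]) \<in> I"
      obtain u v u' v' where e: "x = (u,v)" "y = (u',v')" by (cases x; cases y)
      have d: "int p dvd (u - u') + r * (v - v')" "int p dvd (u - u') + s * (v - v')"
        using xy(3) by (auto simp: e rs rt_def)
      have "int p dvd (r - s) * (v - v')" using dvd_diff[OF d] by (simp add: algebra_simps)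
      moreover have "\<not> int p dvd r - s" using roots_inj[of r p s] rs by blast
      ultimately have "int p dvd v - v'" using p by (simp add: prime_dvd_mult_iff)
      hence v: "v = v'" using xy e dvd_imp_le_int[of "v - v'" "int p"] by force
      hence "int p dvd u - u'" using d by simp
      hence u: "u = u'" using xy e dvd_imp_le_int[of "u - u'" "int p"] by force
      show "x = y" using u v e by simp
    qed
    thus ?thesis using id' by (simp add: card_cartesian_product power2_eq_square rs rt_def)
  next
    assume "I \<in> fam3 p"
    then obtain r where r: "r \<in> roots (p ^ 2)" "I = rt (int (p ^ 2)) r" by (auto simp: fam3_def)
    hence "int (p ^ 2) dvd poly g r" by (simp add: roots_def)
    thus ?thesis unfolding r(2) using rt_ideal rt_idx[of "p ^ 2" r] p0 by (simp add: rt_def)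
  qed
  thus *: "is_ideal I" "p ^ 2 \<le> idx I" "[:int (p ^ 2):] \<in> I" by auto
  show "fin_idx I" by (rule fin_idx_if_const(1)[OF *(1,3)]) (use p0 in simp)
qed

section \<open>Box points in ideals, with a fixed constant\<close>

lemma ideal_count_real:
  obtains K :: real where "K > 0"
    "\<And>I c R. is_ideal I \<Longrightarrow> fin_idx I \<Longrightarrow> 
       real (idx I) * real (card {a \<in> box 0 (int R). a - c \<in> I}) \<le> (real R + K * root n (idx I)) ^ n"
    "\<And>I c R. is_ideal I \<Longrightarrow> fin_idx I \<Longrightarrow> K * root n (idx I) \<le> real R \<Longrightarrow>
       (real R - K * root n (idx I)) ^ n \<le> real (idx I) * real (card {a \<in> box 0 (int R). a - c \<in> I})"
proof -
  obtain K :: nat where K: 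
    "\<And>I s c R. is_ideal I \<Longrightarrow> fin_idx I \<Longrightarrow> idx I < (s + 1) ^ n \<Longrightarrow> 
       idx I * card {a \<in> box 0 (int R). a - c \<in> I} \<le> (R + 2 * K * s) ^ n"
    "\<And>I s c R. is_ideal I \<Longrightarrow> fin_idx I \<Longrightarrow> idx I < (s + 1) ^ n \<Longrightarrow> 2 * K * s \<le> R \<Longrightarrow>
       (R - 2 * K * s) ^ n \<le> idx I * card {a \<in> box 0 (int R). a - c \<in> I}"
    by (rule ideal_count) blast
  define K' where "K' = 2 * real K + 1"
  have s: "\<exists>s. i < (s + 1) ^ n \<and> 2 * real K * real s \<le> K' * root n i" for i :: nat
  proof (intro exI conjI)
    define s where "s = nat \<lfloor>root n i\<rfloor>"
    have r0: "root n (real i) \<ge> 0" by (rule real_root_ge_zero) simp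
    have "root n (real i) < real s + 1" unfolding s_def using r0 by linarith
    hence "root n (real i) ^ n < (real s + 1) ^ n" using n_pos r0 by (intro power_strict_mono) auto
    hence "real i < real ((s + 1) ^ n)" using n_pos by (simp add: add.commute)
    thus "i < (s + 1) ^ n" by (simp only: of_nat_less_iff)
    have "real s \<le> root n (real i)" unfolding s_def using r0 by (rule of_nat_floor)
    thus "2 * real K * real s \<le> K' * root n i" unfolding K'_def using r0 by (intro mult_mono) auto
  qed
  show ?thesis
  proof
    show "K' > 0" by (simp add: K'_def)
    fix I c R assume I: "is_ideal I" "fin_idx I"
    obtain s where s: "idx I < (s + 1) ^ n" "2 * real K * real s \<le> K' * root n (idx I)" using s by blast
    have "real (idx I * card {a \<in> box 0 (int R). a - c \<in> I}) \<le> real ((R + 2 * K * s) ^ n)"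
      using K(1)[OF I s(1)] by (simp only: of_nat_le_iff)
    also have "\<dots> = (real R + 2 * real K * real s) ^ n" by simp
    also have "\<dots> \<le> (real R + K' * root n (idx I)) ^ n" using s(2) by (intro power_mono) auto
    finally show "real (idx I) * real (card {a \<in> box 0 (int R). a - c \<in> I}) \<le> (real R + K' * root n (idx I)) ^ n" by simp
    assume R: "K' * root n (idx I) \<le> real R"
    hence "real (2 * K * s) \<le> real R" using s(2) by simp
    hence Rs: "2 * K * s \<le> R" by (simp only: of_nat_le_iff)
    have "(real R - K' * root n (idx I)) ^ n \<le> (real R - 2 * real K * real s) ^ n"
      using s(2) R by (intro power_mono) auto
    also have "\<dots> = real ((R - 2 * K * s) ^ n)" using Rs by (simp add: of_nat_diff)
    also have "\<dots> \<le> real (idx I * card {a \<in> box 0 (int R). a - c \<in> I})"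
      using K(2)[OF I s(1) Rs] by (simp only: of_nat_le_iff)
    finally show "(real R - K' * root n (idx I)) ^ n \<le> real (idx I) * real (card {a \<in> box 0 (int R). a - c \<in> I})" by simp
  qed
qed

text \<open>Fixing one admissible constant by choice lets sums over many ideals refer to it by
  name.\<close>

definition Kc :: real where
  "Kc = (SOME K. K > 0 \<and> (\<forall>I c R. is_ideal I \<longrightarrow> fin_idx I \<longrightarrow> 
       real (idx I) * real (card {a \<in> box 0 (int R). a - c \<in> I}) \<le> (real R + K * root n (idx I)) ^ n \<and>
    (K * root n (idx I) \<le> real R \<longrightarrow>
       (real R - K * root n (idx I)) ^ n \<le> real (idx I) * real (card {a \<in> box 0 (int R). a - c \<in> I}))))"

lemma Kc: "Kc > 0"
    "is_ideal I \<Longrightarrow> fin_idx I \<Longrightarrow> 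
       real (idx I) * real (card {a \<in> box 0 (int R). a - c \<in> I}) \<le> (real R + Kc * root n (idx I)) ^ n"
    "is_ideal I \<Longrightarrow> fin_idx I \<Longrightarrow> Kc * root n (idx I) \<le> real R \<Longrightarrow>
       (real R - Kc * root n (idx I)) ^ n \<le> real (idx I) * real (card {a \<in> box 0 (int R). a - c \<in> I})"
proof -
  have "\<exists>K. K > 0 \<and> (\<forall>I c R. is_ideal I \<longrightarrow> fin_idx I \<longrightarrow> 
       real (idx I) * real (card {a \<in> box 0 (int R). a - c \<in> I}) \<le> (real R + K * root n (idx I)) ^ n \<and>
    (K * root n (idx I) \<le> real R \<longrightarrow>
       (real R - K * root n (idx I)) ^ n \<le> real (idx I) * real (card {a \<in> box 0 (int R). a - c \<in> I})))"
    by (rule ideal_count_real) blast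
  from someI_ex[OF this] show "Kc > 0"
    "is_ideal I \<Longrightarrow> fin_idx I \<Longrightarrow> 
       real (idx I) * real (card {a \<in> box 0 (int R). a - c \<in> I}) \<le> (real R + Kc * root n (idx I)) ^ n"
    "is_ideal I \<Longrightarrow> fin_idx I \<Longrightarrow> Kc * root n (idx I) \<le> real R \<Longrightarrow>
       (real R - Kc * root n (idx I)) ^ n \<le> real (idx I) * real (card {a \<in> box 0 (int R). a - c \<in> I})"
    unfolding Kc_def[symmetric] by simp_all
qed

text \<open>The main term is the volume divided by the index, and the index is at least p^2. The
  constant term covers boxes that are small compared with the index.\<close>

lemma fam_count:
  assumes p: "prime p" and I: "I \<in> fam p"
  shows "real (card {a \<in> box 0 (int R). a - c \<in> I}) \<le> 2 ^ n * (real R ^ n / real p ^ 2 + Kc ^ n)"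
proof -
  note f = fam_props[OF p I]
  define i where "i = real (idx I)"
  have p0: "p > 0" using p prime_gt_0_nat by blast
  have ip: "real p ^ 2 \<le> i" using f(3) unfolding i_def by (simp flip: of_nat_power)
  moreover have "0 < real p ^ 2" using p0 by simp
  ultimately have i0: "i > 0" by linarith
  define y where "y = Kc * root n i"
  have yn: "y ^ n = Kc ^ n * i" unfolding y_def using n_pos i0 by (simp add: power_mult_distrib)
  have y0: "y \<ge> 0" unfolding y_def using Kc(1) i0 by (intro mult_nonneg_nonneg real_root_ge_zero) auto
  have "i * real (card {a \<in> box 0 (int R). a - c \<in> I}) \<le> (real R + y) ^ n"
    unfolding i_def y_def by (rule Kc(2)[OF f(1,2)])
  also have "\<dots> \<le> (2 * max (real R) y) ^ n" using y0 by (intro power_mono) auto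
  also have "\<dots> = 2 ^ n * max (real R) y ^ n" by (simp add: power_mult_distrib)
  also have "max (real R) y ^ n \<le> real R ^ n + y ^ n" using y0 by (cases "real R \<le> y") (auto simp: max_def)
  finally have "i * real (card {a \<in> box 0 (int R). a - c \<in> I}) \<le> 2 ^ n * (real R ^ n + Kc ^ n * i)"
    by (simp add: yn)
  hence "real (card {a \<in> box 0 (int R). a - c \<in> I}) \<le> 2 ^ n * (real R ^ n + Kc ^ n * i) / i"
    by (simp only: pos_le_divide_eq[OF i0] mult.commute[of _ i])
  also have "\<dots> = 2 ^ n * (real R ^ n / i + Kc ^ n)" using i0 by (simp add: add_divide_distrib distrib_left)
  also have "\<dots> \<le> 2 ^ n * (real R ^ n / real p ^ 2 + Kc ^ n)"
    using ip p0 i0 by (intro mult_left_mono add_right_mono divide_left_mono) auto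
  finally show ?thesis .
qed

end

section \<open>Sums over primes and the upper Mertens bound\<close>

lemma sum_ind: "finite A \<Longrightarrow> (\<Sum>a\<in>A. if P a then 1 else 0 :: real) = real (card {a\<in>A. P a})"
  by (simp add: sum.If_cases Int_def)

lemma sum_ln_primes_le:
  assumes "finite Q" "\<And>p. p \<in> Q \<Longrightarrow> prime (p::nat)" "\<And>p. p \<in> Q \<Longrightarrow> int p dvd N" "N \<noteq> 0"
  shows "(\<Sum>p\<in>Q. ln (real p)) \<le> ln \<bar>real_of_int N\<bar>"
proof -
  have pos: "p > 0" if "p \<in> Q" for p using assms(2)[OF that] by (rule prime_gt_0_nat)
  have "\<Prod>Q dvd nat \<bar>N\<bar>"
    by (rule prod_primes_dvd[OF assms(1,2)]) (use assms(3) in \<open>auto simp: nat_dvd_iff\<close>)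
  hence "\<Prod>Q \<le> nat \<bar>N\<bar>" using assms(4) by (intro dvd_imp_le) auto
  hence "real (\<Prod>Q) \<le> real (nat \<bar>N\<bar>)" by (simp only: of_nat_le_iff)
  also have "\<dots> = \<bar>real_of_int N\<bar>" by simp
  finally have "ln (real (\<Prod>Q)) \<le> ln \<bar>real_of_int N\<bar>"
    using pos assms(1,4) by (subst ln_le_cancel_iff) (auto intro!: prod_pos)
  thus ?thesis using pos assms(1) by (simp add: ln_prod)
qed

definition Pr :: "nat \<Rightarrow> nat \<Rightarrow> nat set" where "Pr l m = {p. prime p \<and> l < p \<and> p \<le> m}"

lemma finite_Pr [simp]: "finite (Pr l m)" unfolding Pr_def by simp

lemma Pr_sum_ln: "(\<Sum>p\<in>Pr l m. ln (real p)) \<le> 5 * real m"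
proof -
  have "(\<Sum>p\<in>Pr l m. ln (real p)) \<le> theta m"
    unfolding theta_def Pr_def by (intro sum_mono2) (auto intro!: ln_ge_zero simp: Suc_le_eq prime_gt_0_nat)
  thus ?thesis using theta_le[of m] by simp
qed

lemma Pr_sum_inverse_squares: 
  assumes "l > 0" shows "(\<Sum>p\<in>Pr l m. 1 / real p ^ 2) \<le> 1 / l"
proof -
  have "(\<Sum>p\<in>Pr l m. 1 / real p ^ 2) \<le> (\<Sum>p\<in>{l<..m}. 1 / real p ^ 2)"
    by (intro sum_mono2) (auto simp: Pr_def)
  thus ?thesis using sum_inverse_squares_le[OF assms, of m] by simp
qed

context int_poly_field
begin

lemma nrm_bound_ex: "\<exists>C::real. C \<ge> 1 \<and> (\<forall>a M. a \<in> small M \<longrightarrow> \<bar>real_of_int (nrm a)\<bar> \<le> (C * M) ^ n)"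
proof -
  obtain C :: real where C: "C > 0" 
    "\<And>a M t. a \<in> small M \<Longrightarrow> t \<in> Theta \<Longrightarrow> cmod (ipoly a t) \<le> C * M" by (rule values_le_coeff) blast
  have "\<bar>real_of_int (nrm a)\<bar> \<le> (max C 1 * M) ^ n" if a: "a \<in> small M" for a M
  proof -
    have M: "M \<ge> 0" using a n_pos unfolding small_def by force
    have "\<bar>real_of_int (nrm a)\<bar> = cmod (of_int (nrm a))" by simp
    also have "\<dots> = (\<Prod>z\<in>Theta. cmod (ipoly a z))" unfolding nrm by (simp add: prod_norm)
    also have "\<dots> \<le> (\<Prod>z\<in>Theta. C * M)" by (intro prod_mono) (auto intro: C(2)[OF a])
    also have "\<dots> = (C * M) ^ n" by (simp add: Theta_card)
    also have "\<dots> \<le> (max C 1 * M) ^ n" using M C(1) by (intro power_mono mult_right_mono) auto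
    finally show ?thesis .
  qed
  thus ?thesis by (intro exI[of _ "max C 1"]) auto
qed

definition Cn :: real where 
  "Cn = (SOME C::real. C \<ge> 1 \<and> (\<forall>a M. a \<in> small M \<longrightarrow> \<bar>real_of_int (nrm a)\<bar> \<le> (C * M) ^ n))"

lemma Cn: "Cn \<ge> 1" "a \<in> small M \<Longrightarrow> \<bar>real_of_int (nrm a)\<bar> \<le> (Cn * M) ^ n"
proof -
  have "Cn \<ge> 1 \<and> (\<forall>a M. a \<in> small M \<longrightarrow> \<bar>real_of_int (nrm a)\<bar> \<le> (Cn * M) ^ n)"
    unfolding Cn_def by (rule someI_ex[OF nrm_bound_ex])
  thus "Cn \<ge> 1" "a \<in> small M \<Longrightarrow> \<bar>real_of_int (nrm a)\<bar> \<le> (Cn * M) ^ n" by auto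
qed

text \<open>The Mertens sum over the root ideals, each of which has index p; the growth to be
  expected is ln m with coefficient 1.\<close>

definition Sm :: "nat \<Rightarrow> nat \<Rightarrow> real" where
  "Sm l m = (\<Sum>p\<in>Pr l m. real (card (roots p)) * ln p / p)"

definition tc :: "nat \<Rightarrow> int poly \<Rightarrow> real" where
  "tc p a = (\<Sum>r\<in>roots p. if a \<in> rt (int p) r then 1 else 0)"
definition fc :: "nat \<Rightarrow> int poly \<Rightarrow> real" where
  "fc p a = (\<Sum>I\<in>fam p. if a \<in> I then 1 else 0)"

lemma fc_ge_1: "good p \<Longrightarrow> I \<in> fam p \<Longrightarrow> a \<in> I \<Longrightarrow> fc p a \<ge> 1"
  unfolding fc_def sum_ind[OF fam_card(1)] by (auto simp: card_gt_0_iff Suc_le_eq fam_card(1))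

lemma tc_ge_1: "r \<in> roots p \<Longrightarrow> a \<in> rt (int p) r \<Longrightarrow> tc p a \<ge> 1"
  unfolding tc_def sum_ind[OF finite_roots] by (auto simp: card_gt_0_iff Suc_le_eq)

lemma tc_nonneg: "tc p a \<ge> 0" and fc_nonneg: "fc p a \<ge> 0"
  unfolding tc_def fc_def by (auto intro!: sum_nonneg)

text \<open>If \<open>a\<close> lies in two root ideals above p, then it lies in a member of
  \<open>fam2\<close>, and all of its at most n root ideals are charged to \<open>fc\<close>. A
  single root ideal is accounted for by p dividing the norm.\<close>

lemma tc_le:
  assumes "good p"
  shows "tc p a \<le> (if int p dvd nrm a then 1 else 0) + n * fc p a"
proof -
  define Q where "Q = {r\<in>roots p. a \<in> rt (int p) r}"
  have p: "prime p" using assms by (simp add: good_def)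
  have Q: "tc p a = card Q" "finite Q" unfolding tc_def Q_def by (simp_all add: sum_ind)
  have "card Q \<le> card (roots p)" unfolding Q_def by (intro card_mono) auto
  hence Qn: "card Q \<le> n" using card_roots[OF p] by simp
  show ?thesis
  proof (cases "\<exists>r\<in>Q. \<exists>s\<in>Q. r \<noteq> s")
    case True
    then obtain r s where rs: "r \<in> Q" "s \<in> Q" "r \<noteq> s" by blast
    have "rt (int p) r \<inter> rt (int p) s \<in> fam p" using rs by (auto simp: fam_def fam2_def Q_def)
    moreover have "a \<in> rt (int p) r \<inter> rt (int p) s" using rs by (auto simp: Q_def)
    ultimately have "fc p a \<ge> 1" by (rule fc_ge_1[OF assms])
    hence "real n * 1 \<le> n * fc p a" by (intro mult_left_mono) auto
    thus ?thesis using Qn Q(1) by auto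
  next
    case False
    show ?thesis
    proof (cases "Q = {}")
      case True thus ?thesis using Q fc_nonneg[of p a] by auto
    next
      case ne: False
      then obtain r where r: "r \<in> Q" by blast
      hence "Q = {r}" using False by blast
      moreover have "int p dvd nrm a" using r by (intro root_divides_norm[of _ r]) (auto simp: Q_def roots_def rt_def)
      ultimately show ?thesis using Q fc_nonneg[of p a] by simp
    qed
  qed
qed

lemma sum_fc:
  assumes "prime p" "good p"
  shows "(\<Sum>a\<in>box 0 (int R). fc p a) \<le> 3 * n ^ 2 * (2 ^ n * (real R ^ n / real p ^ 2 + Kc ^ n))"
proof -
  have "(\<Sum>a\<in>box 0 (int R). fc p a) = (\<Sum>I\<in>fam p. real (card {a\<in>box 0 (int R). a \<in> I}))"
    unfolding fc_def by (subst sum.swap) (simp add: sum_ind[OF finite_box])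
  also have "\<dots> \<le> (\<Sum>I\<in>fam p. 2 ^ n * (real R ^ n / real p ^ 2 + Kc ^ n))"
    using fam_count[OF assms(1), where c = 0 and R = R] by (intro sum_mono) simp
  also have "\<dots> = card (fam p) * (2 ^ n * (real R ^ n / real p ^ 2 + Kc ^ n))" by simp
  also have "\<dots> \<le> real (3 * n ^ 2) * (2 ^ n * (real R ^ n / real p ^ 2 + Kc ^ n))"
    using fam_card(2)[OF assms(2)] Kc(1) by (intro mult_right_mono of_nat_mono) auto
  finally show ?thesis by simp
qed

text \<open>Pairs of a root ideal and an element of a box are counted twice, with weight ln p. Each
  ideal contains nearly its share R^n / p of the box, where R is a multiple of Z^(1/n). The primes
  dividing the norm of one nonzero element weigh at most the logarithm of that norm, which is at
  most ln Z + O(1).\<close>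

lemma mertens_upper:
  obtains P1 where "P1 > 0" "\<And>P0. P0 \<ge> P1 \<Longrightarrow> \<exists>C. \<forall>Z\<ge>1. Sm P0 Z \<le> 11 / 10 * ln Z + C"
proof -
  obtain D where D: "D > 0" "\<And>p. prime p \<Longrightarrow> p > D \<Longrightarrow> good p" by (rule good_eventually) blast
  define N1 where "N1 = real n * (3 * n ^ 2 * 2 ^ n)"
  have N1: "N1 \<ge> 0" unfolding N1_def by simp
  \<comment> \<open>The ideals of index at least p^2 cost N1 / P0 times ln Z; starting the primes
    beyond \<open>P1\<close> keeps this below ln Z / 40.\<close>
  define P1 where "P1 = D + nat \<lceil>40 * N1\<rceil>"
  \<comment> \<open>With R \<ge> M Z^(1/n) the boundary error Kc p^(1/n) is at most R / (40 n), and
    by Bernoulli's inequality the count loses at most a factor 39/40.\<close>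
  define M where "M = nat \<lceil>40 * n * Kc\<rceil> + 1"
  have M: "real M \<ge> 40 * n * Kc" "M \<ge> 1" unfolding M_def by linarith+
  show ?thesis
  proof
    show "P1 > 0" using D by (simp add: P1_def)
    fix P0 assume P0: "P0 \<ge> P1"
    have P0': "P0 > 0" "N1 / P0 \<le> 1 / 40" 
    proof -
      show "P0 > 0" using P0 D by (simp add: P1_def)
      have "real P0 \<ge> 40 * N1" using P0 unfolding P1_def by linarith
      thus "N1 / P0 \<le> 1 / 40" using \<open>P0 > 0\<close> by (simp add: field_simps)
    qed
    have gd: "prime p" "good p" "p > 0" "p \<le> Z" "ln (real p) \<ge> 0" if "p \<in> Pr P0 Z" for p Z
      using that P0 D(2)[of p] prime_gt_0_nat[of p] by (auto simp: Pr_def P1_def Suc_le_eq intro!: ln_ge_zero)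
    define C where "C = (n * ln (Cn * (2 * M)) + 5 + 5 * N1 * Kc ^ n) * (40 / 39)"
    have "Sm P0 Z \<le> 11 / 10 * ln Z + C" if Z: "Z \<ge> 1" for Z :: nat
    proof -
      define rr where "rr = root n Z"
      have rr1: "rr \<ge> 1" unfolding rr_def using Z n_pos by simp
      have rrn: "rr ^ n = Z" unfolding rr_def using n_pos by simp
      define R where "R = M * nat \<lceil>rr\<rceil>"
      have Rlo: "M * rr \<le> R" unfolding R_def using rr1 by (simp add: mult_left_mono)
      have "real (nat \<lceil>rr\<rceil>) \<le> 2 * rr" using rr1 by linarith
      hence "real M * real (nat \<lceil>rr\<rceil>) \<le> real M * (2 * rr)" by (rule mult_left_mono) simp
      hence Rhi: "R \<le> 2 * M * rr" unfolding R_def of_nat_mult by (simp only: mult_ac)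
      have rrR: "rr \<le> R" using order.trans[OF mult_right_mono[of 1 "real M" rr] Rlo] M(2) rr1 by simp
      hence Rpos: "real R > 0" using rr1 by linarith
      have RnZ: "real R ^ n \<ge> Z" unfolding rrn[symmetric] using rr1 rrR by (intro power_mono) auto
      have Rn0: "real R ^ n > 0" using Rpos by simp
      have lnZ: "ln (real Z) \<ge> 0" using Z by simp
      let ?B = "box 0 (int R)"
      have cB: "real (card ?B) = real R ^ n" by (simp add: card_box)
      define S where "S = (\<Sum>p\<in>Pr P0 Z. \<Sum>a\<in>?B. ln p * tc p a)"
      have low: "39 / 40 * real R ^ n * Sm P0 Z \<le> S"
        unfolding Sm_def S_def sum_distrib_left
      proof (rule sum_mono)
        fix p assume p: "p \<in> Pr P0 Z"
        note g = gd[OF p]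
        have each: "39 / 40 * real R ^ n / p \<le> real (card {a\<in>?B. a \<in> rt (int p) r})" if r: "r \<in> roots p" for r
        proof -
          have gr: "int p dvd poly g r" using r by (simp add: roots_def)
          note i = rt_idx[OF g(3) gr]
          have "root n p \<le> rr" unfolding rr_def using g(4) n_pos by simp
          hence k: "Kc * root n p \<le> Kc * rr" using Kc(1) by simp
          have k2: "Kc * rr \<le> real R * (1 / (40 * n))"
          proof -
            have "Kc * rr * (40 * n) \<le> real M * rr" using mult_right_mono[OF M(1), of rr] rr1 by (simp add: algebra_simps)
            also have "\<dots> \<le> R" by (rule Rlo)
            finally show ?thesis using n_pos by (simp add: field_simps)
          qed
          have k3: "real R * (1 / (40 * n)) \<le> real R" using n_pos Rpos by (simp add: field_simps)
          have "39 / 40 \<le> (1 + (- (1 / (40 * real n)))) ^ n"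
            using Bernoulli_inequality[of "- (1 / (40 * real n))" n] n_pos by (simp add: field_simps)
          hence "39 / 40 * real R ^ n \<le> (1 - 1 / (40 * n)) ^ n * real R ^ n"
            using Rn0 by (intro mult_right_mono) auto
          also have "\<dots> = (real R - real R * (1 / (40 * n))) ^ n"
            by (simp add: power_mult_distrib[symmetric] algebra_simps)
          also have "\<dots> \<le> (real R - Kc * root n (idx (rt (int p) r))) ^ n"
            unfolding i using k k2 k3 by (intro power_mono) auto
          also have "\<dots> \<le> real (idx (rt (int p) r)) * real (card {a \<in> ?B. a - 0 \<in> rt (int p) r})"
            by (rule Kc(3)[OF rt_ideal[OF gr] rt_fin[OF g(3) gr]]) (unfold i, use k k2 k3 in linarith)
          finally show ?thesis using g(3) unfolding i by (simp add: field_simps)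
        qed
        have "39 / 40 * real R ^ n * (real (card (roots p)) * ln p / p) = ln p * (\<Sum>r\<in>roots p. 39 / 40 * real R ^ n / p)"
          by (simp add: field_simps)
        also have "\<dots> \<le> ln p * (\<Sum>r\<in>roots p. real (card {a\<in>?B. a \<in> rt (int p) r}))"
          using g(5) by (intro mult_left_mono sum_mono each) auto
        also have "\<dots> = (\<Sum>a\<in>?B. ln p * tc p a)"
          unfolding tc_def sum_distrib_left[symmetric] by (subst sum.swap) (simp add: sum_ind[OF finite_box])
        finally show "39 / 40 * real R ^ n * (real (card (roots p)) * ln p / p) \<le> (\<Sum>a\<in>?B. ln p * tc p a)" .
      qed
      define L where "L = n * ln (Cn * R)"
      have lnCnR: "ln (Cn * R) \<ge> 0" 
      proof -
        have "1 * 1 \<le> Cn * real R" using Cn(1) rr1 rrR by (intro mult_mono) auto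
        thus ?thesis by simp
      qed
      \<comment> \<open>The norm of 0 is divisible by every prime. By Chebyshev's bound this one
        element costs at most 5 Z, which is later absorbed in 5 R^n.\<close>
      have single: "(\<Sum>p\<in>Pr P0 Z. ln p * (if int p dvd nrm a then 1 else 0)) \<le> L + (if a = 0 then 5 * real Z else 0)"
        if a: "a \<in> ?B" for a
      proof (cases "a = 0")
        case True
        have "(\<Sum>p\<in>Pr P0 Z. ln p * (if int p dvd nrm a then 1 else 0)) \<le> (\<Sum>p\<in>Pr P0 Z. ln p)"
          using gd(5) by (intro sum_mono) auto
        also have "\<dots> \<le> 5 * real Z" by (rule Pr_sum_ln)
        finally have "(\<Sum>p\<in>Pr P0 Z. ln p * (if int p dvd nrm a then 1 else 0)) \<le> 5 * real Z" .
        moreover have "L \<ge> 0" unfolding L_def using lnCnR by (intro mult_nonneg_nonneg) auto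
        ultimately show ?thesis using True by simp
      next
        case False
        have sm: "a \<in> small (int R)" using a by (auto simp: box_def small_def)
        have nz: "nrm a \<noteq> 0" by (rule nrm_nz[OF _ False]) (use a in \<open>auto simp: box_def\<close>)
        have "(\<Sum>p\<in>Pr P0 Z. ln p * (if int p dvd nrm a then 1 else 0)) = (\<Sum>p\<in>{p\<in>Pr P0 Z. int p dvd nrm a}. ln p)"
          by (rule sum.mono_neutral_cong_right) auto
        also have "\<dots> \<le> ln \<bar>real_of_int (nrm a)\<bar>"
          by (rule sum_ln_primes_le) (use nz in \<open>auto simp: Pr_def\<close>)
        also have "\<dots> \<le> ln ((Cn * R) ^ n)"
          using Cn(2)[OF sm] nz Cn(1) Rpos by (subst ln_le_cancel_iff) auto
        also have "\<dots> = L" unfolding L_def using Cn(1) Rpos by (simp add: ln_realpow)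
        finally show ?thesis using False by simp
      qed
      have "S \<le> (\<Sum>p\<in>Pr P0 Z. \<Sum>a\<in>?B. ln p * (if int p dvd nrm a then 1 else 0) + ln p * (n * fc p a))"
        unfolding S_def distrib_left[symmetric]
        by (intro sum_mono mult_left_mono tc_le) (auto dest: gd)
      also have "\<dots> = (\<Sum>p\<in>Pr P0 Z. \<Sum>a\<in>?B. ln p * (if int p dvd nrm a then 1 else 0)) + 
        (\<Sum>p\<in>Pr P0 Z. \<Sum>a\<in>?B. ln p * (n * fc p a))" by (simp only: sum.distrib)
      also have "(\<Sum>p\<in>Pr P0 Z. \<Sum>a\<in>?B. ln p * (if int p dvd nrm a then 1 else 0)) \<le> real R ^ n * L + 5 * real Z"
      proof -
        have "(\<Sum>p\<in>Pr P0 Z. \<Sum>a\<in>?B. ln p * (if int p dvd nrm a then 1 else 0)) =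
          (\<Sum>a\<in>?B. \<Sum>p\<in>Pr P0 Z. ln p * (if int p dvd nrm a then 1 else 0))" by (rule sum.swap)
        also have "\<dots> \<le> (\<Sum>a\<in>?B. L + (if a = 0 then 5 * real Z else 0))" by (intro sum_mono single)
        also have "\<dots> = real R ^ n * L + (\<Sum>a\<in>?B. if a = 0 then 5 * real Z else 0)"
          by (simp add: sum.distrib cB)
        also have "(\<Sum>a\<in>?B. if a = 0 then 5 * real Z else 0) \<le> 5 * real Z"
          using finite_box by simp
        finally show ?thesis by simp
      qed
      also have "(\<Sum>p\<in>Pr P0 Z. \<Sum>a\<in>?B. ln p * (n * fc p a)) \<le> N1 * (real R ^ n * ln Z * (1 / P0) + Kc ^ n * (5 * Z))"
      proof -
        have "(\<Sum>p\<in>Pr P0 Z. \<Sum>a\<in>?B. ln p * (n * fc p a)) = (\<Sum>p\<in>Pr P0 Z. ln p * (n * (\<Sum>a\<in>?B. fc p a)))"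
          by (simp add: sum_distrib_left)
        also have "\<dots> \<le> (\<Sum>p\<in>Pr P0 Z. ln p * (n * (3 * n ^ 2 * (2 ^ n * (real R ^ n / real p ^ 2 + Kc ^ n)))))"
          by (intro sum_mono mult_left_mono sum_fc) (auto dest: gd)
        also have "\<dots> = (\<Sum>p\<in>Pr P0 Z. N1 * (real R ^ n * (ln p * (1 / real p ^ 2)) + Kc ^ n * ln p))"
          by (intro sum.cong refl) (simp add: N1_def algebra_simps)
        also have "\<dots> = N1 * (real R ^ n * (\<Sum>p\<in>Pr P0 Z. ln p * (1 / real p ^ 2)) + Kc ^ n * (\<Sum>p\<in>Pr P0 Z. ln p))"
          by (simp only: sum_distrib_left sum.distrib distrib_left)
        also have "\<dots> \<le> N1 * (real R ^ n * (ln Z * (1 / P0)) + Kc ^ n * (5 * Z))"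
        proof (intro mult_left_mono add_mono N1)
          have "(\<Sum>p\<in>Pr P0 Z. ln p * (1 / real p ^ 2)) \<le> (\<Sum>p\<in>Pr P0 Z. ln Z * (1 / real p ^ 2))"
            by (intro sum_mono mult_right_mono) (use gd(3,4) in force)+
          also have "\<dots> = ln Z * (\<Sum>p\<in>Pr P0 Z. 1 / real p ^ 2)" by (simp only: sum_distrib_left)
          also have "\<dots> \<le> ln Z * (1 / P0)" by (intro mult_left_mono Pr_sum_inverse_squares P0' lnZ)
          finally show "(\<Sum>p\<in>Pr P0 Z. ln p * (1 / real p ^ 2)) \<le> ln Z * (1 / P0)" .
          show "(\<Sum>p\<in>Pr P0 Z. ln (real p)) \<le> real (5 * Z)" using Pr_sum_ln[of P0 Z] by simp
        qed (use Kc(1) in auto)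
        finally show ?thesis by (simp add: mult.assoc)
      qed
      finally have up: "S \<le> real R ^ n * L + 5 * real Z + N1 * (real R ^ n * ln Z * (1 / P0) + Kc ^ n * (5 * Z))" by simp
      also have "\<dots> \<le> real R ^ n * L + 5 * real R ^ n + real R ^ n * (N1 / P0) * ln Z + 5 * N1 * Kc ^ n * real R ^ n"
      proof -
        have A: "N1 * (real R ^ n * ln Z * (1 / P0) + Kc ^ n * (5 * Z)) = real R ^ n * (N1 / P0) * ln Z + 5 * (N1 * Kc ^ n) * real Z"
          by (simp add: algebra_simps)
        have "5 * (N1 * Kc ^ n) * real Z \<le> 5 * (N1 * Kc ^ n) * real R ^ n"
          using N1 Kc(1) by (intro mult_left_mono RnZ) auto
        moreover have "5 * N1 * Kc ^ n * real R ^ n = 5 * (N1 * Kc ^ n) * real R ^ n" by simp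
        ultimately show ?thesis unfolding A using RnZ by linarith
      qed
      also have "\<dots> = real R ^ n * (L + 5 + (N1 / P0) * ln Z + 5 * N1 * Kc ^ n)" by (simp add: algebra_simps)
      finally have "39 / 40 * real R ^ n * Sm P0 Z \<le> real R ^ n * (L + 5 + (N1 / P0) * ln Z + 5 * N1 * Kc ^ n)"
        using low by linarith
      hence "real R ^ n * (39 / 40 * Sm P0 Z) \<le> real R ^ n * (L + 5 + (N1 / P0) * ln Z + 5 * N1 * Kc ^ n)"
        by (simp only: mult_ac)
      hence 1: "39 / 40 * Sm P0 Z \<le> L + 5 + (N1 / P0) * ln Z + 5 * N1 * Kc ^ n"
        using Rn0 by (simp only: mult_le_cancel_left_pos)
      have "L \<le> n * ln (Cn * (2 * M) * rr)" unfolding L_def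
        using Rhi Rpos Cn(1) M(2) rr1 by (intro mult_left_mono) (auto simp: mult.assoc)
      also have "\<dots> = n * ln (Cn * (2 * M)) + n * ln rr"
        using Cn(1) M(2) rr1 by (subst ln_mult) (auto simp: algebra_simps)
      also have "n * ln rr = ln Z" unfolding rrn[symmetric] using rr1 by (simp add: ln_realpow)
      finally have 2: "L \<le> n * ln (Cn * (2 * M)) + ln Z" .
      have 3: "(N1 / P0) * ln Z \<le> 1 / 40 * ln Z" by (intro mult_right_mono P0' lnZ)
      \<comment> \<open>The coefficient of ln Z is (1 + 1/40) / (39/40) = 41/39, which is below
        11/10.\<close>
      show ?thesis unfolding C_def using 1 2 3 lnZ by (simp add: field_simps)
    qed
    thus "\<exists>C. \<forall>Z\<ge>1. Sm P0 Z \<le> 11 / 10 * ln Z + C" by blast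
  qed
qed

end

section \<open>Average logarithm of the norm and the lower Mertens bound\<close>

lemma card_ints_in_interval:
  fixes W :: int
  assumes "W \<ge> 1" "h > 0" "finite S" "\<And>k. k \<in> S \<Longrightarrow> \<bar>real_of_int (W * k) + x\<bar> < h"
  shows "real (card S) \<le> 2 * h + 1"
proof -
  have "S \<subseteq> {\<lceil>(- h - x) / W\<rceil>..\<lfloor>(h - x) / W\<rfloor>}"
  proof
    fix k assume "k \<in> S"
    from assms(4)[OF this] have k: "- h - x < W * real_of_int k" "W * real_of_int k < h - x" by (auto simp: abs_less_iff)
    have W: "real_of_int W > 0" using assms(1) by simp
    have "(- h - x) / W \<le> k" using k(1) W by (simp add: pos_divide_le_eq mult.commute)
    moreover have "k \<le> (h - x) / W" using k(2) W by (simp add: pos_le_divide_eq mult.commute)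
    ultimately show "k \<in> {\<lceil>(- h - x) / W\<rceil>..\<lfloor>(h - x) / W\<rfloor>}" by (simp add: ceiling_le_iff le_floor_iff)
  qed
  from card_mono[OF _ this] have "card S \<le> nat (\<lfloor>(h - x) / W\<rfloor> - \<lceil>(- h - x) / W\<rceil> + 1)" by simp
  hence "real (card S) \<le> real (nat (\<lfloor>(h - x) / W\<rfloor> - \<lceil>(- h - x) / W\<rceil> + 1))" by (simp only: of_nat_le_iff)
  also have "\<dots> \<le> (h - x) / W - (- h - x) / W + 1"
  proof (cases "\<lfloor>(h - x) / W\<rfloor> - \<lceil>(- h - x) / W\<rceil> + 1 \<ge> 0")
    case True thus ?thesis by simp linarith
  next
    case False
    have "(- h - x) / W \<le> (h - x) / W" using assms by (intro divide_right_mono) auto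
    thus ?thesis using False by simp
  qed
  also have "(h - x) / W - (- h - x) / W = 2 * h / W" by (simp add: diff_divide_distrib[symmetric])
  also have "2 * h / W \<le> 2 * h / 1" using assms by (intro divide_left_mono) auto
  finally show ?thesis by simp
qed

context int_poly_field
begin

text \<open>Elements congruent to 1 modulo W have norms congruent to 1 modulo W, so no prime factor
  of W occurs in these norms.\<close>

definition aff :: "nat \<Rightarrow> int poly \<Rightarrow> int poly" where "aff W b = 1 + smult (int W) b"

lemma aff_coeff: "b \<in> box 0 (int R) \<Longrightarrow> i \<ge> n \<Longrightarrow> coeff (aff W b) i = 0"
  using n_pos by (auto simp: aff_def box_def coeff_1)

lemma aff_nrm_nz: "b \<in> box 0 (int R) \<Longrightarrow> nrm (aff W b) \<noteq> 0"
proof (rule nrm_nz)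
  assume b: "b \<in> box 0 (int R)"
  show "\<And>i. i \<ge> n \<Longrightarrow> coeff (aff W b) i = 0" by (rule aff_coeff[OF b])
  have "coeff b 0 \<ge> 0" using b n_pos by (auto simp: box_def)
  hence "coeff (aff W b) 0 > 0" by (simp add: aff_def add_pos_nonneg)
  thus "aff W b \<noteq> 0" by auto
qed

lemma aff_small: "b \<in> box 0 (int R) \<Longrightarrow> R \<ge> 1 \<Longrightarrow> aff W b \<in> small (int ((1 + W) * R))"
  unfolding small_def
proof safe
  fix i assume b: "b \<in> box 0 (int R)" and R: "R \<ge> 1" and i: "i < n"
  have bi: "0 \<le> coeff b i" "coeff b i \<le> int R" using b i by (auto simp: box_def)
  have "\<bar>coeff (aff W b) i\<bar> \<le> 1 + int W * coeff b i" using bi by (auto simp: aff_def coeff_1)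
  also have "\<dots> \<le> int R + int W * int R" using bi R by (intro add_mono mult_left_mono) auto
  finally show "\<bar>coeff (aff W b) i\<bar> \<le> int ((1 + W) * R)" by (simp add: algebra_simps)
qed (rule aff_coeff)

text \<open>With w the inverse of W modulo m, membership of 1 + W b in \<open>I\<close> means
  membership of b + w, so the counts in shifted classes apply to these elements.\<close>

lemma aff_coset:
  assumes I: "is_ideal I" "[:int m:] \<in> I" and "coprime (int m) (int W)"
  obtains c where "\<And>b. aff W b \<in> I \<longleftrightarrow> b - c \<in> I"
proof -
  have "gcd (int m) (int W) = 1" using assms(3) by simp
  then obtain t w where tw: "t * int m + w * int W = 1" using bezout_int[of "int m" "int W"] by auto
  have m: "smult k [:int m:] * a \<in> I" for k a by (intro is_ideal_closed(5,8)[OF I(1)] I(2))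
  have "aff W b \<in> I \<longleftrightarrow> b - [:-w:] \<in> I" for b
  proof
    have e: "b - [:-w:] = smult w (aff W b) + smult t [:int m:] * b"
    proof -
      have "smult w (aff W b) + smult t [:int m:] * b = [:w:] + smult (t * int m + w * int W) b"
        by (simp add: aff_def smult_add_right smult_add_left one_pCons)
      thus ?thesis unfolding tw by simp
    qed
    show "b - [:-w:] \<in> I" if "aff W b \<in> I" unfolding e by (intro is_ideal_closed(3,8)[OF I(1)] m that)
    have e2: "aff W b = smult (int W) (b - [:-w:]) + smult t [:int m:] * 1"
      using tw by (simp add: aff_def smult_diff_right one_pCons algebra_simps)
    show "aff W b \<in> I" if "b - [:-w:] \<in> I" unfolding e2 by (intro is_ideal_closed(3,8)[OF I(1)] m that)
  qed
  thus ?thesis by (rule that)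
qed

text \<open>Along each line in the direction of the constant polynomials the norm is a monic polynomial
  of degree \<open>n\<close>, so it is small only near its roots.\<close>

lemma few_small_norms:
  fixes \<delta> :: real
  assumes W: "W \<ge> 1" and \<delta>: "\<delta> > 0" "\<delta> * R \<ge> 1"
  shows "real (card {b\<in>box 0 (int R). \<bar>real_of_int (nrm (aff W b))\<bar> < (\<delta> * R) ^ n}) \<le> 3 * n * \<delta> * real R ^ n"
proof -
  have R: "real R > 0" using \<delta> by (cases "R = 0") auto
  define h where "h = \<delta> * R"
  have h: "h \<ge> 1" using \<delta> by (simp add: h_def)
  define rest where "rest b = b - [:coeff b 0:]" for b :: "int poly"
  define Y where "Y = rest ` box 0 (int R)"
  \<comment> \<open>Varying the constant coefficient alone moves a conjugate of
    \<open>aff W b\<close> in steps of W \<ge> 1, so at most 2 h + 1 \<le> 3 h positions bring its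
    real part below h in absolute value.\<close>
  define E where "E y t = {k\<in>{0..<int R}. \<bar>real_of_int (int W * k) + (1 + W * Re (ipoly y t))\<bar> < h}" for y t
  let ?bad = "{b\<in>box 0 (int R). \<bar>real_of_int (nrm (aff W b))\<bar> < h ^ n}"
  have finY: "finite Y" unfolding Y_def by (simp add: finite_box)
  have finE: "finite (E y t)" for y t unfolding E_def by (rule finite_subset[of _ "{0..<int R}"]) auto
  have cE: "real (card (E y t)) \<le> 3 * h" for y t
  proof -
    have "real (card (E y t)) \<le> 2 * h + 1"
      by (rule card_ints_in_interval[of "int W" _ _ "1 + W * Re (ipoly y t)"]) (use W h finE in \<open>auto simp: E_def\<close>)
    thus ?thesis using h by simp
  qed
  have sub: "?bad \<subseteq> (\<lambda>(y,k). y + [:k:]) ` (SIGMA y:Y. \<Union>t\<in>Theta. E y t)"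
  proof
    fix b assume b: "b \<in> ?bad"
    have "\<exists>t\<in>Theta. cmod (ipoly (aff W b) t) < h"
    proof (rule ccontr)
      assume "\<not> ?thesis"
      hence "(\<Prod>t\<in>Theta. h) \<le> (\<Prod>t\<in>Theta. cmod (ipoly (aff W b) t))" using h by (intro prod_mono) (auto simp: not_less)
      also have "\<dots> = cmod (of_int (nrm (aff W b)))" unfolding nrm by (simp add: prod_norm)
      finally show False using b by (simp add: Theta_card)
    qed
    then obtain t where t: "t \<in> Theta" "cmod (ipoly (aff W b) t) < h" by blast
    have "Re (ipoly (aff W b) t) = real_of_int (int W * coeff b 0) + (1 + W * Re (ipoly (rest b) t))"
      by (simp add: aff_def rest_def algebra_simps)
    hence "\<bar>real_of_int (int W * coeff b 0) + (1 + W * Re (ipoly (rest b) t))\<bar> < h"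
      using abs_Re_le_cmod[of "ipoly (aff W b) t"] t(2) by linarith
    hence "coeff b 0 \<in> E (rest b) t" using b n_pos by (auto simp: E_def box_def)
    hence "(rest b, coeff b 0) \<in> (SIGMA y:Y. \<Union>t\<in>Theta. E y t)" using b t(1) by (auto simp: Y_def)
    moreover have "b = (\<lambda>(y,k). y + [:k:]) (rest b, coeff b 0)" by (simp add: rest_def)
    ultimately show "b \<in> (\<lambda>(y,k). y + [:k:]) ` (SIGMA y:Y. \<Union>t\<in>Theta. E y t)" by (rule rev_image_eqI)
  qed
  have fin: "finite (SIGMA y:Y. \<Union>t\<in>Theta. E y t)" using finY finE Theta_finite by auto
  have "card ?bad \<le> card ((\<lambda>(y,k). y + [:k:]) ` (SIGMA y:Y. \<Union>t\<in>Theta. E y t))"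
    by (rule card_mono[OF finite_imageI[OF fin] sub])
  also have "\<dots> \<le> card (SIGMA y:Y. \<Union>t\<in>Theta. E y t)" by (rule card_image_le[OF fin])
  also have "\<dots> = (\<Sum>y\<in>Y. card (\<Union>t\<in>Theta. E y t))" using finY finE Theta_finite by (intro card_SigmaI) auto
  also have "\<dots> \<le> (\<Sum>y\<in>Y. \<Sum>t\<in>Theta. card (E y t))" by (intro sum_mono card_UN_le Theta_finite)
  finally have "real (card ?bad) \<le> real (\<Sum>y\<in>Y. \<Sum>t\<in>Theta. card (E y t))" by (simp only: of_nat_le_iff)
  also have "\<dots> = (\<Sum>y\<in>Y. \<Sum>t\<in>Theta. real (card (E y t)))" by simp
  also have "\<dots> \<le> (\<Sum>y\<in>Y. \<Sum>t\<in>Theta. 3 * h)" by (intro sum_mono cE)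
  also have "\<dots> = real (card Y) * (n * (3 * h))" by (simp add: Theta_card)
  finally have 1: "real (card ?bad) \<le> real (card Y) * (n * (3 * h))" .
  \<comment> \<open>This amounts to at most R^(n-1) lines, in a form that avoids the exponent n -
    1.\<close>
  have "card (Y \<times> {0..<int R}) \<le> card (box 0 (int R))"
  proof (rule card_inj_on_le[of "\<lambda>(y,k). y + [:k:]", OF _ _ finite_box])
    have y0: "coeff y 0 = 0" if "y \<in> Y" for y using that by (auto simp: Y_def rest_def)
    show "inj_on (\<lambda>(y,k). y + [:k:]) (Y \<times> {0..<int R})"
    proof (rule inj_onI, clarify)
      fix y k y' k' assume *: "y \<in> Y" "y' \<in> Y" "y + [:k:] = y' + [:k':]"
      have "k = k'" using arg_cong[OF *(3), of "\<lambda>q. coeff q 0"] y0[OF *(1)] y0[OF *(2)] by simp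
      thus "y = y' \<and> k = k'" using *(3) by simp
    qed
    show "(\<lambda>(y,k). y + [:k:]) ` (Y \<times> {0..<int R}) \<subseteq> box 0 (int R)"
    proof (rule image_subsetI, clarify)
      fix y k assume "y \<in> Y" and k: "k \<in> {0..<int R}"
      then obtain b where b: "b \<in> box 0 (int R)" "y = rest b" unfolding Y_def by blast
      have "coeff (y + [:k:]) i = (if i = 0 then k else coeff b i)" for i
        by (cases i) (simp_all add: b rest_def coeff_pCons)
      thus "y + [:k:] \<in> box 0 (int R)" using b(1) k n_pos by (simp add: box_def)
    qed
  qed
  hence "card Y * R \<le> R ^ n" by (simp add: card_cartesian_product card_box)
  hence "real (card Y * R) \<le> real (R ^ n)" by (simp only: of_nat_le_iff)
  hence "real (card Y) * real R * (n * (3 * \<delta>)) \<le> real R ^ n * (n * (3 * \<delta>))" using \<delta> by (intro mult_right_mono) auto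
  hence "real (card Y) * (n * (3 * h)) \<le> 3 * n * \<delta> * real R ^ n" unfolding h_def by (simp add: mult_ac)
  thus ?thesis using 1 unfolding h_def by linarith
qed

lemma average_log_norm:
  fixes \<delta> :: real
  assumes W: "W \<ge> 1" and \<delta>: "\<delta> > 0" "\<delta> * R \<ge> 1"
  shows "(1 - 3 * n * \<delta>) * real R ^ n * (n * ln (\<delta> * R)) \<le> (\<Sum>b\<in>box 0 (int R). ln \<bar>real_of_int (nrm (aff W b))\<bar>)"
proof -
  let ?B = "box 0 (int R)"
  let ?bad = "{b\<in>?B. \<bar>real_of_int (nrm (aff W b))\<bar> < (\<delta> * R) ^ n}"
  let ?l = "ln ((\<delta> * R) ^ n)"
  have l: "?l = n * ln (\<delta> * R)" using \<delta> by (simp add: ln_realpow)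
  have l0: "?l \<ge> 0" using \<delta> by (simp add: one_le_power)
  have c: "real (card (?B - ?bad)) \<ge> real R ^ n - 3 * n * \<delta> * real R ^ n"
  proof -
    have fb: "finite ?bad" by (rule finite_subset[OF _ finite_box[of 0 "int R"]]) auto
    have "card (?B - ?bad) = card ?B - card ?bad" by (rule card_Diff_subset[OF fb]) auto
    moreover have "card ?bad \<le> card ?B" by (rule card_mono[OF finite_box]) auto
    ultimately have "real (card (?B - ?bad)) = real R ^ n - real (card ?bad)" by (simp add: card_box)
    thus ?thesis using few_small_norms[OF W \<delta>] by linarith
  qed
  have "(1 - 3 * n * \<delta>) * real R ^ n * ?l \<le> real (card (?B - ?bad)) * ?l"
    using c l0 by (intro mult_right_mono) (auto simp: algebra_simps)
  also have "\<dots> = (\<Sum>b\<in>?B - ?bad. ?l)" by simp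
  also have "\<dots> \<le> (\<Sum>b\<in>?B - ?bad. ln \<bar>real_of_int (nrm (aff W b))\<bar>)"
  proof (rule sum_mono)
    fix b assume "b \<in> ?B - ?bad"
    hence "(\<delta> * R) ^ n \<le> \<bar>real_of_int (nrm (aff W b))\<bar>" by auto
    moreover have "0 < (\<delta> * R) ^ n" using \<delta> by simp
    ultimately show "?l \<le> ln \<bar>real_of_int (nrm (aff W b))\<bar>" by (subst ln_le_cancel_iff) auto
  qed
  \<comment> \<open>The terms added here are nonnegative because the norms are nonzero
    integers.\<close>
  also have "\<dots> \<le> (\<Sum>b\<in>?B. ln \<bar>real_of_int (nrm (aff W b))\<bar>)"
  proof (rule sum_mono2[OF finite_box])
    fix b assume "b \<in> ?B - (?B - ?bad)"
    hence "nrm (aff W b) \<noteq> 0" using aff_nrm_nz by blast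
    hence "1 \<le> \<bar>nrm (aff W b)\<bar>" by simp
    hence "1 \<le> \<bar>real_of_int (nrm (aff W b))\<bar>" by linarith
    thus "0 \<le> ln \<bar>real_of_int (nrm (aff W b))\<bar>" by simp
  qed auto
  finally show ?thesis unfolding l .
qed

text \<open>Factor the norm. If an ideal of \<open>fam p\<close> contains \<open>a\<close>, the
  whole p-part is charged to it, with logarithm at most L. Otherwise p divides the norm exactly once
  and \<open>a\<close> lies in a root ideal, which is charged ln p.\<close>

lemma log_norm_le:
  assumes gd: "\<And>p. prime p \<Longrightarrow> p > P0 \<Longrightarrow> good p" and nz: "nrm a \<noteq> 0"
    and small: "\<And>p. prime p \<Longrightarrow> int p dvd nrm a \<Longrightarrow> p > P0"
    and le: "\<bar>nrm a\<bar> \<le> int Y" and L: "ln \<bar>real_of_int (nrm a)\<bar> \<le> L"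
  shows "ln \<bar>real_of_int (nrm a)\<bar> \<le> (\<Sum>p\<in>Pr P0 Y. ln p * tc p a + L * fc p a)"
proof -
  define N where "N = nat \<bar>nrm a\<bar>"
  have N: "N > 0" using nz by (simp add: N_def)
  have dvdN: "p dvd N \<longleftrightarrow> int p dvd nrm a" for p unfolding N_def by (simp add: nat_dvd_iff)
  have rN: "real N = \<bar>real_of_int (nrm a)\<bar>" by (simp add: N_def)
  have L0: "L \<ge> 0" 
  proof -
    have "ln (real N) \<ge> 0" using N by (intro ln_ge_zero) simp
    thus ?thesis using L rN by simp
  qed
  have PF: "prime_factors N \<subseteq> Pr P0 Y"
  proof
    fix p assume "p \<in> prime_factors N"
    hence p: "prime p" "p dvd N" by auto
    have "p \<le> N" using p N by (intro dvd_imp_le)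
    also have "N \<le> Y" using le by (simp add: N_def)
    finally show "p \<in> Pr P0 Y" using p small[of p] dvdN by (simp add: Pr_def)
  qed
  have "ln (real N) = ln (\<Prod>p\<in>prime_factors N. real p ^ multiplicity p N)"
  proof -
    have "real N = real (\<Prod>p\<in>prime_factors N. p ^ multiplicity p N)"
      by (rule arg_cong[OF prime_factorization_nat[OF N]])
    also have "\<dots> = (\<Prod>p\<in>prime_factors N. real p ^ multiplicity p N)" by simp
    finally show ?thesis by (rule arg_cong)
  qed
  also have "\<dots> = (\<Sum>p\<in>prime_factors N. multiplicity p N * ln (real p))"
    by (subst ln_prod) (auto simp: ln_realpow prime_factors_gt_0_nat)
  finally have lnN: "ln (real N) = (\<Sum>p\<in>prime_factors N. multiplicity p N * ln (real p))" .
  have "multiplicity p N * ln (real p) \<le> ln p * tc p a + L * fc p a" if p: "p \<in> prime_factors N" for p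
  proof -
    have pr: "prime p" "p dvd N" "p > 1" "real p > 0" using p prime_gt_1_nat prime_gt_0_nat by auto
    have g: "good p" using gd[OF pr(1)] small[OF pr(1)] pr(2) dvdN by blast
    have lnp: "ln (real p) \<ge> 0" using pr by simp
    have all: "multiplicity p N * ln (real p) \<le> L"
    proof -
      have "p ^ multiplicity p N \<le> N" using N by (intro dvd_imp_le multiplicity_dvd)
      hence "real (p ^ multiplicity p N) \<le> real N" by (simp only: of_nat_le_iff)
      hence "real p ^ multiplicity p N \<le> real N" by (simp only: of_nat_power)
      hence "ln (real p ^ multiplicity p N) \<le> ln (real N)" using pr(4) N by (subst ln_le_cancel_iff) auto
      thus ?thesis using L rN pr(4) by (simp add: ln_realpow)
    qed
    show ?thesis
    proof (cases "\<exists>I\<in>fam p. a \<in> I")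
      case True
      hence "fc p a \<ge> 1" using fc_ge_1[OF g] by blast
      hence "L * 1 \<le> L * fc p a" using L0 by (intro mult_left_mono)
      moreover have "ln p * tc p a \<ge> 0" using lnp tc_nonneg[of p a] by (rule mult_nonneg_nonneg)
      ultimately show ?thesis using all by linarith
    next
      case False
      have "\<not> int p ^ 2 dvd nrm a" using square_dividing_norm[OF g, of a] False by (auto simp: fam_def)
      hence "\<not> p ^ 2 dvd N" using dvdN[of "p ^ 2"] by simp
      hence "multiplicity p N < 2" using multiplicity_dvd'[of 2 p N] by (cases "multiplicity p N < 2") auto
      hence m: "multiplicity p N * ln (real p) \<le> 1 * ln (real p)" using lnp by (intro mult_right_mono) auto
      obtain r where "r \<in> roots p" "a \<in> rt (int p) r"
        using prime_dividing_norm[OF pr(1), of a] pr(2) dvdN False by (auto simp: fam_def)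
      hence "tc p a \<ge> 1" by (rule tc_ge_1)
      hence "ln p * 1 \<le> ln p * tc p a" using lnp by (intro mult_left_mono)
      moreover have "L * fc p a \<ge> 0" using L0 fc_nonneg[of p a] by (rule mult_nonneg_nonneg)
      ultimately show ?thesis using m by linarith
    qed
  qed
  hence "ln (real N) \<le> (\<Sum>p\<in>prime_factors N. ln p * tc p a + L * fc p a)" unfolding lnN by (rule sum_mono)
  also have "\<dots> \<le> (\<Sum>p\<in>Pr P0 Y. ln p * tc p a + L * fc p a)"
  proof (rule sum_mono2[OF finite_Pr PF])
    fix p assume "p \<in> Pr P0 Y - prime_factors N"
    hence "ln (real p) \<ge> 0" by (auto simp: Pr_def Suc_le_eq prime_gt_0_nat intro!: ln_ge_zero)
    thus "0 \<le> ln p * tc p a + L * fc p a" using L0 tc_nonneg fc_nonneg by simp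
  qed
  finally show ?thesis unfolding rN .
qed

end

lemma sum_split_aux:
  fixes A B q :: "'a \<Rightarrow> real"
  assumes "finite S"
  shows "(\<Sum>p\<in>S. r * (c * A p + k * B p) + L * (N * (r / q p + K))) =
    r * (c * sum A S + k * sum B S) + L * N * (r * (\<Sum>p\<in>S. 1 / q p) + K * card S)"
  using assms by (induction S rule: finite_induct) (simp_all add: algebra_simps)

lemma le_double_floor: 
  fixes x :: real assumes "x \<ge> 1" shows "x \<le> 2 * real (nat \<lfloor>x\<rfloor>)"
proof -
  have "\<lfloor>x\<rfloor> \<ge> 1" using assms by simp
  hence "real (nat \<lfloor>x\<rfloor>) = of_int \<lfloor>x\<rfloor>" "of_int \<lfloor>x\<rfloor> \<ge> (1::real)" by simp_all
  moreover have "x < of_int \<lfloor>x\<rfloor> + 1" by linarith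
  ultimately show ?thesis by linarith
qed

context int_poly_field
begin

lemma Sm_mono: "m \<le> m' \<Longrightarrow> Sm l m \<le> Sm l m'"
  unfolding Sm_def by (intro sum_mono2) (auto simp: Pr_def Suc_le_eq prime_gt_0_nat intro!: mult_nonneg_nonneg divide_nonneg_nonneg ln_ge_zero)

text \<open>On average over the box, the logarithm of the norm is at least 39/40 of n ln (\<delta>
  R), and factoring the norms distributes it over the root ideals. The norms reach (C1 R)^n, beyond
  the range in which ideals are counted accurately; the primes between (\<eta> R)^n and (C1 R)^n are
  only bounded from above, and Chebyshev's estimate shows that their share is O(1).\<close>

lemma mertens_lower:
  obtains P1 where "P1 > 0" 
    "\<And>P0. P0 \<ge> P1 \<Longrightarrow> \<exists>C Z0. \<forall>Z\<ge>Z0. Sm P0 Z \<ge> 9 / 10 * ln (real Z) - C"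
proof -
  obtain D where D: "D > 0" "\<And>p. prime p \<Longrightarrow> p > D \<Longrightarrow> good p" by (rule good_eventually) blast
  define N1 :: real where "N1 = 3 * n ^ 2 * 2 ^ n"
  have N1: "N1 \<ge> 0" unfolding N1_def by simp
  define P1 where "P1 = D + nat \<lceil>40 * N1\<rceil>"
  \<comment> \<open>Chosen such that the proportion 3 n \<delta> of elements with small norm is
    1/40.\<close>
  define \<delta> where "\<delta> = 1 / (120 * real n)"
  have \<delta>0: "\<delta> > 0" using n_pos by (simp add: \<delta>_def)
  \<comment> \<open>For p^(1/n) \<le> \<eta> R the relative boundary error is at most Kc \<eta> = 1
    / (80 n), so the n-th power costs at most exp (1/80) \<le> 41/40.\<close>
  define \<eta> where "\<eta> = 1 / (80 * real n * Kc)"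
  have \<eta>0: "\<eta> > 0" using n_pos Kc(1) by (simp add: \<eta>_def)
  have \<eta>K: "(1 + Kc * \<eta>) ^ n \<le> 41 / 40"
  proof -
    have "Kc * \<eta> = 1 / (80 * real n)" using Kc(1) by (simp add: \<eta>_def)
    moreover have "(1 + 1 / (80 * real n)) ^ n \<le> exp (1 / (80 * real n)) ^ n"
      by (intro power_mono) (auto simp: exp_ge_add_one_self)
    moreover have "exp (1 / (80 * real n)) ^ n = exp (1 / 80)"
      using n_pos by (simp add: exp_of_nat_mult[symmetric])
    moreover have "exp (1 / 80 :: real) \<le> 1 + 1 / 80 + (1 / 80)\<^sup>2" by (rule exp_bound) auto
    ultimately show ?thesis by (simp add: power2_eq_square)
  qed
  show ?thesis
  proof
    show "P1 > 0" using D by (simp add: P1_def)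
    fix P0 assume P0: "P0 \<ge> P1"
    have P0': "P0 > 0" "N1 / P0 \<le> 1 / 40" 
    proof -
      show "P0 > 0" using P0 D by (simp add: P1_def)
      have "real P0 \<ge> 40 * N1" using P0 unfolding P1_def by linarith
      thus "N1 / P0 \<le> 1 / 40" using \<open>P0 > 0\<close> by (simp add: field_simps)
    qed
    have gd0: "good p" if "prime p" "p > P0" for p
      using D(2)[of p] that P0 by (simp add: P1_def)
    have gd: "prime p" "good p" "p > 0" "p \<le> Z" "ln (real p) \<ge> 0" "p > P0" if "p \<in> Pr P0 Z" for p Z
      using that gd0[of p] prime_gt_0_nat[of p] by (auto simp: Pr_def Suc_le_eq intro!: ln_ge_zero)
    \<comment> \<open>Passing to 1 + W b removes all primes up to \<open>P0\<close>, the bad ones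
      among them included, from the norms.\<close>
    define W where "W = \<Prod>{p. prime p \<and> p \<le> P0}"
    have W1: "W \<ge> 1" unfolding W_def by (auto simp: Suc_le_eq prime_gt_0_nat intro!: prod_pos)
    have Wdvd: "p dvd W" if "prime p" "p \<le> P0" for p
      unfolding W_def using that by (intro dvd_prodI[of _ _ "\<lambda>p. p", simplified]) auto
    have Wcop: "coprime p W" if "prime p" "p > P0" for p
      unfolding W_def using that by (intro prod_coprime_right) (auto intro!: primes_coprime)
    define C1 where "C1 = Cn * real (1 + W)"
    have C1: "C1 \<ge> 1" unfolding C1_def using Cn(1) mult_mono[of 1 Cn 1 "real (1 + W)"] by simp
    define c2 where "c2 = (1 + Kc * C1) ^ n * (n * (5 * (C1 / \<eta>) ^ n)) + N1 * Kc ^ n * (13 * C1 ^ n)"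
    have key: "(1 - 3 * n * \<delta>) * (n * ln (\<delta> * R)) \<le> 41 / 40 * Sm P0 (nat \<lfloor>(C1 * R) ^ n\<rfloor>) + c2 + N1 / P0 * (n * ln (C1 * R))"
      if R: "\<delta> * real R \<ge> 1" for R :: nat
    proof -
      have R1: "R \<ge> 1" using R by (cases "R = 0") auto
      define Y where "Y = nat \<lfloor>(C1 * R) ^ n\<rfloor>"
      define L where "L = n * ln (C1 * R)"
      let ?B = "box 0 (int R)"
      have CR1: "C1 * R \<ge> 1" using mult_mono[of 1 C1 1 "real R"] C1 R1 by simp
      have CRn: "(C1 * R) ^ n \<ge> 1" using CR1 by (rule one_le_power)
      have Lln: "L = ln ((C1 * R) ^ n)" unfolding L_def using CR1 by (simp add: ln_realpow)
      have L0: "L \<ge> 0" unfolding Lln using CRn by simp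
      have Yle: "real Y \<le> (C1 * R) ^ n" unfolding Y_def using CRn by (intro of_nat_floor) simp
      have Y1: "Y \<ge> 1" unfolding Y_def using CRn by (simp add: le_nat_floor)
      have Rn0: "real R ^ n > 0" using R1 by simp
      have nb: "\<bar>real_of_int (nrm (aff W b))\<bar> \<le> (C1 * R) ^ n" if "b \<in> ?B" for b
        using Cn(2)[OF aff_small[OF that R1, of W]] unfolding C1_def by (simp add: algebra_simps)
      have each: "ln \<bar>real_of_int (nrm (aff W b))\<bar> \<le> (\<Sum>p\<in>Pr P0 Y. ln p * tc p (aff W b) + L * fc p (aff W b))"
        if b: "b \<in> ?B" for b
      proof (rule log_norm_le[OF gd0])
        show nz: "nrm (aff W b) \<noteq> 0" by (rule aff_nrm_nz[OF b])
        show "\<bar>nrm (aff W b)\<bar> \<le> int Y"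
        proof -
          have "real_of_int \<bar>nrm (aff W b)\<bar> \<le> (C1 * R) ^ n" using nb[OF b] by simp
          hence "\<bar>nrm (aff W b)\<bar> \<le> \<lfloor>(C1 * R) ^ n\<rfloor>" by (simp only: le_floor_iff)
          moreover have "0 \<le> (C1 * R) ^ n" using CRn by linarith
          ultimately show ?thesis unfolding Y_def by simp
        qed
        show "ln \<bar>real_of_int (nrm (aff W b))\<bar> \<le> L" unfolding Lln
          using nb[OF b] nz CRn by (subst ln_le_cancel_iff) auto
        fix p assume p: "prime p" "int p dvd nrm (aff W b)"
        show "p > P0"
        proof (rule ccontr)
          assume "\<not> p > P0"
          hence "int p dvd int W" using Wdvd[OF p(1)] by simp
          also have "int W dvd nrm (aff W b) - nrm 1" unfolding aff_def by (rule nrm_cong)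
          finally have "int p dvd nrm (aff W b) - 1" by (simp add: nrm_one)
          hence "int p dvd nrm (aff W b) - (nrm (aff W b) - 1)" using p(2) by (rule dvd_diff[rotated])
          thus False using p(1) by simp
        qed
      qed
      have cnt: "real (card {b\<in>?B. aff W b \<in> rt (int p) r}) * p \<le> (real R + Kc * root n p) ^ n" 
        if p: "p \<in> Pr P0 Y" and r: "r \<in> roots p" for p r
      proof -
        have gr: "int p dvd poly g r" using r by (simp add: roots_def)
        have I: "is_ideal (rt (int p) r)" by (rule rt_ideal[OF gr])
        have "[:int p:] \<in> rt (int p) r" by (simp add: rt_def)
        moreover have "coprime (int p) (int W)" using Wcop gd[OF p] by simp
        ultimately obtain c where c: "\<And>b. aff W b \<in> rt (int p) r \<longleftrightarrow> b - c \<in> rt (int p) r" by (rule aff_coset[OF I]) blast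
        show ?thesis unfolding c using Kc(2)[OF I rt_fin[OF gd(3)[OF p] gr], where c = c and R = R]
          by (simp add: rt_idx[OF gd(3)[OF p] gr] mult.commute)
      qed
      have tsum: "(\<Sum>b\<in>?B. tc p (aff W b)) * p \<le> real (card (roots p)) * (real R + Kc * root n p) ^ n" 
        if p: "p \<in> Pr P0 Y" for p
      proof -
        have "(\<Sum>b\<in>?B. tc p (aff W b)) = (\<Sum>r\<in>roots p. real (card {b\<in>?B. aff W b \<in> rt (int p) r}))"
          unfolding tc_def by (subst sum.swap) (simp add: sum_ind[OF finite_box])
        hence "(\<Sum>b\<in>?B. tc p (aff W b)) * p = (\<Sum>r\<in>roots p. real (card {b\<in>?B. aff W b \<in> rt (int p) r}) * p)"
          by (simp only: sum_distrib_right)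
        also have "\<dots> \<le> (\<Sum>r\<in>roots p. (real R + Kc * root n p) ^ n)" by (intro sum_mono cnt p)
        finally show ?thesis by simp
      qed
      have fsum: "(\<Sum>b\<in>?B. fc p (aff W b)) \<le> N1 * (real R ^ n / real p ^ 2 + Kc ^ n)" if p: "p \<in> Pr P0 Y" for p
      proof -
        have "real (card {b\<in>?B. aff W b \<in> I}) \<le> 2 ^ n * (real R ^ n / real p ^ 2 + Kc ^ n)" if I: "I \<in> fam p" for I
        proof -
          note f = fam_props[OF gd(1)[OF p] I]
          have "coprime (int (p ^ 2)) (int W)" using Wcop gd[OF p] by simp
          then obtain c where c: "\<And>b. aff W b \<in> I \<longleftrightarrow> b - c \<in> I" by (rule aff_coset[OF f(1,4)]) blast
          show ?thesis unfolding c by (rule fam_count[OF gd(1)[OF p] I])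
        qed
        hence "(\<Sum>I\<in>fam p. real (card {b\<in>?B. aff W b \<in> I})) \<le> (\<Sum>I\<in>fam p. 2 ^ n * (real R ^ n / real p ^ 2 + Kc ^ n))"
          by (intro sum_mono)
        also have "\<dots> = real (card (fam p)) * (2 ^ n * (real R ^ n / real p ^ 2 + Kc ^ n))" by simp
        also have "\<dots> \<le> real (3 * n ^ 2) * (2 ^ n * (real R ^ n / real p ^ 2 + Kc ^ n))"
          using fam_card(2)[OF gd(2)[OF p]] Kc(1) by (intro mult_right_mono of_nat_mono) auto
        finally have "(\<Sum>I\<in>fam p. real (card {b\<in>?B. aff W b \<in> I})) \<le> real (3 * n ^ 2) * (2 ^ n * (real R ^ n / real p ^ 2 + Kc ^ n))" .
        moreover have "(\<Sum>b\<in>?B. fc p (aff W b)) = (\<Sum>I\<in>fam p. real (card {b\<in>?B. aff W b \<in> I}))"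
          unfolding fc_def by (subst sum.swap) (simp add: sum_ind[OF finite_box])
        ultimately show ?thesis unfolding N1_def by (simp add: mult.assoc)
      qed
      \<comment> \<open>The first summand is the accurate count for p up to (\<eta> R)^n; the second
        takes over for larger p, where the count is known only up to a constant factor.\<close>
      have t1: "ln p * (\<Sum>b\<in>?B. tc p (aff W b)) \<le> 
         real R ^ n * (41 / 40 * (real (card (roots p)) * ln p / p) + (1 + Kc * C1) ^ n * (n / (\<eta> * R) ^ n) * ln p)"
        if p: "p \<in> Pr P0 Y" for p
      proof -
        note g = gd[OF p]
        have p0: "real p > 0" using g by simp
        have er: "\<eta> * R > 0" using \<eta>0 R1 by simp
        have rp0: "root n (real p) \<ge> 0" by (rule real_root_ge_zero) simp
        have rpn: "root n (real p) ^ n = p" using n_pos by simp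
        have bound: "ln p * (\<Sum>b\<in>?B. tc p (aff W b)) \<le> ln p * (real (card (roots p)) * (real R + Kc * root n p) ^ n / p)"
          using tsum[OF p] p0 g(5) by (intro mult_left_mono) (auto simp: pos_le_divide_eq)
        show ?thesis
        proof (cases "root n (real p) \<le> \<eta> * R")
          case True
          have "real R + Kc * root n p \<le> real R * (1 + Kc * \<eta>)" using mult_left_mono[OF True, of Kc] Kc(1) by (simp add: algebra_simps)
          hence "(real R + Kc * root n p) ^ n \<le> (real R * (1 + Kc * \<eta>)) ^ n" using Kc(1) rp0 by (intro power_mono) auto
          also have "\<dots> \<le> real R ^ n * (41 / 40)" unfolding power_mult_distrib by (intro mult_left_mono \<eta>K) auto
          finally have "ln p * (real (card (roots p)) * (real R + Kc * root n p) ^ n / p) \<le> 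
             ln p * (real (card (roots p)) * (real R ^ n * (41 / 40)) / p)"
            using g(5) p0 by (intro mult_left_mono divide_right_mono) auto
          also have "\<dots> = real R ^ n * (41 / 40 * (real (card (roots p)) * ln p / p))" by simp
          also have "\<dots> \<le> real R ^ n * (41 / 40 * (real (card (roots p)) * ln p / p) + (1 + Kc * C1) ^ n * (n / (\<eta> * R) ^ n) * ln p)"
            using Kc(1) C1 er g(5) by (intro mult_left_mono) auto
          finally show ?thesis using bound by linarith
        next
          case False
          hence "(\<eta> * R) ^ n \<le> root n (real p) ^ n" using er by (intro power_mono) auto
          hence pe: "(\<eta> * R) ^ n \<le> p" unfolding rpn .
          have "real p \<le> (C1 * R) ^ n" using g(4) Yle by linarith
          hence "root n (real p) \<le> root n ((C1 * R) ^ n)" using n_pos by simp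
          also have "\<dots> = C1 * R" using CR1 n_pos by (intro real_root_power_cancel) auto
          finally have "real R + Kc * root n p \<le> real R * (1 + Kc * C1)"
            using mult_left_mono[of "root n (real p)" "C1 * R" Kc] Kc(1) by (simp add: algebra_simps)
          hence "(real R + Kc * root n p) ^ n \<le> (real R * (1 + Kc * C1)) ^ n" using Kc(1) rp0 by (intro power_mono) auto
          hence "real (card (roots p)) * (real R + Kc * root n p) ^ n / p \<le> n * (real R * (1 + Kc * C1)) ^ n / (\<eta> * R) ^ n"
            using card_roots[OF g(1)] p0 pe er Kc(1) C1 rp0
            by (intro frac_le mult_mono mult_nonneg_nonneg zero_le_power) auto
          hence "ln p * (real (card (roots p)) * (real R + Kc * root n p) ^ n / p) \<le> ln p * (n * (real R * (1 + Kc * C1)) ^ n / (\<eta> * R) ^ n)"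
            using g(5) by (intro mult_left_mono)
          also have "\<dots> = real R ^ n * ((1 + Kc * C1) ^ n * (n / (\<eta> * R) ^ n) * ln p)"
            by (simp add: power_mult_distrib)
          also have "\<dots> \<le> real R ^ n * (41 / 40 * (real (card (roots p)) * ln p / p) + (1 + Kc * C1) ^ n * (n / (\<eta> * R) ^ n) * ln p)"
            using g(5) by (intro mult_left_mono) auto
          finally show ?thesis using bound by linarith
        qed
      qed
      have "(1 - 3 * n * \<delta>) * real R ^ n * (n * ln (\<delta> * R)) \<le> (\<Sum>b\<in>?B. ln \<bar>real_of_int (nrm (aff W b))\<bar>)"
        by (rule average_log_norm[OF W1 \<delta>0 R])
      also have "\<dots> \<le> (\<Sum>b\<in>?B. \<Sum>p\<in>Pr P0 Y. ln p * tc p (aff W b) + L * fc p (aff W b))"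
        by (intro sum_mono each)
      also have "\<dots> = (\<Sum>p\<in>Pr P0 Y. ln p * (\<Sum>b\<in>?B. tc p (aff W b)) + L * (\<Sum>b\<in>?B. fc p (aff W b)))"
        by (subst sum.swap) (simp only: sum.distrib sum_distrib_left)
      also have "\<dots> \<le> (\<Sum>p\<in>Pr P0 Y. real R ^ n * (41 / 40 * (real (card (roots p)) * ln p / p) + (1 + Kc * C1) ^ n * (n / (\<eta> * R) ^ n) * ln p)
          + L * (N1 * (real R ^ n / real p ^ 2 + Kc ^ n)))"
        by (intro sum_mono add_mono t1 mult_left_mono fsum L0)
      also have "\<dots> = real R ^ n * (41 / 40 * Sm P0 Y + (1 + Kc * C1) ^ n * (n / (\<eta> * R) ^ n) * (\<Sum>p\<in>Pr P0 Y. ln (real p)))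
          + L * N1 * (real R ^ n * (\<Sum>p\<in>Pr P0 Y. 1 / real p ^ 2) + Kc ^ n * card (Pr P0 Y))"
        unfolding Sm_def by (rule sum_split_aux) simp
      also have "\<dots> \<le> real R ^ n * (41 / 40 * Sm P0 Y + (1 + Kc * C1) ^ n * (n * (5 * (C1 / \<eta>) ^ n)))
          + real R ^ n * (N1 / P0 * L + N1 * Kc ^ n * (13 * C1 ^ n))"
      proof (rule add_mono)
        have er: "(\<eta> * R) ^ n > 0" using \<eta>0 R1 by simp
        have "(\<Sum>p\<in>Pr P0 Y. ln (real p)) \<le> 5 * (C1 * R) ^ n" using Pr_sum_ln[of P0 Y] Yle by linarith
        hence "n / (\<eta> * R) ^ n * (\<Sum>p\<in>Pr P0 Y. ln (real p)) \<le> n / (\<eta> * R) ^ n * (5 * (C1 * R) ^ n)"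
          using er by (intro mult_left_mono) auto
        also have "\<dots> = n * (5 * (C1 / \<eta>) ^ n)" using R1 \<eta>0 by (simp add: power_mult_distrib power_divide)
        finally have "(1 + Kc * C1) ^ n * (n / (\<eta> * R) ^ n * (\<Sum>p\<in>Pr P0 Y. ln (real p))) \<le> (1 + Kc * C1) ^ n * (n * (5 * (C1 / \<eta>) ^ n))"
          using Kc(1) C1 by (intro mult_left_mono) auto
        thus "real R ^ n * (41 / 40 * Sm P0 Y + (1 + Kc * C1) ^ n * (n / (\<eta> * R) ^ n) * (\<Sum>p\<in>Pr P0 Y. ln (real p))) \<le>
          real R ^ n * (41 / 40 * Sm P0 Y + (1 + Kc * C1) ^ n * (n * (5 * (C1 / \<eta>) ^ n)))"
          by (intro mult_left_mono add_left_mono) (auto simp: mult.assoc)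
        \<comment> \<open>Every ideal costs the constant Kc^n even if its index exceeds the volume
          of the box, and this with weight L. So the number of primes up to Y must be O(Y / ln Y);
          13 is 12 from that estimate plus 1 from L \<le> 1 + ln Y.\<close>
        have cL: "L * card (Pr P0 Y) \<le> 13 * (C1 * R) ^ n"
        proof -
          have cle: "card (Pr P0 Y) \<le> card {p. prime p \<and> p \<le> Y}" by (intro card_mono) (auto simp: Pr_def)
          have cY: "card {p::nat. prime p \<and> p \<le> Y} \<le> Y"
            using card_mono[of "{1..Y}" "{p. prime p \<and> p \<le> Y}"] by (auto simp: Suc_le_eq prime_gt_0_nat subset_iff)
          have "(C1 * R) ^ n \<le> 2 * real Y" unfolding Y_def by (rule le_double_floor[OF CRn])
          hence "L \<le> ln (2 * real Y)" unfolding Lln using CRn Y1 by (subst ln_le_cancel_iff) auto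
          also have "\<dots> = ln 2 + ln (real Y)" using Y1 by (simp add: ln_mult)
          also have "\<dots> \<le> 1 + ln (real Y)" using ln_2_less_1 by simp
          finally have "L * card (Pr P0 Y) \<le> (1 + ln (real Y)) * card {p::nat. prime p \<and> p \<le> Y}"
            using cle Y1 by (intro mult_mono of_nat_mono) auto
          also have "\<dots> \<le> real Y + 12 * real Y" using cY primes_le_count[of Y] by (simp add: algebra_simps)
          finally show ?thesis using Yle by simp
        qed
        have "L * N1 * (real R ^ n * (\<Sum>p\<in>Pr P0 Y. 1 / real p ^ 2)) \<le> L * N1 * (real R ^ n * (1 / P0))"
          using L0 N1 Pr_sum_inverse_squares[OF P0'(1), of Y] by (intro mult_left_mono) auto
        moreover have "N1 * Kc ^ n * (L * card (Pr P0 Y)) \<le> N1 * Kc ^ n * (13 * (C1 * R) ^ n)"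
          using N1 Kc(1) by (intro mult_left_mono cL) auto
        moreover have "L * N1 * (real R ^ n * (1 / P0)) + N1 * Kc ^ n * (13 * (C1 * R) ^ n) = real R ^ n * (N1 / P0 * L + N1 * Kc ^ n * (13 * C1 ^ n))"
          by (simp add: algebra_simps power_mult_distrib)
        moreover have "L * N1 * (real R ^ n * (\<Sum>p\<in>Pr P0 Y. 1 / real p ^ 2) + Kc ^ n * card (Pr P0 Y)) = 
            L * N1 * (real R ^ n * (\<Sum>p\<in>Pr P0 Y. 1 / real p ^ 2)) + N1 * Kc ^ n * (L * card (Pr P0 Y))"
          by (simp add: algebra_simps)
        ultimately show "L * N1 * (real R ^ n * (\<Sum>p\<in>Pr P0 Y. 1 / real p ^ 2) + Kc ^ n * card (Pr P0 Y)) \<le>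
            real R ^ n * (N1 / P0 * L + N1 * Kc ^ n * (13 * C1 ^ n))" by linarith
      qed
      finally have "real R ^ n * ((1 - 3 * n * \<delta>) * (n * ln (\<delta> * R))) \<le> real R ^ n * (41 / 40 * Sm P0 Y + c2 + N1 / P0 * L)"
        unfolding c2_def by (simp add: algebra_simps)
      hence "(1 - 3 * n * \<delta>) * (n * ln (\<delta> * R)) \<le> 41 / 40 * Sm P0 Y + c2 + N1 / P0 * L"
        using Rn0 by (simp only: mult_le_cancel_left_pos)
      thus ?thesis unfolding Y_def L_def .
    qed
    define C where "C = n * (\<bar>ln \<delta>\<bar> + \<bar>ln C1\<bar> + \<bar>ln (2 * C1)\<bar>) + c2"
    define Z0 where "Z0 = nat \<lceil>(C1 * (1 / \<delta> + 1)) ^ n\<rceil> + 1"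
    have "Sm P0 Z \<ge> 9 / 10 * ln (real Z) - C" if Z: "Z \<ge> Z0" for Z
    proof -
      have Z1: "real Z \<ge> (C1 * (1 / \<delta> + 1)) ^ n" "Z \<ge> 1" using Z unfolding Z0_def by linarith+
      define rr where "rr = root n Z"
      have rrn: "rr ^ n = Z" unfolding rr_def using n_pos by simp
      have "root n ((C1 * (1 / \<delta> + 1)) ^ n) \<le> rr" unfolding rr_def using Z1 n_pos by simp
      moreover have "root n ((C1 * (1 / \<delta> + 1)) ^ n) = C1 * (1 / \<delta> + 1)"
        using n_pos C1 \<delta>0 by (intro real_root_power_cancel) auto
      ultimately have rr: "rr \<ge> C1 * (1 / \<delta> + 1)" by simp
      \<comment> \<open>Then (C1 R)^n is at most Z, so that only primes up to Z divide the
        norms.\<close>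
      define R where "R = nat \<lfloor>rr / C1\<rfloor>"
      have q: "rr / C1 \<ge> 1 / \<delta> + 1" using rr C1 by (simp add: pos_le_divide_eq mult.commute)
      have q1: "rr / C1 \<ge> 1" using q \<delta>0 by (smt (verit) zero_le_divide_1_iff)
      have Rlo: "real R \<ge> rr / C1 - 1" unfolding R_def by linarith
      have Rhi: "real R \<le> rr / C1" unfolding R_def using q1 by (intro of_nat_floor) simp
      have Rhalf: "real R \<ge> rr / (2 * C1)" unfolding R_def using le_double_floor[OF q1] by (simp add: mult.commute)
      have R\<delta>: "\<delta> * real R \<ge> 1" 
      proof -
        have "real R \<ge> 1 / \<delta>" using Rlo q by linarith
        thus ?thesis using \<delta>0 by (simp add: field_simps)
      qed
      have R0: "real R > 0" using R\<delta> by (cases "R = 0") auto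
      have rr0: "rr > 0" using R0 Rhi C1 by (smt (verit) divide_nonpos_pos)
      have CRle: "C1 * R \<le> rr" using Rhi C1 by (simp add: pos_le_divide_eq mult.commute)
      have "(C1 * R) ^ n \<le> real Z" unfolding rrn[symmetric] using CRle C1 by (intro power_mono) auto
      hence "nat \<lfloor>(C1 * R) ^ n\<rfloor> \<le> Z" by linarith
      from Sm_mono[OF this] have S: "Sm P0 (nat \<lfloor>(C1 * R) ^ n\<rfloor>) \<le> Sm P0 Z" .
      have lnZ: "ln (real Z) = n * ln rr" unfolding rrn[symmetric] using rr0 by (simp add: ln_realpow)
      have lnR: "ln R \<ge> ln rr - ln (2 * C1)"
      proof -
        have "ln (rr / (2 * C1)) \<le> ln R" using Rhalf R0 rr0 C1 by (subst ln_le_cancel_iff) auto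
        thus ?thesis using rr0 C1 by (simp add: ln_div)
      qed
      have d3: "3 * n * \<delta> = 1 / 40" using n_pos by (simp add: \<delta>_def)
      have lnR0: "ln (C1 * R) \<ge> 0" "ln (\<delta> * R) \<ge> 0"
      proof -
        show "ln (\<delta> * R) \<ge> 0" using R\<delta> by simp
        have "\<delta> \<le> 1" using n_pos by (simp add: \<delta>_def)
        hence "real R \<ge> 1" using R\<delta> mult_right_mono[of \<delta> 1 "real R"] by simp
        hence "C1 * R \<ge> 1" using C1 mult_mono[of 1 C1 1 "real R"] by simp
        thus "ln (C1 * R) \<ge> 0" by simp
      qed
      have "39 / 40 * (n * ln (\<delta> * R)) \<le> 41 / 40 * Sm P0 Z + c2 + N1 / P0 * (n * ln (C1 * R))"
        using key[OF R\<delta>] S unfolding d3 by simp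
      also have "N1 / P0 * (n * ln (C1 * R)) \<le> 1 / 40 * (n * ln (C1 * R))"
        using lnR0 by (intro mult_right_mono P0') auto
      finally have 1: "39 / 40 * (n * ln (\<delta> * R)) \<le> 41 / 40 * Sm P0 Z + c2 + 1 / 40 * (n * ln (C1 * R))" by simp
      have e: "ln (\<delta> * R) = ln \<delta> + ln R" "ln (C1 * R) = ln C1 + ln R" using \<delta>0 R0 C1 by (simp_all add: ln_mult)
      have 2: "38 / 40 * (n * ln R) \<le> 41 / 40 * Sm P0 Z + c2 + 39 / 40 * (n * - ln \<delta>) + 1 / 40 * (n * ln C1)"
        using 1 unfolding e by (simp add: algebra_simps)
      have 3: "n * (ln rr - ln (2 * C1)) \<le> n * ln R" by (intro mult_left_mono lnR) auto
      have 4: "n * - ln \<delta> \<le> n * \<bar>ln \<delta>\<bar>" "n * ln C1 \<le> n * \<bar>ln C1\<bar>" "n * ln (2 * C1) \<le> n * \<bar>ln (2 * C1)\<bar>"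
         by (intro mult_left_mono; simp)+
      have 5: "0 \<le> n * \<bar>ln \<delta>\<bar>" "0 \<le> n * \<bar>ln C1\<bar>" "0 \<le> n * \<bar>ln (2 * C1)\<bar>" by simp_all
      have c20: "c2 \<ge> 0" unfolding c2_def using Kc(1) C1 \<eta>0 N1 by simp
      have lnZ0: "n * ln rr \<ge> 0" unfolding lnZ[symmetric] using Z1 by simp
      have C: "C = n * \<bar>ln \<delta>\<bar> + n * \<bar>ln C1\<bar> + n * \<bar>ln (2 * C1)\<bar> + c2" by (simp add: C_def distrib_left)
      \<comment> \<open>The coefficient of ln Z is (39/40 - 1/40) / (41/40) = 38/41, which is above
        9/10.\<close>
      show ?thesis unfolding lnZ C
        using 2 3[unfolded right_diff_distrib] 4 5 c20 lnZ0 by linarith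
    qed
    thus "\<exists>C Z0. \<forall>Z\<ge>Z0. Sm P0 Z \<ge> 9 / 10 * ln (real Z) - C" by blast
  qed
qed

text \<open>From T to T^(4/3) the sum \<open>Sm\<close> grows by at least (9/10 * 4/3 - 11/10) ln T
  - O(1) = ln T / 10 - O(1), which exceeds 2 n for large T. Each prime in between has at most n
  roots and is larger than T, so the weights ln p add up to at least 2 T.\<close>

lemma many_primes_with_root:
  obtains T0 :: real where "T0 \<ge> 1" 
    "\<And>T. T \<ge> T0 \<Longrightarrow> \<exists>S. finite S \<and> (\<forall>p\<in>S. good p \<and> roots p \<noteq> {} \<and> p > P \<and> T < p \<and> real p \<le> T powr (4/3)) 
       \<and> (\<Sum>p\<in>S. ln (real p)) \<ge> 2 * T"
proof -
  obtain D where D: "D > 0" "\<And>p. prime p \<Longrightarrow> p > D \<Longrightarrow> good p" by (rule good_eventually) blast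
  obtain Pu where Pu: "\<And>P0. P0 \<ge> Pu \<Longrightarrow> \<exists>C. \<forall>Z\<ge>1. Sm P0 Z \<le> 11 / 10 * ln Z + C" by (rule mertens_upper) blast
  obtain Pl where Pl: "\<And>P0. P0 \<ge> Pl \<Longrightarrow> \<exists>C Z0. \<forall>Z\<ge>Z0. Sm P0 Z \<ge> 9 / 10 * ln (real Z) - C" by (rule mertens_lower) blast
  define P0 where "P0 = Pu + Pl + P + D"
  obtain Cu where Cu: "\<And>Z. Z \<ge> 1 \<Longrightarrow> Sm P0 Z \<le> 11 / 10 * ln Z + Cu" using Pu[of P0] by (auto simp: P0_def)
  obtain Cl Z0 where Cl: "\<And>Z. Z \<ge> Z0 \<Longrightarrow> Sm P0 Z \<ge> 9 / 10 * ln (real Z) - Cl" using Pl[of P0] by (auto simp: P0_def)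
  define c where "c = \<bar>Cu\<bar> + \<bar>Cl\<bar> + 1"
  \<comment> \<open>The exponential makes ln T / 10 at least 2 n + c; the other entry brings the
    upper end of the interval into the range of the lower bound.\<close>
  define T0 where "T0 = max (real Z0 + 1) (exp (10 * (2 * n + c)))"
  show ?thesis
  proof
    show "T0 \<ge> 1" by (simp add: T0_def)
    fix T assume T: "T \<ge> T0"
    have T1: "T \<ge> 1" "T > 0" using T by (auto simp: T0_def)
    have lnT: "ln T \<ge> 10 * (2 * n + c)"
    proof -
      have "exp (10 * (2 * n + c)) \<le> T" using T by (simp add: T0_def)
      thus ?thesis using T1 by (simp add: ln_ge_iff)
    qed
    have TA: "T \<le> T powr (4/3)" using T1 powr_mono[of 1 "4/3" T] by simp
    define Zl where "Zl = nat \<lfloor>T\<rfloor>"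
    define Zh where "Zh = nat \<lfloor>T powr (4/3)\<rfloor>"
    have Zl: "real Zl \<le> T" "T < real Zl + 1" "Zl \<ge> 1" using T1 unfolding Zl_def by linarith+
    have A1: "T powr (4/3) \<ge> 1" using TA T1 by linarith
    have Zh: "real Zh \<le> T powr (4/3)" "T powr (4/3) \<le> 2 * real Zh"
      unfolding Zh_def by (rule of_nat_floor; use A1 in linarith) (rule le_double_floor[OF A1])
    have ZZ: "Zl \<le> Zh" unfolding Zl_def Zh_def using TA by (intro nat_mono floor_mono)
    have "real Z0 + 1 \<le> T" using T by (simp add: T0_def)
    hence "Z0 \<le> Zl" using Zl(2) by linarith
    hence Z0: "Z0 \<le> Zh" using ZZ by simp
    have Zh0: "real Zh > 0" using ZZ Zl(3) by simp
    have "ln (T powr (4/3)) \<le> ln (2 * real Zh)" using Zh A1 Zh0 by (subst ln_le_cancel_iff) auto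
    also have "\<dots> = ln 2 + ln (real Zh)" using Zh0 by (simp add: ln_mult)
    also have "\<dots> \<le> 1 + ln (real Zh)" using ln_2_less_1 by simp
    finally have lnZh: "4 / 3 * ln T \<le> 1 + ln (real Zh)" using T1 by (simp add: ln_powr)
    have lnZl: "ln (real Zl) \<le> ln T" using Zl T1 by (subst ln_le_cancel_iff) auto
    define S where "S = {p\<in>Pr P0 Zh - Pr P0 Zl. roots p \<noteq> {}}"
    have S: "good p \<and> roots p \<noteq> {} \<and> p > P \<and> T < p \<and> real p \<le> T powr (4/3)" if "p \<in> S" for p
    proof -
      have p: "prime p" "p > P0" "p \<le> Zh" "p > Zl" "roots p \<noteq> {}" using that unfolding S_def Pr_def by auto
      have "real p \<ge> real Zl + 1" using p(4) by linarith
      hence "T < p" using Zl(2) by linarith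
      moreover have "real p \<le> T powr (4/3)" using p(3) Zh(1) by linarith
      moreover have "good p" by (rule D(2)) (use p in \<open>auto simp: P0_def\<close>)
      ultimately show ?thesis using p by (simp add: P0_def)
    qed
    have sub: "Pr P0 Zl \<subseteq> Pr P0 Zh" using ZZ by (auto simp: Pr_def)
    have "2 * real n \<le> Sm P0 Zh - Sm P0 Zl"
    proof -
      have "9 / 10 * ln (real Zh) - Cl \<le> Sm P0 Zh" by (rule Cl[OF Z0])
      moreover have "Sm P0 Zl \<le> 11 / 10 * ln (real Zl) + Cu" by (rule Cu[OF Zl(3)])
      moreover have "\<bar>Cu\<bar> \<ge> Cu" "\<bar>Cl\<bar> \<ge> Cl" by simp_all
      ultimately show ?thesis using lnT lnZh lnZl unfolding c_def by (simp add: algebra_simps)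
    qed
    also have "Sm P0 Zh - Sm P0 Zl = (\<Sum>p\<in>Pr P0 Zh - Pr P0 Zl. real (card (roots p)) * ln p / p)"
      unfolding Sm_def by (rule sum_diff[OF finite_Pr sub, symmetric])
    also have "\<dots> = (\<Sum>p\<in>S. real (card (roots p)) * ln p / p)"
      unfolding S_def by (rule sum.mono_neutral_right) auto
    also have "\<dots> \<le> (\<Sum>p\<in>S. n * ln p / T)"
    proof (rule sum_mono)
      fix p assume "p \<in> S"
      from S[OF this] have p: "prime p" "T < p" by (auto simp: good_def)
      have "ln (real p) \<ge> 0" using p T1 by (intro ln_ge_zero) linarith
      thus "real (card (roots p)) * ln p / p \<le> n * ln p / T"
        using card_roots[OF p(1)] p(2) T1 by (intro frac_le mult_right_mono mult_nonneg_nonneg) auto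
    qed
    also have "\<dots> = (\<Sum>p\<in>S. ln (real p)) * (n / T)" by (simp add: sum_distrib_right sum_distrib_left mult.commute)
    finally have "2 * real n * T \<le> (\<Sum>p\<in>S. ln (real p)) * n" using T1 by (simp add: pos_le_divide_eq)
    hence "2 * T \<le> (\<Sum>p\<in>S. ln (real p))" using n_pos by (simp add: mult.commute mult.left_commute)
    moreover have "finite S" unfolding S_def by simp
    ultimately show "\<exists>S. finite S \<and> (\<forall>p\<in>S. good p \<and> roots p \<noteq> {} \<and> p > P \<and> T < p \<and> real p \<le> T powr (4/3)) 
       \<and> (\<Sum>p\<in>S. ln (real p)) \<ge> 2 * T" using S by blast
  qed
qed

end

section \<open>Plane curves\<close>

lemma homogeneous_system:
  fixes v :: "'z \<Rightarrow> 'i \<Rightarrow> 'a::field"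
  assumes "finite Z" "finite I" "card Z < card I"
  shows "\<exists>c. (\<exists>i\<in>I. c i \<noteq> 0) \<and> (\<forall>z\<in>Z. (\<Sum>i\<in>I. c i * v z i) = 0)"
  using assms
proof (induction Z arbitrary: I v rule: finite_induct)
  case empty
  hence "I \<noteq> {}" by auto
  thus ?case by (intro exI[of _ "\<lambda>_. 1"]) auto
next
  case (insert z Z)
  show ?case
  proof (cases "\<forall>i\<in>I. v z i = 0")
    case True
    obtain c where "\<exists>i\<in>I. c i \<noteq> 0" "\<forall>z\<in>Z. (\<Sum>i\<in>I. c i * v z i) = 0"
      using insert.IH[of I v] insert.prems insert.hyps by auto
    thus ?thesis using True by (intro exI[of _ c]) simp
  next
    case False
    then obtain j where j: "j \<in> I" "v z j \<noteq> 0" by blast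
    define I' where "I' = I - {j}"
    have fin: "finite I'" and cI: "card Z < card I'" and jI: "j \<notin> I'" 
      using insert.prems insert.hyps j by (auto simp: I'_def)
    obtain c where c: "\<exists>i\<in>I'. c i \<noteq> 0" "\<forall>w\<in>Z. (\<Sum>i\<in>I'. c i * (v w i - v w j / v z j * v z i)) = 0"
      using insert.IH[of I' "\<lambda>w i. v w i - v w j / v z j * v z i"] fin cI by blast
    define s where "s = (\<Sum>i\<in>I'. c i * v z i)"
    define c' where "c' i = (if i = j then - s / v z j else c i)" for i
    have sum: "(\<Sum>i\<in>I. c' i * v w i) = - s / v z j * v w j + (\<Sum>i\<in>I'. c i * v w i)" for w
    proof -
      have "(\<Sum>i\<in>I. c' i * v w i) = c' j * v w j + (\<Sum>i\<in>I'. c' i * v w i)"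
        unfolding I'_def using insert.prems j by (intro sum.remove) auto
      also have "(\<Sum>i\<in>I'. c' i * v w i) = (\<Sum>i\<in>I'. c i * v w i)" using jI by (intro sum.cong) (auto simp: c'_def)
      finally show ?thesis by (simp add: c'_def)
    qed
    have "(\<Sum>i\<in>I. c' i * v w i) = 0" if "w \<in> insert z Z" for w
    proof (cases "w = z")
      case True thus ?thesis unfolding sum using j by (simp add: s_def)
    next
      case False
      hence "(\<Sum>i\<in>I'. c i * (v w i - v w j / v z j * v z i)) = 0" using c(2) that by blast
      moreover have "(\<Sum>i\<in>I'. c i * (v w i - v w j / v z j * v z i)) = (\<Sum>i\<in>I'. c i * v w i) - v w j / v z j * s"
        unfolding s_def by (simp add: right_diff_distrib sum_subtractf sum_distrib_left mult.left_commute)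
      ultimately show ?thesis unfolding sum by simp
    qed
    moreover have "\<exists>i\<in>I. c' i \<noteq> 0"
    proof -
      obtain i where "i \<in> I'" "c i \<noteq> 0" using c(1) by blast
      hence "i \<in> I" "c' i \<noteq> 0" using jI by (auto simp: c'_def I'_def)
      thus ?thesis by blast
    qed
    ultimately show ?thesis by blast
  qed
qed

text \<open>The equations \<open>v z\<close> in a minimal equivalent subsystem are linearly independent and lie in the
  hyperplane orthogonal to a given solution.\<close>

lemma small_equivalent_subsystem:
  fixes v :: "'z \<Rightarrow> 'i \<Rightarrow> 'a::field"
  assumes Z: "finite Z" and I: "finite I" and c0: "k \<in> I" "c0 k \<noteq> 0" "\<And>z. z \<in> Z \<Longrightarrow> (\<Sum>i\<in>I. c0 i * v z i) = 0"
  obtains Z' where "Z' \<subseteq> Z" "card Z' < card I" 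
    "\<forall>c. (\<forall>z\<in>Z'. (\<Sum>i\<in>I. c i * v z i) = 0) \<longrightarrow> (\<forall>z\<in>Z. (\<Sum>i\<in>I. c i * v z i) = 0)"
proof -
  define P where "P Z' \<longleftrightarrow> Z' \<subseteq> Z \<and> (\<forall>c. (\<forall>z\<in>Z'. (\<Sum>i\<in>I. c i * v z i) = 0) \<longrightarrow> (\<forall>z\<in>Z. (\<Sum>i\<in>I. c i * v z i) = 0))" for Z'
  have "P Z" by (simp add: P_def)
  then obtain Z' where PZ': "P Z'" and least: "\<And>Y. P Y \<Longrightarrow> card Z' \<le> card Y"
    using ex_has_least_nat[of P Z card] by blast
  have Z': "Z' \<subseteq> Z" "\<And>c. \<forall>z\<in>Z'. (\<Sum>i\<in>I. c i * v z i) = 0 \<Longrightarrow> \<forall>z\<in>Z. (\<Sum>i\<in>I. c i * v z i) = 0"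
    using PZ' by (simp_all add: P_def)
  have fin: "finite Z'" by (rule finite_subset[OF Z'(1) Z])
  have "card Z' < card I"
  proof (rule ccontr)
    assume "\<not> card Z' < card I"
    \<comment> \<open>Outside the coordinate k there are fewer coordinates than equations, so some
      combination of the equations vanishes there. The solution \<open>c0\<close>, whose entry at k
      is nonzero, forces it to vanish at k too, so one equation is redundant.\<close>
    hence "card (I - {k}) < card Z'" using card_Diff1_less[OF I c0(1)] by linarith
    from homogeneous_system[OF _ fin this, of "\<lambda>i z. v z i"] I obtain l where
      l: "\<exists>z\<in>Z'. l z \<noteq> 0" "\<forall>i\<in>I - {k}. (\<Sum>z\<in>Z'. l z * v z i) = 0" by auto
    have "0 = (\<Sum>z\<in>Z'. l z * (\<Sum>i\<in>I. c0 i * v z i))" using c0(3) Z'(1) by (intro sum.neutral[symmetric]) auto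
    also have "\<dots> = (\<Sum>i\<in>I. c0 i * (\<Sum>z\<in>Z'. l z * v z i))"
      unfolding sum_distrib_left by (subst sum.swap) (simp add: mult.left_commute)
    also have "\<dots> = c0 k * (\<Sum>z\<in>Z'. l z * v z k) + (\<Sum>i\<in>I - {k}. c0 i * (\<Sum>z\<in>Z'. l z * v z i))"
      by (rule sum.remove[OF I c0(1)])
    also have "(\<Sum>i\<in>I - {k}. c0 i * (\<Sum>z\<in>Z'. l z * v z i)) = 0" using l(2) by (intro sum.neutral) auto
    finally have "(\<Sum>z\<in>Z'. l z * v z k) = 0" using c0(2) by simp
    hence l': "(\<Sum>z\<in>Z'. l z * v z i) = 0" if "i \<in> I" for i using l(2) that by (cases "i = k") auto
    obtain z where z: "z \<in> Z'" "l z \<noteq> 0" using l(1) by blast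
    have "P (Z' - {z})" unfolding P_def
    proof (intro conjI allI impI)
      show "Z' - {z} \<subseteq> Z" using Z'(1) by blast
      fix c assume c: "\<forall>y\<in>Z' - {z}. (\<Sum>i\<in>I. c i * v y i) = 0"
      have "0 = (\<Sum>i\<in>I. c i * (\<Sum>z\<in>Z'. l z * v z i))" using l' by (intro sum.neutral[symmetric]) auto
      also have "\<dots> = (\<Sum>z\<in>Z'. l z * (\<Sum>i\<in>I. c i * v z i))"
        unfolding sum_distrib_left by (subst sum.swap) (simp add: mult.left_commute)
      also have "\<dots> = l z * (\<Sum>i\<in>I. c i * v z i) + (\<Sum>z\<in>Z' - {z}. l z * (\<Sum>i\<in>I. c i * v z i))"
        by (rule sum.remove[OF fin z(1)])
      also have "(\<Sum>z\<in>Z' - {z}. l z * (\<Sum>i\<in>I. c i * v z i)) = 0" using c by (intro sum.neutral) auto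
      finally have "(\<Sum>i\<in>I. c i * v z i) = 0" using z(2) by simp
      hence "\<forall>y\<in>Z'. (\<Sum>i\<in>I. c i * v y i) = 0" using c by blast
      thus "\<forall>z\<in>Z. (\<Sum>i\<in>I. c i * v z i) = 0" by (rule Z'(2))
    qed
    from least[OF this] show False using card_Diff1_less[OF fin z(1)] by simp
  qed
  with PZ' show ?thesis unfolding P_def by (intro that[of Z']) auto
qed

section \<open>Gauss's lemma and elimination in two variables\<close>

lemma ex_irreducible_factor:
  fixes c :: "'a::field poly"
  assumes "degree c > 0"
  obtains q c' where "irreducible q" "c = q * c'" "degree c' < degree c"
proof -
  let ?P = "\<lambda>q. q dvd c \<and> degree q > 0"
  have "?P c" using assms by simp
  then obtain q where q: "?P q" "\<And>r. ?P r \<Longrightarrow> degree q \<le> degree r"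
    using ex_has_least_nat[of ?P c degree] by auto
  obtain c' where c': "c = q * c'" using q(1) by blast
  have c0: "c \<noteq> 0" using assms by auto
  hence nz: "q \<noteq> 0" "c' \<noteq> 0" using c' by auto
  have "irreducible q"
  proof (rule Factorial_Ring.irreducibleI)
    show "q \<noteq> 0" by (rule nz)
    show "\<not> q dvd 1" using q(1) by (auto simp: is_unit_iff_degree nz)
    fix a b assume ab: "q = a * b"
    hence ab0: "a \<noteq> 0" "b \<noteq> 0" using nz by auto
    have d: "degree q = degree a + degree b" unfolding ab by (rule degree_mult_eq[OF ab0])
    show "a dvd 1 \<or> b dvd 1"
    proof (cases "degree a = 0")
      case True thus ?thesis using ab0 by (simp add: is_unit_iff_degree)
    next
      case False
      have "a dvd q" unfolding ab by simp
      hence "a dvd c" using q(1) dvd_trans by blast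
      hence "degree b = 0" using q(2)[of a] False d by simp
      thus ?thesis using ab0 by (simp add: is_unit_iff_degree)
    qed
  qed
  moreover have "degree c' < degree c" unfolding c' using degree_mult_eq[OF nz] q(1) by simp
  ultimately show ?thesis using c' that by blast
qed

lemma smult_left_cancel: "q \<noteq> 0 \<Longrightarrow> smult q A = smult q B \<Longrightarrow> A = B" for q :: "'a::idom"
proof -
  assume "q \<noteq> 0" "smult q A = smult q B"
  hence "smult q (A - B) = 0" "q \<noteq> 0" by (simp_all add: smult_diff_right)
  thus "A = B" by simp
qed

text \<open>An irreducible factor of c remains prime in K[X1][X2], so it divides Q or P and can be
  cancelled without changing degrees in X2. Once c is constant, F itself has a factor of the degree
  of P.\<close>

lemma gauss_descent:
  fixes F :: "'a::field poly poly"
  assumes "smult c F = Q * P" "c \<noteq> 0" "lead_coeff F = 1"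
  shows "\<exists>Q1 P1. F = Q1 * P1 \<and> degree P1 = degree P"
  using assms
proof (induction "degree c" arbitrary: c Q P rule: less_induct)
  case less
  show ?case
  proof (cases "degree c = 0")
    case True
    then obtain a where a: "c = [:a:]" "a \<noteq> 0" using less.prems(2) by (auto elim: degree_eq_zeroE)
    have "F = smult [:inverse a:] (smult c F)" using a by (simp flip: one_pCons)
    also have "\<dots> = smult [:inverse a:] Q * P" unfolding less.prems(1) by simp
    finally show ?thesis by blast
  next
    case False
    then obtain q c' where q: "irreducible q" "c = q * c'" "degree c' < degree c"
      using ex_irreducible_factor[of c] False by blast
    have q0: "q \<noteq> 0" "c' \<noteq> 0" using q less.prems(2) by auto
    have "prime_elem [:q:]" using q(1) by (simp add: prime_elem_const_poly_iff field_poly_irreducible_imp_prime)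
    moreover have "[:q:] dvd Q * P" unfolding less.prems(1)[symmetric] q(2) smult_smult[symmetric] by (rule dvdI[of _ _ "smult c' F"]) (simp add: mult.commute)
    ultimately consider "[:q:] dvd Q" | "[:q:] dvd P" by (auto simp: prime_elem_dvd_mult_iff)
    thus ?thesis
    proof cases
      case 1
      then obtain Q' where Q': "Q = [:q:] * Q'" by blast
      have "smult q (smult c' F) = smult q (Q' * P)" using less.prems(1) by (simp add: q(2) Q')
      hence "smult c' F = Q' * P" by (rule smult_left_cancel[OF q0(1)])
      from less.hyps[OF q(3) this q0(2) less.prems(3)] show ?thesis .
    next
      case 2
      then obtain P' where P': "P = [:q:] * P'" by blast
      have "smult q (smult c' F) = smult q (Q * P')" using less.prems(1) by (simp add: q(2) P')
      hence e: "smult c' F = Q * P'" by (rule smult_left_cancel[OF q0(1)])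
      have "degree P = degree P'" unfolding P' using q0 by simp
      with less.hyps[OF q(3) e q0(2) less.prems(3)] show ?thesis by simp
    qed
  qed
qed

text \<open>Division by the monic F leaves a remainder with coefficients in K[X1]. Its product with
  r is divisible by F but of smaller degree in X2, hence zero.\<close>

lemma monic_dvd_smult:
  fixes F :: "'a::field poly poly"
  assumes "lead_coeff F = 1" "F dvd smult r G" "r \<noteq> 0"
  shows "F dvd G"
proof -
  have F0: "F \<noteq> 0" using assms(1) by auto
  obtain q s where qs: "pseudo_divmod G F = (q, s)" by fastforce
  have G: "G = F * q + s" using pseudo_divmod(1)[OF F0 qs] assms(1) by simp
  have s: "s = 0 \<or> degree s < degree F" by (rule pseudo_divmod(2)[OF F0 qs])
  have "F dvd smult r G - F * smult r q" using assms(2) by (intro dvd_diff dvd_triv_left)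
  moreover have "smult r G - F * smult r q = smult r s" by (simp add: G smult_add_right)
  ultimately have "F dvd smult r s" by simp
  hence "smult r s = 0"
  proof -
    assume d: "F dvd smult r s"
    have "degree (smult r s) < degree F \<or> s = 0" using s assms(3) by auto
    thus "smult r s = 0" using dvd_imp_degree_le[OF d] by (cases "s = 0") (use assms(3) in auto)
  qed
  thus ?thesis using G assms(3) by simp
qed

text \<open>An element of least X2-degree in the ideal (F, G) divides F and G up to factors from
  K[X1]. If its degree were positive, Gauss's lemma and irreducibility would make it equal to F up
  to such factors, and F would divide G. So it is a nonzero polynomial in X1 alone and does the work
  of the resultant.\<close>

lemma ex_resultant:
  fixes F G :: "'a::field poly poly"
  assumes F: "irreducible F" "lead_coeff F = 1" and G: "\<not> F dvd G"
  obtains r u v where "r \<noteq> 0" "[:r:] = u * F + v * G"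
proof -
  define J where "J = {u * F + v * G | u v. True}"
  have Jmult: "a * x \<in> J" if xJ: "x \<in> J" for a x
  proof -
    obtain u v where "x = u * F + v * G" using xJ unfolding J_def by blast
    hence "a * x = (a * u) * F + (a * v) * G" by (simp add: algebra_simps)
    thus ?thesis unfolding J_def by blast
  qed
  have Jdiff: "x - y \<in> J" if xJ: "x \<in> J" "y \<in> J" for x y
  proof -
    obtain u v u' v' where "x = u * F + v * G" "y = u' * F + v' * G" using xJ unfolding J_def by blast
    hence "x - y = (u - u') * F + (v - v') * G" by (simp add: algebra_simps)
    thus ?thesis unfolding J_def by blast
  qed
  have "F = 1 * F + 0 * G" "G = 0 * F + 1 * G" by simp_all
  hence FJ: "F \<in> J" "G \<in> J" unfolding J_def by blast+
  let ?P = "\<lambda>p. p \<in> J \<and> p \<noteq> 0"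
  have "?P F" using FJ F(2) by auto
  then obtain P where P: "?P P" "\<And>p. ?P p \<Longrightarrow> degree P \<le> degree p"
    using ex_has_least_nat[of ?P F degree] by auto
  have div: "\<exists>c Q. c \<noteq> 0 \<and> smult c x = Q * P" if x: "x \<in> J" for x
  proof -
    obtain q s where qs: "pseudo_divmod x P = (q, s)" by fastforce
    define c where "c = lead_coeff P ^ (Suc (degree x) - degree P)"
    have e: "smult c x = P * q + s" using pseudo_divmod(1)[of P, OF _ qs] P(1) by (simp add: c_def)
    have sx: "s = [:c:] * x - q * P" using e by (simp add: mult.commute)
    have sJ: "s \<in> J" unfolding sx by (intro Jdiff Jmult x conjunct1[OF P(1)])
    have "s = 0 \<or> degree s < degree P" using pseudo_divmod(2)[of P, OF _ qs] P(1) by simp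
    hence "s = 0" using P(2)[of s] sJ leD by blast
    thus ?thesis using e P(1) by (intro exI[of _ c] exI[of _ q]) (simp add: c_def mult.commute)
  qed
  have "degree P = 0"
  proof (rule ccontr)
    assume dP: "degree P \<noteq> 0"
    obtain c Q where cQ: "c \<noteq> 0" "smult c F = Q * P" using div[OF FJ(1)] by blast
    obtain Q1 P1 where QP: "F = Q1 * P1" "degree P1 = degree P" using gauss_descent[OF cQ(2,1) F(2)] by blast
    have F0: "F \<noteq> 0" using F(2) by auto
    have nz: "Q1 \<noteq> 0" "P1 \<noteq> 0" using QP F0 by auto
    have "\<not> P1 dvd 1"
    proof
      assume "P1 dvd 1"
      hence "degree P1 \<le> degree (1 :: 'a poly poly)" by (rule dvd_imp_degree_le) simp
      thus False using dP QP(2) by simp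
    qed
    hence "Q1 dvd 1" using Factorial_Ring.irreducibleD[OF F(1) QP(1)] by blast
    hence dQ1: "degree Q1 = 0" using dvd_imp_degree_le[of Q1 1] by simp
    hence dF: "degree F = degree P" using QP degree_mult_eq[OF nz] by simp
    have "degree Q + degree P = degree (smult c F)" unfolding cQ(2) using cQ P(1) F0 by (subst degree_mult_eq) auto
    hence "degree Q = 0" using dF cQ(1) by simp
    then obtain t where t: "Q = [:t:]" by (rule degree_eq_zeroE)
    have t0: "t \<noteq> 0" using cQ F0 t by auto
    obtain c' Q' where cQ': "c' \<noteq> 0" "smult c' G = Q' * P" using div[OF FJ(2)] by blast
    have "smult (t * c') G = Q' * smult t P" using cQ'(2) by (simp add: smult_smult[symmetric] del: smult_smult)
    also have "smult t P = smult c F" using cQ(2) t by simp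
    also have "Q' * smult c F = smult c Q' * F" by simp
    finally have "F dvd smult (t * c') G" by (simp only: dvd_triv_right)
    hence "F dvd G" by (rule monic_dvd_smult[OF F(2)]) (use t0 cQ' in simp)
    thus False using G by simp
  qed
  then obtain r where r: "P = [:r:]" by (rule degree_eq_zeroE)
  thus ?thesis using P(1) that[of r] unfolding J_def by auto
qed

lemma dvd_mult_irreducible:
  fixes F G :: "'a::field poly poly"
  assumes F: "irreducible F" "lead_coeff F = 1" and G: "\<not> F dvd G" and B: "F dvd B * G"
  shows "F dvd B"
proof -
  obtain r u v where r: "r \<noteq> 0" "[:r:] = u * F + v * G" by (rule ex_resultant[OF F G])
  have "smult r B = [:r:] * B" by simp
  also have "\<dots> = F * (u * B) + (B * G) * v" unfolding r(2) by (simp add: algebra_simps)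
  also have "F dvd \<dots>" using B by simp
  finally show ?thesis by (rule monic_dvd_smult[OF F(2) _ r(1)])
qed

section \<open>Coefficients, leading monomials and numbers of monomials\<close>

definition cf :: "'a::zero poly poly \<Rightarrow> nat \<Rightarrow> nat \<Rightarrow> 'a" where "cf F i j = coeff (coeff F j) i"

definition mkp :: "(nat \<times> nat) set \<Rightarrow> (nat \<times> nat \<Rightarrow> 'a::comm_ring_1) \<Rightarrow> 'a poly poly" where
  "mkp I c = (\<Sum>(i,j)\<in>I. monom (monom (c (i,j)) i) j)"

definition tri :: "nat \<Rightarrow> (nat \<times> nat) set" where "tri m = {(i,j). i + j \<le> m}"

lemma cf_simps [simp]: "cf 0 i j = 0" "cf (F + G) i j = cf F i j + cf G i j" for F G :: "'a::comm_ring_1 poly poly"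
  by (simp_all add: cf_def)

lemma cf_sum: "cf (sum f A) i j = (\<Sum>a\<in>A. cf (f a) i j)"
  for f :: "'b \<Rightarrow> 'a::comm_ring_1 poly poly"
  by (simp add: cf_def coeff_sum)

lemma cf_monom: "cf (monom (monom c k) l) i j = (if i = k \<and> j = l then c else 0)"
  by (auto simp: cf_def)

lemma cf_eqI: "(\<And>i j. cf F i j = cf G i j) \<Longrightarrow> F = G"
  by (simp add: cf_def poly_eq_iff)

lemma cf_mkp: "finite I \<Longrightarrow> cf (mkp I c) i j = (if (i,j) \<in> I then c (i,j) else 0)"
proof -
  assume I: "finite I"
  have "cf (mkp I c) i j = (\<Sum>x\<in>I. if x = (i,j) then c x else 0)"
    unfolding mkp_def cf_sum by (intro sum.cong) (auto simp: cf_monom split: if_splits)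
  thus ?thesis using I by simp
qed

lemma eval2_simps [simp]:
  "eval2 (F + G) x y = eval2 F x y + eval2 G x y" "eval2 (F - G) x y = eval2 F x y - eval2 G x y"
  "eval2 (F * G) x y = eval2 F x y * eval2 G x y" "eval2 0 x y = 0" "eval2 [:r:] x y = poly r x"
  by (simp_all add: eval2_def)

lemma eval2_sum: "eval2 (sum f A) x y = (\<Sum>a\<in>A. eval2 (f a) x y)"
  by (simp add: eval2_def poly_sum)

lemma eval2_monom: "eval2 (monom (monom c i) j) x y = c * x ^ i * y ^ j"
  by (simp add: eval2_def poly_monom poly_power)

lemma eval2_mkp: "eval2 (mkp I c) x y = (\<Sum>(i,j)\<in>I. c (i,j) * (x ^ i * y ^ j))"
  unfolding mkp_def eval2_sum by (intro sum.cong) (auto simp: eval2_monom mult.assoc)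

lemma finite_tri [simp]: "finite (tri m)"
  by (rule finite_subset[of _ "{..m} \<times> {..m}"]) (auto simp: tri_def)

lemma mkp_cf:
  assumes "\<And>i j. cf F i j \<noteq> 0 \<Longrightarrow> (i,j) \<in> I" "finite I"
  shows "F = mkp I (\<lambda>(i,j). cf F i j)"
  by (rule cf_eqI) (use assms in \<open>auto simp: cf_mkp\<close>)

lemma tri_Suc: "tri (Suc m) = tri m \<union> (\<lambda>i. (i, Suc m - i)) ` {..Suc m}"
  by (auto simp: tri_def image_iff)

lemma tri_Suc_disjoint: "tri m \<inter> (\<lambda>i. (i, Suc m - i)) ` {..Suc m} = {}"
  by (auto simp: tri_def)

lemma inj_diag: "inj_on (\<lambda>i. (i, m - i)) A" by (auto simp: inj_on_def)

lemma card_tri: "2 * real (card (tri m)) = (real m + 1) * (real m + 2)"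
proof (induction m)
  case 0 
  have "tri 0 = {(0,0)}" by (auto simp: tri_def)
  thus ?case by simp
next
  case (Suc m)
  have "card (tri (Suc m)) = card (tri m) + (m + 2)"
    unfolding tri_Suc by (subst card_Un_disjoint[OF _ _ tri_Suc_disjoint]) (auto simp: card_image[OF inj_diag])
  hence "real (card (tri (Suc m))) = real (card (tri m)) + (real m + 2)" by simp
  hence "2 * real (card (tri (Suc m))) = 2 * real (card (tri m)) + 2 * (real m + 2)" by (simp only: distrib_left)
  thus ?case unfolding Suc by (simp add: algebra_simps)
qed

lemma sum_tri: "3 * (\<Sum>(i,j)\<in>tri m. real (i + j)) = real m * (real m + 1) * (real m + 2)"
proof (induction m)
  case 0 
  have "tri 0 = {(0,0)}" by (auto simp: tri_def)
  thus ?case by simp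
next
  case (Suc m)
  have "(\<Sum>(i,j)\<in>(\<lambda>i. (i, Suc m - i)) ` {..Suc m}. real (i + j)) = (\<Sum>i\<le>Suc m. real (Suc m))"
    by (subst sum.reindex[OF inj_diag]) (auto intro!: sum.cong simp: of_nat_diff)
  hence "(\<Sum>(i,j)\<in>tri (Suc m). real (i + j)) = (\<Sum>(i,j)\<in>tri m. real (i + j)) + (real m + 2) * (real m + 1)"
    unfolding tri_Suc by (subst sum.union_disjoint[OF _ _ tri_Suc_disjoint]) (auto simp: algebra_simps)
  hence "3 * (\<Sum>(i,j)\<in>tri (Suc m). real (i + j)) = 3 * (\<Sum>(i,j)\<in>tri m. real (i + j)) + 3 * ((real m + 2) * (real m + 1))"
    by (simp only: distrib_left)
  thus ?case unfolding Suc by (simp add: algebra_simps)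
qed

text \<open>\<open>(a, b)\<close> is the exponent of the leading monomial for the graded order with \<open>X\<^sub>1 > X\<^sub>2\<close>.\<close>

definition is_lm :: "'a::zero poly poly \<Rightarrow> nat \<Rightarrow> nat \<Rightarrow> bool" where
  "is_lm F a b \<longleftrightarrow> cf F a b \<noteq> 0 \<and> (\<forall>i j. cf F i j \<noteq> 0 \<longrightarrow> i + j < a + b \<or> (i + j = a + b \<and> i \<le> a))"

lemma finite_support: "finite {(i,j). cf F i j \<noteq> 0}"
proof (rule finite_subset)
  show "{(i,j). cf F i j \<noteq> 0} \<subseteq> (\<lambda>(j,i). (i,j)) ` (SIGMA j:{..degree F}. {..degree (coeff F j)})"
  proof safe
    fix i j assume "cf F i j \<noteq> 0"
    hence "i \<le> degree (coeff F j)" "coeff F j \<noteq> 0" by (auto simp: cf_def le_degree)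
    moreover hence "j \<le> degree F" by (simp add: le_degree)
    ultimately show "(i,j) \<in> (\<lambda>(j,i). (i,j)) ` (SIGMA j:{..degree F}. {..degree (coeff F j)})"
      by (intro rev_image_eqI[of "(j,i)"]) auto
  qed
qed auto

lemma total_degree_ge: "cf F i j \<noteq> 0 \<Longrightarrow> i + j \<le> total_degree F"
  and total_degree_attained: "F \<noteq> 0 \<Longrightarrow> \<exists>i j. cf F i j \<noteq> 0 \<and> i + j = total_degree F"
proof -
  let ?S = "{i + j | i j. coeff (coeff F j) i \<noteq> 0}"
  have S: "?S = (\<lambda>(i,j). i + j) ` {(i,j). cf F i j \<noteq> 0}" by (auto simp: cf_def)
  have fin: "finite ?S" unfolding S by (intro finite_imageI finite_support)
  show "cf F i j \<noteq> 0 \<Longrightarrow> i + j \<le> total_degree F"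
    unfolding total_degree_def using fin by (intro Max_ge) (auto simp: cf_def)
  assume "F \<noteq> 0"
  hence "\<exists>i j. cf F i j \<noteq> 0" using cf_eqI[of F 0] by auto
  hence ne: "?S \<noteq> {}" by (auto simp: cf_def)
  have "total_degree F = max 0 (Max ?S)" unfolding total_degree_def by (rule Max_insert[OF fin ne])
  hence "total_degree F \<in> ?S" using Max_in[OF fin ne] by simp
  then obtain i j where "total_degree F = i + j" "coeff (coeff F j) i \<noteq> 0" by blast
  hence "cf F i j \<noteq> 0 \<and> i + j = total_degree F" by (simp add: cf_def)
  thus "\<exists>i j. cf F i j \<noteq> 0 \<and> i + j = total_degree F" by blast
qed

lemma ex_lm:
  assumes "F \<noteq> 0" obtains a b where "is_lm F a b" "a + b = total_degree F"
proof -
  let ?S = "{i. i \<le> total_degree F \<and> cf F i (total_degree F - i) \<noteq> 0}"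
  obtain i j where "cf F i j \<noteq> 0" "i + j = total_degree F" using total_degree_attained[OF assms] by blast
  moreover hence "j = total_degree F - i" by simp
  ultimately have ne: "i \<in> ?S" by auto
  have fin: "finite ?S" by simp
  define a where "a = Max ?S"
  have a: "a \<in> ?S" unfolding a_def using fin ne by (intro Max_in) auto
  have amax: "k \<le> a" if "k \<in> ?S" for k unfolding a_def by (rule Max_ge[OF fin that])
  have "is_lm F a (total_degree F - a)" unfolding is_lm_def
  proof (intro conjI allI impI)
    show "cf F a (total_degree F - a) \<noteq> 0" using a by simp
    fix k l assume kl: "cf F k l \<noteq> 0"
    have le: "k + l \<le> total_degree F" by (rule total_degree_ge[OF kl])
    show "k + l < a + (total_degree F - a) \<or> k + l = a + (total_degree F - a) \<and> k \<le> a"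
    proof (cases "k + l = total_degree F")
      case True
      hence "l = total_degree F - k" by simp
      hence "k \<le> a" using kl True by (intro amax) auto
      thus ?thesis using True a by simp
    next
      case False thus ?thesis using le a by simp
    qed
  qed
  thus ?thesis using a by (intro that[of a "total_degree F - a"]) auto
qed

lemma cf_mult: "cf (F * H) i j = (\<Sum>l\<le>j. \<Sum>k\<le>i. cf F k l * cf H (i - k) (j - l))"
  for F H :: "'a::comm_ring_1 poly poly"
  by (simp add: cf_def coeff_mult coeff_sum)

text \<open>Only the product of the two leading terms contributes: any other pair of exponents with
  this sum exceeds the leading exponent of one of the factors.\<close>

lemma lm_mult:
  fixes F H :: "'a::idom poly poly"
  assumes F: "is_lm F a b" and H: "is_lm H a' b'"
  shows "cf (F * H) (a + a') (b + b') \<noteq> 0"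
proof -
  have z: "cf F k l * cf H (a + a' - k) (b + b' - l) = 0" if "k \<le> a + a'" "l \<le> b + b'" "(k,l) \<noteq> (a,b)" for k l
  proof (rule ccontr)
    assume "\<not> ?thesis"
    hence nz: "cf F k l \<noteq> 0" "cf H (a + a' - k) (b + b' - l) \<noteq> 0" by auto
    have 1: "k + l < a + b \<or> (k + l = a + b \<and> k \<le> a)" using F nz(1) by (simp add: is_lm_def)
    have 2: "(a + a' - k) + (b + b' - l) < a' + b' \<or> ((a + a' - k) + (b + b' - l) = a' + b' \<and> a + a' - k \<le> a')" 
      using H nz(2) by (simp add: is_lm_def)
    show False using 1 2 that by auto
  qed
  have "(\<Sum>l\<le>b + b'. \<Sum>k\<le>a + a'. cf F k l * cf H (a + a' - k) (b + b' - l)) =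
    (\<Sum>l\<le>b + b'. \<Sum>k\<le>a + a'. if k = a then (if l = b then cf F a b * cf H a' b' else 0) else 0)"
  proof (intro sum.cong refl)
    fix l k assume "l \<in> {..b + b'}" "k \<in> {..a + a'}"
    thus "cf F k l * cf H (a + a' - k) (b + b' - l) = (if k = a then (if l = b then cf F a b * cf H a' b' else 0) else 0)"
      using z[of k l] by (cases "k = a"; cases "l = b") (auto simp del: mult_eq_0_iff)
  qed
  also have "\<dots> = cf F a b * cf H a' b'" by simp
  finally show ?thesis using F H by (simp add: cf_mult is_lm_def)
qed

lemma dvd_lm:
  fixes F G :: "'a::idom poly poly"
  assumes F: "is_lm F a b" and G: "F dvd G" "G \<noteq> 0"
  shows "\<exists>i j. i \<ge> a \<and> j \<ge> b \<and> cf G i j \<noteq> 0"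
proof -
  obtain H where H: "G = F * H" using G by blast
  hence "H \<noteq> 0" using G by auto
  then obtain a' b' where "is_lm H a' b'" by (rule ex_lm)
  from lm_mult[OF F this] show ?thesis unfolding H by (intro exI[of _ "a + a'"] exI[of _ "b + b'"]) simp
qed

text \<open>Leading exponents add up under multiplication, so the quotient has total degree
  0.\<close>

lemma dvd_const_quotient:
  fixes F G :: "'a::idom poly poly"
  assumes F: "F \<noteq> 0" and G: "F dvd G" "G \<noteq> 0" "\<And>i j. cf G i j \<noteq> 0 \<Longrightarrow> i + j \<le> total_degree F"
  obtains c where "c \<noteq> 0" "G = smult [:c:] F"
proof -
  obtain H where H: "G = F * H" using G by blast
  hence H0: "H \<noteq> 0" using G by auto
  obtain a b where ab: "is_lm F a b" "a + b = total_degree F" by (rule ex_lm[OF F])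
  obtain a' b' where ab': "is_lm H a' b'" "a' + b' = total_degree H" by (rule ex_lm[OF H0])
  have "(a + a') + (b + b') \<le> total_degree F" using lm_mult[OF ab(1) ab'(1)] G(3) unfolding H by blast
  hence z: "total_degree H = 0" using ab ab' by simp
  have "H = [:[:cf H 0 0:]:]"
  proof (rule cf_eqI)
    fix i j show "cf H i j = cf [:[:cf H 0 0:]:] i j"
      using total_degree_ge[of H i j] z by (cases "i = 0 \<and> j = 0") (auto simp: cf_def coeff_pCons split: nat.splits)
  qed
  hence Hc: "H = [:[:cf H 0 0:]:]" .
  have "cf H 0 0 \<noteq> 0"
  proof
    assume "cf H 0 0 = 0"
    hence "H = 0" by (subst Hc) simp
    thus False using H0 by simp
  qed
  moreover have "G = smult [:cf H 0 0:] F" unfolding H by (subst Hc) (simp add: mult.commute)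
  ultimately show ?thesis by (rule that)
qed

text \<open>Exponents of degree at most m that are not multiples of (a, b). If (a, b) is the leading
  exponent of F, no nonzero polynomial supported here is a multiple of F; this is how auxiliary
  polynomials are kept from being divisible by F.\<close>

definition red :: "nat \<Rightarrow> nat \<Rightarrow> nat \<Rightarrow> (nat \<times> nat) set" where
  "red a b m = {(i,j). i + j \<le> m \<and> \<not> (i \<ge> a \<and> j \<ge> b)}"

lemma red_subset: "red a b m \<subseteq> tri m" and finite_red [simp]: "finite (red a b m)"
proof -
  show "red a b m \<subseteq> tri m" by (auto simp: red_def tri_def)
  thus "finite (red a b m)" by (rule finite_subset) simp
qed

lemma tri_split:
  assumes "a + b \<le> m"
  shows "tri m = red a b m \<union> (\<lambda>(i,j). (i + a, j + b)) ` tri (m - (a + b))"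
    "red a b m \<inter> (\<lambda>(i,j). (i + a, j + b)) ` tri (m - (a + b)) = {}"
proof -
  have "(i,j) \<in> (\<lambda>(i,j). (i + a, j + b)) ` tri (m - (a + b))" if "i + j \<le> m" "i \<ge> a" "j \<ge> b" for i j
    by (rule rev_image_eqI[of "(i - a, j - b)"]) (use that assms in \<open>auto simp: tri_def\<close>)
  thus "tri m = red a b m \<union> (\<lambda>(i,j). (i + a, j + b)) ` tri (m - (a + b))"
    using assms by (auto simp: tri_def red_def)
  show "red a b m \<inter> (\<lambda>(i,j). (i + a, j + b)) ` tri (m - (a + b)) = {}"
    by (auto simp: tri_def red_def)
qed

lemma inj_shift: "inj_on (\<lambda>(i,j). (i + a, j + (b::nat))) A" for a :: nat
  by (auto simp: inj_on_def)

lemma card_red: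
  assumes "a + b \<le> m"
  shows "card (tri m) = card (red a b m) + card (tri (m - (a + b)))"
    "2 * real (card (red a b m)) = real (a + b) * (2 * real m - real (a + b) + 3)"
proof -
  show *: "card (tri m) = card (red a b m) + card (tri (m - (a + b)))"
    by (subst tri_split(1)[OF assms], subst card_Un_disjoint[OF _ _ tri_split(2)[OF assms]])
      (auto simp: card_image[OF inj_shift])
  have m: "real (m - (a + b)) = real m - real (a + b)" using assms by (rule of_nat_diff)
  have "2 * real (card (red a b m)) = 2 * real (card (tri m)) - 2 * real (card (tri (m - (a + b))))"
    unfolding * by simp
  also have "\<dots> = real (a + b) * (2 * real m - real (a + b) + 3)"
    unfolding card_tri m by (simp add: algebra_simps)
  finally show "2 * real (card (red a b m)) = real (a + b) * (2 * real m - real (a + b) + 3)" .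
qed

lemma sum_red:
  assumes "a + b \<le> m"
  shows "6 * (\<Sum>(i,j)\<in>red a b m. real (i + j)) = 3 * real (a + b) * real m * (real m + 1) - real (a + b) * (real (a + b) - 1) * (real (a + b) - 2)"
proof -
  define d where "d = real (a + b)"
  have m: "real (m - (a + b)) = real m - d" using assms unfolding d_def by (rule of_nat_diff)
  have "(\<Sum>(i,j)\<in>(\<lambda>(i,j). (i + a, j + b)) ` tri (m - (a + b)). real (i + j)) = (\<Sum>(i,j)\<in>tri (m - (a + b)). real (i + j) + d)"
    by (subst sum.reindex[OF inj_shift]) (auto simp: d_def intro!: sum.cong)
  also have "\<dots> = (\<Sum>(i,j)\<in>tri (m - (a + b)). real (i + j)) + card (tri (m - (a + b))) * d"
    by (simp add: case_prod_unfold sum.distrib)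
  finally have "(\<Sum>(i,j)\<in>tri m. real (i + j)) = (\<Sum>(i,j)\<in>red a b m. real (i + j)) + 
     ((\<Sum>(i,j)\<in>tri (m - (a + b)). real (i + j)) + card (tri (m - (a + b))) * d)"
    by (subst tri_split(1)[OF assms], subst sum.union_disjoint[OF _ _ tri_split(2)[OF assms]]) auto
  hence "6 * (\<Sum>(i,j)\<in>red a b m. real (i + j)) = 2 * (3 * (\<Sum>(i,j)\<in>tri m. real (i + j))) - 
     2 * (3 * (\<Sum>(i,j)\<in>tri (m - (a + b)). real (i + j))) - 3 * d * (2 * card (tri (m - (a + b))))" by simp
  thus ?thesis unfolding sum_tri of_nat_mult card_tri m d_def[symmetric] by (simp add: card_tri m algebra_simps)
qed

lemma sum_red_le:
  assumes "1 \<le> a + b" "a + b \<le> m"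
  shows "2 * (\<Sum>(i,j)\<in>red a b m. real (i + j)) \<le> real (a + b) * real m * (real m + 1)"
proof -
  have "real (a + b) * (real (a + b) - 1) * (real (a + b) - 2) \<ge> 0"
  proof (cases "a + b = 1")
    case False
    hence "a + b \<ge> 2" using assms by simp
    hence "real (a + b) \<ge> 2" by linarith
    thus ?thesis by simp
  qed simp
  thus ?thesis using sum_red[OF assms(2)] by linarith
qed

lemma degree_le_total_degree: "F \<noteq> 0 \<Longrightarrow> degree F \<le> total_degree F"
proof -
  assume "F \<noteq> 0"
  hence "lead_coeff F \<noteq> 0" by simp
  hence "cf F (degree (lead_coeff F)) (degree F) \<noteq> 0" unfolding cf_def by (simp only: leading_coeff_0_iff not_False_eq_True)
  from total_degree_ge[OF this] show ?thesis by simp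
qed

section \<open>Intersection of two plane curves\<close>

lemma card_fibre:
  fixes F :: "'a::field poly poly"
  assumes "lead_coeff F = 1"
  shows "finite {y. eval2 F x y = 0}" "card {y. eval2 F x y = 0} \<le> total_degree F"
proof -
  define f where "f = map_poly (\<lambda>q. poly q x) F"
  have cf: "coeff f j = poly (coeff F j) x" for j unfolding f_def by (simp add: coeff_map_poly)
  have F0: "F \<noteq> 0" using assms by auto
  have e: "eval2 F x y = poly f y" for y
  proof -
    have "eval2 F x y = (\<Sum>j\<le>degree F. poly (coeff F j) x * y ^ j)"
      unfolding eval2_def poly_altdef[of F] by (simp add: poly_sum poly_power)
    also have "\<dots> = poly f y" unfolding poly_altdef[of f] cf
    proof (rule sum.mono_neutral_right)
      show "{..degree f} \<subseteq> {..degree F}" unfolding f_def using degree_map_poly_le[of "\<lambda>q. poly q x" F] by auto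
      show "\<forall>i\<in>{..degree F} - {..degree f}. poly (coeff F i) x * y ^ i = 0"
      proof
        fix i assume "i \<in> {..degree F} - {..degree f}"
        hence "coeff f i = 0" by (simp add: coeff_eq_0)
        thus "poly (coeff F i) x * y ^ i = 0" by (simp add: cf)
      qed
    qed simp
    finally show ?thesis .
  qed
  have "coeff f (degree F) = 1" using assms by (simp add: cf)
  hence f0: "f \<noteq> 0" by auto
  show "finite {y. eval2 F x y = 0}" unfolding e by (rule poly_roots_finite[OF f0])
  have "card {y. eval2 F x y = 0} \<le> degree f" unfolding e by (rule card_poly_roots_bound[OF f0])
  also have "\<dots> \<le> degree F" unfolding f_def by (rule degree_map_poly_le)
  also have "\<dots> \<le> total_degree F" by (rule degree_le_total_degree[OF F0])
  finally show "card {y. eval2 F x y = 0} \<le> total_degree F" .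
qed

text \<open>Elimination by counting: the powers of X1 up to d D, the monomial multiples of F and the
  multiples of G by monomials from \<open>red\<close> outnumber the monomials of degree at most M. A
  relation R + A F + B G = 0 follows, in which R is nonzero: otherwise F would divide B, whose
  support excludes this. So the common zeros have at most d D first coordinates, each with at most d
  second coordinates. The factor d in excess of Bezout's d D is part of the exponent 8.\<close>

lemma bezout_bound:
  fixes F G :: "'a::field poly poly"
  assumes F: "irreducible F" "lead_coeff F = 1" and G: "\<not> F dvd G" 
    and D: "\<And>i j. cf G i j \<noteq> 0 \<Longrightarrow> i + j \<le> D"
  shows "finite {(x,y). eval2 F x y = 0 \<and> eval2 G x y = 0}"
    "card {(x,y). eval2 F x y = 0 \<and> eval2 G x y = 0} \<le> total_degree F * (total_degree F * D)"
proof -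
  define d where "d = total_degree F"
  have F0: "F \<noteq> 0" using F(2) by auto
  obtain a b where ab: "is_lm F a b" "a + b = d" unfolding d_def by (rule ex_lm[OF F0])
  \<comment> \<open>For this degree all three kinds of products fit, and their number exceeds that
    of the monomials by exactly one.\<close>
  define M where "M = d * D + d + D"
  define U where "U = Inl ` {..d * D} \<union> Inr ` (Inl ` tri (M - d) \<union> Inr ` red a b (M - D))"
  define pu where "pu u = (case u of Inl k \<Rightarrow> monom (monom 1 k) 0 | Inr (Inl (i,j)) \<Rightarrow> monom (monom 1 i) j * F
     | Inr (Inr (i,j)) \<Rightarrow> monom (monom 1 i) j * G)" for u :: "nat + (nat \<times> nat) + (nat \<times> nat)"
  have finU: "finite U" by (auto simp: U_def)
  have cU: "card U = d * D + 1 + card (tri (M - d)) + card (red a b (M - D))"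
  proof -
    have "card U = card (Inl ` {..d * D} :: (nat + (nat \<times> nat) + (nat \<times> nat)) set) + 
       card (Inr ` (Inl ` tri (M - d) \<union> Inr ` red a b (M - D)) :: (nat + (nat \<times> nat) + (nat \<times> nat)) set)"
      unfolding U_def by (intro card_Un_disjoint) auto
    also have "\<dots> = d * D + 1 + card (Inl ` tri (M - d) \<union> Inr ` red a b (M - D))"
      by (simp add: card_image)
    also have "card (Inl ` tri (M - d) \<union> Inr ` red a b (M - D)) = card (tri (M - d)) + card (red a b (M - D))"
      by (subst card_Un_disjoint) (auto simp: card_image)
    finally show ?thesis by simp
  qed
  have "real (card (tri M)) < real (card U)"
  proof -
    have "a + b \<le> M - D" unfolding ab(2) M_def by simp
    from card_red(2)[OF this] have r: "2 * real (card (red a b (M - D))) = real d * (2 * real (M - D) - real d + 3)" unfolding ab(2) .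
    have e: "real (M - D) = real (d * D) + real d" "real (M - d) = real (d * D) + real D" "real M = real (d * D) + real d + real D"
      by (simp_all add: M_def)
    have "2 * real (card U) = 2 * (real (d * D) + 1) + 2 * real (card (tri (M - d))) + 2 * real (card (red a b (M - D)))"
      unfolding cU by simp
    also have "\<dots> = 2 * real (card (tri M)) + 2"
      unfolding r card_tri e by (simp add: algebra_simps)
    finally show ?thesis by simp
  qed
  hence lt: "card (tri M) < card U" by simp
  from homogeneous_system[OF finite_tri finU lt, of "\<lambda>z u. cf (pu u) (fst z) (snd z)"]
  obtain c where c1: "\<exists>u\<in>U. c u \<noteq> 0" and c2: "\<forall>z\<in>tri M. (\<Sum>u\<in>U. c u * cf (pu u) (fst z) (snd z)) = 0" by blast
  have c2: "(\<Sum>u\<in>U. c u * cf (pu u) i j) = 0" if "(i,j) \<in> tri M" for i j using bspec[OF c2 that] by simp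
  note c = c1 c2
  define T where "T = (\<Sum>u\<in>U. smult [:c u:] (pu u))"
  have cfs: "cf (smult [:z:] p) i j = z * cf p i j" for z :: 'a and p i j by (simp add: cf_def)
  have F_deg: "i + j \<le> d" if "cf F i j \<noteq> 0" for i j unfolding d_def by (rule total_degree_ge[OF that])
  have shift: "i + j \<le> k + l + e" if nz: "cf (monom (monom 1 k) l * P) i j \<noteq> 0" and P: "\<And>i j. cf P i j \<noteq> 0 \<Longrightarrow> i + j \<le> e" 
    for i j k l e and P :: "'a poly poly"
  proof -
    obtain l' k' where "l' \<le> j" "k' \<le> i" "cf (monom (monom 1 k) l) k' l' * cf P (i - k') (j - l') \<noteq> 0"
    proof -
      have "\<exists>l'\<le>j. \<exists>k'\<le>i. cf (monom (monom 1 k) l) k' l' * cf P (i - k') (j - l') \<noteq> 0"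
      proof (rule ccontr)
        assume "\<not> ?thesis"
        hence "(\<Sum>l'\<le>j. \<Sum>k'\<le>i. cf (monom (monom 1 k) l) k' l' * cf P (i - k') (j - l')) = 0"
          by (intro sum.neutral ballI) (simp del: mult_eq_0_iff)
        thus False using nz unfolding cf_mult by simp
      qed
      thus ?thesis using that by blast
    qed
    hence "k' = k" "l' = l" "cf P (i - k) (j - l) \<noteq> 0" "l \<le> j" "k \<le> i" by (auto simp: cf_monom split: if_splits)
    thus ?thesis using P[of "i - k" "j - l"] by auto
  qed
  have pu_deg: "(i,j) \<in> tri M" if u: "u \<in> U" and nz: "cf (pu u) i j \<noteq> 0" for u i j
  proof -
    consider (1) k where "u = Inl k" "k \<le> d * D" | (2) k l where "u = Inr (Inl (k,l))" "(k,l) \<in> tri (M - d)"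
      | (3) k l where "u = Inr (Inr (k,l))" "(k,l) \<in> red a b (M - D)"
      using u by (auto simp: U_def)
    thus ?thesis
    proof cases
      case 1 thus ?thesis using nz by (auto simp: pu_def cf_monom tri_def M_def split: if_splits)
    next
      case 2
      have "i + j \<le> k + l + d" using nz 2 by (intro shift[of k l F] F_deg) (auto simp: pu_def)
      thus ?thesis using 2 by (auto simp: tri_def M_def)
    next
      case 3
      have "i + j \<le> k + l + D" using nz 3 by (intro shift[of k l G] D) (auto simp: pu_def)
      thus ?thesis using 3 by (auto simp: tri_def red_def M_def)
    qed
  qed
  have "T = 0"
  proof (rule cf_eqI)
    fix i j
    have "cf T i j = (\<Sum>u\<in>U. c u * cf (pu u) i j)" unfolding T_def cf_sum cfs ..
    also have "\<dots> = 0"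
    proof (cases "(i,j) \<in> tri M")
      case True thus ?thesis by (rule c(2))
    next
      case False thus ?thesis using pu_deg by (intro sum.neutral) auto
    qed
    finally show "cf T i j = cf 0 i j" by simp
  qed
  define R where "R = (\<Sum>k\<le>d * D. monom (c (Inl k)) k)"
  define A where "A = mkp (tri (M - d)) (\<lambda>x. c (Inr (Inl x)))"
  define B where "B = mkp (red a b (M - D)) (\<lambda>x. c (Inr (Inr x)))"
  have "T = [:R:] + A * F + B * G"
  proof -
    have "T = (\<Sum>u\<in>Inl ` {..d * D}. smult [:c u:] (pu u)) + (\<Sum>u\<in>Inr ` (Inl ` tri (M - d) \<union> Inr ` red a b (M - D)). smult [:c u:] (pu u))"
      unfolding T_def U_def by (rule sum.union_disjoint) auto
    also have "(\<Sum>u\<in>Inl ` {..d * D}. smult [:c u:] (pu u)) = (\<Sum>k\<le>d * D. monom (monom (c (Inl k)) k) 0)"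
      by (subst sum.reindex) (auto simp: pu_def smult_monom intro!: sum.cong)
    also have "\<dots> = [:R:]" unfolding R_def by (simp add: monom_0[symmetric] monom_sum)
    also have "(\<Sum>u\<in>Inr ` (Inl ` tri (M - d) \<union> Inr ` red a b (M - D)). smult [:c u:] (pu u)) = 
       (\<Sum>u\<in>Inl ` tri (M - d) \<union> Inr ` red a b (M - D). smult [:c (Inr u):] (pu (Inr u)))"
      by (subst sum.reindex) auto
    also have "\<dots> = (\<Sum>u\<in>Inl ` tri (M - d). smult [:c (Inr u):] (pu (Inr u))) + (\<Sum>u\<in>Inr ` red a b (M - D). smult [:c (Inr u):] (pu (Inr u)))"
      by (rule sum.union_disjoint) auto
    also have "(\<Sum>u\<in>Inl ` tri (M - d). smult [:c (Inr u):] (pu (Inr u))) = A * F"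
      unfolding A_def mkp_def sum_distrib_right
      by (subst sum.reindex) (auto simp: pu_def smult_monom mult_smult_left[symmetric] intro!: sum.cong simp del: mult_smult_left)
    also have "(\<Sum>u\<in>Inr ` red a b (M - D). smult [:c (Inr u):] (pu (Inr u))) = B * G"
      unfolding B_def mkp_def sum_distrib_right
      by (subst sum.reindex) (auto simp: pu_def smult_monom mult_smult_left[symmetric] intro!: sum.cong simp del: mult_smult_left)
    finally show ?thesis by simp
  qed
  with \<open>T = 0\<close> have rel: "[:R:] + A * F + B * G = 0" by simp
  have cR: "coeff R k = (if k \<le> d * D then c (Inl k) else 0)" for k unfolding R_def by (simp add: coeff_sum)
  have R0: "R \<noteq> 0"
  proof
    assume "R = 0"
    hence AB: "A * F + B * G = 0" using rel by simp
    hence "B * G = F * (- A)" by (simp add: eq_neg_iff_add_eq_0 add.commute mult.commute)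
    hence "F dvd B * G" by simp
    hence FB: "F dvd B" by (rule dvd_mult_irreducible[OF F G])
    have B0: "B = 0"
    proof (rule ccontr)
      assume "B \<noteq> 0"
      from dvd_lm[OF ab(1) FB this] obtain i j where "i \<ge> a" "j \<ge> b" "cf B i j \<noteq> 0" by blast
      moreover from this have "(i,j) \<in> red a b (M - D)" by (auto simp: B_def cf_mkp split: if_splits)
      ultimately show False by (simp add: red_def)
    qed
    hence A0: "A = 0" using AB F0 by simp
    have "c (Inl k) = 0" if "k \<le> d * D" for k using cR[of k] \<open>R = 0\<close> that by simp
    moreover have "c (Inr (Inl x)) = 0" if "x \<in> tri (M - d)" for x
      using A0 cf_mkp[of "tri (M - d)" "\<lambda>x. c (Inr (Inl x))" "fst x" "snd x"] that by (simp add: A_def)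
    moreover have "c (Inr (Inr x)) = 0" if "x \<in> red a b (M - D)" for x
      using B0 cf_mkp[of "red a b (M - D)" "\<lambda>x. c (Inr (Inr x))" "fst x" "snd x"] that by (simp add: B_def)
    ultimately show False using c(1) unfolding U_def by blast
  qed
  have dR: "degree R \<le> d * D" by (rule degree_le) (simp add: cR)
  define V where "V = {x. poly R x = 0}"
  have V: "finite V" "card V \<le> d * D"
    unfolding V_def using poly_roots_finite[OF R0] card_poly_roots_bound[OF R0] dR by auto
  have sub: "{(x,y). eval2 F x y = 0 \<and> eval2 G x y = 0} \<subseteq> (SIGMA x:V. {y. eval2 F x y = 0})"
  proof safe
    fix x y assume xy: "eval2 F x y = 0" "eval2 G x y = 0"
    have "eval2 ([:R:] + A * F + B * G) x y = 0" unfolding rel by simp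
    thus "x \<in> V" using xy by (simp add: V_def)
  qed
  have fin: "finite (SIGMA x:V. {y. eval2 F x y = 0})" using V(1) card_fibre(1)[OF F(2)] by auto
  show "finite {(x,y). eval2 F x y = 0 \<and> eval2 G x y = 0}" by (rule finite_subset[OF sub fin])
  have "card {(x,y). eval2 F x y = 0 \<and> eval2 G x y = 0} \<le> card (SIGMA x:V. {y. eval2 F x y = 0})" by (rule card_mono[OF fin sub])
  also have "\<dots> = (\<Sum>x\<in>V. card {y. eval2 F x y = 0})" using V(1) card_fibre(1)[OF F(2)] by (intro card_SigmaI) auto
  also have "\<dots> \<le> (\<Sum>x\<in>V. d)" unfolding d_def by (intro sum_mono card_fibre(2)[OF F(2)])
  also have "\<dots> = card V * d" by simp
  also have "\<dots> \<le> (d * D) * d" using V(2) by (rule mult_right_mono) simp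
  finally show "card {(x,y). eval2 F x y = 0 \<and> eval2 G x y = 0} \<le> total_degree F * (total_degree F * D)"
    unfolding d_def by (simp add: mult_ac)
qed

section \<open>Branches of a curve over the integers modulo powers of a prime\<close>

definition slice :: "'a::comm_ring_1 poly poly \<Rightarrow> 'a \<Rightarrow> 'a poly" where
  "slice F u = map_poly (\<lambda>q. poly q u) F"

lemma coeff_slice: "coeff (slice F u) j = poly (coeff F j) u"
  unfolding slice_def by (simp add: coeff_map_poly)

lemma eval2_altdef: "eval2 F u v = (\<Sum>j\<le>degree F. poly (coeff F j) u * v ^ j)"
  unfolding eval2_def poly_altdef[of F] by (simp add: poly_sum poly_power)

lemma degree_slice_le: "degree (slice F u) \<le> degree F"
  unfolding slice_def by (rule degree_map_poly_le)

lemma eval2_slice: "eval2 F u v = poly (slice F u) v"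
proof -
  have "eval2 F u v = (\<Sum>j\<le>degree F. coeff (slice F u) j * v ^ j)"
    unfolding eval2_altdef coeff_slice ..
  also have "\<dots> = poly (slice F u) v" unfolding poly_altdef[of "slice F u"]
    by (rule sum.mono_neutral_right) (use degree_slice_le[of F u] in \<open>auto simp: coeff_eq_0\<close>)
  finally show ?thesis .
qed

lemma pderiv_slice: "pderiv (slice F u) = slice (pderiv F) u" for u :: "'a::idom"
  by (simp add: poly_eq_iff coeff_pderiv coeff_slice)

lemma eval2_cong:
  fixes F :: "int poly poly"
  assumes "m dvd u - u'" "m dvd v - v'"
  shows "m dvd eval2 F u v - eval2 F u' v'"
proof -
  have "m dvd poly (coeff F j) u * v ^ j - poly (coeff F j) u' * v' ^ j" for j
  proof -
    have "m dvd poly (coeff F j) u - poly (coeff F j) u'" using assms(1) poly_diff_dvd by (rule dvd_trans)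
    moreover have "m dvd v ^ j - v' ^ j"
      using dvd_trans[OF assms(2) poly_diff_dvd[of v v' "monom 1 j"]] by (simp add: poly_monom)
    ultimately have "m dvd (poly (coeff F j) u - poly (coeff F j) u') * v ^ j + poly (coeff F j) u' * (v ^ j - v' ^ j)" by simp
    thus ?thesis by (simp add: algebra_simps)
  qed
  hence "m dvd (\<Sum>j\<le>degree F. poly (coeff F j) u * v ^ j - poly (coeff F j) u' * v' ^ j)" by (intro dvd_sum) auto
  thus ?thesis by (simp add: eval2_altdef sum_subtractf)
qed

lemma eval2_polys:
  fixes F :: "'a::comm_ring_1 poly poly"
  obtains P where "\<And>t. poly P t = eval2 F (poly A t) (poly B t)"
proof
  show "poly (\<Sum>j\<le>degree F. pcompose (coeff F j) A * B ^ j) t = eval2 F (poly A t) (poly B t)" for t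
    by (simp add: eval2_altdef poly_sum poly_pcompose poly_power)
qed

text \<open>Newton iteration in \<open>\<int>[t]\<close>: near a nonsingular point the second coordinate is, modulo any
  power of \<open>p\<close>, a polynomial in the first one.\<close>

lemma local_parametrization:
  fixes F :: "int poly poly"
  assumes p: "prime (int p)" and k: "1 \<le> k" "k \<le> E" and ns: "\<not> int p dvd eval2 (pderiv F) \<alpha> \<beta>"
  obtains \<Psi> where "\<And>u v. int p ^ k dvd u - \<alpha> \<Longrightarrow> int p ^ k dvd v - \<beta> \<Longrightarrow> int p ^ E dvd eval2 F u v \<Longrightarrow>
     int p ^ E dvd v - poly \<Psi> (u - \<alpha>)"
proof -
  define C where "C u v \<longleftrightarrow> int p ^ k dvd u - \<alpha> \<and> int p ^ k dvd v - \<beta> \<and> int p ^ E dvd eval2 F u v" for u v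
  \<comment> \<open>The inverse \<open>w\<close> of the derivative modulo p is computed once and
    kept fixed. Each iteration then gains only one power of p, but \<Psi> does not depend on the
    point.\<close>
  obtain c w where cw: "c * int p + w * eval2 (pderiv F) \<alpha> \<beta> = 1" by (rule bezout_prime_int[OF p ns])
  have pk: "int p dvd int p ^ k" using k by (simp add: dvd_power)
  have "\<exists>\<Psi>. \<forall>u v. C u v \<longrightarrow> int p ^ (k + t) dvd poly \<Psi> (u - \<alpha>) - v" if "k + t \<le> E" for t
    using that
  proof (induction t)
    case 0
    show ?case by (intro exI[of _ "[:\<beta>:]"]) (auto simp: C_def dvd_diff_commute)
  next
    case (Suc t)
    then obtain \<Psi> where \<Psi>: "\<And>u v. C u v \<Longrightarrow> int p ^ (k + t) dvd poly \<Psi> (u - \<alpha>) - v" by auto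
    obtain P where P: "\<And>t. poly P t = eval2 F (poly [:\<alpha>, 1:] t) (poly \<Psi> t)" using eval2_polys by blast
    have "int p ^ (k + Suc t) dvd poly (\<Psi> - smult w P) (u - \<alpha>) - v" if uv: "C u v" for u v
    proof -
      define \<psi> where "\<psi> = poly \<Psi> (u - \<alpha>)"
      define f where "f = slice F u"
      have d: "int p ^ (k + t) dvd \<psi> - v" unfolding \<psi>_def by (rule \<Psi>[OF uv])
      have Pu: "poly P (u - \<alpha>) = poly f \<psi>" unfolding P f_def \<psi>_def by (simp add: eval2_slice)
      obtain e where e: "poly f (v + (\<psi> - v)) = poly f v + (\<psi> - v) * poly (pderiv f) v + (\<psi> - v) ^ 2 * e" by (rule poly_taylor1)
      \<comment> \<open>Taylor expansion at the true second coordinate v. All three terms turn out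
        divisible by one more power of p than the old error \<psi> - v.\<close>
      have eq: "poly (\<Psi> - smult w P) (u - \<alpha>) - v = (\<psi> - v) * (1 - w * poly (pderiv f) v) - w * poly f v - w * e * ((\<psi> - v) * (\<psi> - v))"
      proof -
        have fe: "poly f \<psi> = poly f v + (\<psi> - v) * poly (pderiv f) v + (\<psi> - v) ^ 2 * e" using e by simp
        show ?thesis by (simp add: Pu \<psi>_def[symmetric] fe algebra_simps power2_eq_square)
      qed
      have "int p dvd eval2 (pderiv F) u v - eval2 (pderiv F) \<alpha> \<beta>"
        using uv pk by (intro eval2_cong) (auto simp: C_def intro: dvd_trans)
      hence "int p dvd poly (pderiv f) v - eval2 (pderiv F) \<alpha> \<beta>" by (simp add: f_def pderiv_slice eval2_slice)
      hence "int p dvd c * int p - w * (poly (pderiv f) v - eval2 (pderiv F) \<alpha> \<beta>)" by simp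
      hence "int p dvd 1 - w * poly (pderiv f) v" using cw by (simp add: algebra_simps)
      with d have "int p ^ (k + t) * int p dvd (\<psi> - v) * (1 - w * poly (pderiv f) v)" by (rule mult_dvd_mono)
      hence 1: "int p ^ (k + Suc t) dvd (\<psi> - v) * (1 - w * poly (pderiv f) v)" by (simp add: mult.commute)
      have "int p ^ (k + Suc t) dvd int p ^ E" using Suc.prems by (intro le_imp_power_dvd) simp
      hence "int p ^ (k + Suc t) dvd poly f v" using uv unfolding C_def f_def eval2_slice by (blast intro: dvd_trans)
      hence 2: "int p ^ (k + Suc t) dvd w * poly f v" by simp
      have "int p ^ (k + t) * int p dvd (\<psi> - v) * (\<psi> - v)"
      proof (rule mult_dvd_mono[OF d])
        have "int p dvd int p ^ (k + t)" using k by (simp add: dvd_power)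
        thus "int p dvd \<psi> - v" using d by (rule dvd_trans)
      qed
      hence 3: "int p ^ (k + Suc t) dvd w * e * ((\<psi> - v) * (\<psi> - v))" by (simp add: mult.commute)
      show ?thesis unfolding eq by (intro dvd_diff 1 2 3)
    qed
    thus ?case by blast
  qed
  from this[of "E - k"] k obtain \<Psi> where "\<And>u v. C u v \<Longrightarrow> int p ^ E dvd poly \<Psi> (u - \<alpha>) - v" by auto
  thus ?thesis by (intro that[of \<Psi>]) (simp add: C_def dvd_diff_commute)
qed

text \<open>Roots modulo p^k that are simple modulo p are determined by their residues modulo p, so
  the bound for a monic polynomial over a field applies.\<close>

lemma residues_in_fibre:
  fixes F :: "int poly poly"
  assumes p: "prime (int p)" and F: "lead_coeff F = 1" and S: "S \<subseteq> {0..<int p ^ k}" and k: "k \<ge> 1"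
    and S1: "\<And>s. s \<in> S \<Longrightarrow> int p ^ k dvd eval2 F \<alpha> s" and S2: "\<And>s. s \<in> S \<Longrightarrow> \<not> int p dvd eval2 (pderiv F) \<alpha> s"
  shows "card S \<le> degree F"
proof -
  let ?f = "slice F \<alpha>"
  have "coeff ?f (degree F) = 1" using F by (simp add: coeff_slice)
  hence d: "degree ?f = degree F" using degree_slice_le[of F \<alpha>] le_degree[of ?f "degree F"] by simp
  have "card S \<le> degree ?f"
  proof (rule roots_mod_prime_card[OF p])
    show "lead_coeff ?f = 1" unfolding d by fact
    show "finite S" by (rule finite_subset[OF S]) simp
    have pk: "int p dvd int p ^ k" using k by (simp add: dvd_power)
    fix s assume s: "s \<in> S"
    show "int p dvd poly ?f s" using dvd_trans[OF pk S1[OF s]] by (simp add: eval2_slice)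
    fix t assume t: "t \<in> S" and st: "int p dvd s - t"
    have "int p ^ k dvd s - t"
    proof (rule simple_root_unique[OF p _ _ st])
      show "int p ^ k dvd poly ?f s" "int p ^ k dvd poly ?f t" using S1 s t by (simp_all add: eval2_slice)
      show "\<not> int p dvd poly (pderiv ?f) s" using S2[OF s] by (simp add: eval2_slice pderiv_slice)
    qed
    moreover have "s \<in> {0..<int p ^ k}" "t \<in> {0..<int p ^ k}" using S s t by blast+
    hence "\<bar>s - t\<bar> < int p ^ k" by auto
    ultimately show "s = t" using dvd_imp_le_int[of "s - t" "int p ^ k"] by (cases "s = t") auto
  qed
  thus ?thesis unfolding d .
qed

text \<open>Each coefficient makes up for the powers of q that t^m lacks. Prescribing the m-th
  coefficient modulo q^(s - m) for all m < s costs q^(s (s + 1) / 2) possibilities and gains the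
  factor q^s at every point of the class, a triangular saving as in the determinant method.\<close>

lemma poly_dvd_by_weights:
  fixes P :: "int poly"
  assumes "\<And>m. m < s \<Longrightarrow> q ^ (s - m) dvd coeff P m" "q dvd t"
  shows "q ^ s dvd poly P t"
  unfolding poly_altdef
proof (rule dvd_sum)
  fix m
  have tm: "q ^ m dvd t ^ m" using assms(2) by (rule dvd_power_same)
  show "q ^ s dvd coeff P m * t ^ m"
  proof (cases "m < s")
    case True
    have "q ^ (s - m) * q ^ m dvd coeff P m * t ^ m" using assms(1)[OF True] tm by (rule mult_dvd_mono)
    thus ?thesis using True by (simp add: power_add[symmetric])
  next
    case False
    hence "q ^ s dvd q ^ m" by (intro le_imp_power_dvd) simp
    thus ?thesis using tm by (meson dvd_mult dvd_trans)
  qed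
qed

section \<open>Integral points in residue classes\<close>

abbreviation OK :: "'a::field_char_0 set" where "OK \<equiv> ring_of_integers"

lemma OK_closed [intro]:
  "x \<in> OK \<Longrightarrow> y \<in> OK \<Longrightarrow> x + y \<in> OK" "x \<in> OK \<Longrightarrow> y \<in> OK \<Longrightarrow> x * y \<in> OK" 
  "x \<in> OK \<Longrightarrow> y \<in> OK \<Longrightarrow> x - y \<in> OK" "0 \<in> OK" "1 \<in> OK" "x \<in> OK \<Longrightarrow> x ^ k \<in> OK" "of_nat m \<in> OK"
  unfolding ring_of_integers_def using algebraic_int_of_int[of "int m"] algebraic_int_of_int[of 1]
  by (auto intro: algebraic_int_add_mult algebraic_int_diff algebraic_int_power)

lemma OK_sum: "(\<And>i. i \<in> A \<Longrightarrow> f i \<in> OK) \<Longrightarrow> sum f A \<in> OK"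
  unfolding ring_of_integers_def by (auto intro: algebraic_int_sum)

text \<open>A ring homomorphism from the ring of integers to \<open>\<int>/p\<^sup>E\<close>, as a function with integer values;
  \<open>Nm\<close> plays the role of the norm.\<close>

definition residue_map :: "('a::field_char_0 \<Rightarrow> int) \<Rightarrow> nat \<Rightarrow> nat \<Rightarrow> ('a \<Rightarrow> int) \<Rightarrow> bool" where
  "residue_map Nm p E \<phi> \<longleftrightarrow> \<phi> 0 = 0 \<and> \<phi> 1 = 1 \<and>
     (\<forall>x\<in>OK. \<forall>y\<in>OK. int p ^ E dvd \<phi> (x + y) - (\<phi> x + \<phi> y) \<and> int p ^ E dvd \<phi> (x * y) - \<phi> x * \<phi> y) \<and>
     (\<forall>x\<in>OK. \<forall>e\<le>E. int p ^ e dvd \<phi> x \<longrightarrow> int p ^ e dvd Nm x)"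

lemma residue_map_sum:
  assumes "residue_map Nm p E \<phi>" "finite A" "\<And>i. i \<in> A \<Longrightarrow> f i \<in> OK"
  shows "int p ^ E dvd \<phi> (sum f A) - (\<Sum>i\<in>A. \<phi> (f i))"
  using assms(2,3)
proof (induction A rule: finite_induct)
  case empty thus ?case using assms(1) by (simp add: residue_map_def)
next
  case (insert i A)
  have "int p ^ E dvd \<phi> (f i + sum f A) - (\<phi> (f i) + \<phi> (sum f A))"
    using assms(1) insert.prems OK_sum[of A f] unfolding residue_map_def by auto
  moreover have "int p ^ E dvd \<phi> (sum f A) - (\<Sum>i\<in>A. \<phi> (f i))" using insert by auto
  ultimately have "int p ^ E dvd (\<phi> (f i + sum f A) - (\<phi> (f i) + \<phi> (sum f A))) + (\<phi> (sum f A) - (\<Sum>i\<in>A. \<phi> (f i)))"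
    by (rule dvd_add)
  thus ?case using insert.hyps by (simp add: algebra_simps)
qed

lemma residue_map_mult:
  assumes "residue_map Nm p E \<phi>" "x \<in> OK" "y \<in> OK" shows "int p ^ E dvd \<phi> (x * y) - \<phi> x * \<phi> y"
  using assms by (simp add: residue_map_def)

lemma residue_map_power:
  assumes "residue_map Nm p E \<phi>" "x \<in> OK" shows "int p ^ E dvd \<phi> (x ^ k) - \<phi> x ^ k"
proof (induction k)
  case 0 thus ?case using assms by (simp add: residue_map_def)
next
  case (Suc k)
  have "int p ^ E dvd \<phi> (x * x ^ k) - \<phi> x * \<phi> (x ^ k)" using assms by (intro residue_map_mult) auto
  moreover have "int p ^ E dvd \<phi> x * (\<phi> (x ^ k) - \<phi> x ^ k)" using Suc by simp
  ultimately have "int p ^ E dvd (\<phi> (x * x ^ k) - \<phi> x * \<phi> (x ^ k)) + \<phi> x * (\<phi> (x ^ k) - \<phi> x ^ k)" by (rule dvd_add)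
  thus ?case by (simp add: algebra_simps)
qed

lemma residue_map_diff:
  assumes "residue_map Nm p E \<phi>" "x \<in> OK" "y \<in> OK" shows "int p ^ E dvd \<phi> (x - y) - (\<phi> x - \<phi> y)"
proof -
  have "int p ^ E dvd \<phi> ((x - y) + y) - (\<phi> (x - y) + \<phi> y)" using assms unfolding residue_map_def by blast
  hence "int p ^ E dvd - (\<phi> ((x - y) + y) - (\<phi> (x - y) + \<phi> y))" by (simp only: dvd_minus_iff)
  thus ?thesis by (simp add: algebra_simps)
qed

lemma dvd_mult_diff: "m dvd a - a' \<Longrightarrow> m dvd b - b' \<Longrightarrow> m dvd a * b - a' * b'" for m :: "'a::comm_ring_1"
proof -
  assume "m dvd a - a'" "m dvd b - b'"
  hence "m dvd (a - a') * b + a' * (b - b')" by simp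
  thus ?thesis by (simp add: algebra_simps)
qed

lemma residue_map_mkp:
  assumes r: "residue_map Nm p E \<phi>" and I: "finite I" "\<And>z. z \<in> I \<Longrightarrow> c z \<in> OK" and xy: "x \<in> OK" "y \<in> OK"
  shows "int p ^ E dvd \<phi> (eval2 (mkp I c) x y) - eval2 (mkp I (\<lambda>z. \<phi> (c z))) (\<phi> x) (\<phi> y)"
proof -
  have tm: "int p ^ E dvd \<phi> (c (i,j) * (x ^ i * y ^ j)) - \<phi> (c (i,j)) * (\<phi> x ^ i * \<phi> y ^ j)" if z: "(i,j) \<in> I" for i j
  proof -
    have 1: "int p ^ E dvd \<phi> (c (i,j) * (x ^ i * y ^ j)) - \<phi> (c (i,j)) * \<phi> (x ^ i * y ^ j)"
      using I(2)[OF z] xy by (intro residue_map_mult[OF r]) auto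
    have 2: "int p ^ E dvd \<phi> (x ^ i * y ^ j) - \<phi> (x ^ i) * \<phi> (y ^ j)"
      using xy by (intro residue_map_mult[OF r]) auto
    have 3: "int p ^ E dvd \<phi> (x ^ i) * \<phi> (y ^ j) - \<phi> x ^ i * \<phi> y ^ j"
      using xy by (intro dvd_mult_diff residue_map_power[OF r])
    have "int p ^ E dvd \<phi> (x ^ i * y ^ j) - \<phi> x ^ i * \<phi> y ^ j" using dvd_add[OF 2 3] by simp
    hence "int p ^ E dvd \<phi> (c (i,j)) * (\<phi> (x ^ i * y ^ j) - \<phi> x ^ i * \<phi> y ^ j)" by simp
    from dvd_add[OF 1 this] show ?thesis by (simp add: algebra_simps)
  qed
  let ?f = "\<lambda>(i,j). c (i,j) * (x ^ i * y ^ j)"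
  have s: "int p ^ E dvd \<phi> (sum ?f I) - (\<Sum>z\<in>I. \<phi> (?f z))"
    by (rule residue_map_sum[OF r I(1)]) (use I(2) xy in auto)
  have "int p ^ E dvd (\<Sum>z\<in>I. \<phi> (?f z) - (case z of (i,j) \<Rightarrow> \<phi> (c (i,j)) * (\<phi> x ^ i * \<phi> y ^ j)))"
    by (rule dvd_sum) (use tm in auto)
  hence "int p ^ E dvd (\<Sum>z\<in>I. \<phi> (?f z)) - (\<Sum>(i,j)\<in>I. \<phi> (c (i,j)) * (\<phi> x ^ i * \<phi> y ^ j))"
    by (simp only: sum_subtractf)
  from dvd_add[OF s this] show ?thesis by (simp add: eval2_mkp)
qed

text \<open>This is all that the count of points uses about the number field. \<open>Box L\<close>
  feeds the pigeonhole arguments with more than L^n integers of height O(L), \<open>count\<close>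
  bounds the number of values they can take, \<open>Nm\<close> turns divisibility into vanishing,
  and the residue maps exist for every exponent E because the exponent is fixed only after the
  prime.\<close>

locale residue_supply =
  fixes n :: nat and Ck :: real and Box :: "real \<Rightarrow> 'a::field_char_0 set" and Nm :: "'a \<Rightarrow> int" and T0 :: real
  assumes n_pos: "n > 0" and Ck: "Ck \<ge> 1"
    and house_nonneg: "house (x::'a) \<ge> 0"
    and house_add: "house (x + y :: 'a) \<le> house x + house y"
    and house_mult: "house (x * y :: 'a) \<le> house x * house y"
    and house_of_nat: "house (of_nat m :: 'a) \<le> real m"
    and Box: "L \<ge> 0 \<Longrightarrow> finite (Box L)" "L \<ge> 0 \<Longrightarrow> Box L \<subseteq> OK" "L \<ge> 0 \<Longrightarrow> L ^ n < real (card (Box L))"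
      "L \<ge> 0 \<Longrightarrow> x \<in> Box L \<Longrightarrow> y \<in> Box L \<Longrightarrow> house (x - y) \<le> Ck * L" "L \<ge> 0 \<Longrightarrow> x \<in> Box L \<Longrightarrow> house x \<le> Ck * L"
    and count: "H \<ge> 1 \<Longrightarrow> finite {x\<in>OK. house (x::'a) \<le> H}" "H \<ge> 1 \<Longrightarrow> real (card {x\<in>OK. house (x::'a) \<le> H}) \<le> Ck * H ^ n"
    and Nm: "x \<in> OK \<Longrightarrow> x \<noteq> 0 \<Longrightarrow> Nm x \<noteq> 0" "x \<in> OK \<Longrightarrow> \<bar>real_of_int (Nm x)\<bar> \<le> Ck * house x ^ n"
    and T0: "T0 \<ge> 1"
    and enough_primes: "T \<ge> T0 \<Longrightarrow> \<exists>S \<phi>. finite S \<and>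
       (\<forall>p\<in>S. prime p \<and> T < p \<and> real p \<le> T powr (4/3) \<and> (\<forall>E. residue_map Nm p E (\<phi> p E))) \<and>
       (\<Sum>p\<in>S. ln (real p)) \<ge> 2 * T"
begin

lemma house_power: "house (x ^ k :: 'a) \<le> house x ^ k"
proof (induction k)
  case 0 show ?case using house_of_nat[of 1] by simp
next
  case (Suc k)
  have "house (x * x ^ k) \<le> house x * house (x ^ k)" by (rule house_mult)
  also have "\<dots> \<le> house x * house x ^ k" by (intro mult_left_mono Suc house_nonneg)
  finally show ?case by simp
qed

lemma house_sum: "finite A \<Longrightarrow> house (sum f A :: 'a) \<le> (\<Sum>i\<in>A. house (f i))"
proof (induction A rule: finite_induct)
  case empty show ?case using house_of_nat[of 0] by simp
next
  case (insert i A)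
  thus ?case using house_add[of "f i" "sum f A"] by simp
qed

lemma house_mkp:
  fixes M :: real
  assumes "finite I" "house x \<le> B" "house y \<le> B" "\<And>i j. (i,j) \<in> I \<Longrightarrow> house (c (i,j) :: 'a) * B ^ (i + j) \<le> M"
  shows "house (eval2 (mkp I c) x y) \<le> real (card I) * M"
proof -
  have "house (eval2 (mkp I c) x y) \<le> (\<Sum>z\<in>I. house (case z of (i,j) \<Rightarrow> c (i,j) * (x ^ i * y ^ j)))"
    unfolding eval2_mkp by (rule house_sum[OF assms(1)])
  also have "\<dots> \<le> (\<Sum>z\<in>I. M)"
  proof (rule sum_mono, clarify)
    fix i j assume z: "(i,j) \<in> I"
    have B0: "B \<ge> 0" using assms(2) house_nonneg order_trans by blast
    have "house (x ^ i * y ^ j) \<le> house (x ^ i) * house (y ^ j)" by (rule house_mult)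
    also have "\<dots> \<le> B ^ i * B ^ j"
      by (intro mult_mono house_nonneg order.trans[OF house_power] power_mono assms zero_le_power B0)
    finally have "house (x ^ i * y ^ j) \<le> B ^ (i + j)" by (simp add: power_add)
    hence "house (c (i,j)) * house (x ^ i * y ^ j) \<le> house (c (i,j)) * B ^ (i + j)" by (intro mult_left_mono house_nonneg)
    thus "house (c (i,j) * (x ^ i * y ^ j)) \<le> M" using house_mult[of "c (i,j)" "x ^ i * y ^ j"] assms(4)[OF z] by linarith
  qed
  finally show ?thesis by simp
qed

lemma Nm_small_imp_zero:
  assumes x: "x \<in> OK" and d: "int m dvd Nm x" and s: "Ck * house x ^ n < real m"
  shows "x = 0"
proof (rule ccontr)
  assume "x \<noteq> 0"
  hence nz: "Nm x \<noteq> 0" by (rule Nm(1)[OF x])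
  have "int m \<le> \<bar>Nm x\<bar>" by (rule dvd_imp_le_int[OF nz, of "int m", simplified]) (rule d)
  hence "real m \<le> \<bar>real_of_int (Nm x)\<bar>" by linarith
  thus False using Nm(2)[OF x] s by linarith
qed

text \<open>A coefficient vector of bounded height for which all Taylor coefficients along the branch
  through the residue class are highly divisible exists by the pigeonhole principle. Its values at
  the points of the class are then divisible by a power of \<open>p\<close> exceeding their norm.\<close>

lemma auxiliary_polynomial:
  fixes F :: "int poly poly" and B q :: real
  assumes p: "prime p" and k: "k \<ge> 1" and ns: "\<not> int p dvd eval2 (pderiv F) \<alpha> \<beta>"
    and I: "finite I" "I \<noteq> {}" and r: "residue_map Nm p (k * card I) \<phi>" and B: "B \<ge> 1" and q: "q = real p ^ k"
    and L: "\<Lambda> > 0" "Ck * (card I * (Ck * \<Lambda>)) ^ n < q ^ card I"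
      "q ^ (card I * (card I + 1) div 2) * B ^ (n * (\<Sum>(i,j)\<in>I. i + j)) \<le> \<Lambda> ^ (n * card I)"
  obtains c where "\<And>z. z \<in> I \<Longrightarrow> c z \<in> OK" "\<exists>z\<in>I. c z \<noteq> (0::'a)"
    "\<And>x y. x \<in> OK \<Longrightarrow> y \<in> OK \<Longrightarrow> house x \<le> B \<Longrightarrow> house y \<le> B \<Longrightarrow> int p ^ k dvd \<phi> x - \<alpha> \<Longrightarrow> int p ^ k dvd \<phi> y - \<beta> \<Longrightarrow>
       int p ^ (k * card I) dvd eval2 F (\<phi> x) (\<phi> y) \<Longrightarrow> eval2 (mkp I c) x y = 0"
proof -
  define s where "s = card I"
  define E where "E = k * s"
  have s1: "s \<ge> 1" unfolding s_def using I by (simp add: Suc_le_eq card_gt_0_iff)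
  have kE: "k \<le> E" unfolding E_def using s1 by simp
  have pp: "prime (int p)" using p by simp
  have p0: "p > 0" using prime_gt_0_nat[OF p] .
  obtain \<Psi> where \<Psi>: "\<And>u v. int p ^ k dvd u - \<alpha> \<Longrightarrow> int p ^ k dvd v - \<beta> \<Longrightarrow> int p ^ E dvd eval2 F u v \<Longrightarrow>
     int p ^ E dvd v - poly \<Psi> (u - \<alpha>)" by (rule local_parametrization[OF pp k kE ns]) blast
  \<comment> \<open>Monomials of high degree get small coefficients, such that each term of the
    polynomial has height at most Ck \<Lambda> at points of height at most B.\<close>
  define L where "L z = \<Lambda> / B ^ (fst z + snd z)" for z :: "nat \<times> nat"
  have L0: "L z \<ge> 0" for z unfolding L_def using L(1) B by simp
  define A where "A = (\<Pi>\<^sub>E z\<in>I. Box (L z))"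
  \<comment> \<open>The label lists the Taylor coefficients along the branch, the m-th one modulo
    q^(s - m), as required by \<open>poly_dvd_by_weights\<close>.\<close>
  define lab where "lab c = (\<lambda>m\<in>{..<s}. coeff (\<Sum>(i,j)\<in>I. smult (\<phi> (c (i,j))) ([:\<alpha>, 1:] ^ i * \<Psi> ^ j)) m mod (int p ^ (k * (s - m))))" for c
  define Lb where "Lb = (\<Pi>\<^sub>E m\<in>{..<s}. {0..<int p ^ (k * (s - m))})"
  have finA: "finite A" unfolding A_def using I Box(1)[OF L0] by (intro finite_PiE) auto
  have finLb: "finite Lb" unfolding Lb_def by (intro finite_PiE) auto
  have labLb: "lab c \<in> Lb" for c unfolding lab_def Lb_def using p0 by auto
  have cLb: "real (card Lb) = q ^ (s * (s + 1) div 2)"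
  proof -
    have "card Lb = (\<Prod>m<s. p ^ (k * (s - m)))" unfolding Lb_def by (subst card_PiE) (auto simp: nat_power_eq)
    also have "\<dots> = p ^ (\<Sum>m<s. k * (s - m))" by (simp add: power_sum)
    also have "(\<Sum>m<s. k * (s - m)) = k * (\<Sum>m<s. s - m)" by (simp add: sum_distrib_left)
    also have "(\<Sum>m<s. s - m) = (\<Sum>m\<in>{1..s}. m)" 
      by (rule sum.reindex_bij_witness[of _ "\<lambda>m. s - m" "\<lambda>m. s - m"]) auto
    also have "\<dots> = s * (s + 1) div 2" using Sum_Icc_nat[of 1 s] by simp
    finally show ?thesis unfolding q by (simp add: power_mult)
  qed
  have cA: "real (card A) > q ^ (s * (s + 1) div 2)"
  proof -
    have "(\<Prod>z\<in>I. L z ^ n) < (\<Prod>z\<in>I. real (card (Box (L z))))"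
    proof -
      obtain z0 where z0: "z0 \<in> I" using I(2) by blast
      have b: "L z ^ n < real (card (Box (L z)))" for z by (rule Box(3)[OF L0])
      have c: "0 \<le> L z ^ n" for z by (rule zero_le_power[OF L0])
      show ?thesis
        by (rule prod_mono_strict[OF z0 _ I(1)]) (use b c le_less_trans[OF c b] in \<open>auto intro: less_imp_le\<close>)
    qed
    also have "\<dots> = real (card A)" unfolding A_def using I by (subst card_PiE) auto
    finally have 1: "(\<Prod>z\<in>I. L z ^ n) < real (card A)" .
    have "(\<Prod>z\<in>I. L z ^ n) = (\<Prod>z\<in>I. \<Lambda> ^ n / B ^ (n * (fst z + snd z)))"
      by (intro prod.cong refl) (simp add: L_def power_divide power_mult[symmetric] mult.commute)
    also have "\<dots> = \<Lambda> ^ (n * s) / B ^ (\<Sum>z\<in>I. n * (fst z + snd z))"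
      using I by (simp add: prod_dividef power_sum s_def power_mult)
    also have "(\<Sum>z\<in>I. n * (fst z + snd z)) = n * (\<Sum>(i,j)\<in>I. i + j)"
      by (simp add: sum_distrib_left case_prod_unfold)
    finally have "(\<Prod>z\<in>I. L z ^ n) = \<Lambda> ^ (n * s) / B ^ (n * (\<Sum>(i,j)\<in>I. i + j))" .
    moreover have "q ^ (s * (s + 1) div 2) \<le> \<Lambda> ^ (n * s) / B ^ (n * (\<Sum>(i,j)\<in>I. i + j))"
      using L(3) B unfolding s_def by (simp add: pos_le_divide_eq)
    ultimately show ?thesis using 1 by linarith
  qed
  hence "card Lb < card A" using cLb by linarith
  have "\<not> inj_on lab A"
  proof
    assume "inj_on lab A"
    hence "card A \<le> card Lb" using labLb finLb by (intro card_inj_on_le) auto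
    thus False using \<open>card Lb < card A\<close> by simp
  qed
  then obtain c1 c2 where c12: "c1 \<in> A" "c2 \<in> A" "c1 \<noteq> c2" "lab c1 = lab c2" unfolding inj_on_def by blast
  define c where "c z = c1 z - c2 z" for z
  have inBox: "c1 z \<in> Box (L z)" "c2 z \<in> Box (L z)" if "z \<in> I" for z using c12 that unfolding A_def by auto
  have inOK: "c1 z \<in> OK" "c2 z \<in> OK" if "z \<in> I" for z using inBox[OF that] Box(2)[OF L0] by blast+
  have cOK: "c z \<in> OK" if "z \<in> I" for z unfolding c_def using inOK[OF that] by blast
  have cnz: "\<exists>z\<in>I. c z \<noteq> 0"
  proof (rule ccontr)
    assume "\<not> ?thesis"
    hence "c1 z = c2 z" if "z \<in> I" for z using that by (auto simp: c_def)
    hence "c1 = c2" using c12(1,2) unfolding A_def by (intro PiE_ext) auto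
    thus False using c12(3) by simp
  qed
  \<comment> \<open>Built from the difference of the images of \<open>c1\<close> and
    \<open>c2\<close>, not from the image of \<open>c\<close>: for this polynomial the equality of
    the labels gives the divisibility at once, and the two versions agree modulo p^E.\<close>
  define P where "P = (\<Sum>(i,j)\<in>I. smult (\<phi> (c1 (i,j))) ([:\<alpha>, 1:] ^ i * \<Psi> ^ j)) - (\<Sum>(i,j)\<in>I. smult (\<phi> (c2 (i,j))) ([:\<alpha>, 1:] ^ i * \<Psi> ^ j))"
  have Pdvd: "(int p ^ k) ^ (s - m) dvd coeff P m" if "m < s" for m
  proof -
    have "lab c1 m = lab c2 m" using c12(4) by simp
    thus ?thesis using that by (simp add: lab_def P_def mod_eq_dvd_iff power_mult)
  qed
  have Pval: "poly P t = (\<Sum>(i,j)\<in>I. (\<phi> (c1 (i,j)) - \<phi> (c2 (i,j))) * ((\<alpha> + t) ^ i * poly \<Psi> t ^ j))" for t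
    unfolding P_def by (simp add: poly_sum case_prod_unfold sum_subtractf[symmetric] algebra_simps poly_power)
  show ?thesis
  proof (rule that[of c, OF cOK cnz])
    fix x y assume xy: "x \<in> OK" "y \<in> OK" "house x \<le> B" "house y \<le> B"
      and cl: "int p ^ k dvd \<phi> x - \<alpha>" "int p ^ k dvd \<phi> y - \<beta>" "int p ^ (k * card I) dvd eval2 F (\<phi> x) (\<phi> y)"
    define t where "t = \<phi> x - \<alpha>"
    have yt: "int p ^ E dvd \<phi> y - poly \<Psi> t" unfolding t_def by (rule \<Psi>[OF cl(1,2)]) (use cl(3) in \<open>simp add: E_def s_def\<close>)
    have r': "residue_map Nm p E \<phi>" using r by (simp add: E_def s_def)
    have 1: "int p ^ E dvd \<phi> (eval2 (mkp I c) x y) - eval2 (mkp I (\<lambda>z. \<phi> (c z))) (\<phi> x) (\<phi> y)"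
      by (rule residue_map_mkp[OF r' I(1) cOK xy(1,2)])
    have "int p ^ E dvd (\<Sum>(i,j)\<in>I. \<phi> (c (i,j)) * (\<phi> x ^ i * \<phi> y ^ j) - (\<phi> (c1 (i,j)) - \<phi> (c2 (i,j))) * (\<phi> x ^ i * poly \<Psi> t ^ j))"
    proof (rule dvd_sum, clarify)
      fix i j assume z: "(i,j) \<in> I"
      have "int p ^ E dvd \<phi> (c (i,j)) - (\<phi> (c1 (i,j)) - \<phi> (c2 (i,j)))"
        unfolding c_def by (rule residue_map_diff[OF r' inOK[OF z]])
      moreover have "int p ^ E dvd \<phi> y ^ j - poly \<Psi> t ^ j"
        using dvd_trans[OF yt poly_diff_dvd[of "\<phi> y" "poly \<Psi> t" "monom 1 j"]] by (simp add: poly_monom)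
      ultimately show "int p ^ E dvd \<phi> (c (i,j)) * (\<phi> x ^ i * \<phi> y ^ j) - (\<phi> (c1 (i,j)) - \<phi> (c2 (i,j))) * (\<phi> x ^ i * poly \<Psi> t ^ j)"
        by (intro dvd_mult_diff) auto
    qed
    hence 2: "int p ^ E dvd eval2 (mkp I (\<lambda>z. \<phi> (c z))) (\<phi> x) (\<phi> y) - poly P t"
      unfolding Pval eval2_mkp by (simp add: case_prod_unfold sum_subtractf t_def)
    have "(int p ^ k) ^ s dvd poly P t" using Pdvd cl(1) unfolding t_def by (rule poly_dvd_by_weights)
    hence 3: "int p ^ E dvd poly P t" by (simp add: E_def power_mult)
    have "int p ^ E dvd \<phi> (eval2 (mkp I c) x y)" using dvd_add[OF dvd_add[OF 1 2] 3] by simp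
    moreover have inO: "eval2 (mkp I c) x y \<in> OK" unfolding eval2_mkp using cOK xy by (intro OK_sum) auto
    ultimately have dN: "int (p ^ E) dvd Nm (eval2 (mkp I c) x y)" using r' unfolding residue_map_def by simp
    have "house (eval2 (mkp I c) x y) \<le> card I * (Ck * \<Lambda>)"
    proof (rule house_mkp[OF I(1) xy(3,4)])
      fix i j assume z: "(i,j) \<in> I"
      have "house (c (i,j)) \<le> Ck * L (i,j)" unfolding c_def by (rule Box(4)[OF L0 inBox[OF z]])
      hence "house (c (i,j)) * B ^ (i + j) \<le> Ck * L (i,j) * B ^ (i + j)" using B by (intro mult_right_mono) auto
      thus "house (c (i,j)) * B ^ (i + j) \<le> Ck * \<Lambda>" using B by (simp add: L_def)
    qed
    hence "Ck * house (eval2 (mkp I c) x y) ^ n \<le> Ck * (card I * (Ck * \<Lambda>)) ^ n"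
      using Ck by (intro mult_left_mono power_mono house_nonneg) auto
    also have "\<dots> < q ^ card I" by (rule L(2))
    also have "q ^ card I = real (p ^ E)" unfolding q E_def s_def by (simp add: power_mult)
    finally show "eval2 (mkp I c) x y = 0" by (rule Nm_small_imp_zero[OF inO dN])
  qed
qed

end

text \<open>With \<open>s\<close> monomials of total degree \<open>w\<close> and \<open>\<Lambda> ^ n = q ^ s / (2 * Ck * (s * Ck) ^ n)\<close>, the last claim reduces
  to the bound \<open>(s - 1) / (2 * d) + d + 1 / 2\<close> for the mean degree \<open>w / s\<close>, where \<open>d = a + b\<close>.\<close>

lemma parameter_choice:
  fixes Ck B q :: real
  assumes n: "n > 0" and Ck: "Ck \<ge> 1" and B: "B \<ge> 1" and d: "1 \<le> a + b" "a + b \<le> D" and BD: "ln B \<le> real D"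
    and q: "q > 0" "ln q \<ge> real n * ln B / real (a + b) + (8 * real n + 2 * ln (2 * Ck) + 2 * real n * ln Ck)"
  obtains \<Lambda> where "\<Lambda> > 0" "Ck * (real (card (red a b D)) * (Ck * \<Lambda>)) ^ n < q ^ card (red a b D)"
    "q ^ (card (red a b D) * (card (red a b D) + 1) div 2) * B ^ (n * (\<Sum>(i,j)\<in>red a b D. i + j)) \<le> \<Lambda> ^ (n * card (red a b D))"
proof -
  define s where "s = card (red a b D)"
  define w where "w = (\<Sum>(i,j)\<in>red a b D. i + j)"
  define \<delta> where "\<delta> = real (a + b)"
  define l where "l = ln B"
  define y where "y = 2 * real D - \<delta> + 3"
  have \<delta>1: "\<delta> \<ge> 1" "\<delta> \<le> real D" using d unfolding \<delta>_def by linarith+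
  have s: "2 * real s = \<delta> * y" using card_red(2)[OF d(2)] unfolding s_def y_def \<delta>_def .
  have w: "2 * real w \<le> \<delta> * real D * (real D + 1)"
    using sum_red_le[OF d] unfolding w_def \<delta>_def by (simp add: case_prod_unfold)
  have y3: "y \<ge> real D + 3" using \<delta>1 unfolding y_def by linarith
  have y0: "y > 0" using y3 by linarith
  have "\<delta> * (real D + 3) \<le> \<delta> * y" using y3 \<delta>1 by (intro mult_left_mono) auto
  hence s_ge: "2 * real s \<ge> \<delta> * real D + 3 * \<delta>" using s by (simp add: algebra_simps)
  have dD: "\<delta> * real D \<ge> 1" using mult_mono[of 1 \<delta> 1 "real D"] \<delta>1 by simp
  have s2: "real s \<ge> 2" using s_ge dD \<delta>1 by linarith
  have l0: "l \<ge> 0" "l \<le> real D" using B BD unfolding l_def by auto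
  define M where "M = 2 * Ck * (real s * Ck) ^ n"
  \<comment> \<open>Of the s^2 powers of q gained, s (s + 1) / 2 are spent on the labels. The
    remaining s (s - 1) / 2 are u for each monomial, so all losses are bounded by multiples of
    \<open>u\<close>.\<close>
  define u where "u = (real s - 1) / 2"
  define v where "v = l / \<delta>"
  have M0: "M > 0" unfolding M_def using Ck s2 by simp
  define \<Lambda> where "\<Lambda> = root n (q ^ s / M)"
  have \<Lambda>n: "\<Lambda> ^ n = q ^ s / M" unfolding \<Lambda>_def using n q(1) M0 by simp
  have L0: "\<Lambda> > 0" unfolding \<Lambda>_def using n q(1) M0 by simp
  have "Ck * (real s * (Ck * \<Lambda>)) ^ n = Ck * (real s * Ck) ^ n * \<Lambda> ^ n" by (simp add: power_mult_distrib)
  also have "\<dots> = q ^ s / 2" unfolding \<Lambda>n M_def using Ck s2 by (simp add: field_simps)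
  also have "\<dots> < q ^ s" using q(1) by simp
  finally have 1: "Ck * (real s * (Ck * \<Lambda>)) ^ n < q ^ s" .
  have lnM: "ln M = ln (2 * Ck) + real n * (ln (real s) + ln Ck)"
    unfolding M_def using Ck s2 by (simp add: ln_mult ln_realpow)
  have "ln (real s) \<le> real s - 1" using s2 by (intro ln_le_minus_one) auto
  moreover have "0 \<le> ln Ck" "0 \<le> ln (2 * Ck)" using Ck by simp_all
  moreover have "ln Ck \<le> (real s - 1) * ln Ck" "ln (2*Ck) \<le> (real s - 1) * ln (2*Ck)"
    using s2 calculation(2,3) mult_right_mono[of 1 "real s - 1"] by simp_all
  ultimately have "ln M \<le> (real s - 1) * ln (2*Ck) + real n * ((real s - 1) + (real s - 1) * ln Ck)"
    unfolding lnM by (intro add_mono mult_left_mono) auto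
  hence lnM': "ln M \<le> (real s - 1) / 2 * (2 * real n + 2 * ln (2*Ck) + 2 * real n * ln Ck)" by (simp add: algebra_simps)
  have ws: "real w / real s \<le> real D * (real D + 1) / y"
  proof -
    have "2 * real w * y \<le> (\<delta> * real D * (real D + 1)) * y" using w y0 by (intro mult_right_mono) auto
    also have "\<dots> = real D * (real D + 1) * (2 * real s)" unfolding s by simp
    finally have "real w * y \<le> real D * (real D + 1) * real s" by simp
    thus ?thesis using y0 s2 by (simp add: field_simps)
  qed
  have "4 * real D * (real D + 1) \<le> y * y + 4 * real D * \<delta>"
  proof -
    have "4 * real D * (real D + 1) = y * y + 4 * real D * \<delta> - 8 * real D - (3 - \<delta>) * (3 - \<delta>)" unfolding y_def by (simp add: algebra_simps)
    thus ?thesis using zero_le_square[of "3 - \<delta>"] by linarith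
  qed
  also have "\<dots> \<le> y * y + 4 * \<delta> * y" using mult_right_mono[of "real D" y \<delta>] y3 \<delta>1 by (simp add: algebra_simps)
  also have "\<dots> = 4 * ((y / 4 + \<delta>) * y)" by (simp add: distrib_right)
  finally have "real D * (real D + 1) \<le> (y / 4 + \<delta>) * y" by simp
  hence "real D * (real D + 1) / y \<le> y / 4 + \<delta>" by (subst pos_divide_le_eq[OF y0])
  with ws have ws': "real w / real s \<le> y / 4 + \<delta>" by linarith
  have sd: "(real s - 1) / (2 * \<delta>) = y / 4 - 1 / (2 * \<delta>)" 
  proof -
    have s': "real s = \<delta> * y / 2" using s by simp
    show ?thesis unfolding s' using \<delta>1 by (simp add: diff_divide_distrib)
  qed
  have "1 / (2 * \<delta>) \<le> 1 / 2" using \<delta>1 by (simp add: field_simps)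
  hence "real w / real s \<le> (real s - 1) / (2 * \<delta>) + \<delta> + 1 / 2" using ws' sd by linarith
  hence "real w / real s * l \<le> ((real s - 1) / (2 * \<delta>) + \<delta> + 1 / 2) * l" using l0 by (intro mult_right_mono)
  also have "\<dots> = (real s - 1) / (2 * \<delta>) * l + (\<delta> + 1 / 2) * l" by (simp add: algebra_simps)
  \<comment> \<open>Here ln B \<le> D enters: the excess over the ideal mean degree costs O(\<delta>
    D) = O(s), which a bounded multiple of \<open>u\<close> absorbs.\<close>
  also have "(\<delta> + 1 / 2) * l \<le> (3 / 2 * \<delta>) * real D" using \<delta>1 l0 by (intro mult_mono) auto
  also have "\<dots> = 3 / 2 * (\<delta> * real D)" by simp
  also have "\<dots> \<le> u * 6"
  proof -
    have "3 / 2 * e \<le> u * 6" if "e + 3 * \<delta> \<le> 2 * real s" for e using that \<delta>1(1) unfolding u_def by simp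
    from this[OF s_ge] show ?thesis .
  qed
  also have "(real s - 1) / (2 * \<delta>) * l = u * v" by (simp add: u_def v_def)
  finally have 2: "real w / real s * l \<le> u * (v + 6)" by (simp add: distrib_left)
  have "real n * (real w / real s * l) + ln M \<le> real n * (u * (v + 6)) + u * (2 * real n + 2 * ln (2*Ck) + 2 * real n * ln Ck)"
    using 2 lnM' unfolding u_def[symmetric] by (intro add_mono mult_left_mono) auto
  \<comment> \<open>The term 8 n is 6 n from the mean degree plus 2 n from ln s \<le> s - 1.\<close>
  also have "\<dots> = u * (real n * v + (8 * real n + 2 * ln (2 * Ck) + 2 * real n * ln Ck))" by (simp add: algebra_simps)
  also have "\<dots> \<le> u * ln q" using q(2) s2 unfolding l_def \<delta>_def u_def v_def by (intro mult_left_mono) auto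
  finally have 3: "real n * (real w / real s * l) + ln M \<le> u * ln q" .
  have 4: "real n * real w * l + real s * ln M \<le> real s * (real s - 1) / 2 * ln q"
    using mult_left_mono[OF 3, of "real s"] s2 unfolding u_def by (simp add: algebra_simps)
  have hs: "real (s * (s + 1) div 2) = real s * (real s + 1) / 2" by (subst real_of_nat_div) (auto simp: algebra_simps)
  have "ln (q ^ (s * (s + 1) div 2) * B ^ (n * w) * M ^ s) = real (s * (s + 1) div 2) * ln q + real (n * w) * l + real s * ln M"
    using q(1) B M0 unfolding l_def by (simp add: ln_mult ln_realpow)
  also have "\<dots> \<le> real s * real s * ln q" using 4 unfolding hs by (simp add: field_simps)
  also have "\<dots> = ln (q ^ (s * s))" using q(1) by (simp add: ln_realpow)
  finally have "q ^ (s * (s + 1) div 2) * B ^ (n * w) * M ^ s \<le> q ^ (s * s)" 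
    by (subst (asm) ln_le_cancel_iff) (use q(1) B M0 in simp_all)
  hence 5: "q ^ (s * (s + 1) div 2) * B ^ (n * w) \<le> q ^ (s * s) / M ^ s" using M0 by (subst pos_le_divide_eq) simp_all
  have 6: "q ^ (s * s) / M ^ s = \<Lambda> ^ (n * s)"
    unfolding power_mult[of \<Lambda>] \<Lambda>n power_divide by (simp only: power_mult[of q])
  show ?thesis by (rule that[OF L0 1[unfolded s_def] 5[unfolded 6, unfolded s_def w_def]])
qed

section \<open>Points that are nonsingular modulo a prime\<close>

lemma pderiv_mkp: "eval2 (pderiv (mkp I c)) x y = (\<Sum>(i,j)\<in>I. of_nat j * c (i,j) * (x ^ i * y ^ (j - 1)))"
  for c :: "nat \<times> nat \<Rightarrow> 'a::idom"
proof -
  have "pderiv (mkp I c) = (\<Sum>(i,j)\<in>I. monom (monom (of_nat j * c (i,j)) i) (j - 1))"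
  proof -
    have "pderiv (mkp I c) = (\<Sum>z\<in>I. pderiv (case z of (i,j) \<Rightarrow> monom (monom (c (i,j)) i) j))" unfolding mkp_def
      by (induction I rule: infinite_finite_induct) (auto simp: pderiv_add)
    \<comment> \<open>For j = 0 the truncated exponent j - 1 does no harm because of the factor
      j.\<close>
    also have "\<dots> = (\<Sum>(i,j)\<in>I. monom (monom (of_nat j * c (i,j)) i) (j - 1))"
      by (intro sum.cong refl) (auto simp: pderiv_monom of_nat_poly smult_monom)
    finally show ?thesis .
  qed
  thus ?thesis by (simp add: eval2_sum case_prod_unfold eval2_monom mult.assoc)
qed

lemma residue_map_of_nat:
  assumes "residue_map Nm p E \<phi>" "x \<in> OK" shows "int p ^ E dvd \<phi> (of_nat m * x) - int m * \<phi> x"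
  using residue_map_sum[OF assms(1), of "{..<m}" "\<lambda>_. x"] assms(2) by simp

lemma residue_map_pderiv_mkp:
  assumes r: "residue_map Nm p E \<phi>" and I: "finite I" "\<And>z. z \<in> I \<Longrightarrow> c z \<in> OK" and xy: "x \<in> OK" "y \<in> OK"
  shows "int p ^ E dvd \<phi> (eval2 (pderiv (mkp I c)) x y) - eval2 (pderiv (mkp I (\<lambda>z. \<phi> (c z)))) (\<phi> x) (\<phi> y)"
proof -
  have tm: "int p ^ E dvd \<phi> (of_nat j * c (i,j) * (x ^ i * y ^ (j - 1))) - (int j * \<phi> (c (i,j))) * (\<phi> x ^ i * \<phi> y ^ (j - 1))" if z: "(i,j) \<in> I" for i j
  proof -
    have c: "c (i,j) \<in> OK" "x ^ i \<in> OK" "y ^ (j - 1) \<in> OK" "x ^ i * y ^ (j - 1) \<in> OK" "of_nat j * c (i,j) \<in> OK"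
      using I(2)[OF z] xy by auto
    have 1: "int p ^ E dvd \<phi> (of_nat j * c (i,j) * (x ^ i * y ^ (j - 1))) - \<phi> (of_nat j * c (i,j)) * \<phi> (x ^ i * y ^ (j - 1))"
      by (rule residue_map_mult[OF r c(5,4)])
    have "int p ^ E dvd \<phi> (x ^ i * y ^ (j - 1)) - \<phi> (x ^ i) * \<phi> (y ^ (j - 1))"
      by (rule residue_map_mult[OF r c(2,3)])
    moreover have "int p ^ E dvd \<phi> (x ^ i) * \<phi> (y ^ (j - 1)) - \<phi> x ^ i * \<phi> y ^ (j - 1)"
      by (rule dvd_mult_diff[OF residue_map_power[OF r xy(1)] residue_map_power[OF r xy(2)]])
    ultimately have "int p ^ E dvd (\<phi> (x ^ i * y ^ (j - 1)) - \<phi> (x ^ i) * \<phi> (y ^ (j - 1))) + (\<phi> (x ^ i) * \<phi> (y ^ (j - 1)) - \<phi> x ^ i * \<phi> y ^ (j - 1))" by (rule dvd_add)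
    hence "int p ^ E dvd \<phi> (x ^ i * y ^ (j - 1)) - \<phi> x ^ i * \<phi> y ^ (j - 1)" by simp
    from dvd_mult_diff[OF residue_map_of_nat[OF r c(1), of j] this] 1
    have "int p ^ E dvd (\<phi> (of_nat j * c (i,j) * (x ^ i * y ^ (j - 1))) - \<phi> (of_nat j * c (i,j)) * \<phi> (x ^ i * y ^ (j - 1))) +
       (\<phi> (of_nat j * c (i,j)) * \<phi> (x ^ i * y ^ (j - 1)) - (int j * \<phi> (c (i,j))) * (\<phi> x ^ i * \<phi> y ^ (j - 1)))" by (intro dvd_add)
    thus ?thesis by simp
  qed
  let ?f = "\<lambda>(i,j). of_nat j * c (i,j) * (x ^ i * y ^ (j - 1))"
  have s: "int p ^ E dvd \<phi> (sum ?f I) - (\<Sum>z\<in>I. \<phi> (?f z))"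
    by (rule residue_map_sum[OF r I(1)]) (use I(2) xy in auto)
  have "int p ^ E dvd (\<Sum>z\<in>I. \<phi> (?f z) - (case z of (i,j) \<Rightarrow> int j * \<phi> (c (i,j)) * (\<phi> x ^ i * \<phi> y ^ (j - 1))))"
    by (rule dvd_sum) (use tm in auto)
  hence "int p ^ E dvd (\<Sum>z\<in>I. \<phi> (?f z)) - (\<Sum>(i,j)\<in>I. int j * \<phi> (c (i,j)) * (\<phi> x ^ i * \<phi> y ^ (j - 1)))"
    by (simp only: sum_subtractf)
  from dvd_add[OF s this] show ?thesis by (simp add: pderiv_mkp)
qed

lemma card_le_fibres:
  assumes W: "finite W" "f ` A \<subseteq> W" and b: "\<And>w. w \<in> W \<Longrightarrow> finite {a\<in>A. f a = w} \<and> card {a\<in>A. f a = w} \<le> m"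
  shows "finite A" "card A \<le> card W * m"
proof -
  have A: "A \<subseteq> (\<Union>w\<in>W. {a\<in>A. f a = w})" using W(2) by auto
  have fin: "finite (\<Union>w\<in>W. {a\<in>A. f a = w})" by (rule finite_UN_I[OF W(1)]) (drule b, erule conjunct1)
  show "finite A" by (rule finite_subset[OF A fin])
  have "card A \<le> card (\<Union>w\<in>W. {a\<in>A. f a = w})" by (rule card_mono[OF fin A])
  also have "\<dots> \<le> (\<Sum>w\<in>W. card {a\<in>A. f a = w})" by (rule card_UN_le[OF W(1)])
  also have "\<dots> \<le> (\<Sum>w\<in>W. m)" by (rule sum_mono) (drule b, erule conjunct2)
  finally show "card A \<le> card W * m" by simp
qed

context residue_supply
begin

text \<open>The image of F modulo p^E is monic in X2, so over each of the p^k first residues it has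
  at most d nonsingular second residues, hence at most p^k d classes in all. On each class a
  polynomial supported on \<open>red a b D\<close> vanishes, and its intersection with F has at most
  d (d D) points. The exponent E = k s is fixed inside the proof by the number s of monomials
  used.\<close>

lemma nonsingular_points_le:
  fixes F :: "'a poly poly"
  assumes F: "irreducible F" "lead_coeff F = 1" "integral_coeffs F"
    and p: "prime p" and k: "k \<ge> 1" and D: "total_degree F \<le> D" "ln B \<le> real D" "1 \<le> total_degree F" and B: "B \<ge> 1"
    and q: "ln (real p ^ k) \<ge> real n * ln B / real (total_degree F) + (8 * real n + 2 * ln (2 * Ck) + 2 * real n * ln Ck)"
    and r: "\<And>E. residue_map Nm p E (\<phi> E)"
  shows "\<exists>E. k \<le> E \<and> card {(x,y)\<in>integral_zeros F B. \<not> int p dvd \<phi> E (eval2 (pderiv F) x y)}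
     \<le> p ^ k * total_degree F * (total_degree F * (total_degree F * D))" (is "\<exists>E. _ \<and> card (?Z E) \<le> _")
proof -
  define d where "d = total_degree F"
  have F0: "F \<noteq> 0" using F(2) by auto
  obtain a b where ab: "is_lm F a b" "a + b = total_degree F" by (rule ex_lm[OF F0])
  define I where "I = red a b D"
  define E where "E = k * card I"
  have p0: "p > 0" using prime_gt_0_nat[OF p] .
  have pp: "prime (int p)" using p by simp
  have q0: "real p ^ k > 0" using p0 by simp
  have D': "1 \<le> a + b" "a + b \<le> D" using D ab(2) by simp_all
  obtain \<Lambda> where \<Lambda>: "\<Lambda> > 0" "Ck * (real (card I) * (Ck * \<Lambda>)) ^ n < (real p ^ k) ^ card I"
    "(real p ^ k) ^ (card I * (card I + 1) div 2) * B ^ (n * (\<Sum>(i,j)\<in>I. i + j)) \<le> \<Lambda> ^ (n * card I)"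
    unfolding I_def by (rule parameter_choice[OF n_pos Ck B D' D(2) q0 q[folded ab(2)]]) blast
  have I0: "finite I" unfolding I_def by simp
  have "2 * real (card I) = real (a + b) * (2 * real D - real (a + b) + 3)" unfolding I_def by (rule card_red(2)) (use ab(2) D in simp)
  moreover have "real (a + b) * (2 * real D - real (a + b) + 3) > 0" using ab(2) D by (intro mult_pos_pos) linarith+
  ultimately have "real (card I) > 0" by linarith
  hence I1: "I \<noteq> {}" by auto
  hence cI: "card I \<ge> 1" using I0 by (simp add: Suc_le_eq card_gt_0_iff)
  have kE: "k \<le> E" unfolding E_def using cI by simp
  define \<psi> where "\<psi> = \<phi> E"
  have r: "residue_map Nm p (k * card I) \<psi>" using r[of E] by (simp add: E_def \<psi>_def)
  hence r': "residue_map Nm p E \<psi>" by (simp add: E_def)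
  have \<psi>01: "\<psi> 0 = 0" "\<psi> 1 = 1" using r by (simp_all add: residue_map_def)
  define T where "T = tri d"
  define fc where "fc = (\<lambda>(i,j). cf F i j)"
  have F_eq: "F = mkp T fc" unfolding fc_def T_def d_def 
  proof (rule mkp_cf)
    show "(i,j) \<in> tri (total_degree F)" if "cf F i j \<noteq> 0" for i j using total_degree_ge[OF that] by (simp add: tri_def)
  qed simp
  have fcO: "fc z \<in> OK" for z using F(3) by (cases z) (auto simp: fc_def cf_def integral_coeffs_def)
  define G where "G = mkp T (\<lambda>z. \<psi> (fc z))"
  have T0: "finite T" unfolding T_def by simp
  have cfG: "cf G i j = \<psi> (cf F i j)" for i j
  proof (cases "(i,j) \<in> T")
    case True thus ?thesis unfolding G_def by (simp add: cf_mkp[OF T0] fc_def)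
  next
    case False
    hence "cf F i j = 0" unfolding T_def tri_def d_def using total_degree_ge[of F i j] by auto
    thus ?thesis using False \<psi>01 unfolding G_def by (simp add: cf_mkp[OF T0])
  qed
  have coG: "coeff (coeff G j) i = \<psi> (coeff (coeff F j) i)" for i j using cfG[of i j] by (simp add: cf_def)
  \<comment> \<open>Residue maps send 0 and 1 to 0 and 1 exactly, not only modulo p^E, so G keeps
    the degree and the leading coefficient of F.\<close>
  have c1: "coeff G (degree F) = 1"
    by (rule poly_eqI) (use F(2) \<psi>01 in \<open>auto simp: coG\<close>)
  have "degree G \<le> degree F"
    by (rule degree_le) (auto intro!: poly_eqI simp: coG coeff_eq_0 \<psi>01)
  hence dG: "degree G = degree F" using c1 le_degree[of G "degree F"] by simp
  have lG: "lead_coeff G = 1" using c1 dG by simp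
  have Gv: "int p ^ E dvd eval2 G (\<psi> x) (\<psi> y)" if "(x,y) \<in> integral_zeros F B" for x y
  proof -
    have xy: "x \<in> OK" "y \<in> OK" "eval2 F x y = 0" using that by (auto simp: integral_zeros_def)
    have "int p ^ E dvd \<psi> (eval2 (mkp T fc) x y) - eval2 G (\<psi> x) (\<psi> y)" unfolding G_def
      by (rule residue_map_mkp[OF r' T0 fcO xy(1,2)])
    thus ?thesis unfolding F_eq[symmetric] xy(3) \<psi>01 by simp
  qed
  have Gp: "int p dvd \<psi> (eval2 (pderiv F) x y) - eval2 (pderiv G) (\<psi> x) (\<psi> y)" if "(x,y) \<in> integral_zeros F B" for x y
  proof -
    have xy: "x \<in> OK" "y \<in> OK" using that by (auto simp: integral_zeros_def)
    have "int p ^ E dvd \<psi> (eval2 (pderiv (mkp T fc)) x y) - eval2 (pderiv G) (\<psi> x) (\<psi> y)" unfolding G_def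
      by (rule residue_map_pderiv_mkp[OF r' T0 fcO xy])
    hence 1: "int p ^ E dvd \<psi> (eval2 (pderiv F) x y) - eval2 (pderiv G) (\<psi> x) (\<psi> y)" by (simp only: F_eq[symmetric])
    have "int p dvd int p ^ E" using kE k by (intro dvd_power) auto
    thus ?thesis by (rule dvd_trans[OF _ 1])
  qed
  define m where "m = p ^ k"
  have m0: "m > 0" using p0 by (simp add: m_def)
  have m_dvd: "int m dvd int p ^ E" unfolding m_def using kE by (simp add: le_imp_power_dvd)
  have p_m: "int p dvd int m" unfolding m_def using k by (simp add: dvd_power)
  define cl where "cl = (\<lambda>(x,y). (\<psi> x mod int m, \<psi> y mod int m))"
  define S where "S \<alpha> = {s\<in>{0..<int m}. int m dvd eval2 G \<alpha> s \<and> \<not> int p dvd eval2 (pderiv G) \<alpha> s}" for \<alpha>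
  define W where "W = (SIGMA \<alpha>:{0..<int m}. S \<alpha>)"
  have cS: "card (S \<alpha>) \<le> d" for \<alpha>
  proof -
    have "card (S \<alpha>) \<le> degree G" by (rule residues_in_fibre[OF pp lG _ k]) (auto simp: S_def m_def)
    thus ?thesis using dG degree_le_total_degree[OF F0] by (simp add: d_def)
  qed
  have finS: "finite (S \<alpha>)" for \<alpha> unfolding S_def by (rule finite_subset[of _ "{0..<int m}"]) auto
  have finW: "finite W" unfolding W_def using finS by auto
  have "card W = (\<Sum>\<alpha>\<in>{0..<int m}. card (S \<alpha>))" unfolding W_def using finS by (subst card_SigmaI) auto
  also have "\<dots> \<le> (\<Sum>\<alpha>\<in>{0..<int m}. d)" by (rule sum_mono) (rule cS)
  finally have cW: "card W \<le> m * d" by simp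
  have modm: "int m dvd u - u mod int m" for u by (simp add: minus_mod_eq_mult_div)
  have modm': "int m dvd u mod int m - u" for u using modm[of u] by (simp add: dvd_diff_commute)
  have evm: "int m dvd eval2 H (u mod int m) (v mod int m) - eval2 H u v" for H u v
    by (rule eval2_cong[OF modm' modm'])
  have img: "cl ` ?Z E \<subseteq> W"
  proof (rule image_subsetI)
    fix z assume "z \<in> ?Z E"
    then obtain x y where zxy: "z = (x,y)" and z: "(x,y) \<in> integral_zeros F B" and ns: "\<not> int p dvd \<phi> E (eval2 (pderiv F) x y)"
      by auto
    have "int m dvd eval2 G (\<psi> x) (\<psi> y)" using dvd_trans[OF m_dvd Gv[OF z]] .
    hence 1: "int m dvd eval2 G (\<psi> x mod int m) (\<psi> y mod int m)"
      using dvd_iff_if_dvd_diff[OF evm] by blast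
    have "\<not> int p dvd eval2 (pderiv G) (\<psi> x) (\<psi> y)" using ns dvd_iff_if_dvd_diff[OF Gp[OF z]] by (simp add: \<psi>_def)
    hence 2: "\<not> int p dvd eval2 (pderiv G) (\<psi> x mod int m) (\<psi> y mod int m)"
      using dvd_iff_if_dvd_diff[OF dvd_trans[OF p_m evm]] by blast
    show "cl z \<in> W" using 1 2 m0 unfolding zxy cl_def W_def S_def by simp
  qed
  have fib: "finite {z\<in>?Z E. cl z = w} \<and> card {z\<in>?Z E. cl z = w} \<le> d * (d * D)" if w: "w \<in> W" for w
  proof -
    obtain \<alpha> \<beta> where ab': "w = (\<alpha>,\<beta>)" by (cases w)
    have ns: "\<not> int p dvd eval2 (pderiv G) \<alpha> \<beta>" using w unfolding ab' W_def S_def by simp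
    obtain c where c: "\<exists>z\<in>I. c z \<noteq> (0::'a)"
      "\<And>x y. x \<in> OK \<Longrightarrow> y \<in> OK \<Longrightarrow> house x \<le> B \<Longrightarrow> house y \<le> B \<Longrightarrow> int p ^ k dvd \<psi> x - \<alpha> \<Longrightarrow> int p ^ k dvd \<psi> y - \<beta> \<Longrightarrow>
       int p ^ (k * card I) dvd eval2 G (\<psi> x) (\<psi> y) \<Longrightarrow> eval2 (mkp I c) x y = 0"
      by (rule auxiliary_polynomial[OF p k ns I0 I1 r B refl \<Lambda>]) blast
    define H where "H = mkp I c"
    have H0: "H \<noteq> 0"
    proof
      assume h: "H = 0"
      obtain i j where ij: "(i,j) \<in> I" "c (i,j) \<noteq> 0" using c(1) by auto
      have "cf H i j = c (i,j)" unfolding H_def using ij by (simp add: cf_mkp[OF I0])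
      thus False using ij h by simp
    qed
    have nd: "\<not> F dvd H"
    proof
      assume "F dvd H"
      from dvd_lm[OF ab(1) this H0] obtain i j where ij: "i \<ge> a" "j \<ge> b" "cf H i j \<noteq> 0" by blast
      hence "(i,j) \<in> I" unfolding H_def cf_mkp[OF I0] by (auto split: if_splits)
      thus False using ij unfolding I_def red_def by auto
    qed
    have HD: "i + j \<le> D" if "cf H i j \<noteq> 0" for i j
    proof -
      have "(i,j) \<in> I" using that unfolding H_def cf_mkp[OF I0] by (auto split: if_splits)
      thus ?thesis unfolding I_def red_def by auto
    qed
    note bz = bezout_bound[OF F(1,2) nd HD]
    have sub: "{z\<in>?Z E. cl z = w} \<subseteq> {(x,y). eval2 F x y = 0 \<and> eval2 H x y = 0}"
    proof
      fix z assume "z \<in> {z\<in>?Z E. cl z = w}"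
      then obtain x y where zxy: "z = (x,y)" and z: "(x,y) \<in> integral_zeros F B" and cl: "cl (x,y) = w" by auto
      have xy: "x \<in> OK" "y \<in> OK" "house x \<le> B" "house y \<le> B" "eval2 F x y = 0" using z by (auto simp: integral_zeros_def)
      have "int p ^ k dvd \<psi> x - \<alpha>" "int p ^ k dvd \<psi> y - \<beta>"
        using cl modm[of "\<psi> x"] modm[of "\<psi> y"] unfolding cl_def ab' m_def by auto
      hence "eval2 H x y = 0" unfolding H_def using c(2)[OF xy(1-4)] Gv[OF z] unfolding E_def by blast
      thus "z \<in> {(x,y). eval2 F x y = 0 \<and> eval2 H x y = 0}" using xy zxy by simp
    qed
    show ?thesis using finite_subset[OF sub bz(1)] card_mono[OF bz(1) sub] bz(2) unfolding d_def by linarith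
  qed
  have "card (?Z E) \<le> card W * (d * (d * D))" by (rule card_le_fibres(2)[OF finW img fib])
  also have "\<dots> \<le> m * d * (d * (d * D))" by (intro mult_right_mono cW) simp
  finally show ?thesis using kE unfolding m_def d_def by blast
qed

end

section \<open>A multiple of bounded height and the primes at which a point is singular\<close>

lemma integral_zerosD:
  "(x,y) \<in> integral_zeros F B \<Longrightarrow> x \<in> OK" "(x,y) \<in> integral_zeros F B \<Longrightarrow> y \<in> OK"
  "(x,y) \<in> integral_zeros F B \<Longrightarrow> eval2 F x y = 0"
  "(x,y) \<in> integral_zeros F B \<Longrightarrow> house x \<le> B" "(x,y) \<in> integral_zeros F B \<Longrightarrow> house y \<le> B"
  by (simp_all add: integral_zeros_def)

lemma irreducible_degree_pos:
  fixes F :: "'a::field poly poly"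
  assumes "irreducible F" "lead_coeff F = 1" shows "degree F \<ge> 1"
proof (rule ccontr)
  assume "\<not> degree F \<ge> 1"
  hence "degree F = 0" by simp
  hence "F = [:1:]" using assms(2) degree_0_id[of F] by simp
  thus False using assms(1) by (simp add: Factorial_Ring.irreducible_def one_pCons[symmetric])
qed

context residue_supply
begin

lemma finite_integral_zeros: "B \<ge> 1 \<Longrightarrow> finite (integral_zeros F B :: ('a \<times> 'a) set)"
  by (rule finite_subset[of _ "{x\<in>OK. house x \<le> B} \<times> {x\<in>OK. house x \<le> B}"])
    (use count(1)[of B] in \<open>auto simp: integral_zeros_def\<close>)

text \<open>A bound as in Siegel's lemma for the coefficients of a polynomial of degree d that
  vanishes at the zeros: the base is the growth from a coefficient to a value, and the exponent is
  the number of unknowns.\<close>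

definition Lam :: "nat \<Rightarrow> real \<Rightarrow> real" where
  "Lam d B = (Ck * (real (card (tri d)) * (Ck * B ^ d))) ^ card (tri d)"

lemma card_tri_pos: "card (tri d) \<ge> 1"
proof -
  have "(0,0) \<in> tri d" by (simp add: tri_def)
  hence "tri d \<noteq> {}" by blast
  thus ?thesis by (simp add: Suc_le_eq card_gt_0_iff)
qed

lemma Lam_ge_1: "B \<ge> 1 \<Longrightarrow> Lam d B \<ge> 1"
proof -
  assume B: "B \<ge> 1"
  have "1 \<le> Ck * B ^ d" using mult_mono[of 1 Ck 1 "B ^ d"] Ck one_le_power[OF B, of d] by simp
  hence "1 \<le> real (card (tri d)) * (Ck * B ^ d)" using mult_mono[of 1 "real (card (tri d))" 1 "Ck * B ^ d"] card_tri_pos[of d] by simp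
  hence "1 \<le> Ck * (real (card (tri d)) * (Ck * B ^ d))" using mult_mono[of 1 Ck 1 "real (card (tri d)) * (Ck * B ^ d)"] Ck by simp
  thus ?thesis unfolding Lam_def by (rule one_le_power)
qed

text \<open>The vectors of coefficients in \<open>Box \<Lambda>\<close> outnumber their possible values at fewer than
  \<open>card (tri d)\<close> zeros of \<open>F\<close> that impose the same conditions as all zeros; the difference of two
  of them is a form vanishing at all zeros, hence either cuts out few of them or is a multiple of \<open>F\<close>.\<close>

lemma few_zeros_or_small_multiple:
  fixes F :: "'a poly poly"
  assumes F: "irreducible F" "lead_coeff F = 1" "integral_coeffs F" and B: "B \<ge> 1"
  shows "card (integral_zeros F B) \<le> total_degree F * (total_degree F * total_degree F) \<or>
     (\<exists>c. c \<noteq> 0 \<and> c \<in> OK \<and> (\<forall>i j. house (c * cf F i j) \<le> Ck * Lam (total_degree F) B))"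
proof -
  define d where "d = total_degree F"
  define I where "I = tri d"
  define Z where "Z = integral_zeros F B"
  define M where "M = card I"
  define v where "v = (\<lambda>(x::'a,y) (i,j). x ^ i * y ^ j)"
  define \<Lambda> where "\<Lambda> = Lam d B"
  have finI: "finite I" unfolding I_def by simp
  have finZ: "finite Z" unfolding Z_def by (rule finite_integral_zeros[OF B])
  have M1: "M \<ge> 1" unfolding M_def I_def by (rule card_tri_pos)
  have L1: "\<Lambda> \<ge> 1" unfolding \<Lambda>_def by (rule Lam_ge_1[OF B])
  hence L0: "\<Lambda> \<ge> 0" by simp
  have F0: "F \<noteq> 0" using F(2) by auto
  have F_eq: "F = mkp I (\<lambda>(i,j). cf F i j)"
  proof (rule mkp_cf)
    show "(i,j) \<in> I" if "cf F i j \<noteq> 0" for i j using total_degree_ge[OF that] by (simp add: I_def tri_def d_def)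
  qed (rule finI)
  have ev: "eval2 (mkp I c) x y = (\<Sum>z\<in>I. c z * v (x,y) z)" for c :: "nat \<times> nat \<Rightarrow> 'a" and x y
    unfolding eval2_mkp v_def by (simp add: case_prod_unfold)
  define fc where "fc = (\<lambda>(i,j). cf F i j)"
  obtain i0 j0 where ij0: "cf F i0 j0 \<noteq> 0" "i0 + j0 = d" using total_degree_attained[OF F0] unfolding d_def by blast
  have k: "(i0,j0) \<in> I" "fc (i0,j0) \<noteq> 0" using ij0 by (auto simp: I_def tri_def fc_def)
  have vanish: "(\<Sum>i\<in>I. fc i * v z i) = 0" if "z \<in> Z" for z
  proof -
    obtain x y where z: "z = (x,y)" by (cases z)
    have "eval2 (mkp I fc) x y = 0" using F_eq that integral_zerosD(3)[of x y F B] unfolding fc_def Z_def z by simp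
    thus ?thesis unfolding ev z .
  qed
  obtain Z' where Z': "Z' \<subseteq> Z" "card Z' < card I" 
    and Zeq: "\<forall>c. (\<forall>z\<in>Z'. (\<Sum>i\<in>I. c i * v z i) = 0) \<longrightarrow> (\<forall>z\<in>Z. (\<Sum>i\<in>I. c i * v z i) = 0)"
    by (rule small_equivalent_subsystem[OF finZ finI k vanish])
  have finZ': "finite Z'" by (rule finite_subset[OF Z'(1) finZ])
  define H where "H = real M * (Ck * \<Lambda> * B ^ d)"
  have H1: "H \<ge> 1"
  proof -
    have "1 \<le> Ck * \<Lambda>" using mult_mono[of 1 Ck 1 \<Lambda>] Ck L1 by simp
    hence "1 \<le> Ck * \<Lambda> * B ^ d" using mult_mono[of 1 "Ck * \<Lambda>" 1 "B ^ d"] one_le_power[OF B, of d] by simp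
    thus ?thesis unfolding H_def using mult_mono[of 1 "real M" 1 "Ck * \<Lambda> * B ^ d"] M1 by simp
  qed
  define A where "A = (\<Pi>\<^sub>E z\<in>I. Box \<Lambda>)"
  define V where "V = {x\<in>OK. house (x::'a) \<le> H}"
  define lab where "lab c = (\<lambda>z\<in>Z'. \<Sum>i\<in>I. c i * v z i)" for c
  define Lb where "Lb = (\<Pi>\<^sub>E z\<in>Z'. V)"
  have Bp: "house (c (i,j)) * B ^ (i + j) \<le> Ck * \<Lambda> * B ^ d" if "(i,j) \<in> I" "house (c (i,j) :: 'a) \<le> Ck * \<Lambda>" for c i j
    by (intro mult_mono that(2) power_increasing B) (use that(1) Ck L1 B in \<open>auto simp: I_def tri_def\<close>)
  have labLb: "lab c \<in> Lb" if c: "c \<in> A" for c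
    unfolding lab_def Lb_def
  proof (rule restrict_PiE_iff[THEN iffD2], rule ballI)
    fix z assume z: "z \<in> Z'"
    obtain x y where xy: "z = (x,y)" by (cases z)
    have zZ: "(x,y) \<in> integral_zeros F B" using z Z'(1) unfolding xy Z_def by blast
    have cB: "c w \<in> Box \<Lambda>" if "w \<in> I" for w using c that unfolding A_def by auto
    have "house (eval2 (mkp I c) x y) \<le> real (card I) * (Ck * \<Lambda> * B ^ d)"
      by (rule house_mkp[OF finI integral_zerosD(4,5)[OF zZ]]) (rule Bp, assumption, rule Box(5)[OF L0 cB])
    moreover have "eval2 (mkp I c) x y \<in> OK" unfolding eval2_mkp
      using cB Box(2)[OF L0] integral_zerosD(1,2)[OF zZ] by (intro OK_sum) auto
    ultimately show "(\<Sum>i\<in>I. c i * v z i) \<in> V" unfolding V_def xy ev H_def M_def by simp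
  qed
  have finA: "finite A" unfolding A_def using finI Box(1)[OF L0] by (intro finite_PiE) auto
  have finV: "finite V" unfolding V_def by (rule count(1)[OF H1])
  have finLb: "finite Lb" unfolding Lb_def using finZ' finV by (intro finite_PiE) auto
  have "real (card Lb) < real (card A)"
  proof -
    have cV: "real (card V) \<le> Ck * H ^ n" unfolding V_def by (rule count(2)[OF H1])
    have "Ck * H ^ n \<ge> 1" using mult_mono[of 1 Ck 1 "H ^ n"] Ck one_le_power[OF H1, of n] by simp
    have "real (card Lb) = real (card V) ^ card Z'" unfolding Lb_def using finZ' by (simp add: card_PiE)
    also have "\<dots> \<le> (Ck * H ^ n) ^ card Z'" by (intro power_mono cV) simp
    also have "\<dots> \<le> (Ck * H ^ n) ^ (M - 1)" using Z'(2) \<open>Ck * H ^ n \<ge> 1\<close> unfolding M_def by (intro power_increasing) auto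
    also have "\<dots> \<le> ((Ck * H) ^ n) ^ (M - 1)"
    proof -
      have "Ck ^ 1 \<le> Ck ^ n" using n_pos Ck by (intro power_increasing) auto
      thus ?thesis using H1 Ck by (intro power_mono) (auto simp: power_mult_distrib intro!: mult_right_mono)
    qed
    also have "\<dots> = (Ck * (real M * (Ck * B ^ d)) * \<Lambda>) ^ (n * (M - 1))" 
    proof -
      have "Ck * H = Ck * (real M * (Ck * B ^ d)) * \<Lambda>" unfolding H_def by simp
      thus ?thesis by (simp only: power_mult)
    qed
    also have "\<dots> = ((Ck * (real M * (Ck * B ^ d))) ^ (M - 1)) ^ n * \<Lambda> ^ (n * (M - 1))"
    proof -
      have "(w * \<Lambda>) ^ (n * k) = (w ^ k) ^ n * \<Lambda> ^ (n * k)" for w :: real and k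
        by (simp add: power_mult_distrib power_mult[symmetric] mult.commute)
      thus ?thesis .
    qed
    \<comment> \<open>There are at most M - 1 conditions for M unknowns; the surplus factor
      \<Lambda>^n pays for the size of the values.\<close>
    also have "(Ck * (real M * (Ck * B ^ d))) ^ (M - 1) \<le> \<Lambda>"
    proof -
      have "1 \<le> Lam d B" by (rule Lam_ge_1[OF B])
      have "1 \<le> Ck * B ^ d" using mult_mono[of 1 Ck 1 "B ^ d"] Ck one_le_power[OF B, of d] by simp
      hence "1 \<le> real M * (Ck * B ^ d)" using mult_mono[of 1 "real M" 1 "Ck * B ^ d"] M1 by simp
      hence "1 \<le> Ck * (real M * (Ck * B ^ d))" using mult_mono[of 1 Ck 1 "real M * (Ck * B ^ d)"] Ck by simp
      thus ?thesis unfolding \<Lambda>_def Lam_def M_def I_def by (intro power_increasing) auto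
    qed
    hence "((Ck * (real M * (Ck * B ^ d))) ^ (M - 1)) ^ n * \<Lambda> ^ (n * (M - 1)) \<le> \<Lambda> ^ n * \<Lambda> ^ (n * (M - 1))"
      using L0 Ck B by (intro mult_right_mono power_mono) auto
    also have "\<dots> = \<Lambda> ^ (n * M)" using M1 by (simp add: power_add[symmetric] algebra_simps mult_eq_if)
    also have "\<dots> = (\<Prod>z\<in>I. \<Lambda> ^ n)" unfolding M_def by (simp add: power_mult)
    also have "\<dots> < (\<Prod>z\<in>I. real (card (Box \<Lambda>)))"
      by (rule prod_mono_strict[OF k(1) _ finI]) (use Box(3)[OF L0] L0 L1 le_less_trans[OF zero_le_power[OF L0] Box(3)[OF L0]] in \<open>auto intro: less_imp_le\<close>)
    also have "\<dots> = real (card A)" unfolding A_def using finI by (simp add: card_PiE)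
    finally show ?thesis .
  qed
  hence lt: "card Lb < card A" by simp
  have "\<not> inj_on lab A"
  proof
    assume "inj_on lab A"
    hence "card A \<le> card Lb" using labLb finLb by (intro card_inj_on_le) auto
    thus False using lt by simp
  qed
  then obtain c1 c2 where c12: "c1 \<in> A" "c2 \<in> A" "c1 \<noteq> c2" "lab c1 = lab c2" unfolding inj_on_def by blast
  define c where "c z = c1 z - c2 z" for z
  have inBox: "c1 z \<in> Box \<Lambda>" "c2 z \<in> Box \<Lambda>" if "z \<in> I" for z using c12 that unfolding A_def by auto
  have cOK: "c z \<in> OK" if "z \<in> I" for z unfolding c_def using inBox[OF that] Box(2)[OF L0] by blast
  have cH: "house (c z) \<le> Ck * \<Lambda>" if "z \<in> I" for z unfolding c_def by (rule Box(4)[OF L0 inBox[OF that]])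
  have "\<exists>z\<in>I. c z \<noteq> 0"
  proof (rule ccontr)
    assume "\<not> ?thesis"
    hence "c1 z = c2 z" if "z \<in> I" for z using that by (auto simp: c_def)
    hence "c1 = c2" using c12(1,2) unfolding A_def by (intro PiE_ext) auto
    thus False using c12(3) by simp
  qed
  then obtain i1 j1 where c1: "(i1,j1) \<in> I" "c (i1,j1) \<noteq> 0" by auto
  have "(\<Sum>i\<in>I. c i * v z i) = 0" if "z \<in> Z'" for z
  proof -
    have "lab c1 z = lab c2 z" using c12(4) by simp
    thus ?thesis using that by (simp add: lab_def c_def left_diff_distrib sum_subtractf)
  qed
  hence cZ: "(\<Sum>i\<in>I. c i * v z i) = 0" if "z \<in> Z" for z using Zeq that by blast
  define G where "G = mkp I c"
  have cfG: "cf G i j = (if (i,j) \<in> I then c (i,j) else 0)" for i j unfolding G_def by (rule cf_mkp[OF finI])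
  have G0: "G \<noteq> 0" using c1 cfG[of i1 j1] by auto
  have GD: "i + j \<le> d" if "cf G i j \<noteq> 0" for i j using that unfolding cfG by (auto simp: I_def tri_def split: if_splits)
  show ?thesis
  proof (cases "F dvd G")
    case False
    have sub: "Z \<subseteq> {(x,y). eval2 F x y = 0 \<and> eval2 G x y = 0}"
    proof
      fix z assume z: "z \<in> Z"
      obtain x y where xy: "z = (x,y)" by (cases z)
      have "eval2 G x y = 0" using cZ[OF z] unfolding G_def ev xy .
      moreover have "eval2 F x y = 0" using z integral_zerosD(3)[of x y F B] unfolding Z_def xy by blast
      ultimately show "z \<in> {(x,y). eval2 F x y = 0 \<and> eval2 G x y = 0}" by (simp add: xy)
    qed
    note bz = bezout_bound[OF F(1,2) False GD]
    show ?thesis using card_mono[OF bz(1) sub] bz(2) unfolding Z_def d_def by linarith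
  next
    case True
    obtain e where e: "e \<noteq> 0" "G = smult [:e:] F"
      by (rule dvd_const_quotient[OF F0 True G0 GD[unfolded d_def]]) blast
    have cfe: "cf G i j = e * cf F i j" for i j unfolding e(2) cf_def by simp
    have "house (e * cf F i j) \<le> Ck * \<Lambda>" for i j
    proof (cases "(i,j) \<in> I")
      case True thus ?thesis using cH[OF True] cfe[of i j] cfG[of i j] by simp
    next
      case False 
      hence "e * cf F i j = 0" using cfe[of i j] cfG[of i j] by simp
      moreover have "house (0 :: 'a) \<le> Ck * \<Lambda>" by (rule order_trans[of _ 0]) (use house_of_nat[of 0] Ck L1 in auto)
      ultimately show ?thesis by (simp only:)
    qed
    \<comment> \<open>F is monic in X2, so the factor e is itself a coefficient of G.\<close>
    moreover have "e \<in> OK"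
    proof -
      have "cf F 0 (degree F) = 1" unfolding cf_def F(2) by simp
      hence "e = cf G 0 (degree F)" by (simp add: cfe)
      thus ?thesis unfolding cfG using cOK by (auto simp: OK_closed)
    qed
    ultimately show ?thesis using e(1) unfolding \<Lambda>_def d_def by blast
  qed
qed

text \<open>In units of d^3 ln B, 21 = 4 + 1 + 15 + 1 collects the number of monomials, ln d, ln
  \<Lambda> and d ln B, while 7 = 1 + 6 counts the occurrences of ln Ck.\<close>

definition height_const :: real where "height_const = ln Ck + real n * (21 + 7 * ln Ck)"

text \<open>All these primes divide the norm of c u, where u is the derivative at the point, and a
  nonzero integer is at least the product of its distinct prime divisors. The multiple c F is used
  because the coefficients of F themselves are unbounded. The main term of the logarithm is ln
  \<Lambda>, of order d^2 times d ln B.\<close>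

lemma singular_primes_weight:
  fixes F :: "'a poly poly"
  assumes F: "irreducible F" "lead_coeff F = 1" "integral_coeffs F" and B: "ln B \<ge> 1" "B \<ge> 1"
    and c: "c \<noteq> 0" "c \<in> OK" "\<And>i j. house (c * cf F i j) \<le> Ck * Lam (total_degree F) B"
    and z: "(x,y) \<in> integral_zeros F B" "eval2 (pderiv F) x y \<noteq> 0"
    and S: "finite S" "\<And>p. p \<in> S \<Longrightarrow> prime p" "\<And>p. p \<in> S \<Longrightarrow> E p \<ge> 1" "\<And>p. p \<in> S \<Longrightarrow> residue_map Nm p (E p) (\<phi> p)"
      "\<And>p. p \<in> S \<Longrightarrow> int p dvd \<phi> p (eval2 (pderiv F) x y)"
  shows "(\<Sum>p\<in>S. ln (real p)) \<le> height_const * real (total_degree F) ^ 3 * ln B"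
proof -
  define d where "d = total_degree F"
  define M where "M = card (tri d)"
  define \<Lambda> where "\<Lambda> = Lam d B"
  define l where "l = ln B"
  define u where "u = eval2 (pderiv F) x y"
  have F0: "F \<noteq> 0" using F(2) by auto
  have d1: "d \<ge> 1" using irreducible_degree_pos[OF F(1,2)] degree_le_total_degree[OF F0] unfolding d_def by linarith
  have M1: "M \<ge> 1" unfolding M_def by (rule card_tri_pos)
  have L1: "\<Lambda> \<ge> 1" unfolding \<Lambda>_def by (rule Lam_ge_1[OF B(2)])
  have F_eq: "F = mkp (tri d) (\<lambda>(i,j). cf F i j)"
  proof (rule mkp_cf)
    show "(i,j) \<in> tri d" if "cf F i j \<noteq> 0" for i j using total_degree_ge[OF that] by (simp add: tri_def d_def)
  qed simp
  have u: "u = (\<Sum>(i,j)\<in>tri d. of_nat j * cf F i j * (x ^ i * y ^ (j - 1)))"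
    unfolding u_def by (subst F_eq, subst pderiv_mkp) (simp add: case_prod_unfold)
  note xy = integral_zerosD[OF z(1)]
  have uO: "u \<in> OK" unfolding u using F(3) xy(1,2) 
    by (intro OK_sum) (auto simp: integral_coeffs_def cf_def)
  have cuO: "c * u \<in> OK" by (rule OK_closed(2)[OF c(2) uO])
  have cu0: "c * u \<noteq> 0" using c(1) z(2) unfolding u_def by simp
  have dvdN: "int p dvd Nm (c * u)" if p: "p \<in> S" for p
  proof -
    note r = S(4)[OF p]
    have pE: "int p dvd int p ^ E p" using S(3)[OF p] by (intro dvd_power) auto
    have "int p dvd \<phi> p (c * u) - \<phi> p c * \<phi> p u" by (rule dvd_trans[OF pE residue_map_mult[OF r c(2) uO]])
    moreover have "int p dvd \<phi> p c * \<phi> p u" using S(5)[OF p] unfolding u_def by (rule dvd_mult)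
    ultimately have "int p dvd (\<phi> p (c * u) - \<phi> p c * \<phi> p u) + \<phi> p c * \<phi> p u" by (rule dvd_add)
    hence "int p ^ 1 dvd \<phi> p (c * u)" by simp
    moreover have "\<forall>x\<in>OK. \<forall>e\<le>E p. int p ^ e dvd \<phi> p x \<longrightarrow> int p ^ e dvd Nm x" using r unfolding residue_map_def by blast
    ultimately have "int p ^ 1 dvd Nm (c * u)" using cuO S(3)[OF p] by blast
    thus ?thesis by simp
  qed
  have N0: "Nm (c * u) \<noteq> 0" by (rule Nm(1)[OF cuO cu0])
  have hu: "house (c * u) \<le> real M * (real d * (Ck * \<Lambda> * B ^ d))"
  proof -
    have "c * u = (\<Sum>(i,j)\<in>tri d. of_nat j * (c * cf F i j * (x ^ i * y ^ (j - 1))))"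
      unfolding u sum_distrib_left by (intro sum.cong refl) (auto simp: mult_ac)
    also have "house \<dots> \<le> (\<Sum>z\<in>tri d. house (case z of (i,j) \<Rightarrow> of_nat j * (c * cf F i j * (x ^ i * y ^ (j - 1)))))"
      by (rule house_sum) simp
    also have "\<dots> \<le> (\<Sum>z\<in>tri d. real d * (Ck * \<Lambda> * B ^ d))"
    proof (rule sum_mono, clarify)
      fix i j assume ij: "(i,j) \<in> tri d"
      have 1: "house (x ^ i * y ^ (j - 1)) \<le> B ^ d"
      proof -
        have "house (x ^ i * y ^ (j - 1)) \<le> house (x ^ i) * house (y ^ (j - 1))" by (rule house_mult)
        also have "\<dots> \<le> B ^ i * B ^ (j - 1)"
          by (intro mult_mono house_nonneg order.trans[OF house_power] power_mono xy zero_le_power) (use B in auto)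
        also have "\<dots> \<le> B ^ d" unfolding power_add[symmetric] using ij B by (intro power_increasing) (auto simp: tri_def)
        finally show ?thesis .
      qed
      have "house (c * cf F i j * (x ^ i * y ^ (j - 1))) \<le> house (c * cf F i j) * house (x ^ i * y ^ (j - 1))" by (rule house_mult)
      also have "\<dots> \<le> (Ck * \<Lambda>) * B ^ d" using c(3)[of i j] 1 Ck L1 unfolding \<Lambda>_def d_def by (intro mult_mono house_nonneg) auto
      finally have 2: "house (c * cf F i j * (x ^ i * y ^ (j - 1))) \<le> Ck * \<Lambda> * B ^ d" .
      have "house (of_nat j * (c * cf F i j * (x ^ i * y ^ (j - 1)))) \<le> house (of_nat j :: 'a) * house (c * cf F i j * (x ^ i * y ^ (j - 1)))"
        by (rule house_mult)
      also have "\<dots> \<le> real d * (Ck * \<Lambda> * B ^ d)"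
        by (intro mult_mono 2 house_nonneg order.trans[OF house_of_nat]) (use ij in \<open>auto simp: tri_def\<close>)
      finally show "house (of_nat j * (c * cf F i j * (x ^ i * y ^ (j - 1)))) \<le> real d * (Ck * \<Lambda> * B ^ d)" .
    qed
    finally show ?thesis by (simp add: M_def)
  qed
  have M_le: "real M \<le> 3 * real d ^ 2"
  proof -
    have "real d * 1 \<le> real d * real d" using d1 by (intro mult_left_mono) auto
    moreover have "(real d + 1) * (real d + 2) = real d * real d + 3 * real d + 2" by (simp add: algebra_simps)
    ultimately have "(real d + 1) * (real d + 2) \<le> 6 * (real d * real d)" using d1 by linarith
    thus ?thesis using card_tri[of d] unfolding M_def power2_eq_square by linarith
  qed
  define dd where "dd = real d"
  have dd1: "dd \<ge> 1" using d1 unfolding dd_def by simp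
  have lnM: "ln (real M) \<le> 4 * dd"
  proof -
    have "ln (real M) \<le> ln (3 * real d ^ 2)" using M_le M1 d1 by (subst ln_le_cancel_iff) auto
    also have "\<dots> = ln 3 + 2 * ln (real d)" using d1 by (simp add: ln_mult ln_realpow)
    also have "ln (3::real) \<le> 2" using ln_le_minus_one[of "3::real"] by simp
    also have "ln (real d) \<le> real d - 1" using d1 by (intro ln_le_minus_one) auto
    finally show ?thesis using d1 unfolding dd_def by simp
  qed
  define LC where "LC = ln Ck"
  have LC0: "LC \<ge> 0" using Ck unfolding LC_def by simp
  have l1: "l \<ge> 1" using B unfolding l_def by simp
  have lnL: "ln \<Lambda> = real M * (2 * LC + ln (real M) + dd * l)"
    unfolding \<Lambda>_def Lam_def M_def[symmetric] LC_def l_def dd_def using Ck M1 B by (simp add: ln_realpow ln_mult algebra_simps)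
  have big: "(\<Sum>p\<in>S. ln (real p)) \<le> LC + real n * (ln (real M) + ln dd + LC + ln \<Lambda> + dd * l)"
  proof -
    have "(\<Sum>p\<in>S. ln (real p)) \<le> ln \<bar>real_of_int (Nm (c * u))\<bar>" by (rule sum_ln_primes_le[OF S(1,2) dvdN N0])
    also have "\<dots> \<le> ln (Ck * (real M * (real d * (Ck * \<Lambda> * B ^ d))) ^ n)"
    proof (subst ln_le_cancel_iff)
      have "\<bar>real_of_int (Nm (c * u))\<bar> \<le> Ck * house (c * u) ^ n" by (rule Nm(2)[OF cuO])
      also have "\<dots> \<le> Ck * (real M * (real d * (Ck * \<Lambda> * B ^ d))) ^ n"
        using Ck by (intro mult_left_mono power_mono hu house_nonneg) auto
      finally show "\<bar>real_of_int (Nm (c * u))\<bar> \<le> Ck * (real M * (real d * (Ck * \<Lambda> * B ^ d))) ^ n" .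
    qed (use N0 Ck M1 d1 L1 B in auto)
    also have "\<dots> = LC + real n * (ln (real M) + ln dd + LC + ln \<Lambda> + dd * l)"
      using Ck M1 d1 L1 B unfolding LC_def dd_def l_def by (simp add: ln_mult ln_realpow algebra_simps)
    finally show ?thesis .
  qed
  have dl: "dd * l \<ge> dd" using dd1 l1 by simp
  have d2: "dd ^ 2 \<ge> dd" "dd ^ 3 \<ge> dd ^ 2" using dd1 by (simp_all add: power2_eq_square power3_eq_cube)
  define Y where "Y = dd ^ 3 * l"
  have Yge: "Y \<ge> dd ^ 3" "dd ^ 3 \<ge> 1" using l1 dd1 unfolding Y_def by simp_all
  have Y1: "dd * l \<le> Y" using mult_right_mono[of dd "dd ^ 3" l] d2 l1 unfolding Y_def by linarith
  have "ln \<Lambda> \<le> 3 * dd ^ 2 * (2 * LC + 4 * dd + dd * l)"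
    unfolding lnL using M_le lnM LC0 dd1 l1 ln_ge_zero[of "real M"] M1 by (intro mult_mono) (auto simp: dd_def)
  also have "\<dots> = 6 * LC * dd ^ 2 + 12 * dd ^ 3 + 3 * Y" by (simp add: Y_def algebra_simps power2_eq_square power3_eq_cube)
  also have "\<dots> \<le> 6 * LC * Y + 12 * Y + 3 * Y" using Yge d2 LC0 by (intro add_mono mult_left_mono) auto
  finally have lnL': "ln \<Lambda> \<le> 6 * LC * Y + 15 * Y" by simp
  have "ln dd \<le> dd - 1" using dd1 by (intro ln_le_minus_one) auto
  hence a1: "ln dd \<le> Y" using dl Y1 by linarith
  have a2: "ln (real M) \<le> 4 * Y" using lnM dl Y1 by linarith
  have a3: "LC \<le> LC * Y" using LC0 Yge mult_left_mono[of 1 Y LC] by simp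
  have "ln (real M) + ln dd + LC + ln \<Lambda> + dd * l \<le> (21 + 7 * LC) * Y"
    using a1 a2 a3 lnL' Y1 by (simp add: algebra_simps)
  hence "LC + real n * (ln (real M) + ln dd + LC + ln \<Lambda> + dd * l) \<le> LC * Y + real n * ((21 + 7 * LC) * Y)"
    by (intro add_mono a3 mult_left_mono) auto
  also have "\<dots> = height_const * Y" unfolding height_const_def LC_def by (simp add: algebra_simps)
  finally show ?thesis using big unfolding Y_def dd_def d_def l_def by (simp add: mult.assoc)
qed

end

section \<open>Choice of the modulus and the final count\<close>

lemma exponent_choice:
  fixes p :: nat and R :: real
  assumes p: "p > 1" and R: "R \<ge> 0"
  obtains k where "k \<ge> 1" "ln (real p ^ k) \<ge> R" "real p ^ k \<le> real p * exp R"
proof -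
  \<comment> \<open>The least exponent with p^k \<ge> exp R overshoots by a factor of at most p. It
    is 0 only for R = 0, when the exponent 1 is taken instead.\<close>
  define k where "k = nat \<lceil>R / ln (real p)\<rceil>"
  have lp: "ln (real p) > 0" using p by simp
  have kR: "real k = of_int \<lceil>R / ln (real p)\<rceil>" unfolding k_def using R lp by simp
  have "real k \<ge> R / ln (real p)" "real k < R / ln (real p) + 1" unfolding kR by linarith+
  hence k: "R \<le> real k * ln (real p)" "real k * ln (real p) \<le> R + ln (real p)" using lp by (simp_all add: field_simps)
  have lnpk: "ln (real p ^ m) = real m * ln (real p)" for m using p by (simp add: ln_realpow)
  have le: "real p ^ m \<le> real p * exp R" if "real m * ln (real p) \<le> R + ln (real p)" for m
  proof -
    have "real p ^ m = exp (real m * ln (real p))" using p by (simp add: exp_of_nat_mult)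
    also have "\<dots> \<le> exp (R + ln (real p))" using that by simp
    also have "\<dots> = real p * exp R" using p by (simp add: exp_add)
    finally show ?thesis .
  qed
  show ?thesis
  proof (cases "k = 0")
    case True
    thus ?thesis using that[of 1] k le[of 1] R lp by simp
  next
    case False
    thus ?thesis using that[of k] k le[of k] lnpk[of k] by simp
  qed
qed

text \<open>Each point is bad for at most half of the total weight. Summing the weights of all good
  pairs in the other order produces an element of \<open>S\<close> for which at least half of the
  points are good.\<close>

lemma weighted_pigeonhole:
  fixes w :: "'p \<Rightarrow> real"
  assumes S: "finite S" and Z: "finite Z" and w: "\<And>p. p \<in> S \<Longrightarrow> w p > 0" and S2: "sum w S \<ge> 2 * T" "T > 0"
    and bad: "\<And>z. z \<in> Z \<Longrightarrow> (\<Sum>p\<in>{p\<in>S. bad p z}. w p) \<le> T"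
  obtains p where "p \<in> S" "card Z \<le> 2 * card {z\<in>Z. \<not> bad p z}"
proof -
  have "\<exists>p\<in>S. card Z \<le> 2 * card {z\<in>Z. \<not> bad p z}"
  proof (rule ccontr)
    assume "\<not> ?thesis"
    hence lt: "2 * real (card {z\<in>Z. \<not> bad p z}) < real (card Z)" if "p \<in> S" for p using that by force
    have S0: "S \<noteq> {}" using S2 by auto
    have good: "(\<Sum>p\<in>{p\<in>S. \<not> bad p z}. w p) \<ge> sum w S / 2" if z: "z \<in> Z" for z
    proof -
      have "S = {p\<in>S. bad p z} \<union> {p\<in>S. \<not> bad p z}" by auto
      hence "sum w S = sum w ({p\<in>S. bad p z} \<union> {p\<in>S. \<not> bad p z})" by (rule arg_cong)
      also have "\<dots> = sum w {p\<in>S. bad p z} + sum w {p\<in>S. \<not> bad p z}"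
        using S by (intro sum.union_disjoint) auto
      finally show ?thesis using bad[OF z] S2 by linarith
    qed
    have "real (card Z) * (sum w S / 2) \<le> (\<Sum>z\<in>Z. \<Sum>p\<in>{p\<in>S. \<not> bad p z}. w p)"
      using sum_mono[of Z "\<lambda>_. sum w S / 2", OF good] by simp
    also have "\<dots> = (\<Sum>z\<in>Z. \<Sum>p\<in>S. if \<not> bad p z then w p else 0)"
      by (intro sum.cong refl sum.inter_filter S)
    also have "\<dots> = (\<Sum>p\<in>S. \<Sum>z\<in>Z. if \<not> bad p z then w p else 0)" by (rule sum.swap)
    also have "\<dots> = (\<Sum>p\<in>S. real (card {z\<in>Z. \<not> bad p z}) * w p)"
    proof (rule sum.cong[OF refl])
      fix p
      have "(\<Sum>z\<in>Z. if \<not> bad p z then w p else 0) = (\<Sum>z\<in>{z\<in>Z. \<not> bad p z}. w p)"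
        by (rule sum.inter_filter[symmetric, OF Z])
      thus "(\<Sum>z\<in>Z. if \<not> bad p z then w p else 0) = real (card {z\<in>Z. \<not> bad p z}) * w p" by simp
    qed
    also have "\<dots> < (\<Sum>p\<in>S. real (card Z) / 2 * w p)"
    proof (rule sum_strict_mono[OF S S0])
      fix p assume p: "p \<in> S"
      have "real (card {z\<in>Z. \<not> bad p z}) < real (card Z) / 2" using lt[OF p] by simp
      thus "real (card {z\<in>Z. \<not> bad p z}) * w p < real (card Z) / 2 * w p" using w[OF p] by (rule mult_strict_right_mono)
    qed
    also have "\<dots> = real (card Z) * (sum w S / 2)" unfolding sum_distrib_left[symmetric] by simp
    finally show False by simp
  qed
  thus ?thesis using that by blast
qed

context residue_supply
begin

lemma main_bound:
  shows "\<exists>c B\<^sub>0 :: real. c > 0 \<and> B\<^sub>0 > 0 \<and>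
    (\<forall>F :: 'a poly poly. integral_coeffs F \<longrightarrow> irreducible F \<longrightarrow> lead_coeff F = 1 \<longrightarrow>
      (\<forall>B \<ge> B\<^sub>0. finite (integral_zeros F B) \<and>
        real (card (integral_zeros F B)) \<le>
          c * real (total_degree F) ^ 8 * ln B ^ 3 * B powr (real n / real (total_degree F))))"
proof -
  define \<kappa> where "\<kappa> = 8 * real n + 2 * ln (2 * Ck) + 2 * real n * ln Ck"
  have k0: "\<kappa> \<ge> 0" unfolding \<kappa>_def using Ck by simp
  define C where "C = height_const"
  have C1: "C \<ge> 1"
  proof -
    have "real n \<ge> 1" using n_pos by simp
    moreover have "ln Ck \<ge> 0" using Ck by simp
    moreover have "1 * 21 \<le> real n * (21 + 7 * ln Ck)" using calculation by (intro mult_mono) auto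
    ultimately show ?thesis unfolding C_def height_const_def by linarith
  qed
  \<comment> \<open>6 = 2 * 3: a factor 2 because the chosen prime sees only half of the points, and
    3 from D \<le> 3 d ln B. The summand 1 pays for the at most d^3 points with vanishing
    derivative.\<close>
  define c where "c = 6 * (C powr (4/3) * exp \<kappa>) + 1"
  have c: "c > 0" unfolding c_def by (simp add: add_nonneg_pos)
  \<comment> \<open>This gives T \<ge> ln B \<ge> T0, so enough primes exist, with a threshold that
    does not depend on F.\<close>
  define B0 where "B0 = exp T0"
  have main: "finite (integral_zeros F B) \<and> real (card (integral_zeros F B)) \<le>
          c * real (total_degree F) ^ 8 * ln B ^ 3 * B powr (real n / real (total_degree F))"
    if F3: "integral_coeffs F" and F1: "irreducible F" and F2: "lead_coeff F = 1" and BB: "B \<ge> B0" for F :: "'a poly poly" and B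
  proof -
    define d where "d = total_degree F"
    define dd where "dd = real d"
    define l where "l = ln B"
    define W where "W = B powr (real n / dd)"
    define Z where "Z = integral_zeros F B"
    have B0: "B > 0" using BB less_le_trans[OF exp_gt_zero BB[unfolded B0_def]] by simp
    have "ln B \<ge> ln (exp T0)" using BB B0 unfolding B0_def by (subst ln_le_cancel_iff) auto
    hence l: "l \<ge> T0" "l \<ge> 1" using T0 unfolding l_def by auto
    have B1: "B \<ge> 1" using l(2) B0 ln_ge_zero_iff[of B] unfolding l_def by linarith
    have F0: "F \<noteq> 0" using F2 by auto
    have deg: "degree F \<ge> 1" by (rule irreducible_degree_pos[OF F1 F2])
    have d1: "d \<ge> 1" using deg degree_le_total_degree[OF F0] unfolding d_def by linarith
    hence dd1: "dd \<ge> 1" unfolding dd_def by simp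
    have W1: "W \<ge> 1" unfolding W_def using B1 dd1 by (intro ge_one_powr_ge_zero) auto
    have fin: "finite Z" unfolding Z_def by (rule finite_integral_zeros[OF B1])
    have l3: "l ^ 3 \<ge> 1" using l(2) by (rule one_le_power)
    have lW: "l ^ 3 * W \<ge> 1" 
    proof -
      have "1 * 1 \<le> l ^ 3 * W" by (rule mult_mono[OF l3 W1]) (use l3 in linarith, simp)
      thus ?thesis by simp
    qed
    have d38: "dd ^ 3 \<le> dd ^ 8" using dd1 by (intro power_increasing) auto
    have cube: "dd ^ 3 \<le> dd ^ 8 * l ^ 3 * W"
    proof -
      have "dd ^ 3 * 1 \<le> dd ^ 8 * (l ^ 3 * W)" by (rule mult_mono[OF d38 lW]) (use dd1 in \<open>simp_all\<close>)
      thus ?thesis by (simp only: mult_1_right mult.assoc)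
    qed
    have pF: "\<not> F dvd pderiv F"
    proof
      assume "F dvd pderiv F"
      moreover have "pderiv F \<noteq> 0" using deg by (simp add: pderiv_eq_0_iff)
      ultimately have "degree F \<le> degree (pderiv F)" by (intro dvd_imp_degree_le) auto
      thus False using deg by (simp add: degree_pderiv)
    qed
    have pD: "i + j \<le> d" if "cf (pderiv F) i j \<noteq> 0" for i j
    proof -
      have "cf F i (Suc j) \<noteq> 0" using that unfolding cf_def coeff_pderiv by (auto simp: of_nat_poly)
      from total_degree_ge[OF this] show ?thesis unfolding d_def by simp
    qed
    define Z0 where "Z0 = {(x,y). eval2 F x y = 0 \<and> eval2 (pderiv F) x y = 0}"
    have Z0: "finite Z0" "card Z0 \<le> d * (d * d)" unfolding Z0_def d_def
      by (rule bezout_bound[OF F1 F2 pF pD[unfolded d_def]], assumption)+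
    define Z1 where "Z1 = {(x,y)\<in>Z. eval2 (pderiv F) x y \<noteq> 0}"
    have Z1_sub: "Z1 \<subseteq> Z" unfolding Z1_def by auto
    have Z1: "finite Z1" "Z1 \<subseteq> Z" by (rule finite_subset[OF Z1_sub fin]) (rule Z1_sub)
    have "Z \<subseteq> Z0 \<union> Z1" unfolding Z0_def Z1_def Z_def integral_zeros_def by auto
    hence "card Z \<le> card (Z0 \<union> Z1)" using Z0 Z1 by (intro card_mono) auto
    hence cZ: "card Z \<le> d * (d * d) + card Z1" using Z0(2) card_Un_le[of Z0 Z1] by linarith
    have "real (card Z) \<le> c * dd ^ 8 * l ^ 3 * W"
    proof (cases "card Z \<le> d * (d * d)")
      case True
      hence "real (card Z) \<le> real (d * (d * d))" by (simp only: of_nat_le_iff)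
      also have "\<dots> = dd ^ 3" by (simp add: dd_def power3_eq_cube)
      also have "\<dots> \<le> 1 * (dd ^ 8 * l ^ 3 * W)" using cube by simp
      also have "\<dots> \<le> c * (dd ^ 8 * l ^ 3 * W)" using l W1 dd1 unfolding c_def by (intro mult_right_mono) auto
      finally show ?thesis by (simp add: mult.assoc)
    next
      case False
      hence "\<exists>e. e \<noteq> 0 \<and> e \<in> OK \<and> (\<forall>i j. house (e * cf F i j) \<le> Ck * Lam (total_degree F) B)"
        using few_zeros_or_small_multiple[OF F1 F2 F3 B1] unfolding Z_def d_def by (simp only: simp_thms)
      then obtain e where "e \<noteq> 0 \<and> e \<in> OK \<and> (\<forall>i j. house (e * cf F i j) \<le> Ck * Lam (total_degree F) B)" ..
      hence e: "e \<noteq> 0" "e \<in> OK" "\<And>i j. house (e * cf F i j) \<le> Ck * Lam (total_degree F) B" by simp_all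
      define T where "T = C * dd ^ 3 * l"
      have d3: "dd ^ 3 \<ge> 1" by (rule one_le_power[OF dd1])
      have "C * dd ^ 3 \<ge> 1" using mult_mono[OF C1 d3] C1 by simp
      hence TT: "T \<ge> l" unfolding T_def using mult_right_mono[of 1 "C * dd ^ 3" l] l by simp
      hence TT0: "T \<ge> T0" "T > 0" using l by linarith+
      obtain S \<phi> where "finite S \<and> (\<forall>p\<in>S. prime p \<and> T < p \<and> real p \<le> T powr (4/3) \<and> (\<forall>E. residue_map Nm p E (\<phi> p E))) \<and>
          (\<Sum>p\<in>S. ln (real p)) \<ge> 2 * T" using enough_primes[OF TT0(1)] by (elim exE)
      hence S: "finite S" "\<And>p. p \<in> S \<Longrightarrow> prime p" "\<And>p. p \<in> S \<Longrightarrow> real p \<le> T powr (4/3)"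
        "\<And>p E. p \<in> S \<Longrightarrow> residue_map Nm p E (\<phi> p E)" "(\<Sum>p\<in>S. ln (real p)) \<ge> 2 * T"
        by simp_all
      define D where "D = d + nat \<lceil>l\<rceil>"
      have D: "total_degree F \<le> D" "ln B \<le> real D" "1 \<le> total_degree F"
      proof -
        have "real D = dd + of_int \<lceil>l\<rceil>" unfolding D_def dd_def using l by simp
        moreover have "l \<le> of_int \<lceil>l\<rceil>" by (rule le_of_int_ceiling)
        ultimately show "ln B \<le> real D" using dd1 unfolding l_def by linarith
      qed (use d1 in \<open>simp_all add: D_def d_def\<close>)
      have Dle: "real D \<le> 3 * (dd * l)"
      proof -
        have "real D \<le> dd + (l + 1)" unfolding D_def dd_def using l by simp
        moreover have "dd * 1 \<le> dd * l" "1 * l \<le> dd * l" using dd1 l by (intro mult_mono; simp)+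
        ultimately show ?thesis using l dd1 by linarith
      qed
      define R where "R = real n * l / dd + \<kappa>"
      have R0: "R \<ge> 0" unfolding R_def using l dd1 k0 by simp
      have kex: "\<exists>k. k \<ge> 1 \<and> ln (real p ^ k) \<ge> R \<and> real p ^ k \<le> real p * exp R" if "p \<in> S" for p
        by (rule exponent_choice[OF prime_gt_1_nat[OF S(2)[OF that]] R0]) blast
      obtain k where "\<forall>p\<in>S. k p \<ge> 1 \<and> ln (real p ^ k p) \<ge> R \<and> real p ^ k p \<le> real p * exp R"
        by (rule exE[OF bchoice[OF ballI[OF kex]]])
      hence k: "\<And>p. p \<in> S \<Longrightarrow> k p \<ge> 1" "\<And>p. p \<in> S \<Longrightarrow> ln (real p ^ k p) \<ge> R" "\<And>p. p \<in> S \<Longrightarrow> real p ^ k p \<le> real p * exp R"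
        by simp_all
      have Eex: "\<exists>E. k p \<le> E \<and> card {(x,y)\<in>integral_zeros F B. \<not> int p dvd \<phi> p E (eval2 (pderiv F) x y)}
         \<le> p ^ k p * total_degree F * (total_degree F * (total_degree F * D))" if "p \<in> S" for p
        by (rule nonsingular_points_le[OF F1 F2 F3 S(2)[OF that] k(1)[OF that] D B1 _ S(4)[OF that]])
          (use k(2)[OF that] in \<open>simp add: R_def l_def dd_def d_def \<kappa>_def\<close>)
      obtain E where "\<forall>p\<in>S. k p \<le> E p \<and> card {(x,y)\<in>integral_zeros F B. \<not> int p dvd \<phi> p (E p) (eval2 (pderiv F) x y)}
         \<le> p ^ k p * total_degree F * (total_degree F * (total_degree F * D))"
        by (rule exE[OF bchoice[OF ballI[OF Eex]]])
      hence E: "\<And>p. p \<in> S \<Longrightarrow> k p \<le> E p" 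
        "\<And>p. p \<in> S \<Longrightarrow> card {(x,y)\<in>Z. \<not> int p dvd \<phi> p (E p) (eval2 (pderiv F) x y)} \<le> p ^ k p * d * (d * (d * D))"
        unfolding Z_def d_def by simp_all
      define bad where "bad p z \<longleftrightarrow> int p dvd \<phi> p (E p) (eval2 (pderiv F) (fst z) (snd z))" for p z
      have badT: "(\<Sum>p\<in>{p\<in>S. bad p z}. ln (real p)) \<le> T" if z: "z \<in> Z1" for z
      proof -
        obtain x y where xy: "z = (x,y)" by (cases z)
        have 1: "(x,y) \<in> integral_zeros F B" "eval2 (pderiv F) x y \<noteq> 0" using z unfolding xy Z1_def Z_def by auto
        have "(\<Sum>p\<in>{p\<in>S. bad p z}. ln (real p)) \<le> height_const * real (total_degree F) ^ 3 * ln B"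
        proof (rule singular_primes_weight[OF F1 F2 F3 _ B1 e 1, where E = E and \<phi> = "\<lambda>p. \<phi> p (E p)"])
          show "1 \<le> ln B" using l by (simp add: l_def)
          show "finite {p\<in>S. bad p z}" using S(1) by simp
          fix p assume p: "p \<in> {p\<in>S. bad p z}"
          show "prime p" "1 \<le> E p" "residue_map Nm p (E p) (\<phi> p (E p))"
            using p S(2,4) k(1)[of p] E(1)[of p] by auto
          show "int p dvd \<phi> p (E p) (eval2 (pderiv F) x y)" using p unfolding bad_def xy by simp
        qed
        thus ?thesis unfolding T_def C_def dd_def d_def l_def .
      qed
      have lp: "ln (real p) > 0" if "p \<in> S" for p using prime_gt_1_nat[OF S(2)[OF that]] by simp
      obtain p where p: "p \<in> S" "card Z1 \<le> 2 * card {z\<in>Z1. \<not> bad p z}"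
        by (rule weighted_pigeonhole[OF S(1) Z1(1) lp S(5) TT0(2) badT])
      have fin2: "finite {(x,y)\<in>Z. \<not> int p dvd \<phi> p (E p) (eval2 (pderiv F) x y)}"
        by (rule finite_subset[OF _ fin]) auto
      have "{z\<in>Z1. \<not> bad p z} \<subseteq> {(x,y)\<in>Z. \<not> int p dvd \<phi> p (E p) (eval2 (pderiv F) x y)}"
      proof
        fix z assume z: "z \<in> {z\<in>Z1. \<not> bad p z}"
        obtain x y where xy: "z = (x,y)" by (cases z)
        show "z \<in> {(x,y)\<in>Z. \<not> int p dvd \<phi> p (E p) (eval2 (pderiv F) x y)}" using z Z1(2) unfolding xy bad_def by auto
      qed
      hence "card {z\<in>Z1. \<not> bad p z} \<le> card {(x,y)\<in>Z. \<not> int p dvd \<phi> p (E p) (eval2 (pderiv F) x y)}"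
        by (rule card_mono[OF fin2])
      with E(2)[OF p(1)] p(2) have "card Z1 \<le> 2 * (p ^ k p * d * (d * (d * D)))" by linarith
      hence "real (card Z1) \<le> real (2 * (p ^ k p * d * (d * (d * D))))" by (simp only: of_nat_le_iff)
      also have "\<dots> = 2 * (real p ^ k p * (dd ^ 3 * real D))" by (simp add: dd_def power3_eq_cube mult_ac)
      also have "\<dots> \<le> 2 * ((C powr (4/3) * dd ^ 4 * l ^ 2 * (exp \<kappa> * W)) * (dd ^ 3 * (3 * (dd * l))))"
      proof -
        have "real p ^ k p \<le> real p * exp R" by (rule k(3)[OF p(1)])
        also have "\<dots> \<le> T powr (4/3) * exp R" by (intro mult_right_mono S(3) p) simp
        also have "exp R = exp \<kappa> * W" 
        proof -
          have "W = exp (real n * l / dd)" unfolding W_def l_def powr_def using B0 by simp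
          thus ?thesis unfolding R_def exp_add by (simp only: mult.commute)
        qed
        \<comment> \<open>The exponent 4/3 turns d^3 into exactly d^4, while (ln B)^(4/3) will be
          rounded up to (ln B)^2.\<close>
        also have "T powr (4/3) = C powr (4/3) * (dd ^ 3) powr (4/3) * l powr (4/3)"
          unfolding T_def using C1 dd1 l by (simp add: powr_mult)
        also have "(dd ^ 3) powr (4/3) = dd ^ 4" 
        proof -
          have "(dd ^ 3) powr (4/3) = (dd powr 3) powr (4/3)" using dd1 by simp
          also have "\<dots> = dd powr 4" unfolding powr_powr by simp
          also have "\<dots> = dd ^ 4" using dd1 by simp
          finally show ?thesis .
        qed
        also have "C powr (4/3) * dd ^ 4 * l powr (4/3) * (exp \<kappa> * W) \<le> C powr (4/3) * dd ^ 4 * l ^ 2 * (exp \<kappa> * W)"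
        proof -
          have "l powr (4/3) \<le> l powr 2" using l by (intro powr_mono) auto
          thus ?thesis using l W1 dd1 by (intro mult_right_mono mult_left_mono) simp_all
        qed
        finally have "real p ^ k p \<le> C powr (4/3) * dd ^ 4 * l ^ 2 * (exp \<kappa> * W)" .
        thus ?thesis using Dle dd1 W1 by (intro mult_left_mono mult_mono) auto
      qed
      \<comment> \<open>The power d^8 consists of d^4 from the prime, d^3 from the classes and the
        intersection bound, and d from D; l^3 is l^2 from the prime and l from D.\<close>
      also have "\<dots> = 6 * (C powr (4/3) * exp \<kappa>) * (dd ^ 8 * l ^ 3 * W)"
      proof -
        have "2 * ((c1 * a4 * l2 * (k * w)) * (a3 * (3 * (a1 * l1)))) = 6 * (c1 * k) * ((a4 * (a3 * a1)) * (l2 * l1) * w)"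
          for c1 a4 l2 k w a3 a1 l1 :: real by (simp add: algebra_simps)
        moreover have "dd ^ 8 = dd ^ 4 * (dd ^ 3 * dd)"
        proof -
          have "dd ^ (4 + (3 + 1)) = dd ^ 4 * (dd ^ 3 * dd)" by (simp only: power_add power_one_right)
          moreover have "4 + (3 + 1) = (8::nat)" by simp
          ultimately show ?thesis by (simp only:)
        qed
        moreover have "l ^ 3 = l ^ 2 * l" by (simp add: power2_eq_square power3_eq_cube)
        ultimately show ?thesis by (simp only:)
      qed
      finally have "real (card Z1) \<le> 6 * (C powr (4/3) * exp \<kappa>) * (dd ^ 8 * l ^ 3 * W)" .
      moreover have "real (card Z) \<le> real (d * (d * d)) + real (card Z1)" using cZ by (simp only: of_nat_le_iff of_nat_add[symmetric])
      moreover have "real (d * (d * d)) = dd ^ 3" by (simp add: dd_def power3_eq_cube)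
      ultimately have "real (card Z) \<le> 1 * (dd ^ 8 * l ^ 3 * W) + 6 * (C powr (4/3) * exp \<kappa>) * (dd ^ 8 * l ^ 3 * W)"
        using cube by linarith
      also have "\<dots> = c * (dd ^ 8 * l ^ 3 * W)" unfolding c_def by (simp add: distrib_right)
      finally show ?thesis by (simp add: mult.assoc)
    qed
    thus ?thesis using fin unfolding Z_def W_def dd_def d_def l_def by simp
  qed
  have "B0 > 0" unfolding B0_def by simp
  show ?thesis
    by (rule exI[of _ c], rule exI[of _ B0], intro conjI allI impI c \<open>B0 > 0\<close>) (simp_all only: main)
qed

end

section \<open>Primitive elements\<close>

lemma map_poly_pCons_0: "f 0 = 0 \<Longrightarrow> map_poly f (pCons c p) = pCons (f c) (map_poly f p)"
  by (cases "c = 0 \<and> p = 0") (auto simp: map_poly_pCons)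

definition rpoly :: "rat poly \<Rightarrow> 'a::field_char_0 \<Rightarrow> 'a" where
  "rpoly p x = poly (map_poly of_rat p) x"

lemma rpoly_pCons [simp]: "rpoly (pCons c p) x = of_rat c + x * rpoly p x" and rpoly_0 [simp]: "rpoly 0 x = 0"
  unfolding rpoly_def map_poly_pCons_0[where f = of_rat, OF of_rat_0] by simp_all

lemma rpoly_add [simp]: "rpoly (p + q) x = rpoly p x + rpoly q x"
proof (induction p arbitrary: q)
  case 0 show ?case by simp
next
  case (pCons a p)
  obtain b r where q: "q = pCons b r" by (cases q)
  show ?case unfolding q by (simp add: pCons.IH of_rat_add algebra_simps)
qed

lemma rpoly_smult [simp]: "rpoly (smult c p) x = of_rat c * rpoly p x"
  by (induction p) (simp_all add: of_rat_mult algebra_simps)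

lemma rpoly_mult [simp]: "rpoly (p * q) x = rpoly p x * rpoly q x"
  by (induction p) (simp_all add: algebra_simps)

lemma rpoly_minus [simp]: "rpoly (- p) x = - rpoly p x"
  by (induction p) (simp_all add: of_rat_minus)

lemma rpoly_diff [simp]: "rpoly (p - q) x = rpoly p x - rpoly q x"
  using rpoly_add[of p "- q" x] by simp

lemma rpoly_1 [simp]: "rpoly 1 x = 1" by (simp add: one_pCons)

lemma rpoly_monom: "rpoly (monom c i) x = of_rat c * x ^ i"
  by (induction i) (simp_all add: monom_0 monom_Suc)

lemma rpoly_sum: "rpoly (sum f A) x = (\<Sum>a\<in>A. rpoly (f a) x)"
  by (induction A rule: infinite_finite_induct) simp_all

lemma rpoly_of_int: "rpoly (map_poly of_int p) x = ipoly p x"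
  by (induction p) (simp_all add: map_poly_pCons_0)

lemma rpoly_pcompose: "rpoly (pcompose p q) x = rpoly p (rpoly q x)"
  by (induction p) (simp_all add: pcompose_pCons)

lemma minimal_polynomial:
  fixes x :: "'a::field_char_0"
  assumes "\<exists>h. h \<noteq> 0 \<and> rpoly h x = 0"
  obtains h where "irreducible h" "lead_coeff h = 1" "rpoly h x = 0" "\<And>p. rpoly p x = 0 \<Longrightarrow> h dvd p"
proof -
  obtain h0 where h0: "h0 \<noteq> 0" "rpoly h0 x = 0" and min: "\<And>p. p \<noteq> 0 \<and> rpoly p x = 0 \<Longrightarrow> degree h0 \<le> degree p"
    using ex_has_least_nat[of "\<lambda>h. h \<noteq> 0 \<and> rpoly h x = 0" _ degree] assms by blast
  define h where "h = smult (inverse (lead_coeff h0)) h0"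
  have h: "h \<noteq> 0" "lead_coeff h = 1" "rpoly h x = 0" "degree h = degree h0" unfolding h_def using h0 by simp_all
  have dvd: "h dvd p" if p: "rpoly p x = 0" for p
  proof (rule ccontr)
    assume nd: "\<not> h dvd p"
    hence nz: "p mod h \<noteq> 0" by (simp add: dvd_eq_mod_eq_0)
    have "rpoly (p div h * h) x + rpoly (p mod h) x = 0" by (simp only: rpoly_add[symmetric] div_mult_mod_eq p)
    hence "rpoly (p mod h) x = 0" using h(3) by simp
    hence "degree h0 \<le> degree (p mod h)" using min nz by blast
    moreover have "degree (p mod h) < degree h" using degree_mod_less[OF h(1), of p] nz by simp
    ultimately show False using h(4) by simp
  qed
  have nu: "\<not> is_unit h"
  proof
    assume "is_unit h"
    then obtain c where "h * c = 1" by (metis dvdE)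
    hence "rpoly (h * c) x = 1" by simp
    thus False using h(3) by simp
  qed
  have "irreducible h"
  proof (rule Factorial_Ring.irreducibleI[OF h(1) nu])
    fix a b assume ab: "h = a * b"
    hence "rpoly a x * rpoly b x = 0" using h(3) by simp
    moreover have nz: "a \<noteq> 0" "b \<noteq> 0" using ab h(1) by auto
    have deg: "degree h = degree a + degree b" using ab nz by (simp add: degree_mult_eq)
    ultimately consider "h dvd a" | "h dvd b" using dvd by auto
    thus "is_unit a \<or> is_unit b"
    proof cases
      case 1 
      hence "degree h \<le> degree a" using nz by (simp add: dvd_imp_degree_le)
      thus ?thesis using deg nz by (simp add: is_unit_iff_degree)
    next
      case 2
      hence "degree h \<le> degree b" using nz by (simp add: dvd_imp_degree_le)
      thus ?thesis using deg nz by (simp add: is_unit_iff_degree)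
    qed
  qed
  thus ?thesis using that h dvd by blast
qed

lemma rpoly_inverse:
  fixes x :: "'a::field_char_0"
  assumes "\<exists>h. h \<noteq> 0 \<and> rpoly h x = 0" 
  shows "\<exists>q. rpoly q x = inverse (rpoly p x)"
proof (cases "rpoly p x = 0")
  case True thus ?thesis by (intro exI[of _ 0]) simp
next
  case False
  obtain h where h: "irreducible h" "lead_coeff h = 1" "rpoly h x = 0" "\<And>p. rpoly p x = 0 \<Longrightarrow> h dvd p"
    by (rule minimal_polynomial[OF assms]) blast
  have "\<not> h dvd p"
  proof
    assume "h dvd p"
    then obtain k where "p = h * k" by (rule dvdE)
    thus False using False h(3) by simp
  qed
  hence "coprime h p" using h(1) by (intro prime_elem_imp_coprime irreducible_imp_prime_elem)
  then obtain u v where uv: "u * h + v * p = 1"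
    using bezout_coefficients_fst_snd[of h p] by (auto simp: coprime_iff_gcd_eq_1)
  have "rpoly (u * h + v * p) x = 1" unfolding uv by simp
  hence "rpoly v x * rpoly p x = 1" using h(3) by simp
  thus ?thesis by (intro exI[of _ v]) (use False in \<open>simp add: field_simps\<close>)
qed

text \<open>The subfield is a set and not a type, so Euclidean division is repeated while keeping
  track of the coefficients. Only the remainder is recorded as having coefficients in
  \<open>k\<close>, since a minimality argument is going to be applied to it.\<close>

lemma division_in_subfield:
  fixes k :: "'a::field set"
  assumes k: "0 \<in> k" "\<And>x y. x \<in> k \<Longrightarrow> y \<in> k \<Longrightarrow> x - y \<in> k" "\<And>x y. x \<in> k \<Longrightarrow> y \<in> k \<Longrightarrow> x * y \<in> k"
      "\<And>x. x \<in> k \<Longrightarrow> inverse x \<in> k"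
    and m: "m \<noteq> 0" "\<And>i. coeff m i \<in> k" and f: "\<And>i. coeff f i \<in> k"
  shows "\<exists>q r. f = m * q + r \<and> (\<forall>i. coeff r i \<in> k) \<and> (r = 0 \<or> degree r < degree m)"
  using f
proof (induction "degree f" arbitrary: f rule: less_induct)
  case less
  show ?case
  proof (cases "f = 0 \<or> degree f < degree m")
    case True thus ?thesis using less.prems by (intro exI[of _ 0] exI[of _ f]) auto
  next
    case False
    define c where "c = lead_coeff f * inverse (lead_coeff m)"
    define t where "t = monom c (degree f - degree m)"
    define f' where "f' = f - m * t"
    have ck: "c \<in> k" unfolding c_def by (intro k less.prems m)
    have co: "coeff (m * t) i = (if degree f - degree m \<le> i then coeff m (i - (degree f - degree m)) * c else 0)" for i

    proof -
      have "m * t = monom c (degree f - degree m) * m" unfolding t_def by (rule mult.commute)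
      thus ?thesis by (simp only: coeff_monom_mult mult.commute[of c])
    qed
    have f'k: "coeff f' i \<in> k" for i
    proof -
      have "coeff (m * t) i \<in> k" unfolding co using k(1) ck m(2) k(3) by auto
      thus ?thesis unfolding f'_def by (simp add: k(2) less.prems)
    qed
    have top: "coeff f' (degree f) = 0"
      unfolding f'_def coeff_diff co using False m(1) by (simp add: c_def)
    have "coeff f' i = 0" if "i > degree f" for i
      unfolding f'_def coeff_diff co using that False by (auto simp: coeff_eq_0)
    hence small: "coeff f' i = 0" if "i \<ge> degree f" for i using top that by (cases "i = degree f") auto
    show ?thesis
    proof (cases "f' = 0")
      case True
      hence "f = m * t + 0" by (simp add: f'_def)
      thus ?thesis using k(1) by (intro exI[of _ t] exI[of _ 0]) simp
    next
      case nz: False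
      have "degree f' < degree f"
      proof (rule ccontr)
        assume "\<not> ?thesis"
        hence "lead_coeff f' = 0" by (intro small) simp
        thus False using nz by simp
      qed
      from less.hyps[OF this f'k] obtain q r where qr: "f' = m * q + r" "\<forall>i. coeff r i \<in> k" "r = 0 \<or> degree r < degree m" by blast
      hence "f = m * (t + q) + r" unfolding f'_def by (simp add: algebra_simps)
      thus ?thesis using qr by blast
    qed
  qed
qed

lemma map_poly_to_ac_mult: "map_poly to_ac (p * q) = map_poly to_ac p * map_poly to_ac q"
  by (rule poly_eqI) (simp add: coeff_map_poly coeff_mult to_ac_sum)

lemma poly_map_to_ac: "poly (map_poly to_ac p) (to_ac x) = to_ac (poly p x)"
  by (induction p) (simp_all add: map_poly_pCons_0)

lemma inj_to_ac: "to_ac x = to_ac y \<Longrightarrow> x = (y :: 'a::field)"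
proof (rule ccontr)
  assume e: "to_ac x = to_ac y" and "x \<noteq> y"
  hence "to_ac (x - y) * to_ac (inverse (x - y)) = 1" by (subst to_ac_mult[symmetric]) simp
  moreover have "to_ac (x - y) = 0" using e by simp
  ultimately show False by simp
qed

text \<open>Let \<open>\<gamma> = \<alpha> + c \<beta>\<close> with \<open>c\<close> avoiding the finitely many coincidences between sums of
  conjugates. Then \<open>\<beta>\<close> is the only common root of \<open>q\<close> and \<open>p (\<gamma> - c t)\<close>, and a simple one, so a
  polynomial of minimal degree over \<open>\<rat>(\<gamma>)\<close> with root \<open>\<beta>\<close> is linear.\<close>

lemma primitive_element_step:
  fixes \<alpha> \<beta> :: "'a::field_char_0"
  assumes alg: "\<And>x::'a. \<exists>h. h \<noteq> 0 \<and> rpoly h x = 0"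
  shows "\<exists>\<gamma> P Q. rpoly P \<gamma> = \<alpha> \<and> rpoly Q \<gamma> = \<beta>"
proof -
  \<comment> \<open>The conjugates of \<alpha> and \<beta> live in an algebraic closure, while
    membership of coefficients in \<open>k\<close> is decided in the field itself.\<close>
  define ac where "ac = map_poly (to_ac :: 'a \<Rightarrow> 'a alg_closure)"
  have ac_mult: "ac (f * h) = ac f * ac h" for f h unfolding ac_def by (rule map_poly_to_ac_mult)
  have ac_poly: "poly (ac f) (to_ac x) = to_ac (poly f x)" for f x unfolding ac_def by (rule poly_map_to_ac)
  have ac0: "to_ac (x::'a) = 0 \<longleftrightarrow> x = 0" for x using inj_to_ac[of x 0] by auto
  have ac_nz: "ac f \<noteq> 0" if "f \<noteq> 0" for f
  proof
    assume "ac f = 0"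
    hence "coeff (ac f) (degree f) = 0" by simp
    thus False using that unfolding ac_def by (simp add: coeff_map_poly ac0)
  qed
  obtain p where p: "p \<noteq> 0" "rpoly p \<alpha> = 0" using alg by blast
  obtain q where q: "irreducible q" "lead_coeff q = 1" "rpoly q \<beta> = 0" "\<And>f. rpoly f \<beta> = 0 \<Longrightarrow> q dvd f"
    by (rule minimal_polynomial[OF alg]) blast
  have q0: "q \<noteq> 0" using q(2) by auto
  have dq: "degree q > 0" using q(1) q0 by (auto simp: Factorial_Ring.irreducible_def is_unit_iff_degree)
  define q' where "q' = (map_poly of_rat q :: 'a poly)"
  define p' where "p' = (map_poly of_rat p :: 'a poly)"
  have q'0: "q' \<noteq> 0" "p' \<noteq> 0" unfolding q'_def p'_def using q0 p(1) by simp_all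
  have simple: "poly (pderiv q') \<beta> \<noteq> 0"
  proof
    assume "poly (pderiv q') \<beta> = 0"
    hence "rpoly (pderiv q) \<beta> = 0" unfolding rpoly_def q'_def by (simp add: of_rat_hom.map_poly_pderiv)
    hence "q dvd pderiv q" by (rule q(4))
    moreover have "pderiv q \<noteq> 0" using dq by (simp add: pderiv_eq_0_iff)
    ultimately have "degree q \<le> degree (pderiv q)" by (simp add: dvd_imp_degree_le)
    thus False using dq by (simp add: degree_pderiv)
  qed
  define A where "A = {a. poly (ac p') a = 0}"
  define Bq where "Bq = {b. poly (ac q') b = 0}"
  have fin: "finite A" "finite Bq" unfolding A_def Bq_def using ac_nz q'0 by (intro poly_roots_finite; blast)+
  define ex where "ex = (\<Union>a\<in>A. \<Union>b\<in>Bq - {to_ac \<beta>}. {c::nat. to_ac \<alpha> + of_nat c * to_ac \<beta> = a + of_nat c * b})"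
  \<comment> \<open>Two such values c and c' would give (c - c') (\<beta> - b) = 0, so each pair of
    conjugates excludes at most one value.\<close>
  have fin1: "finite {c::nat. to_ac \<alpha> + of_nat c * to_ac \<beta> = a + of_nat c * b}" if "b \<noteq> to_ac \<beta>" for a b
  proof -
    have "c = c'" if "to_ac \<alpha> + of_nat c * to_ac \<beta> = a + of_nat c * b" "to_ac \<alpha> + of_nat c' * to_ac \<beta> = a + of_nat c' * b" for c c' :: nat
    proof -
      have "(of_nat c - of_nat c') * (to_ac \<beta> - b) = 
        (to_ac \<alpha> + of_nat c * to_ac \<beta> - (a + of_nat c * b)) - (to_ac \<alpha> + of_nat c' * to_ac \<beta> - (a + of_nat c' * b))"
        by (simp only: algebra_simps)
      also have "\<dots> = 0" unfolding that by simp
      finally have "(of_nat c :: 'a alg_closure) - of_nat c' = 0" using \<open>b \<noteq> to_ac \<beta>\<close> by simp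
      hence "to_ac (of_nat c :: 'a) = to_ac (of_nat c')" by simp
      hence "(of_nat c :: 'a) = of_nat c'" by (rule inj_to_ac)
      thus "c = c'" by simp
    qed
    note uniq = this
    show ?thesis
    proof (cases "\<exists>c0::nat. to_ac \<alpha> + of_nat c0 * to_ac \<beta> = a + of_nat c0 * b")
      case True
      then obtain c0 :: nat where c0: "to_ac \<alpha> + of_nat c0 * to_ac \<beta> = a + of_nat c0 * b" ..
      have "{c::nat. to_ac \<alpha> + of_nat c * to_ac \<beta> = a + of_nat c * b} \<subseteq> {c0}" using uniq[OF _ c0] by auto
      thus ?thesis by (rule finite_subset) simp
    next
      case False
      hence "{c::nat. to_ac \<alpha> + of_nat c * to_ac \<beta> = a + of_nat c * b} = {}" by simp
      thus ?thesis by (simp only: finite.emptyI)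
    qed
  qed
  have "finite ex" unfolding ex_def using fin fin1 by (intro finite_UN_I) auto
  then obtain c :: nat where c: "c \<notin> ex" using ex_new_if_finite infinite_UNIV_nat by blast
  define \<gamma> where "\<gamma> = \<alpha> + of_nat c * \<beta>"
  define k where "k = range (\<lambda>P. rpoly P \<gamma>)"
  have kI: "rpoly P \<gamma> \<in> k" for P unfolding k_def by blast
  have k: "0 \<in> k" "\<And>x y. x \<in> k \<Longrightarrow> y \<in> k \<Longrightarrow> x - y \<in> k" "\<And>x y. x \<in> k \<Longrightarrow> y \<in> k \<Longrightarrow> x * y \<in> k"
      "\<And>x. x \<in> k \<Longrightarrow> inverse x \<in> k" "\<And>r. of_rat r \<in> k" "\<gamma> \<in> k" "\<And>x y. x \<in> k \<Longrightarrow> y \<in> k \<Longrightarrow> x + y \<in> k"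
  proof -
    show "0 \<in> k" using kI[of 0] by simp
    show "x - y \<in> k" if xy: "x \<in> k" "y \<in> k" for x y
    proof -
      obtain P Q where "x = rpoly P \<gamma>" "y = rpoly Q \<gamma>" using xy unfolding k_def by blast
      thus ?thesis using kI[of "P - Q"] by simp
    qed
    show "x * y \<in> k" if xy: "x \<in> k" "y \<in> k" for x y
    proof -
      obtain P Q where "x = rpoly P \<gamma>" "y = rpoly Q \<gamma>" using xy unfolding k_def by blast
      thus ?thesis using kI[of "P * Q"] by simp
    qed
    show "x + y \<in> k" if xy: "x \<in> k" "y \<in> k" for x y
    proof -
      obtain P Q where "x = rpoly P \<gamma>" "y = rpoly Q \<gamma>" using xy unfolding k_def by blast
      thus ?thesis using kI[of "P + Q"] by simp
    qed
    show "inverse x \<in> k" if xk: "x \<in> k" for x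
    proof -
      obtain P where P: "x = rpoly P \<gamma>" using xk unfolding k_def by blast
      obtain Q where "rpoly Q \<gamma> = inverse (rpoly P \<gamma>)" using rpoly_inverse[OF alg] by blast
      thus ?thesis using kI[of Q] P by simp
    qed
    show "of_rat r \<in> k" for r using kI[of "[:r:]"] by simp
    show "\<gamma> \<in> k" using kI[of "[:0, 1:]"] by simp
  qed
  define f2 where "f2 = pcompose p' [:\<gamma>, - of_nat c:]"
  have ck: "- of_nat c \<in> k" using k(5)[of "- of_nat c"] by (simp add: of_rat_minus)
  have kmul: "coeff (f * h) i \<in> k" if "\<And>i. coeff f i \<in> k" "\<And>i. coeff h i \<in> k" for f h i
  proof -
    have "sum f A \<in> k" if "\<And>a. f a \<in> k" for f :: "nat \<Rightarrow> 'a" and A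
      by (induction A rule: infinite_finite_induct) (simp_all add: k(1) k(7) that)
    thus ?thesis unfolding coeff_mult by (simp add: k(3) that)
  qed
  have lin: "coeff [:\<gamma>, - of_nat c:] i \<in> k" for i using k(1,6) ck by (auto simp: coeff_pCons split: nat.split)
  have "coeff (pcompose (map_poly of_rat P) [:\<gamma>, - of_nat c:]) i \<in> k" for P i
  proof (induction P arbitrary: i)
    case 0 show ?case using k(1) by simp
  next
    case (pCons a P)
    have "coeff [:of_rat a:] i \<in> k" using k(1,5) by (auto simp: coeff_pCons split: nat.split)
    moreover have "coeff ([:\<gamma>, - of_nat c:] * pcompose (map_poly of_rat P) [:\<gamma>, - of_nat c:]) i \<in> k"
      by (rule kmul[OF lin pCons.IH])
    ultimately show ?case by (simp only: map_poly_pCons_0[where f = of_rat, OF of_rat_0] pcompose_pCons coeff_add k(7))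
  qed
  hence f2k: "coeff f2 i \<in> k" for i unfolding f2_def p'_def by blast
  have q'k: "coeff q' i \<in> k" for i unfolding q'_def by (simp add: coeff_map_poly k(5))
  have f2\<beta>: "poly f2 \<beta> = 0" using p(2) unfolding f2_def p'_def rpoly_def \<gamma>_def by (simp add: poly_pcompose)
  have q'\<beta>: "poly q' \<beta> = 0" using q(3) unfolding q'_def rpoly_def .
  obtain m where m: "m \<noteq> 0" "\<forall>i. coeff m i \<in> k" "poly m \<beta> = 0" 
    and min: "\<And>f. f \<noteq> 0 \<and> (\<forall>i. coeff f i \<in> k) \<and> poly f \<beta> = 0 \<Longrightarrow> degree m \<le> degree f"
    using ex_has_least_nat[of "\<lambda>m. m \<noteq> 0 \<and> (\<forall>i. coeff m i \<in> k) \<and> poly m \<beta> = 0" q' degree] q'0 q'k q'\<beta> by blast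
  have mdvd: "m dvd f" if fk: "\<And>i. coeff f i \<in> k" "poly f \<beta> = 0" for f
  proof -
    obtain u r where ur: "f = m * u + r" "\<forall>i. coeff r i \<in> k" "r = 0 \<or> degree r < degree m"
      using division_in_subfield[OF k(1-4) m(1) m(2)[rule_format] fk(1)] by blast
    have "poly r \<beta> = 0" using fk(2) m(3) unfolding ur(1) by simp
    hence "r = 0" using min[of r] ur(2,3) by fastforce
    thus ?thesis using ur(1) by simp
  qed
  obtain u where u: "q' = m * u" using mdvd[OF q'k q'\<beta>] by (rule dvdE)
  obtain v where v: "f2 = m * v" using mdvd[OF f2k f2\<beta>] by (rule dvdE)
  \<comment> \<open>A root of m is a common root of q and of p (\<gamma> - c t); a root other than
    \<beta> would realize one of the coincidences that c avoids.\<close>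
  have root: "b = to_ac \<beta>" if b: "poly (ac m) b = 0" for b
  proof (rule ccontr)
    assume ne: "b \<noteq> to_ac \<beta>"
    have "poly (ac q') b = 0" unfolding u ac_mult using b by simp
    hence bB: "b \<in> Bq - {to_ac \<beta>}" using ne unfolding Bq_def by simp
    have "poly (ac f2) b = 0" unfolding v ac_mult using b by simp
    moreover have "poly (ac (pcompose P [:\<gamma>, - of_nat c:])) b = poly (ac P) (to_ac \<gamma> - of_nat c * b)" for P
    proof (induction P)
      case 0 show ?case by (simp add: ac_def)
    next
      case (pCons a P)
      have add: "ac (f + h) = ac f + ac h" for f h unfolding ac_def by (rule poly_eqI) (simp add: coeff_map_poly)
      have "poly (ac (pcompose (pCons a P) [:\<gamma>, - of_nat c:])) b = to_ac a + (to_ac \<gamma> - of_nat c * b) * poly (ac (pcompose P [:\<gamma>, - of_nat c:])) b"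
        unfolding pcompose_pCons add ac_mult by (simp add: ac_def map_poly_pCons_0 algebra_simps)
      thus ?case unfolding pCons.IH by (simp add: ac_def map_poly_pCons_0)
    qed
    ultimately have "to_ac \<gamma> - of_nat c * b \<in> A" unfolding A_def f2_def by simp
    moreover have "to_ac \<alpha> + of_nat c * to_ac \<beta> = (to_ac \<gamma> - of_nat c * b) + of_nat c * b" unfolding \<gamma>_def by simp
    ultimately have "c \<in> ex" unfolding ex_def
      by (intro UN_I[of "to_ac \<gamma> - of_nat c * b"] UN_I[OF bB] CollectI)
    thus False using c by blast
  qed
  have dm: "degree m = 1"
  proof -
    obtain M where M: "size M = degree (ac m)" "ac m = smult (lead_coeff (ac m)) (\<Prod>x\<in>#M. [:-x, 1:])"
      using alg_closed_imp_factorization[OF ac_nz[OF m(1)]] by blast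
    have deg: "degree (ac m) = degree m" unfolding ac_def by (rule degree_map_poly) (simp_all add: ac0)
    have "degree m \<noteq> 0"
    proof
      assume "degree m = 0"
      then obtain w where "m = [:w:]" by (rule degree_eq_zeroE)
      thus False using m(1,3) by simp
    qed
    \<comment> \<open>All roots of m are equal to \<beta>, so a degree of at least 2 would make
      \<beta> a double root of q.\<close>
    moreover have "\<not> degree m \<ge> 2"
    proof
      assume "degree m \<ge> 2"
      hence sM: "size M \<ge> 2" using M(1) deg by simp
      have Mx: "x = to_ac \<beta>" if "x \<in># M" for x
      proof (rule root)
        have "[:-x, 1:] dvd (\<Prod>x\<in>#M. [:-x, 1:])" using that by (intro dvd_prod_mset) auto
        hence "poly (\<Prod>x\<in>#M. [:-x, 1:]) x = 0" using poly_eq_0_iff_dvd by blast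
        thus "poly (ac m) x = 0" by (subst M(2)) simp
      qed
      obtain x M1 where M1: "M = add_mset x M1" using sM by (cases M) auto
      obtain y M2 where M2: "M1 = add_mset y M2" using sM unfolding M1 by (cases M1) auto
      have xy: "x = to_ac \<beta>" "y = to_ac \<beta>" using Mx unfolding M1 M2 by auto
      define w where "w = smult (lead_coeff (ac m)) (\<Prod>x\<in>#M2. [:-x, 1:])"
      have "ac m = [:-x, 1:] * ([:-y, 1:] * w)" by (subst M(2)) (simp add: M1 M2 w_def)
      hence "ac q' = [:- to_ac \<beta>, 1:] * ([:- to_ac \<beta>, 1:] * (w * ac u))" unfolding u ac_mult xy by (simp only: mult.assoc)
      hence "poly (pderiv (ac q')) (to_ac \<beta>) = 0" by (simp only: pderiv_mult poly_add poly_mult) simp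
      moreover have "pderiv (ac q') = ac (pderiv q')" unfolding ac_def by (rule poly_eqI) (simp add: coeff_pderiv coeff_map_poly)
      ultimately have "to_ac (poly (pderiv q') \<beta>) = 0" by (simp add: ac_poly)
      thus False using simple by (simp add: ac0)
    qed
    ultimately show ?thesis by simp
  qed
  have "poly m \<beta> = coeff m 0 + \<beta> * coeff m 1" unfolding poly_altdef dm by simp
  moreover have m1: "coeff m 1 \<noteq> 0" using m(1) dm leading_coeff_neq_0[of m] by simp
  ultimately have "\<beta> = (0 - coeff m 0) * inverse (coeff m 1)" using m(3) by (simp add: field_simps add_eq_0_iff)
  moreover have "(0 - coeff m 0) * inverse (coeff m 1) \<in> k" by (intro k(3)[OF k(2)[OF k(1)] k(4)] m(2)[rule_format])
  ultimately have \<beta>k: "\<beta> \<in> k" by simp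
  have "\<gamma> + (- of_nat c) * \<beta> \<in> k" by (rule k(7)[OF k(6) k(3)[OF ck \<beta>k]])
  hence "\<alpha> \<in> k" unfolding \<gamma>_def by simp
  with \<beta>k show ?thesis unfolding k_def by blast
qed

lemma rpoly_bound: "(\<And>i. i \<ge> n \<Longrightarrow> coeff p i = 0) \<Longrightarrow> rpoly p x = (\<Sum>i<n. of_rat (coeff p i) * x ^ i)"
proof -
  assume h: "\<And>i. i \<ge> n \<Longrightarrow> coeff p i = 0"
  have "p = (\<Sum>i<n. monom (coeff p i) i)"
    by (rule poly_eqI) (use h in \<open>auto simp: coeff_sum not_less\<close>)
  hence "rpoly p x = rpoly (\<Sum>i<n. monom (coeff p i) i) x" by simp
  thus ?thesis by (simp only: rpoly_sum rpoly_monom)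
qed

section \<open>An integral generator of the number field\<close>

lemma number_field_algebraic:
  assumes K: "number_field TYPE('a::field_char_0)" shows "\<exists>h. h \<noteq> 0 \<and> rpoly h (x :: 'a) = 0"
proof -
  interpret V: vector_space "rat_scale :: rat \<Rightarrow> 'a \<Rightarrow> 'a" by (rule vector_space_rat_scale)
  obtain S :: "'a set" where S: "finite S" "V.span S = UNIV" using K unfolding number_field_def by blast
  \<comment> \<open>The powers x^0, ..., x^N either repeat or form a linearly dependent set, being
    one more than the spanning vectors; both cases give an equation for x.\<close>
  define N where "N = card S"
  show ?thesis
  proof (cases "inj_on (\<lambda>i. x ^ i) {..N}")
    case False
    then obtain i j where ij: "i \<noteq> j" "x ^ i = x ^ j" unfolding inj_on_def by blast
    have "monom 1 i - monom 1 j \<noteq> (0 :: rat poly)"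
    proof
      assume "monom 1 i - monom 1 j = (0 :: rat poly)"
      hence "coeff (monom 1 i - monom 1 j :: rat poly) i = 0" by simp
      thus False using ij by simp
    qed
    moreover have "rpoly (monom 1 i - monom 1 j) x = 0" using ij by (simp add: rpoly_monom)
    ultimately show ?thesis by blast
  next
    case inj: True
    define B where "B = (\<lambda>i. x ^ i) ` {..N}"
    have fB: "finite B" and cB: "card B = Suc N" unfolding B_def using card_image[OF inj] by simp_all
    have "V.dependent B"
    proof (rule ccontr)
      assume "\<not> V.dependent B"
      from V.independent_span_bound[OF S(1) this] have "card B \<le> card S" using S(2) by simp
      thus False using cB unfolding N_def by simp
    qed
    then obtain u v where u: "v \<in> B" "u v \<noteq> 0" "(\<Sum>v\<in>B. rat_scale (u v) v) = 0"
      unfolding V.dependent_finite[OF fB] by blast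
    then obtain i0 where i0: "i0 \<le> N" "v = x ^ i0" unfolding B_def by blast
    define h where "h = (\<Sum>i\<le>N. monom (u (x ^ i)) i)"
    have "coeff h i0 = u v" unfolding h_def using i0 by (simp add: coeff_sum)
    hence "h \<noteq> 0" using u(2) by auto
    moreover have "rpoly h x = (\<Sum>v\<in>B. rat_scale (u v) v)"
      unfolding h_def B_def sum.reindex[OF inj] by (simp add: rpoly_sum rpoly_monom rat_scale_def)
    ultimately show ?thesis using u(3) by auto
  qed
qed

text \<open>The elements of a finite spanning set are absorbed one by one into a single generator;
  composition of polynomials carries the earlier ones along.\<close>

lemma number_field_simple:
  assumes K: "number_field TYPE('a::field_char_0)" obtains \<gamma> :: "'a::field_char_0" where "\<And>x. \<exists>p. rpoly p \<gamma> = x"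
proof -
  interpret V: vector_space "rat_scale :: rat \<Rightarrow> 'a \<Rightarrow> 'a" by (rule vector_space_rat_scale)
  obtain S :: "'a set" where S: "finite S" "V.span S = UNIV" using K unfolding number_field_def by blast
  have "\<exists>\<gamma>::'a. S \<subseteq> range (\<lambda>p. rpoly p \<gamma>)" using S(1)
  proof (induction S rule: finite_induct)
    case empty show ?case by simp
  next
    case (insert b S)
    then obtain \<gamma>0 :: 'a where \<gamma>0: "S \<subseteq> range (\<lambda>p. rpoly p \<gamma>0)" by blast
    obtain \<gamma> P Q where g: "rpoly P \<gamma> = \<gamma>0" "rpoly Q \<gamma> = b"
      using primitive_element_step[OF number_field_algebraic[OF K], of \<gamma>0 b] by blast
    have "rpoly p \<gamma>0 \<in> range (\<lambda>p. rpoly p \<gamma>)" for p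
      unfolding g(1)[symmetric] rpoly_pcompose[symmetric] by simp
    hence "S \<subseteq> range (\<lambda>p. rpoly p \<gamma>)" using \<gamma>0 by auto
    moreover have "b \<in> range (\<lambda>p. rpoly p \<gamma>)" using g(2) by auto
    ultimately show ?case by (intro exI[of _ \<gamma>]) simp
  qed
  then obtain \<gamma> :: 'a where \<gamma>: "S \<subseteq> range (\<lambda>p. rpoly p \<gamma>)" by blast
  have "V.subspace (range (\<lambda>p. rpoly p \<gamma>))"
  proof (rule V.subspaceI)
    show "0 \<in> range (\<lambda>p. rpoly p \<gamma>)" by (rule range_eqI[of _ _ 0]) simp
    fix x y assume "x \<in> range (\<lambda>p. rpoly p \<gamma>)" "y \<in> range (\<lambda>p. rpoly p \<gamma>)"
    then obtain p q where "x = rpoly p \<gamma>" "y = rpoly q \<gamma>" by blast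
    thus "x + y \<in> range (\<lambda>p. rpoly p \<gamma>)" by (intro range_eqI[of _ _ "p + q"]) simp
  next
    fix c x assume "x \<in> range (\<lambda>p. rpoly p \<gamma>)"
    then obtain p where "x = rpoly p \<gamma>" by blast
    thus "rat_scale c x \<in> range (\<lambda>p. rpoly p \<gamma>)" by (intro range_eqI[of _ _ "smult c p"]) (simp add: rat_scale_def)
  qed
  from V.span_minimal[OF \<gamma> this] have "range (\<lambda>p. rpoly p \<gamma>) = UNIV" using S(2) by auto
  hence "\<exists>p. rpoly p \<gamma> = x" for x by (metis UNIV_I imageE)
  thus ?thesis by (rule that)
qed

lemma algebraic_int_coeff_prod_mset:
  "(\<And>x. x \<in># M \<Longrightarrow> algebraic_int x) \<Longrightarrow> algebraic_int (coeff (\<Prod>x\<in>#M. [:-x, 1:]) i :: 'a::field_char_0)"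
proof (induction M arbitrary: i)
  case empty
  thus ?case using algebraic_int_of_int[of 1] algebraic_int_of_int[of 0] by (simp add: one_pCons coeff_pCons split: nat.split)
next
  case (add x M)
  have IH: "algebraic_int (coeff (\<Prod>x\<in>#M. [:-x, 1:]) j)" for j using add.IH add.prems by simp
  have x: "algebraic_int (- x)" using add.prems[of x] algebraic_int_diff[OF algebraic_int_of_int[of 0], of x] by simp
  have eq: "coeff (\<Prod>x\<in>#add_mset x M. [:-x, 1:]) i = (- x) * coeff (\<Prod>x\<in>#M. [:-x, 1:]) i + (case i of 0 \<Rightarrow> 0 | Suc j \<Rightarrow> coeff (\<Prod>x\<in>#M. [:-x, 1:]) j)"
    by (simp add: coeff_pCons split: nat.split)
  show ?case unfolding eq
    using algebraic_int_add_mult(1)[OF algebraic_int_add_mult(2)[OF x IH[of i]] IH] algebraic_int_add_mult(2)[OF x IH[of i]]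
    by (cases i) simp_all
qed

lemma rational_algebraic_int_complex:
  assumes "algebraic_int (of_rat r :: complex)" shows "\<exists>k. r = of_int k"
proof -
  have "(of_rat r :: complex) \<in> \<int>" using assms by (rule rational_algebraic_int_is_int) simp
  then obtain k where "(of_rat r :: complex) = of_int k" by (rule Ints_cases)
  hence "(of_rat r :: complex) = of_rat (of_int k)" by simp
  hence "r = of_int k" by (simp only: of_rat_eq_iff)
  thus ?thesis ..
qed

lemma rat_poly_integral_coeffs:
  fixes h :: "rat poly"
  assumes "\<And>i. \<exists>k. coeff h i = of_int k" obtains g where "h = map_poly of_int g"
proof
  show "h = map_poly of_int (map_poly floor h)"
  proof (rule poly_eqI)
    fix i
    obtain k where "coeff h i = of_int k" using assms by blast
    thus "coeff h i = coeff (map_poly of_int (map_poly floor h)) i" by (simp add: coeff_map_poly)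
  qed
qed

text \<open>The complex roots of h satisfy the integral equation of \<theta>, so the coefficients of
  h are algebraic integers; being rational, they are integers.\<close>

lemma minimal_polynomial_integral:
  fixes \<theta> :: "'a::field_char_0"
  assumes \<theta>: "algebraic_int \<theta>" and h: "lead_coeff h = 1" "\<And>p. rpoly p \<theta> = 0 \<Longrightarrow> h dvd p"
  obtains g where "h = map_poly of_int g"
proof -
  obtain P where P: "poly (map_poly of_int P) \<theta> = 0" "lead_coeff P = 1"
    using \<theta> unfolding algebraic_int_altdef_ipoly by blast
  have "rpoly (map_poly of_int P) \<theta> = 0" unfolding rpoly_of_int ipoly_def using P(1) .
  hence "h dvd map_poly of_int P" by (rule h(2))
  then obtain k where k: "map_poly of_int P = h * k" by (rule dvdE)
  define hc where "hc = (map_poly of_rat h :: complex poly)"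
  have hc1: "lead_coeff hc = 1" using h(1) unfolding hc_def by simp
  hence "hc \<noteq> 0" by auto
  then obtain M where M: "hc = smult (lead_coeff hc) (\<Prod>x\<in>#M. [:-x, 1:])" using alg_closed_imp_factorization by blast
  hence M: "hc = (\<Prod>x\<in>#M. [:-x, 1:])" using hc1 by simp
  have "algebraic_int z" if "z \<in># M" for z
  proof -
    have "[:-z, 1:] dvd hc" unfolding M using that by (intro dvd_prod_mset) auto
    hence "poly hc z = 0" using poly_eq_0_iff_dvd by blast
    hence "rpoly h z = 0" unfolding rpoly_def hc_def .
    hence "rpoly (map_poly of_int P) z = 0" unfolding k by simp
    hence "poly (map_poly of_int P) z = 0" unfolding rpoly_of_int ipoly_def .
    thus ?thesis unfolding algebraic_int_altdef_ipoly using P(2) by blast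
  qed
  hence "algebraic_int (coeff hc i)" for i unfolding M by (rule algebraic_int_coeff_prod_mset)
  hence "algebraic_int (of_rat (coeff h i) :: complex)" for i unfolding hc_def by (simp add: coeff_map_poly)
  hence "\<exists>k. coeff h i = of_int k" for i by (rule rational_algebraic_int_complex)
  thus ?thesis by (rule rat_poly_integral_coeffs) (rule that)
qed

text \<open>Let c be the leading coefficient of an integer equation for \<gamma>. Multiplication by
  c \<gamma> maps the powers of \<gamma> below the degree to integer combinations of these
  powers.\<close>

lemma integral_multiple:
  fixes \<gamma> :: "'a::field_char_0"
  assumes "\<exists>h. h \<noteq> 0 \<and> rpoly h \<gamma> = 0" obtains c :: int where "c > 0" "algebraic_int (of_int c * \<gamma>)"
proof -
  obtain h where h: "irreducible h" "lead_coeff h = 1" "rpoly h \<gamma> = 0" "\<And>p. rpoly p \<gamma> = 0 \<Longrightarrow> h dvd p"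
    by (rule minimal_polynomial[OF assms]) blast
  obtain c P where c: "c > 0" "smult (of_int c) h = map_poly of_int P" using rat_poly_clear_denominators by blast
  define d where "d = degree h"
  have h0: "h \<noteq> 0" using h(2) by auto
  have d: "d > 0" unfolding d_def using h(1) h0 by (auto simp: Factorial_Ring.irreducible_def is_unit_iff_degree)
  have "degree (map_poly of_int P :: rat poly) = d" unfolding c(2)[symmetric] d_def using c(1) by simp
  hence dP: "degree P = d" by simp
  have "of_int (coeff P d) = coeff (smult (of_int c) h) d" unfolding c(2) by (simp add: coeff_map_poly)
  also have "\<dots> = of_int c" using h(2) unfolding d_def by simp
  finally have Pd: "coeff P d = c" by simp
  have "ipoly P \<gamma> = rpoly (smult (of_int c) h) \<gamma>" unfolding c(2) rpoly_of_int ..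
  also have "\<dots> = 0" using h(3) by simp
  finally have "0 = (\<Sum>i\<le>d. of_int (coeff P i) * \<gamma> ^ i)" unfolding ipoly_altdef dP by simp
  also have "\<dots> = (\<Sum>i<d. of_int (coeff P i) * \<gamma> ^ i) + of_int c * \<gamma> ^ d" by (simp add: lessThan_Suc_atMost[symmetric] Pd)
  finally have top: "of_int c * \<gamma> ^ d = (\<Sum>i<d. of_int (- coeff P i) * \<gamma> ^ i)" by (simp add: sum_negf add_eq_0_iff)
  have "algebraic_int (of_int c * \<gamma>)"
  proof (rule algebraic_int_if_integer_matrix[of "{..<d}" 0 "\<lambda>i. \<gamma> ^ i" _ "\<lambda>i j. if Suc i < d then (if j = Suc i then c else 0) else - coeff P j"])
    show "of_int c * \<gamma> * \<gamma> ^ i = (\<Sum>j<d. of_int (if Suc i < d then (if j = Suc i then c else 0) else - coeff P j) * \<gamma> ^ j)" if "i \<in> {..<d}" for i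
    proof (cases "Suc i < d")
      case True
      have "(\<Sum>j<d. of_int (if j = Suc i then c else 0) * \<gamma> ^ j) = (\<Sum>j<d. if j = Suc i then of_int c * \<gamma> ^ j else 0)"
        by (intro sum.cong) auto
      thus ?thesis using True by (simp add: mult.assoc)
    next
      case False
      hence "d = Suc i" using that by simp
      thus ?thesis using False top by (simp add: mult.assoc)
    qed
  qed (use d in auto)
  thus ?thesis using that c(1) by blast
qed

text \<open>The powers of \<theta> below the degree of its minimal polynomial form a basis over the
  rationals; this identifies the dimension of the field with the degree of g.\<close>

lemma integral_generator:
  assumes K: "number_field TYPE('a::field_char_0)"
  obtains g and \<theta> :: "'a::field_char_0" where "int_poly_field g (number_field_degree TYPE('a))" "ipoly g \<theta> = 0"
    "\<And>x. \<exists>p. rpoly p \<theta> = x" "\<And>p. rpoly p \<theta> = 0 \<Longrightarrow> map_poly of_int g dvd p"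
proof -
  obtain \<gamma> :: 'a where \<gamma>: "\<And>x. \<exists>p. rpoly p \<gamma> = x" by (rule number_field_simple[OF K]) blast
  obtain c where c: "c > 0" "algebraic_int (of_int c * \<gamma>)" by (rule integral_multiple[OF number_field_algebraic[OF K]])
  define \<theta> where "\<theta> = of_int c * \<gamma>"
  have gen: "\<exists>p. rpoly p \<theta> = x" for x
  proof -
    obtain p where p: "rpoly p \<gamma> = x" using \<gamma> by blast
    have "rpoly [:0, inverse (of_int c):] \<theta> = \<gamma>" 
    proof -
      have "of_rat (inverse (of_int c)) = inverse (of_int c :: 'a)" by (simp only: of_rat_inverse of_rat_of_int_eq)
      hence "rpoly [:0, inverse (of_int c):] \<theta> = of_int c * \<gamma> * inverse (of_int c)" by (simp only: rpoly_pCons rpoly_0 \<theta>_def) simp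
      thus ?thesis using c(1) by simp
    qed
    hence "rpoly (pcompose p [:0, inverse (of_int c):]) \<theta> = x" unfolding rpoly_pcompose using p by simp
    thus ?thesis ..
  qed
  obtain h where h: "irreducible h" "lead_coeff h = 1" "rpoly h \<theta> = 0" "\<And>p. rpoly p \<theta> = 0 \<Longrightarrow> h dvd p"
    by (rule minimal_polynomial[OF number_field_algebraic[OF K]]) blast
  obtain g where g: "h = map_poly of_int g" by (rule minimal_polynomial_integral[OF c(2)[folded \<theta>_def] h(2,4)])
  define d where "d = degree h"
  have h0: "h \<noteq> 0" using h(2) by auto
  have d: "d > 0" unfolding d_def using h(1) h0 by (auto simp: Factorial_Ring.irreducible_def is_unit_iff_degree)
  have nz: "p = 0" if "\<And>i. i \<ge> d \<Longrightarrow> coeff p i = 0" "rpoly p \<theta> = 0" for p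
  proof (rule ccontr)
    assume "p \<noteq> 0"
    moreover from this have "d \<le> degree p" unfolding d_def by (intro dvd_imp_degree_le h(4) that(2))
    ultimately show False using that(1)[of "degree p"] by simp
  qed
  interpret V: vector_space "rat_scale :: rat \<Rightarrow> 'a \<Rightarrow> 'a" by (rule vector_space_rat_scale)
  define B where "B = (\<lambda>i. \<theta> ^ i) ` {..<d}"
  have inj: "inj_on (\<lambda>i. \<theta> ^ i) {..<d}"
  proof (rule inj_onI, rule ccontr)
    fix i j assume ij: "i \<in> {..<d}" "j \<in> {..<d}" "\<theta> ^ i = \<theta> ^ j" "i \<noteq> j"
    have "monom 1 i - monom 1 j = (0 :: rat poly)" by (rule nz) (use ij in \<open>auto simp: rpoly_monom\<close>)
    hence "coeff (monom 1 i - monom 1 j :: rat poly) i = 0" by simp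
    thus False using ij by simp
  qed
  have "V.dim UNIV = d"
  proof (rule V.dim_unique[of B])
    show "card B = d" unfolding B_def card_image[OF inj] by simp
    show "V.independent B"
    proof (rule V.independent_if_scalars_zero)
      show "finite B" unfolding B_def by simp
      fix f x assume f: "(\<Sum>x\<in>B. rat_scale (f x) x) = 0" and x: "x \<in> B"
      define p where "p = (\<Sum>i<d. monom (f (\<theta> ^ i)) i)"
      have co: "coeff p i = (if i < d then f (\<theta> ^ i) else 0)" for i unfolding p_def by (simp add: coeff_sum)
      have "p = 0"
      proof (rule nz)
        show "rpoly p \<theta> = 0" using f unfolding p_def B_def sum.reindex[OF inj] by (simp add: rpoly_sum rpoly_monom rat_scale_def)
      qed (simp add: co)
      moreover obtain i where "i < d" "x = \<theta> ^ i" using x unfolding B_def by blast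
      ultimately show "f x = 0" using co[of i] by simp
    qed
    show "UNIV \<subseteq> V.span B"
    proof
      fix x
      obtain p where p: "rpoly p \<theta> = x" using gen by blast
      have "x = rpoly (p div h * h) \<theta> + rpoly (p mod h) \<theta>" unfolding rpoly_add[symmetric] div_mult_mod_eq p ..
      hence "x = rpoly (p mod h) \<theta>" using h(3) by simp
      also have "\<dots> = (\<Sum>i<d. of_rat (coeff (p mod h) i) * \<theta> ^ i)"
      proof (rule rpoly_bound)
        fix i assume "i \<ge> d"
        thus "coeff (p mod h) i = 0" using degree_mod_less[OF h0, of p] unfolding d_def by (auto simp: coeff_eq_0)
      qed
      also have "\<dots> = (\<Sum>i<d. rat_scale (coeff (p mod h) i) (\<theta> ^ i))" by (simp add: rat_scale_def)
      also have "\<dots> \<in> V.span B"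
        by (rule V.span_sum, rule V.span_scale, rule V.span_base) (simp add: B_def)
      finally show "x \<in> V.span B" .
    qed
  qed simp
  hence n: "number_field_degree TYPE('a) = d" unfolding number_field_degree_def .
  have "int_poly_field g (number_field_degree TYPE('a))"
  proof unfold_locales
    show "lead_coeff g = 1" using h(2) unfolding g by simp
    show "degree g = number_field_degree TYPE('a)" unfolding n d_def g by simp
  qed (use h(1) d in \<open>simp_all add: n g\<close>)
  moreover have "ipoly g \<theta> = 0" using h(3) unfolding g rpoly_of_int .
  ultimately show ?thesis by (rule that[OF _ _ gen h(4)[unfolded g]])
qed

section \<open>Number fields\<close>

locale number_field_basis = int_poly_field g n for g n +
  fixes \<theta> :: "'a::field_char_0"
  assumes root: "ipoly g \<theta> = 0" and generates: "\<exists>p. rpoly p \<theta> = x"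
    and minimal: "rpoly p \<theta> = 0 \<Longrightarrow> map_poly of_int g dvd p"
begin

section \<open>Complex embeddings and the house\<close>

definition rep :: "'a \<Rightarrow> rat poly" where "rep x = (SOME p. rpoly p \<theta> = x)"

lemma rep: "rpoly (rep x) \<theta> = x"
  unfolding rep_def by (rule someI_ex[OF generates])

text \<open>The embedding that sends \<theta> to t. For a root t of \<open>g\<close> its value is
  the same for every polynomial representing x, since two of them differ by a multiple of
  \<open>g\<close>.\<close>

definition conj :: "complex \<Rightarrow> 'a \<Rightarrow> complex" where "conj t x = rpoly (rep x) t"

lemma conj_rpoly: "t \<in> Theta \<Longrightarrow> conj t (rpoly p \<theta>) = rpoly p t"
proof -
  assume t: "t \<in> Theta"
  have "rpoly (rep (rpoly p \<theta>) - p) \<theta> = 0" by (simp add: rep)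
  from minimal[OF this] obtain k where k: "rep (rpoly p \<theta>) - p = map_poly of_int g * k" by (rule dvdE)
  have "rpoly (map_poly of_int g * k) t = 0" using t by (simp add: rpoly_of_int Theta_def)
  hence "rpoly (rep (rpoly p \<theta>) - p) t = 0" unfolding k .
  thus ?thesis unfolding conj_def by simp
qed

lemma conj_ipoly: "t \<in> Theta \<Longrightarrow> conj t (ipoly p \<theta>) = ipoly p t"
  using conj_rpoly[of t "map_poly of_int p"] by (simp add: rpoly_of_int)

lemma conj_hom:
  assumes t: "t \<in> Theta"
  shows "conj t (x + y) = conj t x + conj t y" "conj t (x * y) = conj t x * conj t y" "conj t 1 = 1"
    "conj t (of_int k) = of_int k"
proof -
  show "conj t (x + y) = conj t x + conj t y"
    using conj_rpoly[OF t, of "rep x + rep y"] by (simp add: rep) (simp add: conj_def)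
  show "conj t (x * y) = conj t x * conj t y"
    using conj_rpoly[OF t, of "rep x * rep y"] by (simp add: rep) (simp add: conj_def)
  show "conj t 1 = 1" using conj_rpoly[OF t, of 1] by simp
  show "conj t (of_int k) = of_int k" using conj_ipoly[OF t, of "[:k:]"] by simp
qed

text \<open>A homomorphism is determined by the image of \<theta>, which has to be a root of
  \<open>g\<close>. This also shows that the maximum in \<open>house\<close> runs over a finite
  nonempty set.\<close>

lemma complex_embeddings_eq: "complex_embeddings = conj ` Theta"
proof
  show "conj ` Theta \<subseteq> complex_embeddings"
    by (auto simp: complex_embeddings_def conj_hom)
  show "(complex_embeddings :: ('a \<Rightarrow> complex) set) \<subseteq> conj ` Theta"
  proof
    fix s :: "'a \<Rightarrow> complex" assume "s \<in> complex_embeddings"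
    hence s: "s 1 = 1" "\<And>x y. s (x + y) = s x + s y" "\<And>x y. s (x * y) = s x * s y" by (auto simp: complex_embeddings_def)
    have s0: "s 0 = 0" using s(2)[of 0 0] by simp
    have sm: "s (- x) = - s x" for x using s(2)[of x "- x"] s0 by (simp add: add_eq_0_iff)
    have sn: "s (of_nat m) = of_nat m" for m by (induction m) (simp_all add: s0 s(1,2))
    have si: "s (of_int k) = of_int k" for k by (cases k rule: int_cases2) (simp_all add: sm sn)
    have sP: "s (ipoly P x) = ipoly P (s x)" for P x by (induction P) (simp_all add: s0 s(2,3) si)
    have "ipoly g (s \<theta>) = 0" unfolding sP[symmetric] root s0 ..
    hence sT: "s \<theta> \<in> Theta" unfolding Theta_def by simp
    have "s x = conj (s \<theta>) x" for x
    proof -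
      \<comment> \<open>Additivity and multiplicativity determine s on integer polynomials in
        \<theta>; rational coefficients are reached by clearing denominators.\<close>
      obtain c P where c: "c > 0" "smult (of_int c) (rep x) = map_poly of_int P" using rat_poly_clear_denominators by blast
      have 1: "rpoly (smult (of_int c) (rep x)) z = ipoly P z" for z :: 'a unfolding c(2) rpoly_of_int ..
      have 2: "rpoly (smult (of_int c) (rep x)) z = ipoly P z" for z :: complex unfolding c(2) rpoly_of_int ..
      have "of_int c * x = ipoly P \<theta>" using 1[of \<theta>] by (simp add: rep)
      hence "s (of_int c * x) = ipoly P (s \<theta>)" by (simp only: sP)
      hence "of_int c * s x = of_int c * rpoly (rep x) (s \<theta>)" using 2[of "s \<theta>"] by (simp add: s(3) si)
      thus ?thesis using c(1) by (simp add: conj_def)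
    qed
    hence "s = conj (s \<theta>)" by (rule ext)
    thus "s \<in> conj ` Theta" using sT by (rule image_eqI)
  qed
qed

lemma house_eq: "house (x::'a) = Max ((\<lambda>t. cmod (conj t x)) ` Theta)"
  unfolding house_def complex_embeddings_eq image_image ..

lemma Theta_ne: "Theta \<noteq> {}" using Theta_card n_pos by auto

lemma house_ge: "t \<in> Theta \<Longrightarrow> cmod (conj t x) \<le> house x"
  unfolding house_eq using Theta_finite by (intro Max_ge) auto

lemma house_le: "(\<And>t. t \<in> Theta \<Longrightarrow> cmod (conj t x) \<le> M) \<Longrightarrow> house x \<le> M"
  unfolding house_eq using Theta_finite Theta_ne by (intro Max.boundedI) auto

lemma house_props:
  "house (x::'a) \<ge> 0" "house (x + y :: 'a) \<le> house x + house y" "house (x * y :: 'a) \<le> house x * house y"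
  "house (of_nat m :: 'a) \<le> real m"
proof -
  obtain t where t: "t \<in> Theta" using Theta_ne by blast
  show h0: "house x \<ge> 0" for x :: 'a using order_trans[OF norm_ge_zero house_ge[OF t]] .
  show "house (x + y) \<le> house x + house y"
    by (rule house_le) (simp add: conj_hom order_trans[OF norm_triangle_ineq] add_mono house_ge)
  show "house (x * y) \<le> house x * house y"
    by (rule house_le) (simp add: conj_hom norm_mult mult_mono house_ge h0)
  show "house (of_nat m :: 'a) \<le> real m"
    using conj_hom(4)[of _ "int m"] by (intro house_le) simp
qed

section \<open>Integral coordinates and residue maps\<close>

lemma algebraic_int_conj: 
  assumes "algebraic_int x" "t \<in> Theta" shows "algebraic_int (conj t x)"
proof -
  obtain P where P: "poly (map_poly of_int P) x = 0" "lead_coeff P = 1"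
    using assms(1) unfolding algebraic_int_altdef_ipoly by blast
  have "ipoly P (conj t x) = conj t (ipoly P x)"
    by (induction P) (use conj_hom[OF assms(2)] conj_hom(4)[OF assms(2), of 0] in \<open>simp_all\<close>)
  also have "ipoly P x = 0" using P(1) unfolding ipoly_def .
  also have "conj t 0 = 0" using conj_hom(4)[OF assms(2), of 0] by simp
  finally have "poly (map_poly of_int P) (conj t x) = 0" unfolding ipoly_def .
  thus ?thesis unfolding algebraic_int_altdef_ipoly using P(2) by blast
qed

text \<open>In the role of a discriminant, a common denominator: its product with any algebraic
  integer of the field lies in \<int>[\<theta>].\<close>

definition Dg :: int where "Dg = (SOME D. D \<noteq> 0 \<and> (\<exists>U V. U * g + V * pderiv g = [:D:]))"

lemma Dg: "Dg \<noteq> 0" "\<exists>U V. U * g + V * pderiv g = [:Dg:]"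
proof -
  have "\<exists>D. D \<noteq> 0 \<and> (\<exists>U V. U * g + V * pderiv g = [:D:])" using bezout_pderiv by metis
  from someI_ex[OF this] show "Dg \<noteq> 0" "\<exists>U V. U * g + V * pderiv g = [:Dg:]" unfolding Dg_def by blast+
qed

text \<open>By Lagrange interpolation at the conjugates of \<open>\<theta>\<close>, the coordinates of \<open>Dg * x\<close> are
  rational algebraic integers, because \<open>Dg / g' t\<close> is integral over \<open>\<int>\<close>.\<close>

lemma integral_coordinates:
  assumes x: "x \<in> OK" shows "\<exists>b. (\<forall>i\<ge>n. coeff b i = 0) \<and> ipoly b \<theta> = of_int Dg * x"
proof -
  obtain U V where UV: "U * g + V * pderiv g = [:Dg:]" using Dg(2) by blast
  let ?g = "map_poly of_int g :: rat poly"
  define a where "a = rep x mod ?g"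
  have g0: "?g \<noteq> 0" using g_nz by simp
  have an: "coeff a i = 0" if "i \<ge> n" for i
    unfolding a_def using degree_mod_less[OF g0, of "rep x"] that deg by (auto simp: coeff_eq_0)
  have "x = rpoly (rep x div ?g * ?g) \<theta> + rpoly a \<theta>" unfolding rpoly_add[symmetric] a_def div_mult_mod_eq rep ..
  hence ax: "rpoly a \<theta> = x" by (simp add: rpoly_of_int root)
  define ac where "ac = (map_poly of_rat a :: complex poly)"
  have acn: "coeff ac i = 0" if "i \<ge> n" for i unfolding ac_def using an[OF that] by (simp add: coeff_map_poly)
  have act: "poly ac t = conj t x" if "t \<in> Theta" for t
    using conj_rpoly[OF that, of a] ax unfolding rpoly_def ac_def by simp
  have "\<exists>k. of_int Dg * coeff a i = of_int k" for i
  proof (rule rational_algebraic_int_complex)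
    have V: "of_int Dg / poly (qt t) t = ipoly V t" if t: "t \<in> Theta" for t
    proof -
      have "ipoly (U * g + V * pderiv g) t = of_int Dg" unfolding UV by simp
      hence "ipoly V t * poly (qt t) t = of_int Dg" using t pderiv_g_qt[OF t] by (simp add: Theta_def)
      thus ?thesis using poly_qt[OF t, of t] by (simp add: field_simps)
    qed
    have "(of_rat (of_int Dg * coeff a i) :: complex) = of_int Dg * coeff ac i" unfolding ac_def by (simp add: coeff_map_poly of_rat_mult)
    also have "coeff ac i = (\<Sum>t\<in>Theta. poly ac t / poly (qt t) t * coeff (qt t) i)"
      by (subst lagrange[OF acn]) (simp_all add: coeff_sum)
    also have "of_int Dg * \<dots> = (\<Sum>t\<in>Theta. conj t x * ipoly V t * coeff (qt t) i)"
      unfolding sum_distrib_left by (intro sum.cong refl) (simp add: act V[symmetric])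
    also have "algebraic_int \<dots>"
    proof (rule algebraic_int_sum)
      fix t assume t: "t \<in> Theta"
      have "qt t = (\<Prod>z\<in>#mset_set (Theta - {t}). [:-z, 1:])" unfolding qt_def prod_unfold_prod_mset ..
      hence "algebraic_int (coeff (qt t) i)"
        by (simp only:, intro algebraic_int_coeff_prod_mset) (use Theta_algebraic_int Theta_finite in auto)
      moreover have "algebraic_int (conj t x)" using x t by (simp add: ring_of_integers_def algebraic_int_conj)
      moreover have "algebraic_int (ipoly V t)" by (rule algebraic_int_ipoly[OF Theta_algebraic_int[OF t]])
      ultimately show "algebraic_int (conj t x * ipoly V t * coeff (qt t) i)" by (intro algebraic_int_add_mult(2))
    qed
    finally show "algebraic_int (of_rat (of_int Dg * coeff a i) :: complex)" .
  qed
  hence "\<exists>k. coeff (smult (of_int Dg) a) i = of_int k" for i by simp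
  then obtain b where b: "smult (of_int Dg) a = map_poly of_int b" by (rule rat_poly_integral_coeffs)
  have "ipoly b \<theta> = of_int Dg * x" unfolding rpoly_of_int[symmetric] b[symmetric] by (simp add: ax)
  moreover have "coeff b i = 0" if "i \<ge> n" for i
  proof -
    have "of_int (coeff b i) = coeff (smult (of_int Dg) a) i" unfolding b by (simp add: coeff_map_poly)
    thus ?thesis using an[OF that] by simp
  qed
  ultimately show ?thesis by blast
qed

text \<open>The coordinates of Dg x in the powers of \<theta>. Their norm \<open>nrm (co x)\<close>
  is Dg^n times the norm of x and will serve as \<open>Nm\<close>.\<close>

definition co :: "'a \<Rightarrow> int poly" where
  "co x = (SOME b. (\<forall>i\<ge>n. coeff b i = 0) \<and> ipoly b \<theta> = of_int Dg * x)"

lemma co: "x \<in> OK \<Longrightarrow> i \<ge> n \<Longrightarrow> coeff (co x) i = 0" "x \<in> OK \<Longrightarrow> ipoly (co x) \<theta> = of_int Dg * x"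
  using someI_ex[OF integral_coordinates[of x]] unfolding co_def by blast+

lemma ipoly_zero_dvd: "ipoly c \<theta> = 0 \<Longrightarrow> \<exists>k. c = g * k"
proof -
  assume c: "ipoly c \<theta> = 0"
  have "ipoly (g * quo c + rem c) \<theta> = 0" using c rem_eq[of c] by simp
  hence "rpoly (map_poly of_int (rem c)) \<theta> = 0" by (simp add: root rpoly_of_int)
  hence "map_poly of_int g dvd (map_poly of_int (rem c) :: rat poly)" by (rule minimal)
  hence "rem c = 0" using not_dvd_small[of "rem c"] coeff_rem[of _ c] by blast
  thus ?thesis using rem_eq[of c] by auto
qed

lemma ipoly_inj: "(\<And>i. i \<ge> n \<Longrightarrow> coeff a i = 0) \<Longrightarrow> (\<And>i. i \<ge> n \<Longrightarrow> coeff b i = 0) \<Longrightarrow> ipoly a \<theta> = ipoly b \<theta> \<Longrightarrow> a = b"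
proof -
  assume a: "\<And>i. i \<ge> n \<Longrightarrow> coeff a i = 0" and b: "\<And>i. i \<ge> n \<Longrightarrow> coeff b i = 0" and eq: "ipoly a \<theta> = ipoly b \<theta>"
  have "rpoly (map_poly of_int (a - b)) \<theta> = 0" unfolding rpoly_of_int using eq by simp
  hence "map_poly of_int g dvd (map_poly of_int (a - b) :: rat poly)" by (rule minimal)
  hence "a - b = 0" using not_dvd_small[of "a - b"] a b by auto
  thus "a = b" by simp
qed

lemma co_eqI: "x \<in> OK \<Longrightarrow> (\<And>i. i \<ge> n \<Longrightarrow> coeff b i = 0) \<Longrightarrow> ipoly b \<theta> = of_int Dg * x \<Longrightarrow> co x = b"
  by (rule ipoly_inj) (simp_all add: co)

lemma co_conj: "x \<in> OK \<Longrightarrow> t \<in> Theta \<Longrightarrow> ipoly (co x) t = of_int Dg * conj t x"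
  using conj_ipoly[of t "co x"] by (simp add: co conj_hom)

lemma norm_co_le: "x \<in> OK \<Longrightarrow> \<bar>real_of_int (nrm (co x))\<bar> \<le> (\<bar>real_of_int Dg\<bar> * house x) ^ n"
proof -
  assume x: "x \<in> OK"
  have "\<bar>real_of_int (nrm (co x))\<bar> = cmod (of_int (nrm (co x)))" by simp
  also have "\<dots> = (\<Prod>t\<in>Theta. cmod (ipoly (co x) t))" unfolding nrm by (rule prod_norm[symmetric])
  also have "\<dots> \<le> (\<Prod>t\<in>Theta. \<bar>real_of_int Dg\<bar> * house x)"
    by (rule prod_mono) (simp add: co_conj[OF x] norm_mult mult_left_mono house_ge)
  finally show ?thesis by (simp add: Theta_card)
qed

text \<open>The coordinates are evaluated at a root of \<open>g\<close> modulo a power of p and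
  divided by Dg, which is invertible there. Multiplicativity holds because Dg times the coordinates
  of x y differs from the product of the coordinates of x and y by a multiple of
  \<open>g\<close>.\<close>

lemma residue_map_exists:
  assumes p: "prime p" and D: "\<not> int p dvd Dg" and R: "int p ^ Suc E dvd poly g R"
  shows "\<exists>\<phi>. residue_map (\<lambda>x. nrm (co x)) p E \<phi>"
proof -
  \<comment> \<open>One power of p more than required: then q > 1 even for E = 0, and reduction
    modulo q yields \<phi> 1 = 1 exactly.\<close>
  define q where "q = int p ^ Suc E"
  have q1: "q > 1" unfolding q_def using prime_gt_1_nat[OF p] by (intro one_less_power) auto
  have Eq: "int p ^ e dvd q" if "e \<le> E" for e unfolding q_def using that by (intro le_imp_power_dvd) simp
  have "coprime Dg q"
    unfolding q_def using D p by (intro coprime_power_right_iff[THEN iffD2] disjI1) (use prime_imp_coprime[of "int p" Dg] in \<open>simp add: coprime_commute\<close>)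
  then obtain w v where wv: "w * Dg + v * q = 1"
    using bezout_coefficients_fst_snd[of Dg q] by (auto simp: coprime_iff_gcd_eq_1)
  define \<psi> where "\<psi> x = w * poly (co x) R" for x
  define \<phi> where "\<phi> x = \<psi> x mod q" for x
  have \<phi>\<psi>: "q dvd \<phi> x - \<psi> x" for x unfolding \<phi>_def by (metis dvd_minus_iff minus_diff_eq minus_mod_eq_mult_div dvd_triv_left)
  have wD: "q dvd w * Dg - 1" using wv by (metis add_diff_cancel_left' diff_minus_eq_add dvd_diff_commute dvd_triv_right minus_diff_eq add.commute)
  have gR: "q dvd poly g R" using R by (simp add: q_def)
  have "residue_map (\<lambda>x. nrm (co x)) p E \<phi>" unfolding residue_map_def
  proof (intro conjI ballI allI impI)
    have "co 0 = 0" by (rule co_eqI) auto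
    thus "\<phi> 0 = 0" unfolding \<phi>_def \<psi>_def by simp
    have "co 1 = [:Dg:]" by (rule co_eqI) (use n_pos in \<open>auto simp: coeff_pCons split: nat.split\<close>)
    hence "\<psi> 1 = w * Dg" unfolding \<psi>_def by simp
    hence "\<phi> 1 = 1 mod q" unfolding \<phi>_def using wD by (simp add: mod_eq_dvd_iff)
    thus "\<phi> 1 = 1" using q1 by simp
  next
    fix x y :: 'a assume x: "x \<in> OK" and y: "y \<in> OK"
    have "co (x + y) = co x + co y" by (rule co_eqI) (use x y in \<open>auto simp: co algebra_simps\<close>)
    hence a: "\<psi> (x + y) = \<psi> x + \<psi> y" unfolding \<psi>_def by (simp add: algebra_simps)
    have "q dvd (\<phi> (x + y) - \<psi> (x + y)) - ((\<phi> x - \<psi> x) + (\<phi> y - \<psi> y))" by (intro dvd_diff dvd_add \<phi>\<psi>)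
    hence "q dvd \<phi> (x + y) - (\<phi> x + \<phi> y)" unfolding a by (simp add: algebra_simps)
    thus "int p ^ E dvd \<phi> (x + y) - (\<phi> x + \<phi> y)" by (rule dvd_trans[OF Eq[OF order_refl]])
    have "ipoly (smult Dg (co (x * y)) - co x * co y) \<theta> = 0" using x y by (simp add: co OK_closed algebra_simps)
    then obtain k where k: "smult Dg (co (x * y)) - co x * co y = g * k" using ipoly_zero_dvd by blast
    have "poly (smult Dg (co (x * y)) - co x * co y) R = poly g R * poly k R" unfolding k by simp
    hence 1: "q dvd Dg * poly (co (x * y)) R - poly (co x) R * poly (co y) R" using gR by simp
    have "q dvd w * w * (Dg * poly (co (x * y)) R - poly (co x) R * poly (co y) R) - (w * Dg - 1) * \<psi> (x * y)"
      by (intro dvd_diff dvd_mult[OF 1] dvd_mult2[OF wD])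
    hence 2: "q dvd \<psi> (x * y) - \<psi> x * \<psi> y" unfolding \<psi>_def by (simp add: algebra_simps)
    have "q dvd (\<phi> (x * y) - \<psi> (x * y)) + (\<psi> (x * y) - \<psi> x * \<psi> y) - (\<phi> x * \<phi> y - \<psi> x * \<psi> y)"
      by (intro dvd_diff dvd_add \<phi>\<psi> 2 dvd_mult_diff)
    hence "q dvd \<phi> (x * y) - \<phi> x * \<phi> y" by simp
    thus "int p ^ E dvd \<phi> (x * y) - \<phi> x * \<phi> y" by (rule dvd_trans[OF Eq[OF order_refl]])
  next
    fix x :: 'a and e assume x: "x \<in> OK" and e: "e \<le> E" and d: "int p ^ e dvd \<phi> x"
    note eq = Eq[OF e]
    have "int p ^ e dvd \<phi> x - (\<phi> x - \<psi> x)" by (intro dvd_diff d dvd_trans[OF eq \<phi>\<psi>])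
    hence "int p ^ e dvd \<psi> x" by simp
    \<comment> \<open>As w Dg is 1 modulo q, multiplication by Dg recovers the value of the
      coordinate polynomial at R.\<close>
    hence "int p ^ e dvd Dg * \<psi> x - (w * Dg - 1) * poly (co x) R" by (intro dvd_diff dvd_mult dvd_mult2 dvd_trans[OF eq wD])
    hence "int p ^ e dvd poly (co x) R" unfolding \<psi>_def by (simp add: algebra_simps)
    thus "int p ^ e dvd nrm (co x)" by (rule root_divides_norm[OF dvd_trans[OF eq gR]])
  qed
  thus ?thesis by blast
qed

lemma residue_supply_exists: "\<exists>Ck Box Nm T0. residue_supply n Ck (Box :: real \<Rightarrow> 'a set) Nm T0"
proof -
  obtain C1 :: real where C1: "C1 > 0" 
    "\<And>a M i. (\<And>i. i \<ge> n \<Longrightarrow> coeff a i = 0) \<Longrightarrow> (\<And>t. t \<in> Theta \<Longrightarrow> cmod (poly a t) \<le> M) \<Longrightarrow> cmod (coeff a i) \<le> C1 * M"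
    by (rule coeff_le_values) blast
  obtain C2 :: real where C2: "C2 > 0" "\<And>a M t. a \<in> small M \<Longrightarrow> t \<in> Theta \<Longrightarrow> cmod (ipoly a t) \<le> C2 * M"
    by (rule values_le_coeff) blast
  define DD where "DD = \<bar>real_of_int Dg\<bar>"
  have DD: "DD \<ge> 1" unfolding DD_def using Dg(1) by linarith
  define K where "K = C1 * DD"
  have K0: "K > 0" unfolding K_def using C1(1) DD by simp
  obtain T0 :: real where T0: "T0 \<ge> 1" 
    "\<And>T. T \<ge> T0 \<Longrightarrow> \<exists>S. finite S \<and> (\<forall>p\<in>S. good p \<and> roots p \<noteq> {} \<and> p > nat \<bar>Dg\<bar> \<and> T < p \<and> real p \<le> T powr (4/3)) 
       \<and> (\<Sum>p\<in>S. ln (real p)) \<ge> 2 * T" by (rule many_primes_with_root[of "nat \<bar>Dg\<bar>"]) blast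
  \<comment> \<open>One constant that dominates three: (2 K + 3)^n for the count of integers of
    bounded height, C2 for the heights in the boxes, and DD^n for the norms.\<close>
  define Ck where "Ck = 1 + (2 * K + 3) ^ n + C2 + DD ^ n"
  have Ck: "Ck \<ge> 1" "Ck \<ge> (2 * K + 3) ^ n" "Ck \<ge> C2" "Ck \<ge> DD ^ n"
    unfolding Ck_def using K0 C2(1) DD zero_le_power[of "2 * K + 3" n] zero_le_power[of DD n] by linarith+
  define Box where "Box L = (\<lambda>a. ipoly a \<theta>) ` box 0 (\<lfloor>L\<rfloor> + 1)" for L :: real
  have \<theta>: "algebraic_int \<theta>" unfolding algebraic_int_altdef_ipoly using root monic unfolding ipoly_def by blast
  have hs: "house (ipoly a \<theta>) \<le> Ck * L" if a: "a \<in> small \<lfloor>L\<rfloor>" and L: "L \<ge> 0" for a and L :: real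
  proof (rule house_le)
    fix t assume t: "t \<in> Theta"
    have "cmod (conj t (ipoly a \<theta>)) \<le> C2 * real_of_int \<lfloor>L\<rfloor>" unfolding conj_ipoly[OF t] by (rule C2(2)[OF a t])
    also have "\<dots> \<le> Ck * L" using C2(1) Ck(1,3) L by (intro mult_mono) auto
    finally show "cmod (conj t (ipoly a \<theta>)) \<le> Ck * L" .
  qed
  have "residue_supply n Ck Box (\<lambda>x. nrm (co x)) T0"
  proof unfold_locales
    show "0 < n" by (rule n_pos)
    show "1 \<le> Ck" by (rule Ck(1))
    show "0 \<le> house x" "house (x + y) \<le> house x + house y" "house (x * y) \<le> house x * house y" for x y :: 'a by (rule house_props)+
    show "house (of_nat m :: 'a) \<le> real m" for m by (rule house_props(4))
    show "1 \<le> T0" by (rule T0(1))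
  next
    fix L :: real assume L: "0 \<le> L"
    show "finite (Box L)" unfolding Box_def by (intro finite_imageI finite_box)
    show "Box L \<subseteq> OK" unfolding Box_def ring_of_integers_def using algebraic_int_ipoly[OF \<theta>] by blast
    have "inj_on (\<lambda>a. ipoly a \<theta>) (box 0 (\<lfloor>L\<rfloor> + 1))"
      by (rule inj_onI, rule ipoly_inj) (simp_all add: box_def)
    hence "card (Box L) = nat (\<lfloor>L\<rfloor> + 1) ^ n" unfolding Box_def by (simp add: card_image card_box)
    hence "real (card (Box L)) = (real_of_int \<lfloor>L\<rfloor> + 1) ^ n" using L by simp
    thus "L ^ n < real (card (Box L))" using L n_pos by (simp add: power_strict_mono)
    fix x assume x: "x \<in> Box L"
    then obtain a where a: "a \<in> box 0 (\<lfloor>L\<rfloor> + 1)" "x = ipoly a \<theta>" unfolding Box_def by blast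
    show "house x \<le> Ck * L" unfolding a(2) by (rule hs[OF _ L]) (use a(1) in \<open>auto simp: box_def small_def\<close>)
    fix y assume y: "y \<in> Box L"
    then obtain b where b: "b \<in> box 0 (\<lfloor>L\<rfloor> + 1)" "y = ipoly b \<theta>" unfolding Box_def by blast
    have "a - b \<in> small \<lfloor>L\<rfloor>" unfolding small_def
    proof (intro CollectI conjI allI impI)
      fix i assume i: "i < n"
      have "0 \<le> coeff a i" "coeff a i < \<lfloor>L\<rfloor> + 1" "0 \<le> coeff b i" "coeff b i < \<lfloor>L\<rfloor> + 1"
        using a(1) b(1) i unfolding box_def by blast+
      thus "\<bar>coeff (a - b) i\<bar> \<le> \<lfloor>L\<rfloor>" by simp
    next
      fix i assume "i \<ge> n" thus "coeff (a - b) i = 0" using a(1) b(1) by (simp add: box_def)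
    qed
    from hs[OF this L] show "house (x - y) \<le> Ck * L" unfolding a(2) b(2) by simp
  next
    fix H :: real assume H: "1 \<le> H"
    define m where "m = \<lceil>K * H\<rceil>"
    have KH: "K * H > 0" using K0 H by simp
    hence m0: "m \<ge> 0" unfolding m_def by simp
    define Z where "Z = {x\<in>OK. house (x::'a) \<le> H}"
    have img: "co ` Z \<subseteq> box (-m) (m + 1)"
    proof
      fix b assume "b \<in> co ` Z"
      then obtain x where x: "x \<in> OK" "house x \<le> H" "b = co x" unfolding Z_def by blast
      have "\<bar>coeff b i\<bar> \<le> m" for i
      proof -
        let ?b = "map_poly of_int b :: complex poly"
        have "cmod (coeff ?b i) \<le> C1 * (DD * H)"
        proof (rule C1(2))
          show "coeff ?b i = 0" if "i \<ge> n" for i using co(1)[OF x(1) that] x(3) by (simp add: coeff_map_poly)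
          fix t assume t: "t \<in> Theta"
          have "cmod (poly ?b t) = DD * cmod (conj t x)" using co_conj[OF x(1) t] unfolding x(3) ipoly_def DD_def by (simp add: norm_mult)
          also have "\<dots> \<le> DD * H" using house_ge[OF t, of x] x(2) DD by (intro mult_left_mono) auto
          finally show "cmod (poly ?b t) \<le> DD * H" .
        qed
        hence "real_of_int \<bar>coeff b i\<bar> \<le> K * H" unfolding K_def by (simp add: coeff_map_poly mult.assoc)
        thus ?thesis unfolding m_def by linarith
      qed
      moreover have "coeff b i = 0" if "i \<ge> n" for i using co(1)[OF x(1) that] x(3) by simp
      ultimately show "b \<in> box (-m) (m + 1)" unfolding box_def by (simp add: abs_le_iff minus_le_iff)
    qed
    have inj: "inj_on co Z"
    proof (rule inj_onI)
      fix x y assume xy: "x \<in> Z" "y \<in> Z" "co x = co y"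
      hence "of_int Dg * x = ipoly (co y) \<theta>" using co(2)[of x] unfolding Z_def by simp
      also have "\<dots> = of_int Dg * y" by (rule co(2)) (use xy in \<open>simp add: Z_def\<close>)
      finally have "of_int Dg * x = of_int Dg * y" .
      thus "x = y" using Dg(1) by simp
    qed
    show "finite {x\<in>OK. house (x::'a) \<le> H}" using finite_subset[OF img finite_box] finite_image_iff[OF inj] unfolding Z_def by blast
    have "card Z \<le> card (box (-m) (m + 1))" by (rule card_inj_on_le[OF inj img finite_box])
    hence "real (card Z) \<le> real (nat (m + 1 - (- m)) ^ n)" unfolding card_box by (simp only: of_nat_le_iff)
    also have "\<dots> = (2 * real_of_int m + 1) ^ n" using m0 by (simp add: algebra_simps)
    also have "\<dots> \<le> ((2 * K + 3) * H) ^ n"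
    proof (rule power_mono)
      have "real_of_int m \<le> K * H + 1" unfolding m_def by linarith
      thus "2 * real_of_int m + 1 \<le> (2 * K + 3) * H" using H by (simp add: distrib_right)
    qed (use m0 in simp)
    also have "\<dots> \<le> Ck * H ^ n" unfolding power_mult_distrib using Ck(2) H by (intro mult_right_mono) auto
    finally show "real (card {x\<in>OK. house (x::'a) \<le> H}) \<le> Ck * H ^ n" unfolding Z_def .
  next
    fix x :: 'a assume x: "x \<in> OK"
    have "(DD * house x) ^ n \<le> Ck * house x ^ n" unfolding power_mult_distrib using Ck(4) house_props(1) by (intro mult_right_mono) auto
    thus "\<bar>real_of_int (nrm (co x))\<bar> \<le> Ck * house x ^ n" using norm_co_le[OF x] unfolding DD_def by linarith
    assume "x \<noteq> 0"
    hence "ipoly (co x) \<theta> \<noteq> 0" unfolding co(2)[OF x] using Dg(1) by simp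
    hence "co x \<noteq> 0" by auto
    thus "nrm (co x) \<noteq> 0" using nrm_nz co(1)[OF x] by blast
  next
    fix T :: real assume T: "T0 \<le> T"
    obtain S where S: "finite S" "\<And>p. p \<in> S \<Longrightarrow> good p \<and> roots p \<noteq> {} \<and> p > nat \<bar>Dg\<bar> \<and> T < p \<and> real p \<le> T powr (4/3)"
      "(\<Sum>p\<in>S. ln (real p)) \<ge> 2 * T" using T0(2)[OF T] by blast
    have ex: "\<exists>\<phi>. residue_map (\<lambda>x. nrm (co x)) p E \<phi>" if p: "p \<in> S" for p E
    proof -
      have pp: "prime p" and g: "good p" using S(2)[OF p] unfolding good_def by blast+
      have "\<not> int p dvd Dg"
      proof
        assume "int p dvd Dg"
        hence "int p \<le> \<bar>Dg\<bar>" using dvd_imp_le_int[OF Dg(1)] by fastforce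
        thus False using S(2)[OF p] by linarith
      qed
      moreover obtain r where r: "int p dvd poly g r" using S(2)[OF p] unfolding roots_def by blast
      have "\<not> int p dvd poly (pderiv g) r" using g r unfolding good_def by blast
      from hensel_lift[OF _ r this] pp obtain R where "int p ^ Suc E dvd poly g R" by auto
      ultimately show ?thesis using residue_map_exists[OF pp] by blast
    qed
    define \<phi> where "\<phi> p E = (SOME \<phi>. residue_map (\<lambda>x. nrm (co x)) p E \<phi>)" for p E
    have "\<forall>E. residue_map (\<lambda>x. nrm (co x)) p E (\<phi> p E)" if "p \<in> S" for p
      unfolding \<phi>_def using someI_ex[OF ex[OF that]] by blast
    hence "\<forall>p\<in>S. prime p \<and> T < real p \<and> real p \<le> T powr (4/3) \<and> (\<forall>E. residue_map (\<lambda>x. nrm (co x)) p E (\<phi> p E))"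
      using S(2) unfolding good_def by simp
    thus "\<exists>S \<phi>. finite S \<and> (\<forall>p\<in>S. prime p \<and> T < real p \<and> real p \<le> T powr (4/3) \<and> (\<forall>E. residue_map (\<lambda>x. nrm (co x)) p E (\<phi> p E))) \<and>
       2 * T \<le> (\<Sum>p\<in>S. ln (real p))" using S(1,3) by (intro exI[of _ S] exI[of _ \<phi>] conjI)
  qed
  thus ?thesis by blast
qed

end

theorem theoremC:
  fixes \<rho> :: nat
  assumes "number_field TYPE('a::field_char_0)"
    and "\<rho> = number_field_degree TYPE('a)"
  shows "\<exists>c B\<^sub>0 :: real. c > 0 \<and> B\<^sub>0 > 0 \<and>
    (\<forall>F :: 'a poly poly. integral_coeffs F \<longrightarrow> irreducible F \<longrightarrow> lead_coeff F = 1 \<longrightarrow>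
      (\<forall>B \<ge> B\<^sub>0. finite (integral_zeros F B) \<and>
        real (card (integral_zeros F B)) \<le>
          c * real (total_degree F) ^ 8 * ln B ^ 3 * B powr (real \<rho> / real (total_degree F))))"
proof -
  obtain g and \<theta> :: 'a where g: "int_poly_field g \<rho>" "ipoly g \<theta> = 0"
    "\<And>x. \<exists>p. rpoly p \<theta> = x" "\<And>p. rpoly p \<theta> = 0 \<Longrightarrow> map_poly of_int g dvd p"
    using integral_generator[OF assms(1)] unfolding assms(2) by blast
  have "number_field_basis g \<rho> \<theta>"
    unfolding number_field_basis_def number_field_basis_axioms_def using g by blast
  from number_field_basis.residue_supply_exists[OF this]
  obtain Ck Box Nm T0 where "residue_supply \<rho> Ck (Box :: real \<Rightarrow> 'a set) Nm T0" by blast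
  thus ?thesis by (rule residue_supply.main_bound)
qed

end
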